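(* The functors $\mathcal L\colon\mathbf{EED}\to\mathbf{CBC}$ and $\mathcal R\colon\mathbf{CBC}\to\mathbf{EED}$ form an adjunction $\mathcal L\dashv\mathcal R$ whose unit $\eta\colon\mathrm{id}_{\mathbf{EED}}\to\mathcal R\mathcal L$ has components $\eta_P=(\Gamma_P,P\rho)$, where $(P\rho)_X=P_{\rho_X}\colon P(X)\to P(X\times I)$ with $\rho_X\colon X\times I\to X$ the right unitor of $\mathcal C$, and whose counit $\epsilon\colon\mathcal L\mathcal R\to\mathrm{id}_{\mathbf{CBC}}$ is a natural isomorphism with components $\epsilon_{\mathcal B}$ sending $R\in\mathrm{Hom}_{\mathcal B}(X\otimes Y,I)$ (a morphism $X\to Y$ of $\mathcal L\mathcal R(\mathcal B)$) to $\rho_X^{-1};(\mathrm{id}_X\otimes(e_Y^*;d_Y));(R\otimes\mathrm{id}_Y);\lambda_Y\colon X\to Y$ (associators omitted), with inverse sending $S\colon X\to Y$ in $\mathcal B$ to $(S\otimes\mathrm{id}_Y);d_Y^*;e_Y\in\mathrm{Hom}_{\mathcal B}(X\otimes Y,I)$.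
   Context: Composition is diagrammatic ($f;g$). Cartesian category: chosen products $\times$, projections $\pi_i$, pairing, terminal $I$, diagonals $\Delta_A$, unitors $\rho_X\colon X\times I\to X$, $\lambda_X$. $\mathbf{InfSL}$: meet-semilattices with top, finite-meet-preserving maps. $P_f=P(f)$. Elementary existential doctrine: $P\colon\mathcal C^{op}\to\mathbf{InfSL}$ with $\delta_A\in P(A\times A)$ such that for $e=\mathrm{id}_X\times\Delta_A$, $P_e$ has left adjoint $\exists_e(\alpha)=P_{\langle\pi_1,\pi_2\rangle}(\alpha)\wedge P_{\langle\pi_2,\pi_3\rangle}(\delta_A)$, and each $P_\pi$ ($\pi$ a product projection) has a left adjoint $\exists_\pi$ satisfying Beck–Chevalley along pullbacks of projections and Frobenius reciprocity. $\mathbf{EED}$: morphisms $(F,b)\colon P\to R$ with $F$ strict cartesian (preserves chosen products and terminal on the nose) and $b\colon P\to R\circ F^{op}$ natural, preserving $\delta$ ($b_{A\times A}(\delta^P_A)=\delta^R_{FA}$) and existential quantifiers along projections ($b_A\circ\exists^P_\pi=\exists^R_{F\pi}\circ b_{X\times A}$); composition $(G,c)\circ(F,b)=(GF,cF\circ b)$. Cartesian bicategory: poset-enriched symmetric monoidal $(\mathcal B,\otimes,I)$ with, for each $X$, $d_X\colon X\to X\otimes X$, $e_X\colon X\to I$ forming a cocommutative comonoid, having right adjoints $d_X^*,e_X^*$, satisfying Frobenius $(d_X\otimes\mathrm{id});(\mathrm{id}\otimes d^*_X)=d^*_X;d_X$, with every $R\colon X\to Y$ satisfying $R;d_Y\le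 d_X;(R\otimes R)$, $R;e_Y\le e_X$, and comonoids coherent with $\otimes$. Maps: $f$ with $f;d_Y=d_X;(f\otimes f)$, $f;e_Y=e_X$; they form a cartesian category $\mathrm{Map}(\mathcal B)$. $\mathbf{CBC}$: morphisms are strict monoidal functors preserving order and $d,e,d^*,e^*$. $\mathcal R$: $\mathcal R(\mathcal B)=\mathrm{Hom}_{\mathcal B}(-,I)\colon\mathrm{Map}(\mathcal B)^{op}\to\mathbf{InfSL}$ (meet $R\wedge S=d_X;(R\otimes S)$, top $e_X$, action $f\mapsto(U\mapsto f;U)$), and $\mathcal R(F)=(F\restriction_{\mathrm{Map}},b^F)$ with $b^F_A(U)=F(U)$. $\mathcal L$: $\mathcal L(P)=\mathcal A_P$, with objects of $\mathcal C$, $\mathrm{Hom}(X,Y)=P(X\times Y)$, identity $\delta_X$, composite $f;g=\exists_{\langle\pi_1,\pi_3\rangle}(P_{\langle\pi_1,\pi_2\rangle}f\wedge P_{\langle\pi_2,\pi_3\rangle}g)$, tensor $f\otimes g=P_{\langle\pi_1,\pi_3\rangle}f\wedge P_{\langle\pi_2,\pi_4\rangle}g$, graph functor $\Gamma_P(f)=P_{f\times\mathrm{id}_Y}(\delta_Y)$ for $f\colon X\to Y$, and all remaining structure (symmetry, unitors, comonoids $\Gamma_P(\Delta_X),\Gamma_P(!_X)$) transported by $\Gamma_P$; $\Gamma_P$ lands in $\mathrm{Map}(\mathcal A_P)$ and is strict cartesian. On morphisms $\mathcal L(F,b)$ is $X\mapsto FX$, $r\mapsto b_{X\times Y}(r)$.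 Thus $\mathcal R\mathcal L(P)=\mathrm{Hom}_{\mathcal A_P}(-,I)=P(-\times I)$ and $\mathcal L\mathcal R(\mathcal B)$ has objects of $\mathcal B$ and morphisms $X\to Y$ the elements of $\mathrm{Hom}_{\mathcal B}(X\otimes Y,I)$. *)

theory Defs
  imports Main "HOL-Library.FuncSet"
begin

section \<open>Categories, functors, adjunctions\<close>

text \<open>
  An arrow consists of its source, its target and a label; a category is given by a set of objects,
  a set of such arrows, identities, and composition in diagrammatic order.  Because hom-sets are
  told apart by source and target, not by the labels, the label type need not grow when hom-sets
  are formed out of the fibres of a doctrine.
\<close>

datatype ('o, 'm) arrow = Arrow (src: 'o) (tgt: 'o) (lab: 'm)

record ('o, 'm) cat =
  Ob  :: "'o set"
  Arr :: "('o, 'm) arrow set"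
  Idn :: "'o \<Rightarrow> ('o, 'm) arrow"
  Seq :: "('o, 'm) arrow \<Rightarrow> ('o, 'm) arrow \<Rightarrow> ('o, 'm) arrow"  (infixr "\<Zsemi>\<index>" 55)

definition hom :: "('o, 'm, 'z) cat_scheme \<Rightarrow> 'o \<Rightarrow> 'o \<Rightarrow> ('o, 'm) arrow set" where
  "hom C X Y = {f \<in> Arr C. src f = X \<and> tgt f = Y}"

locale category =
  fixes C :: "('o, 'm, 'z) cat_scheme" (structure)
  assumes src_Ob: "f \<in> Arr C \<Longrightarrow> src f \<in> Ob C"
    and tgt_Ob: "f \<in> Arr C \<Longrightarrow> tgt f \<in> Ob C"
    and Idn_hom: "X \<in> Ob C \<Longrightarrow> Idn C X \<in> hom C X X"
    and Seq_hom: "f \<in> hom C X Y \<Longrightarrow> g \<in> hom C Y Z \<Longrightarrow> f \<Zsemi> g \<in> hom C X Z"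
    and Idn_left: "f \<in> hom C X Y \<Longrightarrow> Idn C X \<Zsemi> f = f"
    and Idn_right: "f \<in> hom C X Y \<Longrightarrow> f \<Zsemi> Idn C Y = f"
    and Seq_assoc: "f \<in> hom C W X \<Longrightarrow> g \<in> hom C X Y \<Longrightarrow> h \<in> hom C Y Z \<Longrightarrow>
                      (f \<Zsemi> g) \<Zsemi> h = f \<Zsemi> (g \<Zsemi> h)"

definition inverse_arrows ::
  "('o, 'm, 'z) cat_scheme \<Rightarrow> ('o, 'm) arrow \<Rightarrow> ('o, 'm) arrow \<Rightarrow> bool" where
  "inverse_arrows C f g \<longleftrightarrow> f \<in> Arr C \<and> g \<in> hom C (tgt f) (src f) \<and>
     f \<Zsemi>\<^bsub>C\<^esub> g = Idn C (src f) \<and> g \<Zsemi>\<^bsub>C\<^esub> f = Idn C (tgt f)"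

definition is_iso :: "('o, 'm, 'z) cat_scheme \<Rightarrow> ('o, 'm) arrow \<Rightarrow> bool" where
  "is_iso C f \<longleftrightarrow> (\<exists>g. inverse_arrows C f g)"

definition inv_arrow :: "('o, 'm, 'z) cat_scheme \<Rightarrow> ('o, 'm) arrow \<Rightarrow> ('o, 'm) arrow" where
  "inv_arrow C f = (THE g. inverse_arrows C f g)"

record ('o1, 'm1, 'o2, 'm2) ftor =
  on_Ob  :: "'o1 \<Rightarrow> 'o2"
  on_Arr :: "('o1, 'm1) arrow \<Rightarrow> ('o2, 'm2) arrow"

locale is_functor = C: category C + D: category D
  for C :: "('o1, 'm1, 'z1) cat_scheme" and D :: "('o2, 'm2, 'z2) cat_scheme" +
  fixes F :: "('o1, 'm1, 'o2, 'm2, 'f) ftor_scheme"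
  assumes on_Ob: "X \<in> Ob C \<Longrightarrow> on_Ob F X \<in> Ob D"
    and on_Arr: "f \<in> hom C X Y \<Longrightarrow> on_Arr F f \<in> hom D (on_Ob F X) (on_Ob F Y)"
    and on_Idn: "X \<in> Ob C \<Longrightarrow> on_Arr F (Idn C X) = Idn D (on_Ob F X)"
    and on_Seq: "f \<in> hom C X Y \<Longrightarrow> g \<in> hom C Y Z \<Longrightarrow>
                   on_Arr F (f \<Zsemi>\<^bsub>C\<^esub> g) = on_Arr F f \<Zsemi>\<^bsub>D\<^esub> on_Arr F g"

definition id_ftor :: "('o, 'm, 'o, 'm) ftor" where
  "id_ftor = \<lparr>on_Ob = \<lambda>X. X, on_Arr = \<lambda>f. f\<rparr>"

definition comp_ftor ::
  "('o1, 'm1, 'o2, 'm2) ftor \<Rightarrow> ('o2, 'm2, 'o3, 'm3) ftor \<Rightarrow> ('o1, 'm1, 'o3, 'm3) ftor" where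
  "comp_ftor F G = \<lparr>on_Ob = \<lambda>X. on_Ob G (on_Ob F X), on_Arr = \<lambda>f. on_Arr G (on_Arr F f)\<rparr>"

locale nat_trans = F: is_functor C D F + G: is_functor C D G
  for C :: "('o1, 'm1, 'z1) cat_scheme" and D :: "('o2, 'm2, 'z2) cat_scheme"
    and F :: "('o1, 'm1, 'o2, 'm2) ftor" and G :: "('o1, 'm1, 'o2, 'm2) ftor" +
  fixes \<tau> :: "'o1 \<Rightarrow> ('o2, 'm2) arrow"
  assumes component: "X \<in> Ob C \<Longrightarrow> \<tau> X \<in> hom D (on_Ob F X) (on_Ob G X)"
    and natural: "f \<in> hom C X Y \<Longrightarrow> on_Arr F f \<Zsemi>\<^bsub>D\<^esub> \<tau> Y = \<tau> X \<Zsemi>\<^bsub>D\<^esub> on_Arr G f"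

locale nat_iso = nat_trans C D F G \<tau>
  for C :: "('o1, 'm1, 'z1) cat_scheme" and D :: "('o2, 'm2, 'z2) cat_scheme"
    and F :: "('o1, 'm1, 'o2, 'm2) ftor" and G :: "('o1, 'm1, 'o2, 'm2) ftor"
    and \<tau> :: "'o1 \<Rightarrow> ('o2, 'm2) arrow" +
  assumes component_iso: "X \<in> Ob C \<Longrightarrow> is_iso D (\<tau> X)"

text \<open>\<open>adjunction C D L R \<eta> \<epsilon>\<close>: \<open>L\<close> from \<open>C\<close> to \<open>D\<close> is left adjoint to \<open>R\<close> from \<open>D\<close> to \<open>C\<close>.\<close>

locale adjunction =
  L: is_functor C D L + R: is_functor D C R +
  unit: nat_trans C C id_ftor "comp_ftor L R" \<eta> +
  counit: nat_trans D D "comp_ftor R L" id_ftor \<epsilon>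
  for C :: "('o1, 'm1, 'z1) cat_scheme" and D :: "('o2, 'm2, 'z2) cat_scheme"
    and L :: "('o1, 'm1, 'o2, 'm2) ftor" and R :: "('o2, 'm2, 'o1, 'm1) ftor"
    and \<eta> :: "'o1 \<Rightarrow> ('o1, 'm1) arrow" and \<epsilon> :: "'o2 \<Rightarrow> ('o2, 'm2) arrow" +
  assumes triangle_L: "X \<in> Ob C \<Longrightarrow> on_Arr L (\<eta> X) \<Zsemi>\<^bsub>D\<^esub> \<epsilon> (on_Ob L X) = Idn D (on_Ob L X)"
    and triangle_R: "Y \<in> Ob D \<Longrightarrow> \<eta> (on_Ob R Y) \<Zsemi>\<^bsub>C\<^esub> on_Arr R (\<epsilon> Y) = Idn C (on_Ob R Y)"


section \<open>Cartesian categories\<close>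

record ('o, 'm) cart = "('o, 'm) cat" +
  Prod :: "'o \<Rightarrow> 'o \<Rightarrow> 'o"  (infixr "\<times>\<^sub>o\<index>" 70)
  Pr1  :: "'o \<Rightarrow> 'o \<Rightarrow> ('o, 'm) arrow"
  Pr2  :: "'o \<Rightarrow> 'o \<Rightarrow> ('o, 'm) arrow"
  One  :: "'o"

definition is_product ::
  "('o, 'm, 'z) cat_scheme \<Rightarrow> 'o \<Rightarrow> 'o \<Rightarrow> 'o \<Rightarrow> ('o, 'm) arrow \<Rightarrow> ('o, 'm) arrow \<Rightarrow> bool" where
  "is_product C X Y W p q \<longleftrightarrow> p \<in> hom C W X \<and> q \<in> hom C W Y \<and>
     (\<forall>Z\<in>Ob C. \<forall>f\<in>hom C Z X. \<forall>g\<in>hom C Z Y.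
        \<exists>!h. h \<in> hom C Z W \<and> h \<Zsemi>\<^bsub>C\<^esub> p = f \<and> h \<Zsemi>\<^bsub>C\<^esub> q = g)"

locale cartesian_category = category C
  for C :: "('o, 'm, 'z) cart_scheme" (structure) +
  assumes Prod_Ob: "X \<in> Ob C \<Longrightarrow> Y \<in> Ob C \<Longrightarrow> X \<times>\<^sub>o Y \<in> Ob C"
    and Prod_product: "X \<in> Ob C \<Longrightarrow> Y \<in> Ob C \<Longrightarrow>
                         is_product C X Y (X \<times>\<^sub>o Y) (Pr1 C X Y) (Pr2 C X Y)"
    and One_Ob: "One C \<in> Ob C"
    and One_terminal: "X \<in> Ob C \<Longrightarrow> \<exists>!f. f \<in> hom C X (One C)"

definition pair ::
  "('o, 'm, 'z) cart_scheme \<Rightarrow> ('o, 'm) arrow \<Rightarrow> ('o, 'm) arrow \<Rightarrow> ('o, 'm) arrow"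
  ("\<langle>_,/ _\<rangle>\<index>") where
  "\<langle>f, g\<rangle>\<^bsub>C\<^esub> = (THE h. h \<in> hom C (src f) (tgt f \<times>\<^sub>o\<^bsub>C\<^esub> tgt g) \<and>
                   h \<Zsemi>\<^bsub>C\<^esub> Pr1 C (tgt f) (tgt g) = f \<and> h \<Zsemi>\<^bsub>C\<^esub> Pr2 C (tgt f) (tgt g) = g)"

definition bang :: "('o, 'm, 'z) cart_scheme \<Rightarrow> 'o \<Rightarrow> ('o, 'm) arrow" where
  "bang C X = (THE f. f \<in> hom C X (One C))"

definition prod_arr ::
  "('o, 'm, 'z) cart_scheme \<Rightarrow> ('o, 'm) arrow \<Rightarrow> ('o, 'm) arrow \<Rightarrow> ('o, 'm) arrow"
  (infixr "\<times>\<^sub>a\<index>" 70) where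
  "f \<times>\<^sub>a\<^bsub>C\<^esub> g = \<langle>Pr1 C (src f) (src g) \<Zsemi>\<^bsub>C\<^esub> f, Pr2 C (src f) (src g) \<Zsemi>\<^bsub>C\<^esub> g\<rangle>\<^bsub>C\<^esub>"

definition diag :: "('o, 'm, 'z) cart_scheme \<Rightarrow> 'o \<Rightarrow> ('o, 'm) arrow" where
  "diag C X = \<langle>Idn C X, Idn C X\<rangle>\<^bsub>C\<^esub>"

definition cart_run :: "('o, 'm, 'z) cart_scheme \<Rightarrow> 'o \<Rightarrow> ('o, 'm) arrow" where
  "cart_run C X = Pr1 C X (One C)"

definition cart_lun :: "('o, 'm, 'z) cart_scheme \<Rightarrow> 'o \<Rightarrow> ('o, 'm) arrow" where
  "cart_lun C X = Pr2 C (One C) X"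

definition cart_sym :: "('o, 'm, 'z) cart_scheme \<Rightarrow> 'o \<Rightarrow> 'o \<Rightarrow> ('o, 'm) arrow" where
  "cart_sym C X Y = \<langle>Pr2 C X Y, Pr1 C X Y\<rangle>\<^bsub>C\<^esub>"

text \<open>The associator goes from \<open>(X \<times> Y) \<times> Z\<close> to \<open>X \<times> (Y \<times> Z)\<close>.\<close>

definition cart_assoc :: "('o, 'm, 'z) cart_scheme \<Rightarrow> 'o \<Rightarrow> 'o \<Rightarrow> 'o \<Rightarrow> ('o, 'm) arrow" where
  "cart_assoc C X Y Z =
     \<langle>Pr1 C (X \<times>\<^sub>o\<^bsub>C\<^esub> Y) Z \<Zsemi>\<^bsub>C\<^esub> Pr1 C X Y,
      \<langle>Pr1 C (X \<times>\<^sub>o\<^bsub>C\<^esub> Y) Z \<Zsemi>\<^bsub>C\<^esub> Pr2 C X Y, Pr2 C (X \<times>\<^sub>o\<^bsub>C\<^esub> Y) Z\<rangle>\<^bsub>C\<^esub>\<rangle>\<^bsub>C\<^esub>"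

text \<open>
  Projections \<open>\<pi>\<^sub>1, \<pi>\<^sub>2, \<pi>\<^sub>3\<close> of a ternary product, bracketed as \<open>X \<times> (Y \<times> Z)\<close>, and
  \<open>\<pi>\<^sub>1, \<pi>\<^sub>2, \<pi>\<^sub>3, \<pi>\<^sub>4\<close> of a fourfold product, bracketed as \<open>(X \<times> Y) \<times> (Z \<times> W)\<close>.
\<close>

definition tri1 :: "('o, 'm, 'z) cart_scheme \<Rightarrow> 'o \<Rightarrow> 'o \<Rightarrow> 'o \<Rightarrow> ('o, 'm) arrow" where
  "tri1 C X Y Z = Pr1 C X (Y \<times>\<^sub>o\<^bsub>C\<^esub> Z)"

definition tri2 :: "('o, 'm, 'z) cart_scheme \<Rightarrow> 'o \<Rightarrow> 'o \<Rightarrow> 'o \<Rightarrow> ('o, 'm) arrow" where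
  "tri2 C X Y Z = Pr2 C X (Y \<times>\<^sub>o\<^bsub>C\<^esub> Z) \<Zsemi>\<^bsub>C\<^esub> Pr1 C Y Z"

definition tri3 :: "('o, 'm, 'z) cart_scheme \<Rightarrow> 'o \<Rightarrow> 'o \<Rightarrow> 'o \<Rightarrow> ('o, 'm) arrow" where
  "tri3 C X Y Z = Pr2 C X (Y \<times>\<^sub>o\<^bsub>C\<^esub> Z) \<Zsemi>\<^bsub>C\<^esub> Pr2 C Y Z"

definition quad1 :: "('o, 'm, 'z) cart_scheme \<Rightarrow> 'o \<Rightarrow> 'o \<Rightarrow> 'o \<Rightarrow> 'o \<Rightarrow> ('o, 'm) arrow" where
  "quad1 C X Y Z W = Pr1 C (X \<times>\<^sub>o\<^bsub>C\<^esub> Y) (Z \<times>\<^sub>o\<^bsub>C\<^esub> W) \<Zsemi>\<^bsub>C\<^esub> Pr1 C X Y"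

definition quad2 :: "('o, 'm, 'z) cart_scheme \<Rightarrow> 'o \<Rightarrow> 'o \<Rightarrow> 'o \<Rightarrow> 'o \<Rightarrow> ('o, 'm) arrow" where
  "quad2 C X Y Z W = Pr1 C (X \<times>\<^sub>o\<^bsub>C\<^esub> Y) (Z \<times>\<^sub>o\<^bsub>C\<^esub> W) \<Zsemi>\<^bsub>C\<^esub> Pr2 C X Y"

definition quad3 :: "('o, 'm, 'z) cart_scheme \<Rightarrow> 'o \<Rightarrow> 'o \<Rightarrow> 'o \<Rightarrow> 'o \<Rightarrow> ('o, 'm) arrow" where
  "quad3 C X Y Z W = Pr2 C (X \<times>\<^sub>o\<^bsub>C\<^esub> Y) (Z \<times>\<^sub>o\<^bsub>C\<^esub> W) \<Zsemi>\<^bsub>C\<^esub> Pr1 C Z W"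

definition quad4 :: "('o, 'm, 'z) cart_scheme \<Rightarrow> 'o \<Rightarrow> 'o \<Rightarrow> 'o \<Rightarrow> 'o \<Rightarrow> ('o, 'm) arrow" where
  "quad4 C X Y Z W = Pr2 C (X \<times>\<^sub>o\<^bsub>C\<^esub> Y) (Z \<times>\<^sub>o\<^bsub>C\<^esub> W) \<Zsemi>\<^bsub>C\<^esub> Pr2 C Z W"

text \<open>
  A product projection is a leg of some product cone, not only of a chosen one; for instance
  \<open>\<langle>\<pi>\<^sub>1, \<pi>\<^sub>3\<rangle>\<close> from \<open>X \<times> (Y \<times> Z)\<close> to \<open>X \<times> Z\<close> is a product projection.
\<close>

definition is_projection :: "('o, 'm, 'z) cat_scheme \<Rightarrow> ('o, 'm) arrow \<Rightarrow> bool" where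
  "is_projection C p \<longleftrightarrow> p \<in> Arr C \<and> (\<exists>B\<in>Ob C. \<exists>q. is_product C (tgt p) B (src p) p q)"

text \<open>\<open>is_pullback C f p f' p'\<close>: \<open>p'\<close> is the pullback of \<open>p\<close> along \<open>f\<close>, and \<open>p' \<Zsemi> f = f' \<Zsemi> p\<close>.\<close>

definition is_pullback ::
  "('o, 'm, 'z) cat_scheme \<Rightarrow> ('o, 'm) arrow \<Rightarrow> ('o, 'm) arrow \<Rightarrow> ('o, 'm) arrow \<Rightarrow>
     ('o, 'm) arrow \<Rightarrow> bool" where
  "is_pullback C f p f' p' \<longleftrightarrow>
     f \<in> Arr C \<and> p \<in> Arr C \<and> tgt f = tgt p \<and>
     p' \<in> hom C (src p') (src f) \<and> f' \<in> hom C (src p') (src p) \<and> p' \<Zsemi>\<^bsub>C\<^esub> f = f' \<Zsemi>\<^bsub>C\<^esub> p \<and>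
     (\<forall>Z\<in>Ob C. \<forall>u\<in>hom C Z (src f). \<forall>v\<in>hom C Z (src p). u \<Zsemi>\<^bsub>C\<^esub> f = v \<Zsemi>\<^bsub>C\<^esub> p \<longrightarrow>
        (\<exists>!h. h \<in> hom C Z (src p') \<and> h \<Zsemi>\<^bsub>C\<^esub> p' = u \<and> h \<Zsemi>\<^bsub>C\<^esub> f' = v))"

locale strict_cartesian_functor =
  C: cartesian_category C + D: cartesian_category D + is_functor C D F
  for C :: "('o1, 'm1, 'z1) cart_scheme" and D :: "('o2, 'm2, 'z2) cart_scheme"
    and F :: "('o1, 'm1, 'o2, 'm2, 'f) ftor_scheme" +
  assumes on_Prod: "X \<in> Ob C \<Longrightarrow> Y \<in> Ob C \<Longrightarrow> on_Ob F (X \<times>\<^sub>o\<^bsub>C\<^esub> Y) = on_Ob F X \<times>\<^sub>o\<^bsub>D\<^esub> on_Ob F Y"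
    and on_Pr1: "X \<in> Ob C \<Longrightarrow> Y \<in> Ob C \<Longrightarrow> on_Arr F (Pr1 C X Y) = Pr1 D (on_Ob F X) (on_Ob F Y)"
    and on_Pr2: "X \<in> Ob C \<Longrightarrow> Y \<in> Ob C \<Longrightarrow> on_Arr F (Pr2 C X Y) = Pr2 D (on_Ob F X) (on_Ob F Y)"
    and on_One: "on_Ob F (One C) = One D"


section \<open>Elementary existential doctrines\<close>

locale inf_semilattice =
  fixes A :: "'p set" and meet :: "'p \<Rightarrow> 'p \<Rightarrow> 'p" and top :: 'p
  assumes meet_closed: "x \<in> A \<Longrightarrow> y \<in> A \<Longrightarrow> meet x y \<in> A"
    and top_closed: "top \<in> A"
    and meet_assoc: "x \<in> A \<Longrightarrow> y \<in> A \<Longrightarrow> z \<in> A \<Longrightarrow> meet (meet x y) z = meet x (meet y z)"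
    and meet_comm: "x \<in> A \<Longrightarrow> y \<in> A \<Longrightarrow> meet x y = meet y x"
    and meet_idem: "x \<in> A \<Longrightarrow> meet x x = x"
    and meet_top: "x \<in> A \<Longrightarrow> meet x top = x"

record ('o, 'm, 'p) doctrine = "('o, 'm) cart" +
  Fib   :: "'o \<Rightarrow> 'p set"
  Meet  :: "'o \<Rightarrow> 'p \<Rightarrow> 'p \<Rightarrow> 'p"
  Top   :: "'o \<Rightarrow> 'p"
  Act   :: "('o, 'm) arrow \<Rightarrow> 'p \<Rightarrow> 'p"
  Delta :: "'o \<Rightarrow> 'p"

definition fib_le :: "('o, 'm, 'p, 'z) doctrine_scheme \<Rightarrow> 'o \<Rightarrow> 'p \<Rightarrow> 'p \<Rightarrow> bool" where
  "fib_le P X x y \<longleftrightarrow> Meet P X x y = x"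

text \<open>\<open>h\<close> is left adjoint to reindexing along \<open>f\<close>.\<close>

definition is_left_adjoint ::
  "('o, 'm, 'p, 'z) doctrine_scheme \<Rightarrow> ('o, 'm) arrow \<Rightarrow> ('p \<Rightarrow> 'p) \<Rightarrow> bool" where
  "is_left_adjoint P f h \<longleftrightarrow>
     (\<forall>x\<in>Fib P (src f). h x \<in> Fib P (tgt f) \<and>
        (\<forall>y\<in>Fib P (tgt f). fib_le P (tgt f) (h x) y \<longleftrightarrow> fib_le P (src f) x (Act P f y)))"

text \<open>The value at \<open>x\<close> of the left adjoint to reindexing along \<open>f\<close>, if there is a left adjoint.\<close>

definition Exq :: "('o, 'm, 'p, 'z) doctrine_scheme \<Rightarrow> ('o, 'm) arrow \<Rightarrow> 'p \<Rightarrow> 'p" where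
  "Exq P f x = (THE z. z \<in> Fib P (tgt f) \<and>
     (\<forall>y\<in>Fib P (tgt f). fib_le P (tgt f) z y \<longleftrightarrow> fib_le P (src f) x (Act P f y)))"

locale doctrine = cartesian_category P
  for P :: "('o, 'm, 'p, 'z) doctrine_scheme" (structure) +
  assumes fibre: "X \<in> Ob P \<Longrightarrow> inf_semilattice (Fib P X) (Meet P X) (Top P X)"
    and Act_closed: "f \<in> hom P X Y \<Longrightarrow> x \<in> Fib P Y \<Longrightarrow> Act P f x \<in> Fib P X"
    and Act_Meet: "f \<in> hom P X Y \<Longrightarrow> x \<in> Fib P Y \<Longrightarrow> y \<in> Fib P Y \<Longrightarrow>
                     Act P f (Meet P Y x y) = Meet P X (Act P f x) (Act P f y)"
    and Act_Top: "f \<in> hom P X Y \<Longrightarrow> Act P f (Top P Y) = Top P X"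
    and Act_Idn: "X \<in> Ob P \<Longrightarrow> x \<in> Fib P X \<Longrightarrow> Act P (Idn P X) x = x"
    and Act_Seq: "f \<in> hom P X Y \<Longrightarrow> g \<in> hom P Y Z \<Longrightarrow> x \<in> Fib P Z \<Longrightarrow>
                    Act P (f \<Zsemi> g) x = Act P f (Act P g x)"

locale elementary_existential_doctrine = doctrine P
  for P :: "('o, 'm, 'p, 'z) doctrine_scheme" (structure) +
  assumes Delta_closed: "A \<in> Ob P \<Longrightarrow> Delta P A \<in> Fib P (A \<times>\<^sub>o A)"
    and elementary: "X \<in> Ob P \<Longrightarrow> A \<in> Ob P \<Longrightarrow>
          is_left_adjoint P (Idn P X \<times>\<^sub>a diag P A)
            (\<lambda>x. Meet P (X \<times>\<^sub>o (A \<times>\<^sub>o A))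
                   (Act P \<langle>tri1 P X A A, tri2 P X A A\<rangle> x)
                   (Act P \<langle>tri2 P X A A, tri3 P X A A\<rangle> (Delta P A)))"
    and existential: "is_projection P p \<Longrightarrow> \<exists>h. is_left_adjoint P p h"
    and Beck_Chevalley: "is_projection P p \<Longrightarrow> is_pullback P f p f' p' \<Longrightarrow> x \<in> Fib P (src p) \<Longrightarrow>
          Act P f (Exq P p x) = Exq P p' (Act P f' x)"
    and Frobenius_reciprocity:
          "is_projection P p \<Longrightarrow> x \<in> Fib P (tgt p) \<Longrightarrow> y \<in> Fib P (src p) \<Longrightarrow>
          Exq P p (Meet P (src p) (Act P p x) y) = Meet P (tgt p) x (Exq P p y)"

record ('o1, 'm1, 'p1, 'o2, 'm2, 'p2) doctrine_map = "('o1, 'm1, 'o2, 'm2) ftor" +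
  on_Fib :: "'o1 \<Rightarrow> 'p1 \<Rightarrow> 'p2"

text \<open>
  Morphisms of doctrines (and, below, of cartesian bicategories) are extensional functions, so that
  equality of morphisms is equality on objects, arrows and fibre elements.
\<close>

locale EED_morphism =
  P: elementary_existential_doctrine P + Q: elementary_existential_doctrine Q +
  strict_cartesian_functor P Q F
  for P :: "('o1, 'm1, 'p1) doctrine" and Q :: "('o2, 'm2, 'p2) doctrine"
    and F :: "('o1, 'm1, 'p1, 'o2, 'm2, 'p2) doctrine_map" +
  assumes on_Fib_closed: "X \<in> Ob P \<Longrightarrow> x \<in> Fib P X \<Longrightarrow> on_Fib F X x \<in> Fib Q (on_Ob F X)"
    and on_Meet: "X \<in> Ob P \<Longrightarrow> x \<in> Fib P X \<Longrightarrow> y \<in> Fib P X \<Longrightarrow>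
          on_Fib F X (Meet P X x y) = Meet Q (on_Ob F X) (on_Fib F X x) (on_Fib F X y)"
    and on_Top: "X \<in> Ob P \<Longrightarrow> on_Fib F X (Top P X) = Top Q (on_Ob F X)"
    and on_Act: "f \<in> hom P X Y \<Longrightarrow> x \<in> Fib P Y \<Longrightarrow>
          on_Fib F X (Act P f x) = Act Q (on_Arr F f) (on_Fib F Y x)"
    and on_Delta: "A \<in> Ob P \<Longrightarrow> on_Fib F (A \<times>\<^sub>o\<^bsub>P\<^esub> A) (Delta P A) = Delta Q (on_Ob F A)"
    and on_Exq: "is_projection P p \<Longrightarrow> x \<in> Fib P (src p) \<Longrightarrow>
          on_Fib F (tgt p) (Exq P p x) = Exq Q (on_Arr F p) (on_Fib F (src p) x)"
    and on_Ob_extensional: "on_Ob F \<in> extensional (Ob P)"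
    and on_Arr_extensional: "on_Arr F \<in> extensional (Arr P)"
    and on_Fib_extensional: "on_Fib F \<in> extensional (Ob P)"
      "X \<in> Ob P \<Longrightarrow> on_Fib F X \<in> extensional (Fib P X)"

definition id_doctrine_map ::
  "('o, 'm, 'p) doctrine \<Rightarrow> ('o, 'm, 'p, 'o, 'm, 'p) doctrine_map" where
  "id_doctrine_map P =
     \<lparr>on_Ob = \<lambda>X\<in>Ob P. X, on_Arr = \<lambda>f\<in>Arr P. f, on_Fib = \<lambda>X\<in>Ob P. \<lambda>x\<in>Fib P X. x\<rparr>"

definition comp_doctrine_map ::
  "('o1, 'm1, 'p1) doctrine \<Rightarrow> ('o1, 'm1, 'p1, 'o2, 'm2, 'p2) doctrine_map \<Rightarrow>
   ('o2, 'm2, 'p2, 'o3, 'm3, 'p3) doctrine_map \<Rightarrow> ('o1, 'm1, 'p1, 'o3, 'm3, 'p3) doctrine_map" where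
  "comp_doctrine_map P F G =
     \<lparr>on_Ob = \<lambda>X\<in>Ob P. on_Ob G (on_Ob F X),
      on_Arr = \<lambda>f\<in>Arr P. on_Arr G (on_Arr F f),
      on_Fib = \<lambda>X\<in>Ob P. \<lambda>x\<in>Fib P X. on_Fib G (on_Ob F X) (on_Fib F X x)\<rparr>"

definition EED ::
  "(('o, 'm, 'p) doctrine, ('o, 'm, 'p, 'o, 'm, 'p) doctrine_map) cat" where
  "EED = \<lparr>Ob = {P. elementary_existential_doctrine P},
          Arr = {Arrow P Q F | P Q F. EED_morphism P Q F},
          Idn = \<lambda>P. Arrow P P (id_doctrine_map P),
          Seq = \<lambda>F G. Arrow (src F) (tgt G) (comp_doctrine_map (src F) (lab F) (lab G))\<rparr>"


section \<open>Cartesian bicategories\<close>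

text \<open>\<open>Assoc X Y Z\<close> goes from \<open>(X \<otimes> Y) \<otimes> Z\<close> to \<open>X \<otimes> (Y \<otimes> Z)\<close>; \<open>Dup\<close> and \<open>Del\<close> are \<open>d\<close> and \<open>e\<close>.\<close>

record ('o, 'm) bicat = "('o, 'm) cat" +
  Leq     :: "('o, 'm) arrow \<Rightarrow> ('o, 'm) arrow \<Rightarrow> bool"  (infix "\<sqsubseteq>\<index>" 50)
  TensOb  :: "'o \<Rightarrow> 'o \<Rightarrow> 'o"  (infixr "\<otimes>\<^sub>o\<index>" 70)
  TensArr :: "('o, 'm) arrow \<Rightarrow> ('o, 'm) arrow \<Rightarrow> ('o, 'm) arrow"  (infixr "\<otimes>\<^sub>a\<index>" 70)
  Unit    :: "'o"
  Assoc   :: "'o \<Rightarrow> 'o \<Rightarrow> 'o \<Rightarrow> ('o, 'm) arrow"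
  Lun     :: "'o \<Rightarrow> ('o, 'm) arrow"
  Run     :: "'o \<Rightarrow> ('o, 'm) arrow"
  Sym     :: "'o \<Rightarrow> 'o \<Rightarrow> ('o, 'm) arrow"
  Dup     :: "'o \<Rightarrow> ('o, 'm) arrow"
  Del     :: "'o \<Rightarrow> ('o, 'm) arrow"

locale symmetric_monoidal_category = category B
  for B :: "('o, 'm, 'z) bicat_scheme" (structure) +
  assumes Unit_Ob: "Unit B \<in> Ob B"
    and TensOb_Ob: "X \<in> Ob B \<Longrightarrow> Y \<in> Ob B \<Longrightarrow> X \<otimes>\<^sub>o Y \<in> Ob B"
    and TensArr_hom: "f \<in> hom B X Y \<Longrightarrow> g \<in> hom B Z W \<Longrightarrow> f \<otimes>\<^sub>a g \<in> hom B (X \<otimes>\<^sub>o Z) (Y \<otimes>\<^sub>o W)"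
    and TensArr_Idn: "X \<in> Ob B \<Longrightarrow> Y \<in> Ob B \<Longrightarrow> Idn B X \<otimes>\<^sub>a Idn B Y = Idn B (X \<otimes>\<^sub>o Y)"
    and TensArr_Seq: "f \<in> hom B X Y \<Longrightarrow> g \<in> hom B Y Z \<Longrightarrow> f' \<in> hom B X' Y' \<Longrightarrow> g' \<in> hom B Y' Z' \<Longrightarrow>
          (f \<Zsemi> g) \<otimes>\<^sub>a (f' \<Zsemi> g') = (f \<otimes>\<^sub>a f') \<Zsemi> (g \<otimes>\<^sub>a g')"
    and Assoc_hom: "X \<in> Ob B \<Longrightarrow> Y \<in> Ob B \<Longrightarrow> Z \<in> Ob B \<Longrightarrow>
          Assoc B X Y Z \<in> hom B ((X \<otimes>\<^sub>o Y) \<otimes>\<^sub>o Z) (X \<otimes>\<^sub>o (Y \<otimes>\<^sub>o Z))"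
    and Assoc_iso: "X \<in> Ob B \<Longrightarrow> Y \<in> Ob B \<Longrightarrow> Z \<in> Ob B \<Longrightarrow> is_iso B (Assoc B X Y Z)"
    and Assoc_natural: "f \<in> hom B X X' \<Longrightarrow> g \<in> hom B Y Y' \<Longrightarrow> h \<in> hom B Z Z' \<Longrightarrow>
          ((f \<otimes>\<^sub>a g) \<otimes>\<^sub>a h) \<Zsemi> Assoc B X' Y' Z' = Assoc B X Y Z \<Zsemi> (f \<otimes>\<^sub>a (g \<otimes>\<^sub>a h))"
    and Lun_hom: "X \<in> Ob B \<Longrightarrow> Lun B X \<in> hom B (Unit B \<otimes>\<^sub>o X) X"
    and Lun_iso: "X \<in> Ob B \<Longrightarrow> is_iso B (Lun B X)"
    and Lun_natural: "f \<in> hom B X Y \<Longrightarrow> (Idn B (Unit B) \<otimes>\<^sub>a f) \<Zsemi> Lun B Y = Lun B X \<Zsemi> f"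
    and Run_hom: "X \<in> Ob B \<Longrightarrow> Run B X \<in> hom B (X \<otimes>\<^sub>o Unit B) X"
    and Run_iso: "X \<in> Ob B \<Longrightarrow> is_iso B (Run B X)"
    and Run_natural: "f \<in> hom B X Y \<Longrightarrow> (f \<otimes>\<^sub>a Idn B (Unit B)) \<Zsemi> Run B Y = Run B X \<Zsemi> f"
    and Sym_hom: "X \<in> Ob B \<Longrightarrow> Y \<in> Ob B \<Longrightarrow> Sym B X Y \<in> hom B (X \<otimes>\<^sub>o Y) (Y \<otimes>\<^sub>o X)"
    and Sym_natural: "f \<in> hom B X X' \<Longrightarrow> g \<in> hom B Y Y' \<Longrightarrow>
          (f \<otimes>\<^sub>a g) \<Zsemi> Sym B X' Y' = Sym B X Y \<Zsemi> (g \<otimes>\<^sub>a f)"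
    and Sym_Sym: "X \<in> Ob B \<Longrightarrow> Y \<in> Ob B \<Longrightarrow> Sym B X Y \<Zsemi> Sym B Y X = Idn B (X \<otimes>\<^sub>o Y)"
    and pentagon: "W \<in> Ob B \<Longrightarrow> X \<in> Ob B \<Longrightarrow> Y \<in> Ob B \<Longrightarrow> Z \<in> Ob B \<Longrightarrow>
          (Assoc B W X Y \<otimes>\<^sub>a Idn B Z) \<Zsemi> Assoc B W (X \<otimes>\<^sub>o Y) Z \<Zsemi> (Idn B W \<otimes>\<^sub>a Assoc B X Y Z)
          = Assoc B (W \<otimes>\<^sub>o X) Y Z \<Zsemi> Assoc B W X (Y \<otimes>\<^sub>o Z)"
    and triangle: "X \<in> Ob B \<Longrightarrow> Y \<in> Ob B \<Longrightarrow>
          Assoc B X (Unit B) Y \<Zsemi> (Idn B X \<otimes>\<^sub>a Lun B Y) = Run B X \<otimes>\<^sub>a Idn B Y"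
    and hexagon: "X \<in> Ob B \<Longrightarrow> Y \<in> Ob B \<Longrightarrow> Z \<in> Ob B \<Longrightarrow>
          Assoc B X Y Z \<Zsemi> Sym B X (Y \<otimes>\<^sub>o Z) \<Zsemi> Assoc B Y Z X
          = (Sym B X Y \<otimes>\<^sub>a Idn B Z) \<Zsemi> Assoc B Y X Z \<Zsemi> (Idn B Y \<otimes>\<^sub>a Sym B X Z)"

locale poset_enriched_smc = symmetric_monoidal_category B
  for B :: "('o, 'm, 'z) bicat_scheme" (structure) +
  assumes Leq_refl: "f \<in> hom B X Y \<Longrightarrow> f \<sqsubseteq> f"
    and Leq_trans: "f \<in> hom B X Y \<Longrightarrow> g \<in> hom B X Y \<Longrightarrow> h \<in> hom B X Y \<Longrightarrow>
          f \<sqsubseteq> g \<Longrightarrow> g \<sqsubseteq> h \<Longrightarrow> f \<sqsubseteq> h"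
    and Leq_antisym: "f \<in> hom B X Y \<Longrightarrow> g \<in> hom B X Y \<Longrightarrow> f \<sqsubseteq> g \<Longrightarrow> g \<sqsubseteq> f \<Longrightarrow> f = g"
    and Seq_mono: "f \<in> hom B X Y \<Longrightarrow> f' \<in> hom B X Y \<Longrightarrow> g \<in> hom B Y Z \<Longrightarrow> g' \<in> hom B Y Z \<Longrightarrow>
          f \<sqsubseteq> f' \<Longrightarrow> g \<sqsubseteq> g' \<Longrightarrow> f \<Zsemi> g \<sqsubseteq> f' \<Zsemi> g'"
    and TensArr_mono: "f \<in> hom B X Y \<Longrightarrow> f' \<in> hom B X Y \<Longrightarrow> g \<in> hom B Z W \<Longrightarrow> g' \<in> hom B Z W \<Longrightarrow>
          f \<sqsubseteq> f' \<Longrightarrow> g \<sqsubseteq> g' \<Longrightarrow> f \<otimes>\<^sub>a g \<sqsubseteq> f' \<otimes>\<^sub>a g'"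

definition is_right_adjoint ::
  "('o, 'm, 'z) bicat_scheme \<Rightarrow> ('o, 'm) arrow \<Rightarrow> ('o, 'm) arrow \<Rightarrow> bool" where
  "is_right_adjoint B f g \<longleftrightarrow> g \<in> hom B (tgt f) (src f) \<and>
     Idn B (src f) \<sqsubseteq>\<^bsub>B\<^esub> f \<Zsemi>\<^bsub>B\<^esub> g \<and> g \<Zsemi>\<^bsub>B\<^esub> f \<sqsubseteq>\<^bsub>B\<^esub> Idn B (tgt f)"

definition radj :: "('o, 'm, 'z) bicat_scheme \<Rightarrow> ('o, 'm) arrow \<Rightarrow> ('o, 'm) arrow" where
  "radj B f = (THE g. is_right_adjoint B f g)"

text \<open>The canonical isomorphism from \<open>(X \<otimes> X) \<otimes> (Y \<otimes> Y)\<close> to \<open>(X \<otimes> Y) \<otimes> (X \<otimes> Y)\<close>.\<close>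

definition mid_swap :: "('o, 'm, 'z) bicat_scheme \<Rightarrow> 'o \<Rightarrow> 'o \<Rightarrow> ('o, 'm) arrow" where
  "mid_swap B X Y =
     Assoc B X X (Y \<otimes>\<^sub>o\<^bsub>B\<^esub> Y) \<Zsemi>\<^bsub>B\<^esub>
     (Idn B X \<otimes>\<^sub>a\<^bsub>B\<^esub>
        (inv_arrow B (Assoc B X Y Y) \<Zsemi>\<^bsub>B\<^esub> (Sym B X Y \<otimes>\<^sub>a\<^bsub>B\<^esub> Idn B Y) \<Zsemi>\<^bsub>B\<^esub> Assoc B Y X Y)) \<Zsemi>\<^bsub>B\<^esub>
     inv_arrow B (Assoc B X Y (X \<otimes>\<^sub>o\<^bsub>B\<^esub> Y))"

locale cartesian_bicategory = poset_enriched_smc B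
  for B :: "('o, 'm, 'z) bicat_scheme" (structure) +
  assumes Dup_hom: "X \<in> Ob B \<Longrightarrow> Dup B X \<in> hom B X (X \<otimes>\<^sub>o X)"
    and Del_hom: "X \<in> Ob B \<Longrightarrow> Del B X \<in> hom B X (Unit B)"
    and Dup_assoc: "X \<in> Ob B \<Longrightarrow>
          Dup B X \<Zsemi> (Dup B X \<otimes>\<^sub>a Idn B X) \<Zsemi> Assoc B X X X = Dup B X \<Zsemi> (Idn B X \<otimes>\<^sub>a Dup B X)"
    and Dup_Del_right: "X \<in> Ob B \<Longrightarrow> Dup B X \<Zsemi> (Idn B X \<otimes>\<^sub>a Del B X) \<Zsemi> Run B X = Idn B X"
    and Dup_Del_left: "X \<in> Ob B \<Longrightarrow> Dup B X \<Zsemi> (Del B X \<otimes>\<^sub>a Idn B X) \<Zsemi> Lun B X = Idn B X"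
    and Dup_Sym: "X \<in> Ob B \<Longrightarrow> Dup B X \<Zsemi> Sym B X X = Dup B X"
    and Dup_adjoint: "X \<in> Ob B \<Longrightarrow> \<exists>g. is_right_adjoint B (Dup B X) g"
    and Del_adjoint: "X \<in> Ob B \<Longrightarrow> \<exists>g. is_right_adjoint B (Del B X) g"
    and Frobenius: "X \<in> Ob B \<Longrightarrow>
          (Dup B X \<otimes>\<^sub>a Idn B X) \<Zsemi> Assoc B X X X \<Zsemi> (Idn B X \<otimes>\<^sub>a radj B (Dup B X))
          = radj B (Dup B X) \<Zsemi> Dup B X"
    and lax_Dup: "R \<in> hom B X Y \<Longrightarrow> R \<Zsemi> Dup B Y \<sqsubseteq> Dup B X \<Zsemi> (R \<otimes>\<^sub>a R)"
    and lax_Del: "R \<in> hom B X Y \<Longrightarrow> R \<Zsemi> Del B Y \<sqsubseteq> Del B X"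
    and Dup_TensOb: "X \<in> Ob B \<Longrightarrow> Y \<in> Ob B \<Longrightarrow>
          Dup B (X \<otimes>\<^sub>o Y) = (Dup B X \<otimes>\<^sub>a Dup B Y) \<Zsemi> mid_swap B X Y"
    and Del_TensOb: "X \<in> Ob B \<Longrightarrow> Y \<in> Ob B \<Longrightarrow>
          Del B (X \<otimes>\<^sub>o Y) = (Del B X \<otimes>\<^sub>a Del B Y) \<Zsemi> Lun B (Unit B)"
    and Dup_Unit: "Dup B (Unit B) = inv_arrow B (Lun B (Unit B))"
    and Del_Unit: "Del B (Unit B) = Idn B (Unit B)"

text \<open>
  Strict monoidal functors preserve tensor, unit, associators and unitors on the nose.  Preservation
  of the symmetry follows, since \<open>Sym B X Y\<close> is the pairing of the projections among the maps.
\<close>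

locale CBC_morphism =
  B: cartesian_bicategory B + B': cartesian_bicategory B' + is_functor B B' F
  for B :: "('o1, 'm1) bicat" and B' :: "('o2, 'm2) bicat" and F :: "('o1, 'm1, 'o2, 'm2) ftor" +
  assumes on_TensOb: "X \<in> Ob B \<Longrightarrow> Y \<in> Ob B \<Longrightarrow>
          on_Ob F (X \<otimes>\<^sub>o\<^bsub>B\<^esub> Y) = on_Ob F X \<otimes>\<^sub>o\<^bsub>B'\<^esub> on_Ob F Y"
    and on_TensArr: "f \<in> Arr B \<Longrightarrow> g \<in> Arr B \<Longrightarrow>
          on_Arr F (f \<otimes>\<^sub>a\<^bsub>B\<^esub> g) = on_Arr F f \<otimes>\<^sub>a\<^bsub>B'\<^esub> on_Arr F g"
    and on_Unit: "on_Ob F (Unit B) = Unit B'"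
    and on_Assoc: "X \<in> Ob B \<Longrightarrow> Y \<in> Ob B \<Longrightarrow> Z \<in> Ob B \<Longrightarrow>
          on_Arr F (Assoc B X Y Z) = Assoc B' (on_Ob F X) (on_Ob F Y) (on_Ob F Z)"
    and on_Lun: "X \<in> Ob B \<Longrightarrow> on_Arr F (Lun B X) = Lun B' (on_Ob F X)"
    and on_Run: "X \<in> Ob B \<Longrightarrow> on_Arr F (Run B X) = Run B' (on_Ob F X)"
    and on_Leq: "f \<in> hom B X Y \<Longrightarrow> g \<in> hom B X Y \<Longrightarrow> f \<sqsubseteq>\<^bsub>B\<^esub> g \<Longrightarrow> on_Arr F f \<sqsubseteq>\<^bsub>B'\<^esub> on_Arr F g"
    and on_Dup: "X \<in> Ob B \<Longrightarrow> on_Arr F (Dup B X) = Dup B' (on_Ob F X)"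
    and on_Del: "X \<in> Ob B \<Longrightarrow> on_Arr F (Del B X) = Del B' (on_Ob F X)"
    and on_radj_Dup: "X \<in> Ob B \<Longrightarrow> on_Arr F (radj B (Dup B X)) = radj B' (Dup B' (on_Ob F X))"
    and on_radj_Del: "X \<in> Ob B \<Longrightarrow> on_Arr F (radj B (Del B X)) = radj B' (Del B' (on_Ob F X))"
    and on_Ob_extensional: "on_Ob F \<in> extensional (Ob B)"
    and on_Arr_extensional: "on_Arr F \<in> extensional (Arr B)"

definition CBC :: "(('o, 'm) bicat, ('o, 'm, 'o, 'm) ftor) cat" where
  "CBC = \<lparr>Ob = {B. cartesian_bicategory B},
          Arr = {Arrow B B' F | B B' F. CBC_morphism B B' F},
          Idn = \<lambda>B. Arrow B B \<lparr>on_Ob = \<lambda>X\<in>Ob B. X, on_Arr = \<lambda>f\<in>Arr B. f\<rparr>,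
          Seq = \<lambda>F G. Arrow (src F) (tgt G)
                  \<lparr>on_Ob = \<lambda>X\<in>Ob (src F). on_Ob (lab G) (on_Ob (lab F) X),
                   on_Arr = \<lambda>f\<in>Arr (src F). on_Arr (lab G) (on_Arr (lab F) f)\<rparr>\<rparr>"


section \<open>From cartesian bicategories to doctrines\<close>

definition is_map :: "('o, 'm, 'z) bicat_scheme \<Rightarrow> ('o, 'm) arrow \<Rightarrow> bool" where
  "is_map B f \<longleftrightarrow> f \<Zsemi>\<^bsub>B\<^esub> Dup B (tgt f) = Dup B (src f) \<Zsemi>\<^bsub>B\<^esub> (f \<otimes>\<^sub>a\<^bsub>B\<^esub> f) \<and>
                  f \<Zsemi>\<^bsub>B\<^esub> Del B (tgt f) = Del B (src f)"

text \<open>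
  The base category is the cartesian category of maps.  The elements of the fibre over \<open>X\<close> are the
  labels of the arrows from \<open>X\<close> to the unit object, with meet \<open>d\<^sub>X \<Zsemi> (R \<otimes> S)\<close> up to the isomorphism of
  \<open>I \<otimes> I\<close> with \<open>I\<close>.  The equality predicate \<open>\<delta>\<^sub>X\<close>, which is the left adjoint to reindexing along the
  diagonal evaluated at top, is \<open>d\<^sub>X\<^sup>* \<Zsemi> e\<^sub>X\<close>.
\<close>

definition R_ob :: "('o, 'm) bicat \<Rightarrow> ('o, 'm, 'm) doctrine" where
  "R_ob B =
     \<lparr>Ob = Ob B,
      Arr = {f \<in> Arr B. is_map B f},
      Idn = Idn B,
      Seq = Seq B,
      Prod = TensOb B,
      Pr1 = \<lambda>X Y. (Idn B X \<otimes>\<^sub>a\<^bsub>B\<^esub> Del B Y) \<Zsemi>\<^bsub>B\<^esub> Run B X,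
      Pr2 = \<lambda>X Y. (Del B X \<otimes>\<^sub>a\<^bsub>B\<^esub> Idn B Y) \<Zsemi>\<^bsub>B\<^esub> Lun B Y,
      One = Unit B,
      Fib = \<lambda>X. {u. Arrow X (Unit B) u \<in> Arr B},
      Meet = \<lambda>X u v. lab (Dup B X \<Zsemi>\<^bsub>B\<^esub> (Arrow X (Unit B) u \<otimes>\<^sub>a\<^bsub>B\<^esub> Arrow X (Unit B) v) \<Zsemi>\<^bsub>B\<^esub>
                            Lun B (Unit B)),
      Top = \<lambda>X. lab (Del B X),
      Act = \<lambda>f u. lab (f \<Zsemi>\<^bsub>B\<^esub> Arrow (tgt f) (Unit B) u),
      Delta = \<lambda>X. lab (radj B (Dup B X) \<Zsemi>\<^bsub>B\<^esub> Del B X)\<rparr>"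

definition R_mor ::
  "('o1, 'm1) bicat \<Rightarrow> ('o1, 'm1, 'o2, 'm2) ftor \<Rightarrow> ('o1, 'm1, 'm1, 'o2, 'm2, 'm2) doctrine_map" where
  "R_mor B F =
     \<lparr>on_Ob = \<lambda>X\<in>Ob B. on_Ob F X,
      on_Arr = \<lambda>f\<in>Arr (R_ob B). on_Arr F f,
      on_Fib = \<lambda>X\<in>Ob B. \<lambda>u\<in>Fib (R_ob B) X. lab (on_Arr F (Arrow X (Unit B) u))\<rparr>"

definition R_functor ::
  "(('o, 'm) bicat, ('o, 'm, 'o, 'm) ftor,
    ('o, 'm, 'm) doctrine, ('o, 'm, 'm, 'o, 'm, 'm) doctrine_map) ftor" where
  "R_functor =
     \<lparr>on_Ob = R_ob,
      on_Arr = \<lambda>F. Arrow (R_ob (src F)) (R_ob (tgt F)) (R_mor (src F) (lab F))\<rparr>"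


section \<open>From doctrines to cartesian bicategories\<close>

definition graph :: "('o, 'm, 'p) doctrine \<Rightarrow> ('o, 'm) arrow \<Rightarrow> ('o, 'p) arrow" where
  "graph P f = Arrow (src f) (tgt f) (Act P (f \<times>\<^sub>a\<^bsub>P\<^esub> Idn P (tgt f)) (Delta P (tgt f)))"

definition L_seq ::
  "('o, 'm, 'p) doctrine \<Rightarrow> ('o, 'p) arrow \<Rightarrow> ('o, 'p) arrow \<Rightarrow> ('o, 'p) arrow" where
  "L_seq P r s =
     (let X = src r; Y = tgt r; Z = tgt s in
      Arrow X Z
        (Exq P \<langle>tri1 P X Y Z, tri3 P X Y Z\<rangle>\<^bsub>P\<^esub>
           (Meet P (X \<times>\<^sub>o\<^bsub>P\<^esub> (Y \<times>\<^sub>o\<^bsub>P\<^esub> Z))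
              (Act P \<langle>tri1 P X Y Z, tri2 P X Y Z\<rangle>\<^bsub>P\<^esub> (lab r))
              (Act P \<langle>tri2 P X Y Z, tri3 P X Y Z\<rangle>\<^bsub>P\<^esub> (lab s)))))"

definition L_tens ::
  "('o, 'm, 'p) doctrine \<Rightarrow> ('o, 'p) arrow \<Rightarrow> ('o, 'p) arrow \<Rightarrow> ('o, 'p) arrow" where
  "L_tens P r s =
     (let X = src r; Y = tgt r; Z = src s; W = tgt s in
      Arrow (X \<times>\<^sub>o\<^bsub>P\<^esub> Z) (Y \<times>\<^sub>o\<^bsub>P\<^esub> W)
        (Meet P ((X \<times>\<^sub>o\<^bsub>P\<^esub> Z) \<times>\<^sub>o\<^bsub>P\<^esub> (Y \<times>\<^sub>o\<^bsub>P\<^esub> W))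
           (Act P \<langle>quad1 P X Z Y W, quad3 P X Z Y W\<rangle>\<^bsub>P\<^esub> (lab r))
           (Act P \<langle>quad2 P X Z Y W, quad4 P X Z Y W\<rangle>\<^bsub>P\<^esub> (lab s))))"

definition L_ob :: "('o, 'm, 'p) doctrine \<Rightarrow> ('o, 'p) bicat" where
  "L_ob P =
     \<lparr>Ob = Ob P,
      Arr = {Arrow X Y r | X Y r. X \<in> Ob P \<and> Y \<in> Ob P \<and> r \<in> Fib P (X \<times>\<^sub>o\<^bsub>P\<^esub> Y)},
      Idn = \<lambda>X. Arrow X X (Delta P X),
      Seq = L_seq P,
      Leq = \<lambda>r s. src r = src s \<and> tgt r = tgt s \<and>
                   fib_le P (src r \<times>\<^sub>o\<^bsub>P\<^esub> tgt r) (lab r) (lab s),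
      TensOb = Prod P,
      TensArr = L_tens P,
      Unit = One P,
      Assoc = \<lambda>X Y Z. graph P (cart_assoc P X Y Z),
      Lun = \<lambda>X. graph P (cart_lun P X),
      Run = \<lambda>X. graph P (cart_run P X),
      Sym = \<lambda>X Y. graph P (cart_sym P X Y),
      Dup = \<lambda>X. graph P (diag P X),
      Del = \<lambda>X. graph P (bang P X)\<rparr>"

definition L_mor ::
  "('o1, 'm1, 'p1) doctrine \<Rightarrow> ('o1, 'm1, 'p1, 'o2, 'm2, 'p2) doctrine_map \<Rightarrow>
   ('o1, 'p1, 'o2, 'p2) ftor" where
  "L_mor P F =
     \<lparr>on_Ob = \<lambda>X\<in>Ob P. on_Ob F X,
      on_Arr = \<lambda>r\<in>Arr (L_ob P). Arrow (on_Ob F (src r)) (on_Ob F (tgt r))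
                                   (on_Fib F (src r \<times>\<^sub>o\<^bsub>P\<^esub> tgt r) (lab r))\<rparr>"

definition L_functor ::
  "(('o, 'm, 'p) doctrine, ('o, 'm, 'p, 'o, 'm, 'p) doctrine_map,
    ('o, 'p) bicat, ('o, 'p, 'o, 'p) ftor) ftor" where
  "L_functor =
     \<lparr>on_Ob = L_ob,
      on_Arr = \<lambda>F. Arrow (L_ob (src F)) (L_ob (tgt F)) (L_mor (src F) (lab F))\<rparr>"


section \<open>Unit and counit\<close>

text \<open>
  In a doctrine \<open>R_ob B\<close> arrows and fibre elements have the same label type, so the adjunction lives
  on doctrines of type \<open>('o, 'm, 'm) doctrine\<close>.  This is no restriction on the doctrines: labels of
  types \<open>'a\<close> and \<open>'p\<close> can be taken in the sum of the two types.
\<close>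

definition eta ::
  "('o, 'm, 'm) doctrine \<Rightarrow> (('o, 'm, 'm) doctrine, ('o, 'm, 'm, 'o, 'm, 'm) doctrine_map) arrow" where
  "eta P = Arrow P (R_ob (L_ob P))
     \<lparr>on_Ob = \<lambda>X\<in>Ob P. X,
      on_Arr = \<lambda>f\<in>Arr P. graph P f,
      on_Fib = \<lambda>X\<in>Ob P. \<lambda>x\<in>Fib P X. Act P (cart_run P X) x\<rparr>"

text \<open>
  In \<open>L_ob (R_ob B)\<close>, the label of an arrow \<open>R\<close> from \<open>X\<close> to \<open>Y\<close> is the label of an arrow of \<open>B\<close>
  from \<open>X \<otimes> Y\<close> to the unit object.
\<close>

definition eps_arr :: "('o, 'm) bicat \<Rightarrow> ('o, 'm) arrow \<Rightarrow> ('o, 'm) arrow" where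
  "eps_arr B R =
     (let X = src R; Y = tgt R in
      inv_arrow B (Run B X) \<Zsemi>\<^bsub>B\<^esub>
      (Idn B X \<otimes>\<^sub>a\<^bsub>B\<^esub> (radj B (Del B Y) \<Zsemi>\<^bsub>B\<^esub> Dup B Y)) \<Zsemi>\<^bsub>B\<^esub>
      inv_arrow B (Assoc B X Y Y) \<Zsemi>\<^bsub>B\<^esub>
      (Arrow (X \<otimes>\<^sub>o\<^bsub>B\<^esub> Y) (Unit B) (lab R) \<otimes>\<^sub>a\<^bsub>B\<^esub> Idn B Y) \<Zsemi>\<^bsub>B\<^esub>
      Lun B Y)"

definition eps :: "('o, 'm) bicat \<Rightarrow> (('o, 'm) bicat, ('o, 'm, 'o, 'm) ftor) arrow" where
  "eps B = Arrow (L_ob (R_ob B)) B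
     \<lparr>on_Ob = \<lambda>X\<in>Ob B. X, on_Arr = \<lambda>R\<in>Arr (L_ob (R_ob B)). eps_arr B R\<rparr>"

definition eps_inv_arr :: "('o, 'm) bicat \<Rightarrow> ('o, 'm) arrow \<Rightarrow> ('o, 'm) arrow" where
  "eps_inv_arr B S =
     (let X = src S; Y = tgt S in
      Arrow X Y
        (lab ((S \<otimes>\<^sub>a\<^bsub>B\<^esub> Idn B Y) \<Zsemi>\<^bsub>B\<^esub> radj B (Dup B Y) \<Zsemi>\<^bsub>B\<^esub> Del B Y)))"

definition eps_inv :: "('o, 'm) bicat \<Rightarrow> (('o, 'm) bicat, ('o, 'm, 'o, 'm) ftor) arrow" where
  "eps_inv B = Arrow B (L_ob (R_ob B))
     \<lparr>on_Ob = \<lambda>X\<in>Ob B. X, on_Arr = \<lambda>S\<in>Arr B. eps_inv_arr B S\<rparr>"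

end

theory Submission
  imports Defs
begin

text \<open>
  A relation of \<open>L(P)\<close> is known through its generalised elements: \<open>r(x, y)\<close> may or may not hold at a
  stage \<open>\<phi> \<in> P(U)\<close>.  Composition is existential quantification, and by Beck-Chevalley and Frobenius
  reciprocity a statement that holds after the choice of a witness holds already, so the axioms of
  a cartesian bicategory for \<open>L(P)\<close> are checked by elementwise regular logic.

  In a cartesian bicategory left adjoints are maps.  Hence the structural isomorphisms are maps,
  they are tuples of projections in the cartesian category of maps, and equations between them are
  checked there.  Quantification along a projection \<open>p\<close> is precomposition with \<open>p\<^sup>*\<close>, and the
  Frobenius law says that restricting to the predicate \<open>d\<^sup>*; e\<close> on \<open>X \<otimes> X\<close> and projecting is \<open>d\<^sup>*\<close>,
  which is Leibniz's law.

  Bending the output wire, \<open>S \<mapsto> (S \<otimes> id); d\<^sup>*; e\<close>, is an isomorphism from \<open>B\<close> to \<open>L(R(B))\<close> that is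
  the identity on objects; its inverse is the counit.  The fibre maps \<open>P\<^sub>\<rho>\<close> of the unit are order
  isomorphisms, so they preserve meets, tops and quantifiers, which are determined by the order.
\<close>

text \<open>Quantifiers exist along every leg of every product cone, and composition in L(P)
  quantifies along the pair of the first and third projections, which is not a chosen projection.
  Each projection is therefore written as an isomorphism followed by a chosen \<open>Pr1\<close>,
  and facts about \<open>Pr1\<close> are transported. In B the working notion is that of an arrow
  with a right adjoint (\<open>ladj\<close>): it is closed under composition and tensor, contains
  structural arrows and projections, and right adjoints compose. So an identity between maps yields,
  by passing to right adjoints, an identity between arrows that need not be maps; the snake
  identities of bending arise in this way. The counit formula does not visibly preserve anything.
  Its inverse does: on maps it is the graph functor of R(B), so it carries structural arrows to
  structural arrows, and only composition, tensor and order are left to compute. The counit inherits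
  all this. In L(P) bending is reindexing along the unitor, which is what L makes of the unit, so
  the first triangle identity says that unbending undoes bending.\<close>

lemma Arrow_lab [simp]: "src f = X \<Longrightarrow> tgt f = Y \<Longrightarrow> Arrow X Y (lab f) = f"
  by (cases f) auto

lemma in_hom_iff: "f \<in> hom C X Y \<longleftrightarrow> f \<in> Arr C \<and> src f = X \<and> tgt f = Y"
  by (simp add: hom_def)

section \<open>Categories and isomorphisms\<close>

context category
begin

lemmas src_Ob' [simp] = src_Ob and tgt_Ob' [simp] = tgt_Ob

lemma hom_Ob: "f \<in> hom C X Y \<Longrightarrow> X \<in> Ob C" "f \<in> hom C X Y \<Longrightarrow> Y \<in> Ob C"
  by (auto simp: in_hom_iff)

lemma Idn_simps [simp]:
  assumes "X \<in> Ob C"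
  shows "Idn C X \<in> Arr C" "src (Idn C X) = X" "tgt (Idn C X) = X"
  using Idn_hom[OF assms] by (auto simp: in_hom_iff)

lemma Seq_simps [simp]:
  assumes "f \<in> Arr C" "g \<in> Arr C" "tgt f = src g"
  shows "f \<Zsemi> g \<in> Arr C" "src (f \<Zsemi> g) = src f" "tgt (f \<Zsemi> g) = tgt g"
  using Seq_hom[of f "src f" "src g" g "tgt g"] assms by (auto simp: in_hom_iff)

lemma Idn_left' [simp]: "f \<in> Arr C \<Longrightarrow> X = src f \<Longrightarrow> Idn C X \<Zsemi> f = f"
  using Idn_left[of f "src f" "tgt f"] by (simp add: in_hom_iff)

lemma Idn_right' [simp]: "f \<in> Arr C \<Longrightarrow> X = tgt f \<Longrightarrow> f \<Zsemi> Idn C X = f"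
  using Idn_right[of f "src f" "tgt f"] by (simp add: in_hom_iff)

lemma Seq_assoc' [simp]:
  "f \<in> Arr C \<Longrightarrow> g \<in> Arr C \<Longrightarrow> h \<in> Arr C \<Longrightarrow> tgt f = src g \<Longrightarrow> tgt g = src h \<Longrightarrow>
   (f \<Zsemi> g) \<Zsemi> h = f \<Zsemi> (g \<Zsemi> h)"
  by (rule Seq_assoc) (auto simp: in_hom_iff)

lemma inverse_arrows_unique:
  assumes "inverse_arrows C f g" "inverse_arrows C f h"
  shows "g = h"
proof -
  have "g = g \<Zsemi> (f \<Zsemi> h)" using assms by (auto simp: inverse_arrows_def in_hom_iff)
  also have "\<dots> = (g \<Zsemi> f) \<Zsemi> h"
    by (rule Seq_assoc'[symmetric]) (use assms in \<open>auto simp: inverse_arrows_def in_hom_iff\<close>)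
  also have "\<dots> = h" using assms by (auto simp: inverse_arrows_def in_hom_iff simp del: Seq_assoc')
  finally show ?thesis .
qed

lemma inv_arrow_eq: "inverse_arrows C f g \<Longrightarrow> inv_arrow C f = g"
  unfolding inv_arrow_def using inverse_arrows_unique by blast

lemma inv_arrow_inverse: "is_iso C f \<Longrightarrow> inverse_arrows C f (inv_arrow C f)"
  unfolding is_iso_def using inv_arrow_eq by auto

lemma inverse_arrows_sym: "inverse_arrows C f g \<Longrightarrow> inverse_arrows C g f"
  by (auto simp: inverse_arrows_def in_hom_iff)

lemma is_iso_Arr: "is_iso C f \<Longrightarrow> f \<in> Arr C"
  by (auto simp: is_iso_def inverse_arrows_def)

lemma inv_arrow_simps [simp]:
  assumes "is_iso C f"
  shows "inv_arrow C f \<in> Arr C" "src (inv_arrow C f) = tgt f" "tgt (inv_arrow C f) = src f"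
    "f \<Zsemi> inv_arrow C f = Idn C (src f)" "inv_arrow C f \<Zsemi> f = Idn C (tgt f)"
    "is_iso C (inv_arrow C f)"
  using inv_arrow_inverse[OF assms] inverse_arrows_sym[OF inv_arrow_inverse[OF assms]]
  by (auto simp: inverse_arrows_def in_hom_iff is_iso_def)

lemma inv_arrow_cancel [simp]:
  assumes "is_iso C f"
  shows "h \<in> Arr C \<Longrightarrow> src h = src f \<Longrightarrow> f \<Zsemi> (inv_arrow C f \<Zsemi> h) = h"
    "h \<in> Arr C \<Longrightarrow> src h = tgt f \<Longrightarrow> inv_arrow C f \<Zsemi> (f \<Zsemi> h) = h"
  using assms is_iso_Arr[OF assms]
  by (simp_all add: Seq_assoc'[symmetric] del: Seq_assoc')

lemma iso_cancel_left:
  assumes "is_iso C f" "g \<in> Arr C" "h \<in> Arr C" "src g = tgt f" "src h = tgt f" "f \<Zsemi> g = f \<Zsemi> h"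
  shows "g = h"
  using assms inv_arrow_cancel(2)[OF assms(1), of g] inv_arrow_cancel(2)[OF assms(1), of h] by metis

lemma iso_cancel_right:
  assumes "is_iso C f" "g \<in> Arr C" "h \<in> Arr C" "tgt g = src f" "tgt h = src f" "g \<Zsemi> f = h \<Zsemi> f"
  shows "g = h"
proof -
  have "g = (g \<Zsemi> f) \<Zsemi> inv_arrow C f" "(h \<Zsemi> f) \<Zsemi> inv_arrow C f = h"
    using assms(1-5) is_iso_Arr[OF assms(1)] by simp_all
  then show ?thesis using assms(6) by simp
qed

lemma inverse_arrowsI:
  "f \<in> hom C X Y \<Longrightarrow> g \<in> hom C Y X \<Longrightarrow> f \<Zsemi> g = Idn C X \<Longrightarrow> g \<Zsemi> f = Idn C Y \<Longrightarrow>
   inverse_arrows C f g"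
  by (auto simp: inverse_arrows_def in_hom_iff)

lemma inverse_arrows_Seq:
  assumes "inverse_arrows C f f'" "inverse_arrows C g g'" "tgt f = src g"
  shows "inverse_arrows C (f \<Zsemi> g) (g' \<Zsemi> f')"
proof -
  have "g \<Zsemi> (g' \<Zsemi> f') = f'" "f' \<Zsemi> (f \<Zsemi> g) = g"
    using assms by (auto simp: inverse_arrows_def in_hom_iff Seq_assoc'[symmetric] simp del: Seq_assoc')
  then show ?thesis using assms by (auto simp: inverse_arrows_def in_hom_iff)
qed

lemma is_iso_Seq: "is_iso C f \<Longrightarrow> is_iso C g \<Longrightarrow> tgt f = src g \<Longrightarrow> is_iso C (f \<Zsemi> g)"
  unfolding is_iso_def using inverse_arrows_Seq by blast

lemma inverse_arrows_Idn: "X \<in> Ob C \<Longrightarrow> inverse_arrows C (Idn C X) (Idn C X)"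
  by (auto simp: inverse_arrows_def in_hom_iff)

end

lemma (in is_functor) on_Arr_simps [simp]:
  assumes "f \<in> Arr C"
  shows "on_Arr F f \<in> Arr D" "src (on_Arr F f) = on_Ob F (src f)" "tgt (on_Arr F f) = on_Ob F (tgt f)"
  using on_Arr[of f "src f" "tgt f"] assms by (auto simp: in_hom_iff)

lemma (in is_functor) on_Seq' [simp]:
  "f \<in> Arr C \<Longrightarrow> g \<in> Arr C \<Longrightarrow> tgt f = src g \<Longrightarrow>
   on_Arr F (f \<Zsemi>\<^bsub>C\<^esub> g) = on_Arr F f \<Zsemi>\<^bsub>D\<^esub> on_Arr F g"
  by (rule on_Seq) (auto simp: in_hom_iff)

lemma (in is_functor) on_inverse_arrows:
  assumes "inverse_arrows C f g" shows "inverse_arrows D (on_Arr F f) (on_Arr F g)"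
  using assms on_Seq'[of f g] on_Seq'[of g f]
  by (auto simp: inverse_arrows_def in_hom_iff on_Idn)

lemma is_functor_comp:
  assumes "is_functor C D F" "is_functor D E G" shows "is_functor C E (comp_ftor F G)"
proof -
  interpret F: is_functor C D F by fact
  interpret G: is_functor D E G by fact
  show ?thesis
    by unfold_locales (auto simp: comp_ftor_def in_hom_iff F.on_Ob G.on_Ob F.on_Idn G.on_Idn)
qed


section \<open>Cartesian categories\<close>

text \<open>Unfolding these turns every structural arrow into nested pairs of projections. The rules
  \<open>Seq_pair\<close>, \<open>pair_Pr_assoc\<close> and \<open>pair_eta\<close> below then bring
  both sides of a coherence equation to the same normal form.\<close>

lemmas cart_defs = prod_arr_def diag_def cart_run_def cart_lun_def cart_sym_def cart_assoc_def
  tri1_def tri2_def tri3_def quad1_def quad2_def quad3_def quad4_def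

context cartesian_category
begin

lemmas Prod_Ob' [simp] = Prod_Ob and One_Ob' [simp] = One_Ob

lemma Pr_simps [simp]:
  assumes "X \<in> Ob C" "Y \<in> Ob C"
  shows "Pr1 C X Y \<in> Arr C" "src (Pr1 C X Y) = X \<times>\<^sub>o Y" "tgt (Pr1 C X Y) = X"
    "Pr2 C X Y \<in> Arr C" "src (Pr2 C X Y) = X \<times>\<^sub>o Y" "tgt (Pr2 C X Y) = Y"
  using Prod_product[OF assms] by (auto simp: is_product_def in_hom_iff)

lemma pair_aux:
  assumes "f \<in> Arr C" "g \<in> Arr C" "src g = src f"
  shows "\<exists>!h. h \<in> hom C (src f) (tgt f \<times>\<^sub>o tgt g) \<and>
           h \<Zsemi> Pr1 C (tgt f) (tgt g) = f \<and> h \<Zsemi> Pr2 C (tgt f) (tgt g) = g"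
proof -
  have f: "f \<in> hom C (src f) (tgt f)" and g: "g \<in> hom C (src f) (tgt g)" and U: "src f \<in> Ob C"
    using assms by (auto simp: in_hom_iff)
  show ?thesis
    using Prod_product[of "tgt f" "tgt g"] assms f g U unfolding is_product_def by auto
qed

lemma pair_simps [simp]:
  assumes "f \<in> Arr C" "g \<in> Arr C" "src g = src f"
  shows "\<langle>f, g\<rangle> \<in> Arr C" "src \<langle>f, g\<rangle> = src f" "tgt \<langle>f, g\<rangle> = tgt f \<times>\<^sub>o tgt g"
    "A = tgt f \<Longrightarrow> B = tgt g \<Longrightarrow> \<langle>f, g\<rangle> \<Zsemi> Pr1 C A B = f"
    "A = tgt f \<Longrightarrow> B = tgt g \<Longrightarrow> \<langle>f, g\<rangle> \<Zsemi> Pr2 C A B = g"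
  using theI'[OF pair_aux[OF assms]] unfolding pair_def[symmetric] by (auto simp: in_hom_iff)

lemma pair_Pr_assoc [simp]:
  assumes "f \<in> Arr C" "g \<in> Arr C" "src g = src f" "A = tgt f" "B = tgt g" "h \<in> Arr C"
  shows "src h = tgt f \<Longrightarrow> \<langle>f, g\<rangle> \<Zsemi> (Pr1 C A B \<Zsemi> h) = f \<Zsemi> h"
    "src h = tgt g \<Longrightarrow> \<langle>f, g\<rangle> \<Zsemi> (Pr2 C A B \<Zsemi> h) = g \<Zsemi> h"
  using assms by (simp_all add: Seq_assoc'[symmetric] del: Seq_assoc')

lemma prod_eqI:
  assumes "f \<in> Arr C" "g \<in> Arr C" "src f = src g" "tgt f = A \<times>\<^sub>o B" "tgt g = A \<times>\<^sub>o B"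
    "A \<in> Ob C" "B \<in> Ob C"
    "f \<Zsemi> Pr1 C A B = g \<Zsemi> Pr1 C A B" "f \<Zsemi> Pr2 C A B = g \<Zsemi> Pr2 C A B"
  shows "f = g"
proof -
  have "f \<Zsemi> Pr1 C A B \<in> Arr C" "f \<Zsemi> Pr2 C A B \<in> Arr C" using assms by simp_all
  from pair_aux[OF this] show ?thesis using assms by (auto simp: in_hom_iff)
qed

lemma Seq_pair [simp]:
  assumes "f \<in> Arr C" "g \<in> Arr C" "src g = src f" "h \<in> Arr C" "tgt h = src f"
  shows "h \<Zsemi> \<langle>f, g\<rangle> = \<langle>h \<Zsemi> f, h \<Zsemi> g\<rangle>"
  by (rule prod_eqI[of _ _ "tgt f" "tgt g"]) (use assms in simp_all)

lemma pair_eta [simp]: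
  assumes "h \<in> Arr C" "tgt h = A \<times>\<^sub>o B" "A \<in> Ob C" "B \<in> Ob C"
  shows "\<langle>h \<Zsemi> Pr1 C A B, h \<Zsemi> Pr2 C A B\<rangle> = h"
  by (rule prod_eqI[of _ _ A B]) (use assms in simp_all)

lemma pair_Pr [simp]:
  assumes "A \<in> Ob C" "B \<in> Ob C"
  shows "\<langle>Pr1 C A B, Pr2 C A B\<rangle> = Idn C (A \<times>\<^sub>o B)"
  by (rule prod_eqI[of _ _ A B]) (use assms in simp_all)

lemma pair_eq_iff:
  assumes "f \<in> Arr C" "g \<in> Arr C" "src g = src f" "f' \<in> Arr C" "g' \<in> Arr C" "src g' = src f'"
    "tgt f = tgt f'" "tgt g = tgt g'"
  shows "\<langle>f, g\<rangle> = \<langle>f', g'\<rangle> \<longleftrightarrow> f = f' \<and> g = g'"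
  using assms pair_simps(4,5)[of f g "tgt f'" "tgt g'"] pair_simps(4,5)[of f' g' "tgt f'" "tgt g'"]
  by metis

lemma bang_simps [simp]:
  assumes "X \<in> Ob C"
  shows "bang C X \<in> Arr C" "src (bang C X) = X" "tgt (bang C X) = One C"
  using theI'[OF One_terminal[OF assms]] unfolding bang_def[symmetric] by (auto simp: in_hom_iff)

lemma One_eqI:
  "f \<in> Arr C \<Longrightarrow> g \<in> Arr C \<Longrightarrow> src f = src g \<Longrightarrow> tgt f = One C \<Longrightarrow> tgt g = One C \<Longrightarrow> f = g"
  using One_terminal[of "src g"] by (auto simp: in_hom_iff)

lemma diag_simps [simp]:
  assumes "X \<in> Ob C"
  shows "diag C X \<in> Arr C" "src (diag C X) = X" "tgt (diag C X) = X \<times>\<^sub>o X"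
  using assms by (auto simp: diag_def)

lemma prod_arr_simps [simp]:
  assumes "f \<in> Arr C" "g \<in> Arr C"
  shows "f \<times>\<^sub>a g \<in> Arr C" "src (f \<times>\<^sub>a g) = src f \<times>\<^sub>o src g" "tgt (f \<times>\<^sub>a g) = tgt f \<times>\<^sub>o tgt g"
  using assms by (auto simp: prod_arr_def)

lemma cart_run_simps [simp]:
  assumes "X \<in> Ob C"
  shows "cart_run C X \<in> Arr C" "src (cart_run C X) = X \<times>\<^sub>o One C" "tgt (cart_run C X) = X"
  using assms by (auto simp: cart_run_def)

lemma cart_lun_simps [simp]:
  assumes "X \<in> Ob C"
  shows "cart_lun C X \<in> Arr C" "src (cart_lun C X) = One C \<times>\<^sub>o X" "tgt (cart_lun C X) = X"
  using assms by (auto simp: cart_lun_def)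

lemma cart_sym_simps [simp]:
  assumes "X \<in> Ob C" "Y \<in> Ob C"
  shows "cart_sym C X Y \<in> Arr C" "src (cart_sym C X Y) = X \<times>\<^sub>o Y" "tgt (cart_sym C X Y) = Y \<times>\<^sub>o X"
  using assms by (auto simp: cart_sym_def)

lemma cart_assoc_simps [simp]:
  assumes "X \<in> Ob C" "Y \<in> Ob C" "Z \<in> Ob C"
  shows "cart_assoc C X Y Z \<in> Arr C" "src (cart_assoc C X Y Z) = (X \<times>\<^sub>o Y) \<times>\<^sub>o Z"
    "tgt (cart_assoc C X Y Z) = X \<times>\<^sub>o (Y \<times>\<^sub>o Z)"
  using assms by (auto simp: cart_assoc_def)

lemma tri_simps [simp]:
  assumes "X \<in> Ob C" "Y \<in> Ob C" "Z \<in> Ob C"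
  shows "tri1 C X Y Z \<in> Arr C" "src (tri1 C X Y Z) = X \<times>\<^sub>o (Y \<times>\<^sub>o Z)" "tgt (tri1 C X Y Z) = X"
    "tri2 C X Y Z \<in> Arr C" "src (tri2 C X Y Z) = X \<times>\<^sub>o (Y \<times>\<^sub>o Z)" "tgt (tri2 C X Y Z) = Y"
    "tri3 C X Y Z \<in> Arr C" "src (tri3 C X Y Z) = X \<times>\<^sub>o (Y \<times>\<^sub>o Z)" "tgt (tri3 C X Y Z) = Z"
  using assms by (auto simp: tri1_def tri2_def tri3_def)

lemma quad_simps [simp]:
  assumes "X \<in> Ob C" "Y \<in> Ob C" "Z \<in> Ob C" "W \<in> Ob C"
  shows "quad1 C X Y Z W \<in> Arr C" "src (quad1 C X Y Z W) = (X \<times>\<^sub>o Y) \<times>\<^sub>o (Z \<times>\<^sub>o W)" "tgt (quad1 C X Y Z W) = X"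
    "quad2 C X Y Z W \<in> Arr C" "src (quad2 C X Y Z W) = (X \<times>\<^sub>o Y) \<times>\<^sub>o (Z \<times>\<^sub>o W)" "tgt (quad2 C X Y Z W) = Y"
    "quad3 C X Y Z W \<in> Arr C" "src (quad3 C X Y Z W) = (X \<times>\<^sub>o Y) \<times>\<^sub>o (Z \<times>\<^sub>o W)" "tgt (quad3 C X Y Z W) = Z"
    "quad4 C X Y Z W \<in> Arr C" "src (quad4 C X Y Z W) = (X \<times>\<^sub>o Y) \<times>\<^sub>o (Z \<times>\<^sub>o W)" "tgt (quad4 C X Y Z W) = W"
  using assms by (auto simp: quad1_def quad2_def quad3_def quad4_def)

lemma is_product_pairing:
  assumes "is_product C X Y W p q" "f \<in> hom C Z X" "g \<in> hom C Z Y"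
  obtains h where "h \<in> hom C Z W" "h \<Zsemi> p = f" "h \<Zsemi> q = g"
  using assms hom_Ob(1)[OF assms(2)] unfolding is_product_def by blast

lemma is_product_eqI:
  assumes "is_product C X Y W p q" "h \<in> hom C Z W" "k \<in> hom C Z W" "h \<Zsemi> p = k \<Zsemi> p" "h \<Zsemi> q = k \<Zsemi> q"
  shows "h = k"
proof -
  have p: "p \<in> hom C W X" "q \<in> hom C W Y" using assms(1) by (auto simp: is_product_def)
  have "Z \<in> Ob C" "k \<Zsemi> p \<in> hom C Z X" "k \<Zsemi> q \<in> hom C Z Y"
    using assms p hom_Ob Seq_hom by blast+
  then have "\<exists>!h. h \<in> hom C Z W \<and> h \<Zsemi> p = k \<Zsemi> p \<and> h \<Zsemi> q = k \<Zsemi> q"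
    using assms(1) unfolding is_product_def by blast
  then show ?thesis using assms by metis
qed

text \<open>Any product cone is compared with the chosen one by pairing its legs, and the comparison
  is invertible. The other leg disappears into the isomorphism \<open>h\<close>, so statements about
  arbitrary projections reduce to the chosen \<open>Pr1\<close>.\<close>

lemma is_projection_iff:
  "is_projection C p \<longleftrightarrow>
   p \<in> Arr C \<and> (\<exists>B\<in>Ob C. \<exists>h. is_iso C h \<and> src h = src p \<and> tgt h = tgt p \<times>\<^sub>o B \<and> p = h \<Zsemi> Pr1 C (tgt p) B)"
  (is "?L \<longleftrightarrow> ?R")
proof
  assume ?L
  then obtain B q where B: "B \<in> Ob C" and pr: "is_product C (tgt p) B (src p) p q" and p: "p \<in> Arr C"
    by (auto simp: is_projection_def)
  have q: "q \<in> hom C (src p) B" using pr by (auto simp: is_product_def)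
  have "Pr1 C (tgt p) B \<in> hom C (tgt p \<times>\<^sub>o B) (tgt p)" "Pr2 C (tgt p) B \<in> hom C (tgt p \<times>\<^sub>o B) B"
    using B p by (auto simp: in_hom_iff)
  from is_product_pairing[OF pr this] obtain k where
    k: "k \<in> hom C (tgt p \<times>\<^sub>o B) (src p)" "k \<Zsemi> p = Pr1 C (tgt p) B" "k \<Zsemi> q = Pr2 C (tgt p) B" .
  \<comment> \<open>One composite is the identity by uniqueness for the given cone, the other one by
    uniqueness for the chosen cone.\<close>
  have "\<langle>p, q\<rangle> \<Zsemi> k = Idn C (src p)"
    by (rule is_product_eqI[OF pr]) (use p q k B in \<open>auto simp: in_hom_iff\<close>)
  moreover have "k \<Zsemi> \<langle>p, q\<rangle> = Idn C (tgt p \<times>\<^sub>o B)"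
    by (rule prod_eqI[of _ _ "tgt p" B]) (use p q k B in \<open>auto simp: in_hom_iff\<close>)
  ultimately have "inverse_arrows C \<langle>p, q\<rangle> k"
    using p q k by (auto simp: inverse_arrows_def in_hom_iff)
  then have "is_iso C \<langle>p, q\<rangle>" by (auto simp: is_iso_def)
  moreover have "src \<langle>p, q\<rangle> = src p" "tgt \<langle>p, q\<rangle> = tgt p \<times>\<^sub>o B" "p = \<langle>p, q\<rangle> \<Zsemi> Pr1 C (tgt p) B"
    using p q by (auto simp: in_hom_iff)
  ultimately show ?R using p B by blast
next
  assume ?R
  then obtain B h where p: "p \<in> Arr C" and B: "B \<in> Ob C" and h: "is_iso C h" "src h = src p"
    "tgt h = tgt p \<times>\<^sub>o B" and ph: "p = h \<Zsemi> Pr1 C (tgt p) B" by blast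
  define X where "X = tgt p"
  have X: "X \<in> Ob C" using p by (simp add: X_def)
  note hA = is_iso_Arr[OF h(1)]
  have "is_product C X B (src p) p (h \<Zsemi> Pr2 C X B)"
    unfolding is_product_def
  proof (intro conjI ballI)
    show "p \<in> hom C (src p) X" using p by (simp add: X_def in_hom_iff)
    show "h \<Zsemi> Pr2 C X B \<in> hom C (src p) B" using h hA X B by (simp add: X_def in_hom_iff)
    fix Z f g assume Z: "Z \<in> Ob C" and f: "f \<in> hom C Z X" and g: "g \<in> hom C Z B"
    have *: "h \<Zsemi> Pr1 C X B = p" using ph by (simp add: X_def)
    show "\<exists>!k. k \<in> hom C Z (src p) \<and> k \<Zsemi> p = f \<and> k \<Zsemi> (h \<Zsemi> Pr2 C X B) = g"
    proof (rule ex1I[of _ "\<langle>f, g\<rangle> \<Zsemi> inv_arrow C h"])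
      have "inv_arrow C h \<Zsemi> p = Pr1 C X B" unfolding *[symmetric] using h hA X B by (simp add: X_def)
      then show "\<langle>f, g\<rangle> \<Zsemi> inv_arrow C h \<in> hom C Z (src p) \<and> (\<langle>f, g\<rangle> \<Zsemi> inv_arrow C h) \<Zsemi> p = f \<and>
          (\<langle>f, g\<rangle> \<Zsemi> inv_arrow C h) \<Zsemi> h \<Zsemi> Pr2 C X B = g"
        using f g h hA X B p by (simp add: in_hom_iff X_def[symmetric])
    next
      fix k assume k: "k \<in> hom C Z (src p) \<and> k \<Zsemi> p = f \<and> k \<Zsemi> (h \<Zsemi> Pr2 C X B) = g"
      have "k \<Zsemi> h = \<langle>f, g\<rangle>"
        by (rule prod_eqI[of _ _ X B])
          (use k f g h hA X B * in \<open>auto simp: in_hom_iff X_def[symmetric]\<close>)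
      then have "(k \<Zsemi> h) \<Zsemi> inv_arrow C h = \<langle>f, g\<rangle> \<Zsemi> inv_arrow C h" by simp
      then show "k = \<langle>f, g\<rangle> \<Zsemi> inv_arrow C h"
        using k h hA by (auto simp: in_hom_iff)
    qed
  qed
  then show ?L using p B unfolding is_projection_def X_def by blast
qed

lemma is_projection_Pr1: "X \<in> Ob C \<Longrightarrow> Y \<in> Ob C \<Longrightarrow> is_projection C (Pr1 C X Y)"
  using Prod_product[of X Y] by (auto simp: is_projection_def)

end

section \<open>Strict cartesian functors on the derived structure\<close>

context strict_cartesian_functor
begin

lemma on_pair:
  assumes "f \<in> Arr C" "g \<in> Arr C" "src g = src f"
  shows "on_Arr F \<langle>f, g\<rangle>\<^bsub>C\<^esub> = \<langle>on_Arr F f, on_Arr F g\<rangle>\<^bsub>D\<^esub>"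
proof (rule D.prod_eqI[of _ _ "on_Ob F (tgt f)" "on_Ob F (tgt g)"])
  have 1: "on_Arr F f = on_Arr F \<langle>f, g\<rangle>\<^bsub>C\<^esub> \<Zsemi>\<^bsub>D\<^esub> Pr1 D (on_Ob F (tgt f)) (on_Ob F (tgt g))"
    using assms on_Seq'[of "\<langle>f, g\<rangle>\<^bsub>C\<^esub>" "Pr1 C (tgt f) (tgt g)"] by (simp add: on_Pr1)
  have 2: "on_Arr F g = on_Arr F \<langle>f, g\<rangle>\<^bsub>C\<^esub> \<Zsemi>\<^bsub>D\<^esub> Pr2 D (on_Ob F (tgt f)) (on_Ob F (tgt g))"
    using assms on_Seq'[of "\<langle>f, g\<rangle>\<^bsub>C\<^esub>" "Pr2 C (tgt f) (tgt g)"] by (simp add: on_Pr2)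
  show "on_Arr F \<langle>f, g\<rangle>\<^bsub>C\<^esub> \<Zsemi>\<^bsub>D\<^esub> Pr1 D (on_Ob F (tgt f)) (on_Ob F (tgt g)) =
    \<langle>on_Arr F f, on_Arr F g\<rangle>\<^bsub>D\<^esub> \<Zsemi>\<^bsub>D\<^esub> Pr1 D (on_Ob F (tgt f)) (on_Ob F (tgt g))"
    unfolding 1[symmetric] using assms by simp
  show "on_Arr F \<langle>f, g\<rangle>\<^bsub>C\<^esub> \<Zsemi>\<^bsub>D\<^esub> Pr2 D (on_Ob F (tgt f)) (on_Ob F (tgt g)) =
    \<langle>on_Arr F f, on_Arr F g\<rangle>\<^bsub>D\<^esub> \<Zsemi>\<^bsub>D\<^esub> Pr2 D (on_Ob F (tgt f)) (on_Ob F (tgt g))"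
    unfolding 2[symmetric] using assms by simp
qed (use assms in \<open>auto simp: on_Prod on_Ob\<close>)

lemma on_bang: "X \<in> Ob C \<Longrightarrow> on_Arr F (bang C X) = bang D (on_Ob F X)"
  by (rule D.One_eqI) (auto simp: on_One on_Ob)

lemma on_diag: "X \<in> Ob C \<Longrightarrow> on_Arr F (diag C X) = diag D (on_Ob F X)"
  by (simp add: diag_def on_pair on_Idn)

lemma on_prod_arr:
  "f \<in> Arr C \<Longrightarrow> g \<in> Arr C \<Longrightarrow> on_Arr F (f \<times>\<^sub>a\<^bsub>C\<^esub> g) = on_Arr F f \<times>\<^sub>a\<^bsub>D\<^esub> on_Arr F g"
  by (simp add: prod_arr_def on_pair on_Pr1 on_Pr2)

lemma on_tri:
  assumes "X \<in> Ob C" "Y \<in> Ob C" "Z \<in> Ob C"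
  shows "on_Arr F (tri1 C X Y Z) = tri1 D (on_Ob F X) (on_Ob F Y) (on_Ob F Z)"
    "on_Arr F (tri2 C X Y Z) = tri2 D (on_Ob F X) (on_Ob F Y) (on_Ob F Z)"
    "on_Arr F (tri3 C X Y Z) = tri3 D (on_Ob F X) (on_Ob F Y) (on_Ob F Z)"
  using assms by (simp_all add: tri1_def tri2_def tri3_def on_Pr1 on_Pr2 on_Prod)

lemma on_quad:
  assumes "X \<in> Ob C" "Y \<in> Ob C" "Z \<in> Ob C" "W \<in> Ob C"
  shows "on_Arr F (quad1 C X Y Z W) = quad1 D (on_Ob F X) (on_Ob F Y) (on_Ob F Z) (on_Ob F W)"
    "on_Arr F (quad2 C X Y Z W) = quad2 D (on_Ob F X) (on_Ob F Y) (on_Ob F Z) (on_Ob F W)"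
    "on_Arr F (quad3 C X Y Z W) = quad3 D (on_Ob F X) (on_Ob F Y) (on_Ob F Z) (on_Ob F W)"
    "on_Arr F (quad4 C X Y Z W) = quad4 D (on_Ob F X) (on_Ob F Y) (on_Ob F Z) (on_Ob F W)"
  using assms by (simp_all add: quad1_def quad2_def quad3_def quad4_def on_Pr1 on_Pr2 on_Prod)

lemma on_cart:
  assumes "X \<in> Ob C" "Y \<in> Ob C" "Z \<in> Ob C"
  shows "on_Arr F (cart_run C X) = cart_run D (on_Ob F X)"
    "on_Arr F (cart_lun C X) = cart_lun D (on_Ob F X)"
    "on_Arr F (cart_assoc C X Y Z) = cart_assoc D (on_Ob F X) (on_Ob F Y) (on_Ob F Z)"
  using assms by (simp_all add: cart_defs on_Pr1 on_Pr2 on_Prod on_One on_pair)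

text \<open>Preservation is assumed for chosen projections only. A leg of an arbitrary cone is an
  isomorphism followed by a chosen projection, and functors preserve isomorphisms.\<close>

lemma on_projection:
  assumes "is_projection C p" shows "is_projection D (on_Arr F p)"
proof -
  obtain B h where p: "p \<in> Arr C" and B: "B \<in> Ob C" and h: "is_iso C h" "src h = src p"
    "tgt h = tgt p \<times>\<^sub>o\<^bsub>C\<^esub> B" and ph: "p = h \<Zsemi>\<^bsub>C\<^esub> Pr1 C (tgt p) B"
    using assms C.is_projection_iff by blast
  note hA = C.is_iso_Arr[OF h(1)]
  have "is_iso D (on_Arr F h)"
    using on_inverse_arrows C.inv_arrow_inverse[OF h(1)] unfolding is_iso_def by blast
  moreover have "on_Arr F p = on_Arr F h \<Zsemi>\<^bsub>D\<^esub> Pr1 D (on_Ob F (tgt p)) (on_Ob F B)"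
    by (subst ph) (use p B hA h in \<open>simp add: on_Pr1\<close>)
  ultimately show ?thesis
    unfolding D.is_projection_iff using p B hA h
    by (auto simp: on_Prod on_Ob intro!: bexI[of _ "on_Ob F B"])
qed

end

section \<open>Forcing in a doctrine\<close>

context doctrine
begin

lemma Meet_Fib [simp]: "X \<in> Ob P \<Longrightarrow> x \<in> Fib P X \<Longrightarrow> y \<in> Fib P X \<Longrightarrow> Meet P X x y \<in> Fib P X"
  using inf_semilattice.meet_closed[OF fibre] .

lemma Top_Fib [simp]: "X \<in> Ob P \<Longrightarrow> Top P X \<in> Fib P X"
  using inf_semilattice.top_closed[OF fibre] .

lemma le_refl [simp]: "X \<in> Ob P \<Longrightarrow> x \<in> Fib P X \<Longrightarrow> fib_le P X x x"
  unfolding fib_le_def using inf_semilattice.meet_idem[OF fibre] .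

lemma le_antisym:
  "X \<in> Ob P \<Longrightarrow> x \<in> Fib P X \<Longrightarrow> y \<in> Fib P X \<Longrightarrow> fib_le P X x y \<Longrightarrow> fib_le P X y x \<Longrightarrow> x = y"
  unfolding fib_le_def using inf_semilattice.meet_comm[OF fibre] by metis

lemma le_trans:
  "X \<in> Ob P \<Longrightarrow> x \<in> Fib P X \<Longrightarrow> y \<in> Fib P X \<Longrightarrow> z \<in> Fib P X \<Longrightarrow>
   fib_le P X x y \<Longrightarrow> fib_le P X y z \<Longrightarrow> fib_le P X x z"
  unfolding fib_le_def using inf_semilattice.meet_assoc[OF fibre] by metis

lemma le_Meet_iff [simp]:
  assumes "X \<in> Ob P" "x \<in> Fib P X" "y \<in> Fib P X" "z \<in> Fib P X"
  shows "fib_le P X z (Meet P X x y) \<longleftrightarrow> fib_le P X z x \<and> fib_le P X z y"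
proof -
  interpret inf_semilattice "Fib P X" "Meet P X" "Top P X" using fibre assms(1) .
  show ?thesis unfolding fib_le_def using assms
    by (smt (verit) meet_assoc meet_comm meet_idem meet_closed)
qed

lemma Meet_le1: "X \<in> Ob P \<Longrightarrow> x \<in> Fib P X \<Longrightarrow> y \<in> Fib P X \<Longrightarrow> fib_le P X (Meet P X x y) x"
  using le_Meet_iff[of X x y "Meet P X x y"] by simp

lemma Meet_le2: "X \<in> Ob P \<Longrightarrow> x \<in> Fib P X \<Longrightarrow> y \<in> Fib P X \<Longrightarrow> fib_le P X (Meet P X x y) y"
  using le_Meet_iff[of X x y "Meet P X x y"] by simp

lemma le_Top [simp]: "X \<in> Ob P \<Longrightarrow> x \<in> Fib P X \<Longrightarrow> fib_le P X x (Top P X)"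
  unfolding fib_le_def using inf_semilattice.meet_top[OF fibre] .

lemma Act_Fib [simp]: "f \<in> Arr P \<Longrightarrow> x \<in> Fib P (tgt f) \<Longrightarrow> U = src f \<Longrightarrow> Act P f x \<in> Fib P U"
  using Act_closed[of f "src f" "tgt f"] by (simp add: in_hom_iff)

lemma Act_Act [simp]:
  "f \<in> Arr P \<Longrightarrow> g \<in> Arr P \<Longrightarrow> tgt f = src g \<Longrightarrow> x \<in> Fib P (tgt g) \<Longrightarrow>
   Act P f (Act P g x) = Act P (f \<Zsemi> g) x"
  using Act_Seq[of f "src f" "tgt f" g "tgt g"] by (simp add: in_hom_iff)

lemma Act_Meet' [simp]:
  "f \<in> Arr P \<Longrightarrow> tgt f = Y \<Longrightarrow> x \<in> Fib P Y \<Longrightarrow> y \<in> Fib P Y \<Longrightarrow>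
   Act P f (Meet P Y x y) = Meet P (src f) (Act P f x) (Act P f y)"
  using Act_Meet[of f "src f" "tgt f"] by (simp add: in_hom_iff)

lemma Act_Top' [simp]: "f \<in> Arr P \<Longrightarrow> tgt f = Y \<Longrightarrow> Act P f (Top P Y) = Top P (src f)"
  using Act_Top[of f "src f" "tgt f"] by (simp add: in_hom_iff)

lemma Act_Idn' [simp]: "X \<in> Ob P \<Longrightarrow> x \<in> Fib P X \<Longrightarrow> Act P (Idn P X) x = x"
  by (rule Act_Idn)

lemma Act_mono:
  assumes "f \<in> Arr P" "x \<in> Fib P (tgt f)" "y \<in> Fib P (tgt f)" "fib_le P (tgt f) x y"
  shows "fib_le P (src f) (Act P f x) (Act P f y)"
  using assms Act_Meet'[of f "tgt f" x y] by (simp add: fib_le_def)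

end

section \<open>The components of L(P)\<close>

lemma L_ob_simps [simp]:
  "Ob (L_ob P) = Ob P" "TensOb (L_ob P) = Prod P" "Unit (L_ob P) = One P"
  by (simp_all add: L_ob_def)

lemma L_ob_Arr:
  "r \<in> Arr (L_ob P) \<longleftrightarrow> src r \<in> Ob P \<and> tgt r \<in> Ob P \<and> lab r \<in> Fib P (src r \<times>\<^sub>o\<^bsub>P\<^esub> tgt r)"
  by (cases r) (auto simp: L_ob_def)

lemma L_ob_structure:
  "Assoc (L_ob P) X Y Z = graph P (cart_assoc P X Y Z)" "Lun (L_ob P) X = graph P (cart_lun P X)"
  "Run (L_ob P) X = graph P (cart_run P X)" "Sym (L_ob P) X Y = graph P (cart_sym P X Y)"
  "Dup (L_ob P) X = graph P (diag P X)" "Del (L_ob P) X = graph P (bang P X)"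
  by (simp_all add: L_ob_def)

lemma L_ob_Leq:
  "Leq (L_ob P) r s \<longleftrightarrow>
   src r = src s \<and> tgt r = tgt s \<and> fib_le P (src r \<times>\<^sub>o\<^bsub>P\<^esub> tgt r) (lab r) (lab s)"
  by (simp add: L_ob_def)

lemma L_ob_Idn: "Idn (L_ob P) X = Arrow X X (Delta P X)"
  by (simp add: L_ob_def)

lemma L_ob_Idn_simps [simp]: "src (Idn (L_ob P) X) = X" "tgt (Idn (L_ob P) X) = X"
  by (simp_all add: L_ob_Idn)

lemma L_ob_src_tgt [simp]:
  "src (r \<Zsemi>\<^bsub>L_ob P\<^esub> s) = src r" "tgt (r \<Zsemi>\<^bsub>L_ob P\<^esub> s) = tgt s"
  "src (r \<otimes>\<^sub>a\<^bsub>L_ob P\<^esub> s) = src r \<times>\<^sub>o\<^bsub>P\<^esub> src s" "tgt (r \<otimes>\<^sub>a\<^bsub>L_ob P\<^esub> s) = tgt r \<times>\<^sub>o\<^bsub>P\<^esub> tgt s"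
  by (simp_all add: L_ob_def L_seq_def L_tens_def Let_def)

lemma graph_src_tgt [simp]: "src (graph P f) = src f" "tgt (graph P f) = tgt f"
  by (simp_all add: graph_def)

text \<open>The converse of the graph as a relation. It is the right adjoint of
  \<open>graph P f\<close> in L(P), as \<open>right_adjoint_graph\<close> shows.\<close>

definition cograph :: "('o, 'm, 'p) doctrine \<Rightarrow> ('o, 'm) arrow \<Rightarrow> ('o, 'p) arrow" where
  "cograph P f = Arrow (tgt f) (src f) (Act P (Idn P (tgt f) \<times>\<^sub>a\<^bsub>P\<^esub> f) (Delta P (tgt f)))"

lemma cograph_src_tgt [simp]: "src (cograph P f) = tgt f" "tgt (cograph P f) = src f"
  by (simp_all add: cograph_def)

text \<open>
  Kripke-Joyal style: \<open>forces P U \<phi> r x y\<close> says that \<open>r(x, y)\<close> holds for the generalised elements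
  \<open>x\<close>, \<open>y\<close> at the stage \<open>(U, \<phi>)\<close>.
\<close>

definition forces ::
  "('o, 'm, 'p) doctrine \<Rightarrow> 'o \<Rightarrow> 'p \<Rightarrow> ('o, 'p) arrow \<Rightarrow> ('o, 'm) arrow \<Rightarrow> ('o, 'm) arrow \<Rightarrow> bool" where
  "forces P U \<phi> r x y \<longleftrightarrow> U \<in> Ob P \<and> \<phi> \<in> Fib P U \<and> x \<in> hom P U (src r) \<and> y \<in> hom P U (tgt r) \<and>
     fib_le P U \<phi> (Act P \<langle>x, y\<rangle>\<^bsub>P\<^esub> (lab r))"

text \<open>Fixed to plain doctrine records because \<open>L_ob\<close> and \<open>forces\<close>
  are not defined on extended ones.\<close>

locale EED_doctrine = elementary_existential_doctrine P
  for P :: "('o, 'm, 'p) doctrine" (structure)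
begin

abbreviation "L \<equiv> L_ob P"

lemma forcesD:
  assumes "forces P U \<phi> r x y"
  shows "U \<in> Ob P" "\<phi> \<in> Fib P U" "x \<in> Arr P" "src x = U" "tgt x = src r" "y \<in> Arr P" "src y = U"
    "tgt y = tgt r"
  using assms by (auto simp: forces_def in_hom_iff)

text \<open>Persistence of forcing: reindexing along \<open>p\<close> is monotone and functorial. It
  is needed when witnesses are chosen one after the other, each of them enlarging the stage.\<close>

lemma forces_weaken:
  assumes "r \<in> Arr L" "forces P U \<phi> r x y" "p \<in> hom P V U" "\<chi> \<in> Fib P V" "fib_le P V \<chi> (Act P p \<phi>)"
  shows "forces P V \<chi> r (p \<Zsemi> x) (p \<Zsemi> y)"
proof -
  have r: "lab r \<in> Fib P (src r \<times>\<^sub>o tgt r)" using assms(1) by (simp add: L_ob_Arr)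
  have V: "V \<in> Ob P" using assms(3) hom_Ob by blast
  have *: "fib_le P V (Act P p \<phi>) (Act P p (Act P \<langle>x, y\<rangle> (lab r)))"
    using Act_mono[of p \<phi> "Act P \<langle>x, y\<rangle> (lab r)"] assms r by (auto simp: forces_def in_hom_iff)
  moreover have "Act P p (Act P \<langle>x, y\<rangle> (lab r)) = Act P \<langle>p \<Zsemi> x, p \<Zsemi> y\<rangle> (lab r)"
    using assms r by (auto simp: forces_def in_hom_iff)
  ultimately have "fib_le P V \<chi> (Act P \<langle>p \<Zsemi> x, p \<Zsemi> y\<rangle> (lab r))"
    using le_trans[of V \<chi> "Act P p \<phi>" "Act P \<langle>p \<Zsemi> x, p \<Zsemi> y\<rangle> (lab r)"] assms r V
    by (auto simp: forces_def in_hom_iff)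
  then show ?thesis using assms V by (auto simp: forces_def in_hom_iff)
qed

text \<open>A Yoneda argument: the inequality is tested at the generic stage, the product of the two
  objects under the condition \<open>lab r\<close>, with the two projections as elements. There
  \<open>r\<close> is forced by reflexivity of the order.\<close>

lemma L_leI:
  assumes "r \<in> Arr L" "s \<in> Arr L" "src r = src s" "tgt r = tgt s"
    and step: "\<And>U \<phi> x y. U \<in> Ob P \<Longrightarrow> \<phi> \<in> Fib P U \<Longrightarrow> x \<in> hom P U (src r) \<Longrightarrow> y \<in> hom P U (tgt r) \<Longrightarrow>
          forces P U \<phi> r x y \<Longrightarrow> forces P U \<phi> s x y"
  shows "r \<sqsubseteq>\<^bsub>L\<^esub> s"
proof -
  let ?X = "src s" and ?Y = "tgt s"
  have *: "?X \<in> Ob P" "?Y \<in> Ob P" "lab r \<in> Fib P (?X \<times>\<^sub>o ?Y)" "lab s \<in> Fib P (?X \<times>\<^sub>o ?Y)"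
    using assms by (auto simp: L_ob_Arr)
  have "forces P (?X \<times>\<^sub>o ?Y) (lab r) r (Pr1 P ?X ?Y) (Pr2 P ?X ?Y)"
    using * assms by (simp add: forces_def in_hom_iff)
  then have "forces P (?X \<times>\<^sub>o ?Y) (lab r) s (Pr1 P ?X ?Y) (Pr2 P ?X ?Y)"
    by (rule step[rotated -1]) (use * assms(1-4) in \<open>simp_all add: in_hom_iff\<close>)
  then show ?thesis using * assms by (simp add: forces_def in_hom_iff L_ob_Leq)
qed

lemma L_le_antisym:
  assumes "r \<in> Arr L" "s \<in> Arr L" "r \<sqsubseteq>\<^bsub>L\<^esub> s" "s \<sqsubseteq>\<^bsub>L\<^esub> r"
  shows "r = s"
  using assms le_antisym[of "src r \<times>\<^sub>o tgt r" "lab r" "lab s"]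
  by (intro arrow.expand) (auto simp: L_ob_Arr L_ob_Leq)

lemma L_eqI:
  assumes "r \<in> Arr L" "s \<in> Arr L" "src r = src s" "tgt r = tgt s"
    and step: "\<And>U \<phi> x y. U \<in> Ob P \<Longrightarrow> \<phi> \<in> Fib P U \<Longrightarrow> x \<in> hom P U (src r) \<Longrightarrow> y \<in> hom P U (tgt r) \<Longrightarrow>
          forces P U \<phi> r x y \<longleftrightarrow> forces P U \<phi> s x y"
  shows "r = s"
  by (rule L_le_antisym) (use assms in \<open>auto intro!: L_leI\<close>)

lemma forces_le:
  assumes "r \<in> Arr L" "s \<in> Arr L" "r \<sqsubseteq>\<^bsub>L\<^esub> s" "forces P U \<phi> r x y"
  shows "forces P U \<phi> s x y"
proof -
  have "fib_le P U (Act P \<langle>x, y\<rangle> (lab r)) (Act P \<langle>x, y\<rangle> (lab s))"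
    using Act_mono[of "\<langle>x, y\<rangle>" "lab r" "lab s"] assms
    by (auto simp: forces_def in_hom_iff L_ob_Leq L_ob_Arr)
  then show ?thesis
    using le_trans[of U \<phi> "Act P \<langle>x, y\<rangle> (lab r)" "Act P \<langle>x, y\<rangle> (lab s)"] assms
    by (auto simp: forces_def in_hom_iff L_ob_Leq L_ob_Arr)
qed

text \<open>Reindexing is substitution: the components of \<open>w\<close> are the terms that are
  substituted for the two arguments. The clauses for graphs, cographs and tensors, and those for the
  auxiliary relations in the proofs below, are instances.\<close>

lemma forces_Act:
  assumes "w \<in> hom P (X \<times>\<^sub>o Y) (A \<times>\<^sub>o B)" "d \<in> Fib P (A \<times>\<^sub>o B)" "A \<in> Ob P" "B \<in> Ob P"
    "X \<in> Ob P" "Y \<in> Ob P" "x \<in> hom P U X" "y \<in> hom P U Y"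
  shows "forces P U \<phi> (Arrow X Y (Act P w d)) x y \<longleftrightarrow>
         forces P U \<phi> (Arrow A B d) (\<langle>x, y\<rangle> \<Zsemi> (w \<Zsemi> Pr1 P A B)) (\<langle>x, y\<rangle> \<Zsemi> (w \<Zsemi> Pr2 P A B))"
proof -
  have "\<langle>\<langle>x, y\<rangle> \<Zsemi> (w \<Zsemi> Pr1 P A B), \<langle>x, y\<rangle> \<Zsemi> (w \<Zsemi> Pr2 P A B)\<rangle> = \<langle>x, y\<rangle> \<Zsemi> w"
    by (rule prod_eqI[of _ _ A B]) (use assms in \<open>auto simp: in_hom_iff\<close>)
  then show ?thesis using assms by (auto simp: forces_def in_hom_iff)
qed

lemma forces_Meet:
  assumes "X \<in> Ob P" "Y \<in> Ob P" "d \<in> Fib P (X \<times>\<^sub>o Y)" "e \<in> Fib P (X \<times>\<^sub>o Y)"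
  shows "forces P U \<phi> (Arrow X Y (Meet P (X \<times>\<^sub>o Y) d e)) x y \<longleftrightarrow>
         forces P U \<phi> (Arrow X Y d) x y \<and> forces P U \<phi> (Arrow X Y e) x y"
  using assms by (auto simp: forces_def in_hom_iff)

section \<open>Equality as seen by forcing\<close>

lemma Delta_Fib [simp]: "A \<in> Ob P \<Longrightarrow> Delta P A \<in> Fib P (A \<times>\<^sub>o A)"
  by (rule Delta_closed)

lemma L_Idn_Arr [simp]: "A \<in> Ob P \<Longrightarrow> Idn L A \<in> Arr L"
  by (simp add: L_ob_Arr L_ob_Idn)

text \<open>Reflexivity is the unit of the adjunction in \<open>elementary\<close>, taken at the top
  element: reindexing the left adjoint along id \<times> \<Delta> leaves \<delta> at the pair of the
  second projection with itself, which is therefore top.\<close>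

lemma forces_refl:
  assumes "\<phi> \<in> Fib P U" "x \<in> hom P U A"
  shows "forces P U \<phi> (Idn L A) x x"
proof -
  have O: "U \<in> Ob P" "A \<in> Ob P" using hom_Ob assms by auto
  let ?h = "Meet P (A \<times>\<^sub>o (A \<times>\<^sub>o A)) (Act P \<langle>tri1 P A A A, tri2 P A A A\<rangle> (Top P (A \<times>\<^sub>o A)))
                   (Act P \<langle>tri2 P A A A, tri3 P A A A\<rangle> (Delta P A))"
  let ?e = "Idn P A \<times>\<^sub>a diag P A"
  have h: "?h \<in> Fib P (A \<times>\<^sub>o (A \<times>\<^sub>o A))" using O by simp
  have "fib_le P (A \<times>\<^sub>o A) (Top P (A \<times>\<^sub>o A)) (Act P ?e ?h)"
    using elementary[OF O(2) O(2), unfolded is_left_adjoint_def, THEN bspec, of "Top P (A \<times>\<^sub>o A)",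
        THEN conjunct2, THEN bspec, of ?h] O h le_refl[OF _ h]
    by (simp del: Act_Act Act_Meet' le_Meet_iff)
  then have "fib_le P (A \<times>\<^sub>o A) (Top P (A \<times>\<^sub>o A)) (Act P (?e \<Zsemi> \<langle>tri2 P A A A, tri3 P A A A\<rangle>) (Delta P A))"
    using O by simp
  moreover have "?e \<Zsemi> \<langle>tri2 P A A A, tri3 P A A A\<rangle> = \<langle>Pr2 P A A, Pr2 P A A\<rangle>"
    using O by (simp add: cart_defs)
  ultimately have "fib_le P (A \<times>\<^sub>o A) (Top P (A \<times>\<^sub>o A)) (Act P \<langle>Pr2 P A A, Pr2 P A A\<rangle> (Delta P A))"
    by simp
  have "fib_le P U (Top P U) (Act P \<langle>x, x\<rangle> (Delta P A))"
    using Act_mono[of "\<langle>x, x\<rangle>" "Top P (A \<times>\<^sub>o A)" "Act P \<langle>Pr2 P A A, Pr2 P A A\<rangle> (Delta P A)"] O assms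
      \<open>fib_le P (A \<times>\<^sub>o A) (Top P (A \<times>\<^sub>o A)) (Act P \<langle>Pr2 P A A, Pr2 P A A\<rangle> (Delta P A))\<close>
    by (auto simp: in_hom_iff)
  then have "fib_le P U \<phi> (Act P \<langle>x, x\<rangle> (Delta P A))"
    using le_trans[of U \<phi> "Top P U" "Act P \<langle>x, x\<rangle> (Delta P A)"] O assms by (simp add: in_hom_iff)
  then show ?thesis using assms O by (simp add: forces_def L_ob_Idn)
qed

text \<open>Leibniz substitution is the other half of \<open>elementary\<close>. Along id \<times>
  \<Delta> the third variable becomes a copy of the second, so \<open>lab r\<close> read at the
  first and third variables reindexes back to \<open>lab r\<close>. By adjointness, r(c, a) together
  with a = b entails r(c, b).\<close>

lemma forces_subst_right:
  assumes "r \<in> Arr L" "forces P U \<phi> (Idn L A) a b" "forces P U \<phi> r c a"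
  shows "forces P U \<phi> r c b"
proof -
  define X where "X = src r"
  have r: "X \<in> Ob P" "A \<in> Ob P" "tgt r = A" "lab r \<in> Fib P (X \<times>\<^sub>o A)"
    and t: "U \<in> Ob P" "\<phi> \<in> Fib P U" "c \<in> Arr P" "src c = U" "tgt c = X"
     "a \<in> Arr P" "src a = U" "tgt a = A" "b \<in> Arr P" "src b = U" "tgt b = A"
    using assms hom_Ob(2)[of a U A] by (auto simp: forces_def in_hom_iff L_ob_Arr X_def L_ob_Idn)
  let ?h = "Meet P (X \<times>\<^sub>o (A \<times>\<^sub>o A)) (Act P \<langle>tri1 P X A A, tri2 P X A A\<rangle> (lab r))
                   (Act P \<langle>tri2 P X A A, tri3 P X A A\<rangle> (Delta P A))"
  let ?y = "Act P \<langle>tri1 P X A A, tri3 P X A A\<rangle> (lab r)"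
  have "(Idn P X \<times>\<^sub>a diag P A) \<Zsemi> \<langle>tri1 P X A A, tri3 P X A A\<rangle> = Idn P (X \<times>\<^sub>o A)"
    using r by (simp add: cart_defs)
  then have "fib_le P (X \<times>\<^sub>o (A \<times>\<^sub>o A)) ?h ?y"
    using elementary[OF r(1,2)] r unfolding is_left_adjoint_def by simp
  then have "fib_le P U (Act P \<langle>c, \<langle>a, b\<rangle>\<rangle> ?h) (Act P \<langle>c, \<langle>a, b\<rangle>\<rangle> ?y)"
    using r t Act_mono[of "\<langle>c, \<langle>a, b\<rangle>\<rangle>" ?h ?y] by simp
  then have *: "fib_le P U (Meet P U (Act P \<langle>c, a\<rangle> (lab r)) (Act P \<langle>a, b\<rangle> (Delta P A))) (Act P \<langle>c, b\<rangle> (lab r))"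
    using r t by (simp add: tri1_def tri2_def tri3_def)
  have "fib_le P U \<phi> (Meet P U (Act P \<langle>c, a\<rangle> (lab r)) (Act P \<langle>a, b\<rangle> (Delta P A)))"
    using assms r t by (auto simp: forces_def X_def L_ob_Idn)
  then have "fib_le P U \<phi> (Act P \<langle>c, b\<rangle> (lab r))"
    using le_trans[OF _ _ _ _ _ *, of \<phi>] r t by simp
  then show ?thesis using r t by (simp add: forces_def X_def in_hom_iff)
qed

text \<open>Substitution of \<open>b\<close> for the second argument in the relation "y equals x"
  between x and y, starting from reflexivity at \<open>a\<close>.\<close>

lemma forces_sym:
  assumes "forces P U \<phi> (Idn L A) a b"
  shows "forces P U \<phi> (Idn L A) b a"
proof -
  have t: "U \<in> Ob P" "A \<in> Ob P" "\<phi> \<in> Fib P U" "a \<in> hom P U A" "b \<in> hom P U A"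
    using assms hom_Ob(2)[of a U A] by (auto simp: forces_def L_ob_Idn)
  let ?r = "Arrow A A (Act P \<langle>Pr2 P A A, Pr1 P A A\<rangle> (Delta P A))"
  have r: "?r \<in> Arr L" using t by (simp add: L_ob_Arr)
  have *: "forces P U \<phi> ?r x y \<longleftrightarrow> forces P U \<phi> (Idn L A) y x" if "x \<in> hom P U A" "y \<in> hom P U A" for x y
    using forces_Act[of "\<langle>Pr2 P A A, Pr1 P A A\<rangle>" A A A A "Delta P A" x U y \<phi>] t that
    by (simp add: in_hom_iff L_ob_Idn)
  have "forces P U \<phi> ?r a a" using * forces_refl t by simp
  from forces_subst_right[OF r assms this] show ?thesis using * t by simp
qed

text \<open>The elementary structure substitutes in the second argument; the first one is reached by
  exchanging the arguments of \<open>r\<close>.\<close>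

lemma forces_subst_left:
  assumes "r \<in> Arr L" "forces P U \<phi> (Idn L A) a b" "forces P U \<phi> r a c"
  shows "forces P U \<phi> r b c"
proof -
  define X where "X = tgt r"
  have r: "X \<in> Ob P" "A \<in> Ob P" "src r = A" "lab r \<in> Fib P (A \<times>\<^sub>o X)"
    and t: "U \<in> Ob P" "\<phi> \<in> Fib P U" "c \<in> hom P U X" "a \<in> hom P U A" "b \<in> hom P U A"
    using assms hom_Ob(2)[of a U A] by (auto simp: forces_def in_hom_iff L_ob_Arr X_def L_ob_Idn)
  let ?r = "Arrow X A (Act P \<langle>Pr2 P X A, Pr1 P X A\<rangle> (lab r))"
  have r': "?r \<in> Arr L" using r by (simp add: L_ob_Arr)
  have *: "forces P U \<phi> ?r c y \<longleftrightarrow> forces P U \<phi> r y c" if "y \<in> hom P U A" for y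
    using forces_Act[of "\<langle>Pr2 P X A, Pr1 P X A\<rangle>" X A A X "lab r" c U y \<phi>] t r that
    by (simp add: in_hom_iff X_def)
  have "forces P U \<phi> ?r c a" using *[of a] assms(3) t by simp
  from forces_subst_right[OF r' assms(2) this] show ?thesis using *[of b] t by simp
qed

text \<open>Substitution in the relation f(x) = f(y), starting from reflexivity at the image of
  \<open>a\<close>.\<close>

lemma forces_cong:
  assumes "forces P U \<phi> (Idn L A) a b" "f \<in> hom P A B"
  shows "forces P U \<phi> (Idn L B) (a \<Zsemi> f) (b \<Zsemi> f)"
proof -
  have t: "U \<in> Ob P" "A \<in> Ob P" "B \<in> Ob P" "\<phi> \<in> Fib P U" "a \<in> hom P U A" "b \<in> hom P U A"
    using assms hom_Ob(2)[of a U A] hom_Ob(2)[OF assms(2)] by (auto simp: forces_def L_ob_Idn)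
  let ?r = "Arrow A A (Act P \<langle>Pr1 P A A \<Zsemi> f, Pr2 P A A \<Zsemi> f\<rangle> (Delta P B))"
  have r: "?r \<in> Arr L" using t assms by (simp add: L_ob_Arr in_hom_iff)
  have *: "forces P U \<phi> ?r x y \<longleftrightarrow> forces P U \<phi> (Idn L B) (x \<Zsemi> f) (y \<Zsemi> f)"
    if "x \<in> hom P U A" "y \<in> hom P U A" for x y
    using forces_Act[of "\<langle>Pr1 P A A \<Zsemi> f, Pr2 P A A \<Zsemi> f\<rangle>" A A B B "Delta P B" x U y \<phi>] t that assms
    by (simp add: in_hom_iff L_ob_Idn)
  have "forces P U \<phi> ?r a a" using *[of a a] forces_refl[of \<phi> U "a \<Zsemi> f" B] t assms by (simp add: in_hom_iff)
  from forces_subst_right[OF r assms(1) this] show ?thesis using * t by simp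
qed

text \<open>The axioms speak about \<open>Delta\<close> on one object at a time; that equality on a
  product is componentwise is a consequence of substitution. It is what makes \<open>graph\<close>
  compatible with tensors.\<close>

lemma forces_Idn_Prod:
  assumes "A \<in> Ob P" "B \<in> Ob P" "x \<in> hom P U (A \<times>\<^sub>o B)" "y \<in> hom P U (A \<times>\<^sub>o B)"
  shows "forces P U \<phi> (Idn L (A \<times>\<^sub>o B)) x y \<longleftrightarrow>
     forces P U \<phi> (Idn L A) (x \<Zsemi> Pr1 P A B) (y \<Zsemi> Pr1 P A B) \<and>
     forces P U \<phi> (Idn L B) (x \<Zsemi> Pr2 P A B) (y \<Zsemi> Pr2 P A B)"
proof (intro iffI conjI)
  assume "forces P U \<phi> (Idn L (A \<times>\<^sub>o B)) x y"
  from forces_cong[OF this, of "Pr1 P A B" A] forces_cong[OF this, of "Pr2 P A B" B]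
  show "forces P U \<phi> (Idn L A) (x \<Zsemi> Pr1 P A B) (y \<Zsemi> Pr1 P A B)"
    "forces P U \<phi> (Idn L B) (x \<Zsemi> Pr2 P A B) (y \<Zsemi> Pr2 P A B)"
    using assms by (auto simp: in_hom_iff)
next
  assume "forces P U \<phi> (Idn L A) (x \<Zsemi> Pr1 P A B) (y \<Zsemi> Pr1 P A B) \<and>
     forces P U \<phi> (Idn L B) (x \<Zsemi> Pr2 P A B) (y \<Zsemi> Pr2 P A B)"
  then have 1: "forces P U \<phi> (Idn L A) (x \<Zsemi> Pr1 P A B) (y \<Zsemi> Pr1 P A B)"
    and 2: "forces P U \<phi> (Idn L B) (x \<Zsemi> Pr2 P A B) (y \<Zsemi> Pr2 P A B)" by auto
  have O: "U \<in> Ob P" "\<phi> \<in> Fib P U" using 1 by (auto simp: forces_def)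
  \<comment> \<open>One component is substituted at a time: \<open>r1\<close> and \<open>r2\<close> are \<open>x = (a, b)\<close>, read as relations
    between \<open>(x, b)\<close> and \<open>a\<close> and between \<open>(x, a)\<close> and \<open>b\<close>.\<close>
  let ?AB = "A \<times>\<^sub>o B"
  let ?w1 = "\<langle>Pr1 P (?AB \<times>\<^sub>o B) A \<Zsemi> Pr1 P ?AB B, \<langle>Pr2 P (?AB \<times>\<^sub>o B) A, Pr1 P (?AB \<times>\<^sub>o B) A \<Zsemi> Pr2 P ?AB B\<rangle>\<rangle>"
  let ?r1 = "Arrow (?AB \<times>\<^sub>o B) A (Act P ?w1 (Delta P ?AB))"
  have r1: "?r1 \<in> Arr L" using assms by (simp add: L_ob_Arr)
  have f1: "forces P U \<phi> ?r1 \<langle>x, b\<rangle> a \<longleftrightarrow> forces P U \<phi> (Idn L ?AB) x \<langle>a, b\<rangle>"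
    if "a \<in> hom P U A" "b \<in> hom P U B" for a b
    using forces_Act[of ?w1 "?AB \<times>\<^sub>o B" A ?AB ?AB "Delta P ?AB" "\<langle>x, b\<rangle>" U a \<phi>] assms that
    by (simp add: in_hom_iff L_ob_Idn)
  let ?w2 = "\<langle>Pr1 P (?AB \<times>\<^sub>o A) B \<Zsemi> Pr1 P ?AB A, \<langle>Pr1 P (?AB \<times>\<^sub>o A) B \<Zsemi> Pr2 P ?AB A, Pr2 P (?AB \<times>\<^sub>o A) B\<rangle>\<rangle>"
  let ?r2 = "Arrow (?AB \<times>\<^sub>o A) B (Act P ?w2 (Delta P ?AB))"
  have r2: "?r2 \<in> Arr L" using assms by (simp add: L_ob_Arr)
  have f2: "forces P U \<phi> ?r2 \<langle>x, a\<rangle> b \<longleftrightarrow> forces P U \<phi> (Idn L ?AB) x \<langle>a, b\<rangle>"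
    if "a \<in> hom P U A" "b \<in> hom P U B" for a b
    using forces_Act[of ?w2 "?AB \<times>\<^sub>o A" B ?AB ?AB "Delta P ?AB" "\<langle>x, a\<rangle>" U b \<phi>] assms that
    by (simp add: in_hom_iff L_ob_Idn)
  let ?x1 = "x \<Zsemi> Pr1 P A B" and ?x2 = "x \<Zsemi> Pr2 P A B" and ?y1 = "y \<Zsemi> Pr1 P A B" and ?y2 = "y \<Zsemi> Pr2 P A B"
  have t: "?x1 \<in> hom P U A" "?x2 \<in> hom P U B" "?y1 \<in> hom P U A" "?y2 \<in> hom P U B"
    using assms by (auto simp: in_hom_iff)
  have xy: "\<langle>?x1, ?x2\<rangle> = x" "\<langle>?y1, ?y2\<rangle> = y" using assms by (auto simp: in_hom_iff)
  have "forces P U \<phi> ?r1 \<langle>x, ?x2\<rangle> ?x1"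
    unfolding f1[OF t(1,2)] xy using forces_refl O assms by simp
  from forces_subst_right[OF r1 1 this] have "forces P U \<phi> ?r2 \<langle>x, ?y1\<rangle> ?x2"
    unfolding f1[OF t(3,2)] f2[OF t(3,2)] .
  from forces_subst_right[OF r2 2 this] show "forces P U \<phi> (Idn L ?AB) x y"
    unfolding f2[OF t(3,4)] xy .
qed

lemma forces_Idn_One:
  assumes "\<phi> \<in> Fib P U" "x \<in> hom P U (One P)" "y \<in> hom P U (One P)"
  shows "forces P U \<phi> (Idn L (One P)) x y"
proof -
  have "x = y" using assms One_eqI by (auto simp: in_hom_iff)
  then show ?thesis using forces_refl assms by simp
qed

section \<open>Graphs, tensors and composition as seen by forcing\<close>

lemma graph_Arr [simp]: "f \<in> Arr P \<Longrightarrow> graph P f \<in> Arr L"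
  by (simp add: L_ob_Arr graph_def)

lemma cograph_Arr [simp]: "f \<in> Arr P \<Longrightarrow> cograph P f \<in> Arr L"
  by (simp add: L_ob_Arr cograph_def)

lemma forces_graph:
  assumes "f \<in> hom P X Y" "x \<in> hom P U X" "y \<in> hom P U Y"
  shows "forces P U \<phi> (graph P f) x y \<longleftrightarrow> forces P U \<phi> (Idn L Y) (x \<Zsemi> f) y"
  using forces_Act[of "f \<times>\<^sub>a Idn P Y" X Y Y Y "Delta P Y" x U y \<phi>] assms hom_Ob[OF assms(1)]
  by (simp add: in_hom_iff L_ob_Idn graph_def prod_arr_def)

lemma forces_cograph:
  assumes "f \<in> hom P X Y" "x \<in> hom P U X" "y \<in> hom P U Y"
  shows "forces P U \<phi> (cograph P f) y x \<longleftrightarrow> forces P U \<phi> (Idn L Y) y (x \<Zsemi> f)"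
  using forces_Act[of "Idn P Y \<times>\<^sub>a f" Y X Y Y "Delta P Y" y U x \<phi>] assms hom_Ob[OF assms(1)]
  by (simp add: in_hom_iff L_ob_Idn cograph_def prod_arr_def)

lemma L_tens_eq:
  "r \<otimes>\<^sub>a\<^bsub>L\<^esub> s = L_tens P r s"
  by (simp add: L_ob_def)

lemma tens_Arr [simp]:
  assumes "r \<in> Arr L" "s \<in> Arr L"
  shows "r \<otimes>\<^sub>a\<^bsub>L\<^esub> s \<in> Arr L"
  using assms by (simp add: L_ob_Arr L_tens_eq L_tens_def Let_def)

lemma forces_tens:
  assumes "r \<in> Arr L" "s \<in> Arr L" "src r = X" "tgt r = Y" "src s = Z" "tgt s = W"
    "x \<in> hom P U (X \<times>\<^sub>o Z)" "y \<in> hom P U (Y \<times>\<^sub>o W)"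
  shows "forces P U \<phi> (r \<otimes>\<^sub>a\<^bsub>L\<^esub> s) x y \<longleftrightarrow>
    forces P U \<phi> r (x \<Zsemi> Pr1 P X Z) (y \<Zsemi> Pr1 P Y W) \<and>
    forces P U \<phi> s (x \<Zsemi> Pr2 P X Z) (y \<Zsemi> Pr2 P Y W)"
proof -
  have O: "X \<in> Ob P" "Y \<in> Ob P" "Z \<in> Ob P" "W \<in> Ob P" "lab r \<in> Fib P (X \<times>\<^sub>o Y)" "lab s \<in> Fib P (Z \<times>\<^sub>o W)"
    using assms by (auto simp: L_ob_Arr)
  show ?thesis
    using assms O forces_Act[of "\<langle>quad1 P X Z Y W, quad3 P X Z Y W\<rangle>" "X \<times>\<^sub>o Z" "Y \<times>\<^sub>o W" X Y "lab r" x U y \<phi>]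
      forces_Act[of "\<langle>quad2 P X Z Y W, quad4 P X Z Y W\<rangle>" "X \<times>\<^sub>o Z" "Y \<times>\<^sub>o W" Z W "lab s" x U y \<phi>]
    by (simp add: in_hom_iff L_tens_eq L_tens_def Let_def forces_Meet)
      (simp add: quad1_def quad2_def quad3_def quad4_def)
qed

text \<open>The values of a left adjoint are unique because the fibres are partial orders, so the
  description in \<open>Exq\<close> denotes.\<close>

lemma Exq_adjoint:
  assumes "is_projection P p" "x \<in> Fib P (src p)"
  shows "Exq P p x \<in> Fib P (tgt p)"
    "y \<in> Fib P (tgt p) \<Longrightarrow> fib_le P (tgt p) (Exq P p x) y \<longleftrightarrow> fib_le P (src p) x (Act P p y)"
proof -
  obtain h where h: "is_left_adjoint P p h" using existential[OF assms(1)] by blast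
  have p: "tgt p \<in> Ob P" using assms(1) by (simp add: is_projection_def)
  let ?Q = "\<lambda>z. z \<in> Fib P (tgt p) \<and>
     (\<forall>y\<in>Fib P (tgt p). fib_le P (tgt p) z y \<longleftrightarrow> fib_le P (src p) x (Act P p y))"
  have "?Q (h x)" using h assms(2) by (auto simp: is_left_adjoint_def)
  moreover have "z = h x" if "?Q z" for z
    using that \<open>?Q (h x)\<close> le_antisym[OF p] le_refl[OF p] by metis
  ultimately have "?Q (Exq P p x)" unfolding Exq_def by (rule theI)
  then show "Exq P p x \<in> Fib P (tgt p)"
    "y \<in> Fib P (tgt p) \<Longrightarrow> fib_le P (tgt p) (Exq P p x) y \<longleftrightarrow> fib_le P (src p) x (Act P p y)" by auto
qed

lemma tri_eta:
  assumes "h \<in> hom P U (X \<times>\<^sub>o (Y \<times>\<^sub>o Z))" "X \<in> Ob P" "Y \<in> Ob P" "Z \<in> Ob P"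
  shows "\<langle>h \<Zsemi> tri1 P X Y Z, \<langle>h \<Zsemi> tri2 P X Y Z, h \<Zsemi> tri3 P X Y Z\<rangle>\<rangle> = h"
proof -
  have "\<langle>h \<Zsemi> tri2 P X Y Z, h \<Zsemi> tri3 P X Y Z\<rangle> = h \<Zsemi> Pr2 P X (Y \<times>\<^sub>o Z)"
    by (rule prod_eqI[of _ _ Y Z]) (use assms in \<open>simp_all add: in_hom_iff tri2_def tri3_def\<close>)
  then show ?thesis using assms by (simp add: in_hom_iff tri1_def)
qed

text \<open>The other leg of the product cone is \<open>tri2\<close>. Hence the quantifier in
  \<open>L_seq\<close> is among those that \<open>existential\<close> provides.\<close>

lemma projection_13:
  assumes "X \<in> Ob P" "Y \<in> Ob P" "Z \<in> Ob P"
  shows "is_projection P \<langle>tri1 P X Y Z, tri3 P X Y Z\<rangle>"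
proof -
  have "is_product P (X \<times>\<^sub>o Z) Y (X \<times>\<^sub>o (Y \<times>\<^sub>o Z)) \<langle>tri1 P X Y Z, tri3 P X Y Z\<rangle> (tri2 P X Y Z)"
    unfolding is_product_def
  proof (intro conjI ballI)
    fix U f g assume f: "f \<in> hom P U (X \<times>\<^sub>o Z)" and g: "g \<in> hom P U Y"
    show "\<exists>!h. h \<in> hom P U (X \<times>\<^sub>o (Y \<times>\<^sub>o Z)) \<and> h \<Zsemi> \<langle>tri1 P X Y Z, tri3 P X Y Z\<rangle> = f \<and> h \<Zsemi> tri2 P X Y Z = g"
    proof (rule ex1I[of _ "\<langle>f \<Zsemi> Pr1 P X Z, \<langle>g, f \<Zsemi> Pr2 P X Z\<rangle>\<rangle>"])
      fix h assume h: "h \<in> hom P U (X \<times>\<^sub>o (Y \<times>\<^sub>o Z)) \<and> h \<Zsemi> \<langle>tri1 P X Y Z, tri3 P X Y Z\<rangle> = f \<and> h \<Zsemi> tri2 P X Y Z = g"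
      then have hh: "h \<in> Arr P" "src h = U" "tgt h = X \<times>\<^sub>o (Y \<times>\<^sub>o Z)" by (auto simp: in_hom_iff)
      have "f = h \<Zsemi> \<langle>tri1 P X Y Z, tri3 P X Y Z\<rangle>" and g: "g = h \<Zsemi> tri2 P X Y Z" using h by auto
      then have f: "f = \<langle>h \<Zsemi> tri1 P X Y Z, h \<Zsemi> tri3 P X Y Z\<rangle>" using hh assms by simp
      show "h = \<langle>f \<Zsemi> Pr1 P X Z, \<langle>g, f \<Zsemi> Pr2 P X Z\<rangle>\<rangle>"
        unfolding f g using hh assms tri_eta[of h U X Y Z] by (simp add: in_hom_iff)
    qed (use f g assms in \<open>auto simp: in_hom_iff tri1_def tri2_def tri3_def\<close>)
  qed (use assms in \<open>auto simp: in_hom_iff\<close>)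
  then show ?thesis using assms unfolding is_projection_def by auto
qed

text \<open>Over a pair of elements \<open>x\<close> and \<open>z\<close> only the middle component
  is free, so the fibre of the composition quantifier is \<open>Pr1 P U Y\<close>. By
  Beck-Chevalley, a composite at (x, z) is a quantifier along this chosen projection, with
  \<open>Pr2 P U Y\<close> as generic witness.\<close>

lemma pullback_13:
  assumes O: "X \<in> Ob P" "Y \<in> Ob P" "Z \<in> Ob P" "U \<in> Ob P" and x: "x \<in> hom P U X" and z: "z \<in> hom P U Z"
  shows "is_pullback P \<langle>x, z\<rangle> \<langle>tri1 P X Y Z, tri3 P X Y Z\<rangle>
    \<langle>Pr1 P U Y \<Zsemi> x, \<langle>Pr2 P U Y, Pr1 P U Y \<Zsemi> z\<rangle>\<rangle> (Pr1 P U Y)"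
    (is "is_pullback P ?f ?m ?f' ?p'")
  unfolding is_pullback_def
proof (intro conjI ballI impI)
  show "?p' \<Zsemi> ?f = ?f' \<Zsemi> ?m" using assms by (auto simp: in_hom_iff tri1_def tri2_def tri3_def)
  fix V u v assume u: "u \<in> hom P V (src ?f)" and v: "v \<in> hom P V (src ?m)" and uv: "u \<Zsemi> ?f = v \<Zsemi> ?m"
  have u': "u \<in> Arr P" "src u = V" "tgt u = U" and v': "v \<in> Arr P" "src v = V" "tgt v = X \<times>\<^sub>o (Y \<times>\<^sub>o Z)"
    using u v assms by (auto simp: in_hom_iff)
  have "u \<Zsemi> ?f = \<langle>u \<Zsemi> x, u \<Zsemi> z\<rangle>" "v \<Zsemi> ?m = \<langle>v \<Zsemi> tri1 P X Y Z, v \<Zsemi> tri3 P X Y Z\<rangle>"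
    using assms u' v' by (auto simp: in_hom_iff)
  then have 1: "u \<Zsemi> x = v \<Zsemi> tri1 P X Y Z" "u \<Zsemi> z = v \<Zsemi> tri3 P X Y Z"
    using uv pair_eq_iff[of "u \<Zsemi> x" "u \<Zsemi> z" "v \<Zsemi> tri1 P X Y Z" "v \<Zsemi> tri3 P X Y Z"] assms u' v'
    by (auto simp: in_hom_iff)
  have 2: "v \<Zsemi> Pr2 P X (Y \<times>\<^sub>o Z) = \<langle>v \<Zsemi> tri2 P X Y Z, v \<Zsemi> tri3 P X Y Z\<rangle>"
    by (rule prod_eqI[of _ _ Y Z]) (use assms v' in \<open>auto simp: in_hom_iff tri2_def tri3_def\<close>)
  have 3: "v = \<langle>u \<Zsemi> x, \<langle>v \<Zsemi> tri2 P X Y Z, u \<Zsemi> z\<rangle>\<rangle>"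
    unfolding 1 2[symmetric] using O v' by (simp add: tri1_def)
  show "\<exists>!h. h \<in> hom P V (src ?p') \<and> h \<Zsemi> ?p' = u \<and> h \<Zsemi> ?f' = v"
  proof (rule ex1I[of _ "\<langle>u, v \<Zsemi> tri2 P X Y Z\<rangle>"])
    show "\<langle>u, v \<Zsemi> tri2 P X Y Z\<rangle> \<in> hom P V (src ?p') \<and> \<langle>u, v \<Zsemi> tri2 P X Y Z\<rangle> \<Zsemi> ?p' = u \<and>
        \<langle>u, v \<Zsemi> tri2 P X Y Z\<rangle> \<Zsemi> ?f' = v"
      using O x z u' v' 3[symmetric] by (simp add: in_hom_iff)
  next
    fix h assume h: "h \<in> hom P V (src ?p') \<and> h \<Zsemi> ?p' = u \<and> h \<Zsemi> ?f' = v"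
    then have hh: "h \<in> Arr P" "src h = V" "tgt h = U \<times>\<^sub>o Y" and v: "v = h \<Zsemi> ?f'" and u: "u = h \<Zsemi> ?p'"
      using O by (auto simp: in_hom_iff)
    show "h = \<langle>u, v \<Zsemi> tri2 P X Y Z\<rangle>"
      unfolding u v using hh O x z by (simp add: in_hom_iff tri2_def)
  qed
qed (use assms in \<open>auto simp: in_hom_iff\<close>)

lemma L_seq_eq: "r \<Zsemi>\<^bsub>L\<^esub> s = L_seq P r s"
  by (simp add: L_ob_def)

lemma seq_Arr [simp]:
  assumes "r \<in> Arr L" "s \<in> Arr L" "tgt r = src s"
  shows "r \<Zsemi>\<^bsub>L\<^esub> s \<in> Arr L"
  using assms Exq_adjoint(1)[OF projection_13, of "src r" "tgt r" "tgt s"]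
  by (simp add: L_ob_Arr L_seq_eq L_seq_def Let_def)

text \<open>Introduction of the existential: the unit of the adjunction, substituted at the triple
  of \<open>x\<close>, \<open>y\<close> and \<open>z\<close>.\<close>

lemma forces_seqI:
  assumes "r \<in> Arr L" "s \<in> Arr L" "tgt r = src s" "forces P U \<phi> r x y" "forces P U \<phi> s y z"
  shows "forces P U \<phi> (r \<Zsemi>\<^bsub>L\<^esub> s) x z"
proof -
  define X Y Z where XYZ: "X = src r" "Y = src s" "Z = tgt s"
  have O: "X \<in> Ob P" "Y \<in> Ob P" "Z \<in> Ob P" "lab r \<in> Fib P (X \<times>\<^sub>o Y)" "lab s \<in> Fib P (Y \<times>\<^sub>o Z)"
    using assms by (auto simp: XYZ L_ob_Arr)
  have t: "U \<in> Ob P" "\<phi> \<in> Fib P U" "x \<in> Arr P" "src x = U" "tgt x = X" "y \<in> Arr P" "src y = U" "tgt y = Y"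
     "z \<in> Arr P" "src z = U" "tgt z = Z"
    using assms by (auto simp: XYZ forces_def in_hom_iff)
  let ?m = "\<langle>tri1 P X Y Z, tri3 P X Y Z\<rangle>"
  let ?w = "Meet P (X \<times>\<^sub>o (Y \<times>\<^sub>o Z)) (Act P \<langle>tri1 P X Y Z, tri2 P X Y Z\<rangle> (lab r))
              (Act P \<langle>tri2 P X Y Z, tri3 P X Y Z\<rangle> (lab s))"
  have m: "is_projection P ?m" using projection_13 O by simp
  have w: "?w \<in> Fib P (src ?m)" using O by simp
  note ex = Exq_adjoint[OF m w]
  have e: "Exq P ?m ?w \<in> Fib P (X \<times>\<^sub>o Z)" using ex(1) O by simp
  have 0: "fib_le P (X \<times>\<^sub>o (Y \<times>\<^sub>o Z)) ?w (Act P ?m (Exq P ?m ?w))"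
    using ex(2)[OF ex(1)] e O by simp
  have "fib_le P U (Act P \<langle>x, \<langle>y, z\<rangle>\<rangle> ?w) (Act P \<langle>x, \<langle>y, z\<rangle>\<rangle> (Act P ?m (Exq P ?m ?w)))"
    using Act_mono[of "\<langle>x, \<langle>y, z\<rangle>\<rangle>" ?w "Act P ?m (Exq P ?m ?w)"] 0 t O e by simp
  then have *: "fib_le P U (Meet P U (Act P \<langle>x, y\<rangle> (lab r)) (Act P \<langle>y, z\<rangle> (lab s))) (Act P \<langle>x, z\<rangle> (Exq P ?m ?w))"
    using t O e by (simp add: tri1_def tri2_def tri3_def)
  have "fib_le P U \<phi> (Meet P U (Act P \<langle>x, y\<rangle> (lab r)) (Act P \<langle>y, z\<rangle> (lab s)))"
    using assms(4,5) t O by (simp add: forces_def)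
  from le_trans[OF _ _ _ _ this *] have "fib_le P U \<phi> (Act P \<langle>x, z\<rangle> (Exq P ?m ?w))"
    using t O e by simp
  then show ?thesis using t assms(3) by (simp add: forces_def L_seq_eq L_seq_def Let_def XYZ in_hom_iff)
qed

text \<open>Elimination of the existential. The stage is enlarged to the product of \<open>U\<close>
  and the middle object, with the second projection as generic witness, under the condition that
  \<open>\<phi>\<close> and both relations hold. The goal concerns an arbitrary \<open>q\<close>
  reindexed from \<open>U\<close>, so the adjunction returns it to \<open>U\<close> once the
  enlarged condition is known to project onto \<open>\<phi>\<close>.\<close>

lemma forces_seqE:
  assumes rs: "r \<in> Arr L" "s \<in> Arr L" "tgt r = src s" and frs: "forces P U \<phi> (r \<Zsemi>\<^bsub>L\<^esub> s) x z"
    and q: "q \<in> Arr L" "a \<in> hom P U (src q)" "b \<in> hom P U (tgt q)"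
    and step: "\<And>V p y \<chi>. V \<in> Ob P \<Longrightarrow> p \<in> hom P V U \<Longrightarrow> \<chi> \<in> Fib P V \<Longrightarrow> fib_le P V \<chi> (Act P p \<phi>) \<Longrightarrow>
      y \<in> hom P V (src s) \<Longrightarrow>
      forces P V \<chi> r (p \<Zsemi> x) y \<Longrightarrow> forces P V \<chi> s y (p \<Zsemi> z) \<Longrightarrow> forces P V \<chi> q (p \<Zsemi> a) (p \<Zsemi> b)"
  shows "forces P U \<phi> q a b"
proof -
  define X Y Z where XYZ: "X = src r" "Y = src s" "Z = tgt s"
  have O: "X \<in> Ob P" "Y \<in> Ob P" "Z \<in> Ob P" "lab r \<in> Fib P (X \<times>\<^sub>o Y)" "lab s \<in> Fib P (Y \<times>\<^sub>o Z)"
    using assms by (auto simp: XYZ L_ob_Arr)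
  have t: "U \<in> Ob P" "\<phi> \<in> Fib P U" "x \<in> Arr P" "src x = U" "tgt x = X" "z \<in> Arr P" "src z = U" "tgt z = Z"
    using frs by (auto simp: XYZ forces_def in_hom_iff)
  have q': "lab q \<in> Fib P (src q \<times>\<^sub>o tgt q)" "a \<in> Arr P" "src a = U" "tgt a = src q"
     "b \<in> Arr P" "src b = U" "tgt b = tgt q" using q by (auto simp: L_ob_Arr in_hom_iff)
  let ?m = "\<langle>tri1 P X Y Z, tri3 P X Y Z\<rangle>"
  let ?w = "Meet P (X \<times>\<^sub>o (Y \<times>\<^sub>o Z)) (Act P \<langle>tri1 P X Y Z, tri2 P X Y Z\<rangle> (lab r))
              (Act P \<langle>tri2 P X Y Z, tri3 P X Y Z\<rangle> (lab s))"
  let ?p = "Pr1 P U Y" and ?y = "Pr2 P U Y"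
  let ?f' = "\<langle>?p \<Zsemi> x, \<langle>?y, ?p \<Zsemi> z\<rangle>\<rangle>"
  let ?\<psi> = "Meet P (U \<times>\<^sub>o Y) (Act P \<langle>?p \<Zsemi> x, ?y\<rangle> (lab r)) (Act P \<langle>?y, ?p \<Zsemi> z\<rangle> (lab s))"
  let ?\<chi> = "Meet P (U \<times>\<^sub>o Y) (Act P ?p \<phi>) ?\<psi>"
  have \<psi>: "?\<psi> \<in> Fib P (U \<times>\<^sub>o Y)" and \<chi>: "?\<chi> \<in> Fib P (U \<times>\<^sub>o Y)" using O t by auto
  have p: "is_projection P ?p" using is_projection_Pr1 O t by simp
  have w: "?w \<in> Fib P (src ?m)" using O by simp
  have "Act P \<langle>x, z\<rangle> (Exq P ?m ?w) = Exq P ?p (Act P ?f' ?w)"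
    using Beck_Chevalley[OF projection_13 pullback_13 w] O t by (simp add: in_hom_iff)
  also have "Act P ?f' ?w = ?\<psi>" using O t by (simp add: tri1_def tri2_def tri3_def)
  finally have "fib_le P U \<phi> (Exq P ?p ?\<psi>)"
    using frs rs(3) t by (simp add: forces_def L_seq_eq L_seq_def Let_def XYZ)
  then have "Meet P U \<phi> (Exq P ?p ?\<psi>) = \<phi>" by (simp add: fib_le_def)
  \<comment> \<open>Frobenius reciprocity: the enlarged condition projects to the meet of
    \<open>\<phi>\<close> with a quantified predicate that lies above \<open>\<phi>\<close>.\<close>
  then have ex: "Exq P ?p ?\<chi> = \<phi>"
    using Frobenius_reciprocity[OF p, of \<phi> ?\<psi>] t O \<psi> by simp
  have *: "fib_le P (U \<times>\<^sub>o Y) ?\<chi> (Act P ?p \<phi>)" "fib_le P (U \<times>\<^sub>o Y) ?\<chi> ?\<psi>"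
    using Meet_le1[of "U \<times>\<^sub>o Y" "Act P ?p \<phi>" ?\<psi>] Meet_le2[of "U \<times>\<^sub>o Y" "Act P ?p \<phi>" ?\<psi>] \<psi> t O
    by (simp_all del: le_Meet_iff)
  have "forces P (U \<times>\<^sub>o Y) ?\<chi> q (?p \<Zsemi> a) (?p \<Zsemi> b)"
  proof (rule step[of "U \<times>\<^sub>o Y" ?p ?\<chi> ?y])
    show "forces P (U \<times>\<^sub>o Y) ?\<chi> r (?p \<Zsemi> x) ?y" "forces P (U \<times>\<^sub>o Y) ?\<chi> s ?y (?p \<Zsemi> z)"
      using * \<chi> t O rs by (auto simp: forces_def in_hom_iff XYZ)
  qed (use * \<chi> t O in \<open>auto simp: in_hom_iff XYZ\<close>)
  then have "fib_le P (U \<times>\<^sub>o Y) ?\<chi> (Act P ?p (Act P \<langle>a, b\<rangle> (lab q)))"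
    using q' t O by (simp add: forces_def)
  then have "fib_le P U \<phi> (Act P \<langle>a, b\<rangle> (lab q))"
    using Exq_adjoint(2)[OF p, of ?\<chi> "Act P \<langle>a, b\<rangle> (lab q)"] \<chi> t O q' ex by simp
  then show ?thesis using q' t by (simp add: forces_def in_hom_iff)
qed

end

section \<open>The cartesian bicategory of a doctrine\<close>

context poset_enriched_smc
begin

lemma right_adjoint_unique:
  assumes "f \<in> Arr B" "is_right_adjoint B f g" "is_right_adjoint B f h"
  shows "g = h"
proof -
  have le: "g \<sqsubseteq> h" if "is_right_adjoint B f g" "is_right_adjoint B f h" for g h
  proof -
    have h: "f \<in> hom B (src f) (tgt f)" "g \<in> hom B (tgt f) (src f)" "h \<in> hom B (tgt f) (src f)"
      "Idn B (src f) \<sqsubseteq> f \<Zsemi> h" "g \<Zsemi> f \<sqsubseteq> Idn B (tgt f)"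
      using that assms by (auto simp: is_right_adjoint_def in_hom_iff)
    have "g \<Zsemi> Idn B (src f) \<sqsubseteq> g \<Zsemi> (f \<Zsemi> h)"
      by (rule Seq_mono[of _ "tgt f" "src f" _ _ "src f"]) (use h assms Leq_refl in \<open>auto simp: in_hom_iff\<close>)
    moreover have "(g \<Zsemi> f) \<Zsemi> h \<sqsubseteq> Idn B (tgt f) \<Zsemi> h"
      by (rule Seq_mono[of _ "tgt f" "tgt f" _ _ "src f"]) (use h assms Leq_refl in \<open>auto simp: in_hom_iff\<close>)
    ultimately show ?thesis
      using Leq_trans[of g "tgt f" "src f" "g \<Zsemi> f \<Zsemi> h" h] h assms by (simp add: in_hom_iff)
  qed
  show ?thesis
    using Leq_antisym[of g "tgt f" "src f" h] le[OF assms(2,3)] le[OF assms(3,2)] assms(2,3)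
    by (simp add: is_right_adjoint_def)
qed

lemma radj_eq: "f \<in> Arr B \<Longrightarrow> is_right_adjoint B f g \<Longrightarrow> radj B f = g"
  unfolding radj_def using right_adjoint_unique by blast

end

section \<open>The category L(P)\<close>

context EED_doctrine
begin

lemma forces_trans: "forces P U \<phi> (Idn L A) a b \<Longrightarrow> forces P U \<phi> (Idn L A) b c \<Longrightarrow> forces P U \<phi> (Idn L A) a c"
  using forces_subst_right[of "Idn L A" U \<phi> A b c a] forcesD[of U \<phi> "Idn L A" a b] tgt_Ob[of a] by simp

lemma graph_Idn: "X \<in> Ob P \<Longrightarrow> graph P (Idn P X) = Idn L X"
  by (simp add: graph_def L_ob_Idn prod_arr_def)

text \<open>One-point rule: the witness in the middle is equal to the value of \<open>g\<close> at
  \<open>w\<close>, so it can be substituted and the quantifier disappears. The rule for graphs on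
  the left is the mirror image.\<close>

lemma forces_seq_cograph:
  assumes "r \<in> Arr L" "g \<in> hom P W (tgt r)" "x \<in> hom P U (src r)" "w \<in> hom P U W"
  shows "forces P U \<phi> (r \<Zsemi>\<^bsub>L\<^esub> cograph P g) x w \<longleftrightarrow> forces P U \<phi> r x (w \<Zsemi> g)"
proof
  have g: "g \<in> Arr P" "src g = W" "tgt g = tgt r" using assms by (auto simp: in_hom_iff)
  assume *: "forces P U \<phi> (r \<Zsemi>\<^bsub>L\<^esub> cograph P g) x w"
  show "forces P U \<phi> r x (w \<Zsemi> g)"
  proof (rule forces_seqE[OF _ _ _ *])
    fix V p y \<chi>
    assume p: "p \<in> hom P V U" and y: "y \<in> hom P V (src (cograph P g))" and r: "forces P V \<chi> r (p \<Zsemi> x) y"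
      and c: "forces P V \<chi> (cograph P g) y (p \<Zsemi> w)"
    have "forces P V \<chi> (Idn L (tgt r)) y ((p \<Zsemi> w) \<Zsemi> g)"
      using c forces_cograph[of g W "tgt r" "p \<Zsemi> w" V y \<chi>] assms g y p by (simp add: in_hom_iff)
    from forces_subst_right[OF assms(1) this r] show "forces P V \<chi> r (p \<Zsemi> x) (p \<Zsemi> w \<Zsemi> g)"
      using assms p by (simp add: in_hom_iff)
  qed (use assms g in \<open>auto simp: in_hom_iff\<close>)
next
  have g: "g \<in> Arr P" "src g = W" "tgt g = tgt r" using assms by (auto simp: in_hom_iff)
  assume *: "forces P U \<phi> r x (w \<Zsemi> g)"
  have "forces P U \<phi> (cograph P g) (w \<Zsemi> g) w"
    using forces_cograph[of g W "tgt r" w U "w \<Zsemi> g" \<phi>] forces_refl[of \<phi> U "w \<Zsemi> g" "tgt r"]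
      forcesD[OF *] assms g by (simp add: in_hom_iff)
  from forces_seqI[OF _ _ _ * this] show "forces P U \<phi> (r \<Zsemi>\<^bsub>L\<^esub> cograph P g) x w"
    using assms g by simp
qed

lemma forces_graph_seq:
  assumes "s \<in> Arr L" "f \<in> hom P X (src s)" "x \<in> hom P U X" "z \<in> hom P U (tgt s)"
  shows "forces P U \<phi> (graph P f \<Zsemi>\<^bsub>L\<^esub> s) x z \<longleftrightarrow> forces P U \<phi> s (x \<Zsemi> f) z"
proof
  have f: "f \<in> Arr P" "src f = X" "tgt f = src s" using assms by (auto simp: in_hom_iff)
  assume *: "forces P U \<phi> (graph P f \<Zsemi>\<^bsub>L\<^esub> s) x z"
  show "forces P U \<phi> s (x \<Zsemi> f) z"
  proof (rule forces_seqE[OF _ _ _ *])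
    fix V p y \<chi>
    assume p: "p \<in> hom P V U" and y: "y \<in> hom P V (src s)" and s: "forces P V \<chi> s y (p \<Zsemi> z)"
      and c: "forces P V \<chi> (graph P f) (p \<Zsemi> x) y"
    have "forces P V \<chi> (Idn L (src s)) ((p \<Zsemi> x) \<Zsemi> f) y"
      using c forces_graph[of f X "src s" "p \<Zsemi> x" V y \<chi>] assms f y p by (simp add: in_hom_iff)
    from forces_subst_left[OF assms(1) forces_sym[OF this] s] show "forces P V \<chi> s (p \<Zsemi> x \<Zsemi> f) (p \<Zsemi> z)"
      using assms p by (simp add: in_hom_iff)
  qed (use assms f in \<open>auto simp: in_hom_iff\<close>)
next
  have f: "f \<in> Arr P" "src f = X" "tgt f = src s" using assms by (auto simp: in_hom_iff)
  assume *: "forces P U \<phi> s (x \<Zsemi> f) z"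
  have "forces P U \<phi> (graph P f) x (x \<Zsemi> f)"
    using forces_graph[of f X "src s" x U "x \<Zsemi> f" \<phi>] forces_refl[of \<phi> U "x \<Zsemi> f" "src s"]
      forcesD[OF *] assms f by (simp add: in_hom_iff)
  from forces_seqI[OF _ _ _ this *] show "forces P U \<phi> (graph P f \<Zsemi>\<^bsub>L\<^esub> s) x z"
    using assms f by simp
qed

lemma cograph_Idn: "X \<in> Ob P \<Longrightarrow> cograph P (Idn P X) = Idn L X"
  by (simp add: cograph_def L_ob_Idn prod_arr_def)

lemma L_Arr_Ob: "f \<in> Arr L \<Longrightarrow> src f \<in> Ob P" "f \<in> Arr L \<Longrightarrow> tgt f \<in> Ob P"
  by (auto simp: L_ob_Arr)

text \<open>\<open>Idn\<close> is both the graph and the cograph of an identity, so the unit laws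
  are instances of the one-point rules. For associativity the two witnesses are chosen in the order
  in which the brackets present them and reinserted in the other order.\<close>

lemma category_L: "category L"
proof
  fix f X Y assume "f \<in> hom L X Y"
  then have f: "f \<in> Arr L" "src f = X" "tgt f = Y" "X \<in> Ob P" "Y \<in> Ob P" by (auto simp: in_hom_iff L_ob_Arr)
  show "Idn L X \<Zsemi>\<^bsub>L\<^esub> f = f"
    unfolding graph_Idn[OF f(4), symmetric]
  proof (rule L_eqI)
    fix U \<phi> x y assume "x \<in> hom P U (src (graph P (Idn P X) \<Zsemi>\<^bsub>L\<^esub> f))" "y \<in> hom P U (tgt (graph P (Idn P X) \<Zsemi>\<^bsub>L\<^esub> f))"
    then show "forces P U \<phi> (graph P (Idn P X) \<Zsemi>\<^bsub>L\<^esub> f) x y = forces P U \<phi> f x y"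
      using f forces_graph_seq[of f "Idn P X" X x U y \<phi>] by (simp add: in_hom_iff)
  qed (use f in auto)
  show "f \<Zsemi>\<^bsub>L\<^esub> Idn L Y = f"
    unfolding cograph_Idn[OF f(5), symmetric]
  proof (rule L_eqI)
    fix U \<phi> x y assume "x \<in> hom P U (src (f \<Zsemi>\<^bsub>L\<^esub> cograph P (Idn P Y)))" "y \<in> hom P U (tgt (f \<Zsemi>\<^bsub>L\<^esub> cograph P (Idn P Y)))"
    then show "forces P U \<phi> (f \<Zsemi>\<^bsub>L\<^esub> cograph P (Idn P Y)) x y = forces P U \<phi> f x y"
      using f forces_seq_cograph[of f "Idn P Y" Y x U y \<phi>] by (simp add: in_hom_iff)
  qed (use f in auto)
next
  fix r s t W X Y Z assume "r \<in> hom L W X" "s \<in> hom L X Y" "t \<in> hom L Y Z"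
  then have h: "r \<in> Arr L" "s \<in> Arr L" "t \<in> Arr L" "src r = W" "tgt r = X" "src s = X" "tgt s = Y" "src t = Y" "tgt t = Z"
    by (auto simp: in_hom_iff)
  show "(r \<Zsemi>\<^bsub>L\<^esub> s) \<Zsemi>\<^bsub>L\<^esub> t = r \<Zsemi>\<^bsub>L\<^esub> (s \<Zsemi>\<^bsub>L\<^esub> t)"
  proof (rule L_eqI)
    fix U \<phi> w z assume "w \<in> hom P U (src ((r \<Zsemi>\<^bsub>L\<^esub> s) \<Zsemi>\<^bsub>L\<^esub> t))" "z \<in> hom P U (tgt ((r \<Zsemi>\<^bsub>L\<^esub> s) \<Zsemi>\<^bsub>L\<^esub> t))"
    then have wz: "w \<in> Arr P" "src w = U" "tgt w = W" "z \<in> Arr P" "src z = U" "tgt z = Z" using h by (auto simp: in_hom_iff)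
    show "forces P U \<phi> ((r \<Zsemi>\<^bsub>L\<^esub> s) \<Zsemi>\<^bsub>L\<^esub> t) w z = forces P U \<phi> (r \<Zsemi>\<^bsub>L\<^esub> (s \<Zsemi>\<^bsub>L\<^esub> t)) w z"
    proof
      assume 1: "forces P U \<phi> ((r \<Zsemi>\<^bsub>L\<^esub> s) \<Zsemi>\<^bsub>L\<^esub> t) w z"
      show "forces P U \<phi> (r \<Zsemi>\<^bsub>L\<^esub> (s \<Zsemi>\<^bsub>L\<^esub> t)) w z"
      proof (rule forces_seqE[OF _ _ _ 1])
        fix V p y \<chi> assume V: "p \<in> hom P V U" and 2: "forces P V \<chi> (r \<Zsemi>\<^bsub>L\<^esub> s) (p \<Zsemi> w) y" and 3: "forces P V \<chi> t y (p \<Zsemi> z)"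
        show "forces P V \<chi> (r \<Zsemi>\<^bsub>L\<^esub> (s \<Zsemi>\<^bsub>L\<^esub> t)) (p \<Zsemi> w) (p \<Zsemi> z)"
        proof (rule forces_seqE[OF _ _ _ 2])
          fix V' p' x \<chi>' assume V': "p' \<in> hom P V' V" "\<chi>' \<in> Fib P V'" "fib_le P V' \<chi>' (Act P p' \<chi>)"
            and 4: "forces P V' \<chi>' r (p' \<Zsemi> p \<Zsemi> w) x" "forces P V' \<chi>' s x (p' \<Zsemi> y)"
          \<comment> \<open>The fact about \<open>t\<close> was forced before the second witness was
            chosen and has to be carried to the later stage.\<close>
          from forces_weaken[OF h(3) 3 V']
          show "forces P V' \<chi>' (r \<Zsemi>\<^bsub>L\<^esub> (s \<Zsemi>\<^bsub>L\<^esub> t)) (p' \<Zsemi> p \<Zsemi> w) (p' \<Zsemi> p \<Zsemi> z)"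
            using 4 h forces_seqI[of s t V' \<chi>' x "p' \<Zsemi> y" "p' \<Zsemi> p \<Zsemi> z"]
              forces_seqI[of r "s \<Zsemi>\<^bsub>L\<^esub> t" V' \<chi>' "p' \<Zsemi> p \<Zsemi> w" x "p' \<Zsemi> p \<Zsemi> z"] by simp
        qed (use h V wz in \<open>auto simp: in_hom_iff\<close>)
      qed (use h wz in \<open>auto simp: in_hom_iff\<close>)
    next
      assume 1: "forces P U \<phi> (r \<Zsemi>\<^bsub>L\<^esub> (s \<Zsemi>\<^bsub>L\<^esub> t)) w z"
      show "forces P U \<phi> ((r \<Zsemi>\<^bsub>L\<^esub> s) \<Zsemi>\<^bsub>L\<^esub> t) w z"
      proof (rule forces_seqE[OF _ _ _ 1])
        fix V p y \<chi> assume V: "p \<in> hom P V U" and 2: "forces P V \<chi> (s \<Zsemi>\<^bsub>L\<^esub> t) y (p \<Zsemi> z)" and 3: "forces P V \<chi> r (p \<Zsemi> w) y"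
        show "forces P V \<chi> ((r \<Zsemi>\<^bsub>L\<^esub> s) \<Zsemi>\<^bsub>L\<^esub> t) (p \<Zsemi> w) (p \<Zsemi> z)"
        proof (rule forces_seqE[OF _ _ _ 2])
          fix V' p' x \<chi>' assume V': "p' \<in> hom P V' V" "\<chi>' \<in> Fib P V'" "fib_le P V' \<chi>' (Act P p' \<chi>)"
            and 4: "forces P V' \<chi>' s (p' \<Zsemi> y) x" "forces P V' \<chi>' t x (p' \<Zsemi> p \<Zsemi> z)"
          from forces_weaken[OF h(1) 3 V']
          show "forces P V' \<chi>' ((r \<Zsemi>\<^bsub>L\<^esub> s) \<Zsemi>\<^bsub>L\<^esub> t) (p' \<Zsemi> p \<Zsemi> w) (p' \<Zsemi> p \<Zsemi> z)"
            using 4 h forces_seqI[of r s V' \<chi>' "p' \<Zsemi> p \<Zsemi> w" "p' \<Zsemi> y" x]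
              forces_seqI[of "r \<Zsemi>\<^bsub>L\<^esub> s" t V' \<chi>' "p' \<Zsemi> p \<Zsemi> w" x "p' \<Zsemi> p \<Zsemi> z"] by simp
        qed (use h V wz in \<open>auto simp: in_hom_iff\<close>)
      qed (use h wz in \<open>auto simp: in_hom_iff\<close>)
    qed
  qed (use h in auto)
qed (auto simp: in_hom_iff L_Arr_Ob)

end

sublocale EED_doctrine \<subseteq> L: category L
  by (rule category_L)

section \<open>The graph functor and its right adjoints\<close>

context EED_doctrine
begin

lemma graph_seq:
  assumes "f \<in> Arr P" "g \<in> Arr P" "tgt f = src g"
  shows "graph P f \<Zsemi>\<^bsub>L\<^esub> graph P g = graph P (f \<Zsemi> g)"
proof (rule L_eqI)
  fix U \<phi> x y assume "x \<in> hom P U (src (graph P f \<Zsemi>\<^bsub>L\<^esub> graph P g))" "y \<in> hom P U (tgt (graph P f \<Zsemi>\<^bsub>L\<^esub> graph P g))"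
  then show "forces P U \<phi> (graph P f \<Zsemi>\<^bsub>L\<^esub> graph P g) x y \<longleftrightarrow> forces P U \<phi> (graph P (f \<Zsemi> g)) x y"
    using assms forces_graph_seq[of "graph P g" f "src f" x U y \<phi>]
      forces_graph[of "f \<Zsemi> g" "src f" "tgt g" x U y \<phi>] forces_graph[of g "src g" "tgt g" "x \<Zsemi> f" U y \<phi>]
    by (simp add: in_hom_iff)
qed (use assms in auto)

lemma graph_tens:
  assumes "f \<in> Arr P" "g \<in> Arr P"
  shows "graph P f \<otimes>\<^sub>a\<^bsub>L\<^esub> graph P g = graph P (f \<times>\<^sub>a g)"
proof (rule L_eqI)
  fix U \<phi> x y assume "x \<in> hom P U (src (graph P f \<otimes>\<^sub>a\<^bsub>L\<^esub> graph P g))" "y \<in> hom P U (tgt (graph P f \<otimes>\<^sub>a\<^bsub>L\<^esub> graph P g))"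
  then have xy: "x \<in> hom P U (src f \<times>\<^sub>o src g)" "y \<in> hom P U (tgt f \<times>\<^sub>o tgt g)" by auto
  have "forces P U \<phi> (graph P f) (x \<Zsemi> Pr1 P (src f) (src g)) (y \<Zsemi> Pr1 P (tgt f) (tgt g)) \<longleftrightarrow>
     forces P U \<phi> (Idn L (tgt f)) (x \<Zsemi> Pr1 P (src f) (src g) \<Zsemi> f) (y \<Zsemi> Pr1 P (tgt f) (tgt g))"
    using forces_graph[of f "src f" "tgt f" "x \<Zsemi> Pr1 P (src f) (src g)" U "y \<Zsemi> Pr1 P (tgt f) (tgt g)" \<phi>]
      xy assms by (simp add: in_hom_iff)
  moreover have "forces P U \<phi> (graph P g) (x \<Zsemi> Pr2 P (src f) (src g)) (y \<Zsemi> Pr2 P (tgt f) (tgt g)) \<longleftrightarrow>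
     forces P U \<phi> (Idn L (tgt g)) (x \<Zsemi> Pr2 P (src f) (src g) \<Zsemi> g) (y \<Zsemi> Pr2 P (tgt f) (tgt g))"
    using forces_graph[of g "src g" "tgt g" "x \<Zsemi> Pr2 P (src f) (src g)" U "y \<Zsemi> Pr2 P (tgt f) (tgt g)" \<phi>]
      xy assms by (simp add: in_hom_iff)
  moreover have "forces P U \<phi> (graph P (f \<times>\<^sub>a g)) x y \<longleftrightarrow> forces P U \<phi> (Idn L (tgt f \<times>\<^sub>o tgt g)) (x \<Zsemi> (f \<times>\<^sub>a g)) y"
    using forces_graph[of "f \<times>\<^sub>a g" "src f \<times>\<^sub>o src g" "tgt f \<times>\<^sub>o tgt g" x U y \<phi>] xy assms by (simp add: in_hom_iff)
  moreover have "\<dots> \<longleftrightarrow> forces P U \<phi> (Idn L (tgt f)) (x \<Zsemi> Pr1 P (src f) (src g) \<Zsemi> f) (y \<Zsemi> Pr1 P (tgt f) (tgt g)) \<and>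
     forces P U \<phi> (Idn L (tgt g)) (x \<Zsemi> Pr2 P (src f) (src g) \<Zsemi> g) (y \<Zsemi> Pr2 P (tgt f) (tgt g))"
    using forces_Idn_Prod[of "tgt f" "tgt g" "x \<Zsemi> (f \<times>\<^sub>a g)" U y \<phi>] xy assms
    by (simp add: in_hom_iff prod_arr_def)
  ultimately show "forces P U \<phi> (graph P f \<otimes>\<^sub>a\<^bsub>L\<^esub> graph P g) x y \<longleftrightarrow> forces P U \<phi> (graph P (f \<times>\<^sub>a g)) x y"
    using assms xy forces_tens[of "graph P f" "graph P g" "src f" "tgt f" "src g" "tgt g" x U y \<phi>] by simp
qed (use assms in auto)

text \<open>Congruence along \<open>f\<close> and along \<open>g\<close> exchanges x = g(y) with
  f(x) = y. So the graph of an isomorphism can also be removed on the right of a composite, by the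
  rule for cographs.\<close>

lemma cograph_eq_graph:
  assumes "inverse_arrows P f g"
  shows "cograph P g = graph P f"
proof (rule L_eqI)
  have fg: "f \<in> Arr P" "g \<in> Arr P" "src g = tgt f" "tgt g = src f" "f \<Zsemi> g = Idn P (src f)" "g \<Zsemi> f = Idn P (tgt f)"
    using assms by (auto simp: inverse_arrows_def in_hom_iff)
  then show "cograph P g \<in> Arr L" "graph P f \<in> Arr L" "src (cograph P g) = src (graph P f)"
    "tgt (cograph P g) = tgt (graph P f)" by auto
  fix U \<phi> x y assume "x \<in> hom P U (src (cograph P g))" "y \<in> hom P U (tgt (cograph P g))"
  then have xy: "x \<in> Arr P" "src x = U" "tgt x = src f" "y \<in> Arr P" "src y = U" "tgt y = tgt f"
    using fg by (auto simp: in_hom_iff)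
  have "forces P U \<phi> (cograph P g) x y \<longleftrightarrow> forces P U \<phi> (Idn L (src f)) x (y \<Zsemi> g)"
    using forces_cograph[of g "tgt f" "src f" y U x \<phi>] fg xy by (simp add: in_hom_iff)
  also have "\<dots> \<longleftrightarrow> forces P U \<phi> (Idn L (tgt f)) (x \<Zsemi> f) y"
    using forces_cong[of U \<phi> "src f" x "y \<Zsemi> g" f "tgt f"] forces_cong[of U \<phi> "tgt f" "x \<Zsemi> f" y g "src f"] fg xy
    by (auto simp: in_hom_iff)
  also have "\<dots> \<longleftrightarrow> forces P U \<phi> (graph P f) x y"
    using forces_graph[of f "src f" "tgt f" x U y \<phi>] fg xy by (simp add: in_hom_iff)
  finally show "forces P U \<phi> (cograph P g) x y \<longleftrightarrow> forces P U \<phi> (graph P f) x y" .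
qed

lemma forces_seq_graph:
  assumes "r \<in> Arr L" "inverse_arrows P f g" "tgt r = src f" "x \<in> hom P U (src r)" "z \<in> hom P U (tgt f)"
  shows "forces P U \<phi> (r \<Zsemi>\<^bsub>L\<^esub> graph P f) x z \<longleftrightarrow> forces P U \<phi> r x (z \<Zsemi> g)"
  using forces_seq_cograph[of r g "tgt f" x U z \<phi>] cograph_eq_graph[OF assms(2)] assms
  by (auto simp: inverse_arrows_def in_hom_iff)

lemma inverse_graph:
  assumes "inverse_arrows P f g" shows "inverse_arrows L (graph P f) (graph P g)"
  using assms by (auto simp: inverse_arrows_def in_hom_iff graph_seq graph_Idn)

text \<open>The unit is congruence: equal elements have equal images. The counit is transitivity
  through the image of the witness.\<close>

lemma right_adjoint_graph:
  assumes "f \<in> Arr P" shows "is_right_adjoint L (graph P f) (cograph P f)"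
proof -
  let ?X = "src f" and ?Y = "tgt f"
  have "Idn L ?X \<sqsubseteq>\<^bsub>L\<^esub> graph P f \<Zsemi>\<^bsub>L\<^esub> cograph P f"
  proof (rule L_leI)
    fix U \<phi> x y assume *: "forces P U \<phi> (Idn L ?X) x y"
    note t = forcesD[OF this]
    have "forces P U \<phi> (Idn L ?Y) (x \<Zsemi> f) (y \<Zsemi> f)" using forces_cong[OF *, of f ?Y] assms by (simp add: in_hom_iff)
    then show "forces P U \<phi> (graph P f \<Zsemi>\<^bsub>L\<^esub> cograph P f) x y"
      using forces_graph_seq[of "cograph P f" f ?X x U y \<phi>] forces_cograph[of f ?X ?Y y U "x \<Zsemi> f" \<phi>] assms t
      by (simp add: in_hom_iff)
  qed (use assms in auto)
  moreover have "cograph P f \<Zsemi>\<^bsub>L\<^esub> graph P f \<sqsubseteq>\<^bsub>L\<^esub> Idn L ?Y"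
  proof (rule L_leI)
    fix U \<phi> x z assume *: "forces P U \<phi> (cograph P f \<Zsemi>\<^bsub>L\<^esub> graph P f) x z"
    note t = forcesD[OF this]
    show "forces P U \<phi> (Idn L ?Y) x z"
    proof (rule forces_seqE[OF _ _ _ *])
      fix V p y \<chi> assume p: "p \<in> hom P V U" "y \<in> hom P V (src (graph P f))"
        and "forces P V \<chi> (cograph P f) (p \<Zsemi> x) y" "forces P V \<chi> (graph P f) y (p \<Zsemi> z)"
      then have "forces P V \<chi> (Idn L ?Y) (p \<Zsemi> x) (y \<Zsemi> f)" "forces P V \<chi> (Idn L ?Y) (y \<Zsemi> f) (p \<Zsemi> z)"
        using forces_cograph[of f ?X ?Y y V "p \<Zsemi> x" \<chi>] forces_graph[of f ?X ?Y y V "p \<Zsemi> z" \<chi>] t assms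
        by (auto simp: in_hom_iff)
      then show "forces P V \<chi> (Idn L ?Y) (p \<Zsemi> x) (p \<Zsemi> z)" by (rule forces_trans)
    qed (use t assms in \<open>auto simp: in_hom_iff\<close>)
  qed (use assms in auto)
  ultimately show ?thesis using assms by (simp add: is_right_adjoint_def in_hom_iff)
qed

end

text \<open>Written as a tuple, so that inverse associators have the same normal form as all other
  structural arrows.\<close>

definition cart_assoc_inv :: "('o, 'm, 'z) cart_scheme \<Rightarrow> 'o \<Rightarrow> 'o \<Rightarrow> 'o \<Rightarrow> ('o, 'm) arrow" where
  "cart_assoc_inv C X Y Z = \<langle>\<langle>tri1 C X Y Z, tri2 C X Y Z\<rangle>\<^bsub>C\<^esub>, tri3 C X Y Z\<rangle>\<^bsub>C\<^esub>"

context cartesian_category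
begin

lemma cart_assoc_inv_simps [simp]:
  assumes "X \<in> Ob C" "Y \<in> Ob C" "Z \<in> Ob C"
  shows "cart_assoc_inv C X Y Z \<in> Arr C" "src (cart_assoc_inv C X Y Z) = X \<times>\<^sub>o (Y \<times>\<^sub>o Z)"
    "tgt (cart_assoc_inv C X Y Z) = (X \<times>\<^sub>o Y) \<times>\<^sub>o Z"
  using assms by (auto simp: cart_assoc_inv_def)

lemma inverse_cart_assoc:
  assumes "X \<in> Ob C" "Y \<in> Ob C" "Z \<in> Ob C"
  shows "inverse_arrows C (cart_assoc C X Y Z) (cart_assoc_inv C X Y Z)"
  using assms by (intro inverse_arrowsI[of _ "(X \<times>\<^sub>o Y) \<times>\<^sub>o Z" "X \<times>\<^sub>o (Y \<times>\<^sub>o Z)"])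
    (auto simp: in_hom_iff cart_defs cart_assoc_inv_def)

lemma inverse_cart_run:
  assumes "X \<in> Ob C"
  shows "inverse_arrows C (cart_run C X) \<langle>Idn C X, bang C X\<rangle>"
proof (rule inverse_arrowsI[of _ "X \<times>\<^sub>o One C" X])
  show "cart_run C X \<Zsemi> \<langle>Idn C X, bang C X\<rangle> = Idn C (X \<times>\<^sub>o One C)"
    by (rule prod_eqI[of _ _ X "One C"]) (use assms in \<open>auto simp: cart_run_def intro: One_eqI\<close>)
qed (use assms in \<open>auto simp: in_hom_iff cart_run_def\<close>)

lemma inverse_cart_lun:
  assumes "X \<in> Ob C"
  shows "inverse_arrows C (cart_lun C X) \<langle>bang C X, Idn C X\<rangle>"
proof (rule inverse_arrowsI[of _ "One C \<times>\<^sub>o X" X])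
  show "cart_lun C X \<Zsemi> \<langle>bang C X, Idn C X\<rangle> = Idn C (One C \<times>\<^sub>o X)"
    by (rule prod_eqI[of _ _ "One C" X]) (use assms in \<open>auto simp: cart_lun_def intro: One_eqI\<close>)
qed (use assms in \<open>auto simp: in_hom_iff cart_lun_def\<close>)

lemma inverse_cart_sym:
  assumes "X \<in> Ob C" "Y \<in> Ob C"
  shows "inverse_arrows C (cart_sym C X Y) (cart_sym C Y X)"
  using assms by (intro inverse_arrowsI[of _ "X \<times>\<^sub>o Y" "Y \<times>\<^sub>o X"]) (auto simp: in_hom_iff cart_sym_def)

end

section \<open>Symmetric monoidal structure and order of L(P)\<close>

context EED_doctrine
begin

lemmas L_structure_inverses =
  inverse_graph[OF inverse_cart_assoc, folded L_ob_structure]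
  inverse_graph[OF inverse_cart_run, folded L_ob_structure]
  inverse_graph[OF inverse_cart_lun, folded L_ob_structure]
  inverse_graph[OF inverse_cart_sym, folded L_ob_structure]

text \<open>Both sides ask for a witness in each factor. From left to right the witnesses are chosen
  one after the other and paired at the later stage; from right to left the single witness is split
  by the projections.\<close>

lemma tens_seq:
  assumes "f \<in> Arr L" "g \<in> Arr L" "tgt f = src g" "f' \<in> Arr L" "g' \<in> Arr L" "tgt f' = src g'"
  shows "(f \<Zsemi>\<^bsub>L\<^esub> g) \<otimes>\<^sub>a\<^bsub>L\<^esub> (f' \<Zsemi>\<^bsub>L\<^esub> g') = (f \<otimes>\<^sub>a\<^bsub>L\<^esub> f') \<Zsemi>\<^bsub>L\<^esub> (g \<otimes>\<^sub>a\<^bsub>L\<^esub> g')"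
proof (rule L_eqI)
  define X Y Z X' Y' Z' where o: "X = src f" "Y = src g" "Z = tgt g" "X' = src f'" "Y' = src g'" "Z' = tgt g'"
  note ty = assms o[symmetric]
  have O: "X \<in> Ob P" "Y \<in> Ob P" "Z \<in> Ob P" "X' \<in> Ob P" "Y' \<in> Ob P" "Z' \<in> Ob P"
    using assms by (auto simp: o L_ob_Arr)
  fix U \<phi> x z assume "x \<in> hom P U (src ((f \<Zsemi>\<^bsub>L\<^esub> g) \<otimes>\<^sub>a\<^bsub>L\<^esub> (f' \<Zsemi>\<^bsub>L\<^esub> g')))" "z \<in> hom P U (tgt ((f \<Zsemi>\<^bsub>L\<^esub> g) \<otimes>\<^sub>a\<^bsub>L\<^esub> (f' \<Zsemi>\<^bsub>L\<^esub> g')))"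
  then have xz: "x \<in> Arr P" "src x = U" "tgt x = X \<times>\<^sub>o X'" "z \<in> Arr P" "src z = U" "tgt z = Z \<times>\<^sub>o Z'"
    by (auto simp: in_hom_iff o)
  let ?x = "x \<Zsemi> Pr1 P X X'" and ?x' = "x \<Zsemi> Pr2 P X X'" and ?z = "z \<Zsemi> Pr1 P Z Z'" and ?z' = "z \<Zsemi> Pr2 P Z Z'"
  have lhs: "forces P U \<phi> ((f \<Zsemi>\<^bsub>L\<^esub> g) \<otimes>\<^sub>a\<^bsub>L\<^esub> (f' \<Zsemi>\<^bsub>L\<^esub> g')) x z \<longleftrightarrow>
      forces P U \<phi> (f \<Zsemi>\<^bsub>L\<^esub> g) ?x ?z \<and> forces P U \<phi> (f' \<Zsemi>\<^bsub>L\<^esub> g') ?x' ?z'"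
    using forces_tens[of "f \<Zsemi>\<^bsub>L\<^esub> g" "f' \<Zsemi>\<^bsub>L\<^esub> g'" X Z X' Z' x U z \<phi>] ty xz by (simp add: in_hom_iff)
  have step: "forces P V \<chi> (f \<otimes>\<^sub>a\<^bsub>L\<^esub> f') a b \<longleftrightarrow>
      forces P V \<chi> f (a \<Zsemi> Pr1 P X X') (b \<Zsemi> Pr1 P Y Y') \<and> forces P V \<chi> f' (a \<Zsemi> Pr2 P X X') (b \<Zsemi> Pr2 P Y Y')"
    if "a \<in> hom P V (X \<times>\<^sub>o X')" "b \<in> hom P V (Y \<times>\<^sub>o Y')" for V \<chi> a b
    using forces_tens[of f f' X Y X' Y' a V b \<chi>] ty that by simp
  have step': "forces P V \<chi> (g \<otimes>\<^sub>a\<^bsub>L\<^esub> g') a b \<longleftrightarrow>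
      forces P V \<chi> g (a \<Zsemi> Pr1 P Y Y') (b \<Zsemi> Pr1 P Z Z') \<and> forces P V \<chi> g' (a \<Zsemi> Pr2 P Y Y') (b \<Zsemi> Pr2 P Z Z')"
    if "a \<in> hom P V (Y \<times>\<^sub>o Y')" "b \<in> hom P V (Z \<times>\<^sub>o Z')" for V \<chi> a b
    using forces_tens[of g g' Y Z Y' Z' a V b \<chi>] ty that by simp
  show "forces P U \<phi> ((f \<Zsemi>\<^bsub>L\<^esub> g) \<otimes>\<^sub>a\<^bsub>L\<^esub> (f' \<Zsemi>\<^bsub>L\<^esub> g')) x z \<longleftrightarrow> forces P U \<phi> ((f \<otimes>\<^sub>a\<^bsub>L\<^esub> f') \<Zsemi>\<^bsub>L\<^esub> (g \<otimes>\<^sub>a\<^bsub>L\<^esub> g')) x z"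
  proof
    assume "forces P U \<phi> ((f \<Zsemi>\<^bsub>L\<^esub> g) \<otimes>\<^sub>a\<^bsub>L\<^esub> (f' \<Zsemi>\<^bsub>L\<^esub> g')) x z"
    then have 1: "forces P U \<phi> (f \<Zsemi>\<^bsub>L\<^esub> g) ?x ?z" and 2: "forces P U \<phi> (f' \<Zsemi>\<^bsub>L\<^esub> g') ?x' ?z'" using lhs by auto
    show "forces P U \<phi> ((f \<otimes>\<^sub>a\<^bsub>L\<^esub> f') \<Zsemi>\<^bsub>L\<^esub> (g \<otimes>\<^sub>a\<^bsub>L\<^esub> g')) x z"
    proof (rule forces_seqE[OF _ _ _ 1])
      fix V p y \<chi> assume V: "p \<in> hom P V U" "\<chi> \<in> Fib P V" "fib_le P V \<chi> (Act P p \<phi>)" and y: "y \<in> hom P V (src g)"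
        and 3: "forces P V \<chi> f (p \<Zsemi> ?x) y" "forces P V \<chi> g y (p \<Zsemi> ?z)"
      have 4: "forces P V \<chi> (f' \<Zsemi>\<^bsub>L\<^esub> g') (p \<Zsemi> ?x') (p \<Zsemi> ?z')"
        using forces_weaken[OF _ 2 V] assms by simp
      show "forces P V \<chi> ((f \<otimes>\<^sub>a\<^bsub>L\<^esub> f') \<Zsemi>\<^bsub>L\<^esub> (g \<otimes>\<^sub>a\<^bsub>L\<^esub> g')) (p \<Zsemi> x) (p \<Zsemi> z)"
      proof (rule forces_seqE[OF _ _ _ 4])
        fix V' p' y' \<chi>' assume V': "p' \<in> hom P V' V" "\<chi>' \<in> Fib P V'" "fib_le P V' \<chi>' (Act P p' \<chi>)"
          and y': "y' \<in> hom P V' (src g')"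
          and 5: "forces P V' \<chi>' f' (p' \<Zsemi> p \<Zsemi> ?x') y'" "forces P V' \<chi>' g' y' (p' \<Zsemi> p \<Zsemi> ?z')"
        have 6: "forces P V' \<chi>' f (p' \<Zsemi> p \<Zsemi> ?x) (p' \<Zsemi> y)" "forces P V' \<chi>' g (p' \<Zsemi> y) (p' \<Zsemi> p \<Zsemi> ?z)"
          using forces_weaken[OF _ 3(1) V'] forces_weaken[OF _ 3(2) V'] assms by auto
        show "forces P V' \<chi>' ((f \<otimes>\<^sub>a\<^bsub>L\<^esub> f') \<Zsemi>\<^bsub>L\<^esub> (g \<otimes>\<^sub>a\<^bsub>L\<^esub> g')) (p' \<Zsemi> p \<Zsemi> x) (p' \<Zsemi> p \<Zsemi> z)"
          by (rule forces_seqI[of _ _ _ _ _ "\<langle>p' \<Zsemi> y, y'\<rangle>"])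
            (use 5 6 V V' y y' xz ty O step[of "p' \<Zsemi> p \<Zsemi> x" V' "\<langle>p' \<Zsemi> y, y'\<rangle>" \<chi>']
              step'[of "\<langle>p' \<Zsemi> y, y'\<rangle>" V' "p' \<Zsemi> p \<Zsemi> z" \<chi>'] in \<open>simp_all add: in_hom_iff\<close>)
      qed (use V ty xz O in \<open>simp_all add: in_hom_iff\<close>)
    qed (use ty xz O in \<open>simp_all add: in_hom_iff\<close>)
  next
    assume 1: "forces P U \<phi> ((f \<otimes>\<^sub>a\<^bsub>L\<^esub> f') \<Zsemi>\<^bsub>L\<^esub> (g \<otimes>\<^sub>a\<^bsub>L\<^esub> g')) x z"
    have s: "forces P V \<chi> f (p \<Zsemi> ?x) (y \<Zsemi> Pr1 P Y Y') \<and> forces P V \<chi> f' (p \<Zsemi> ?x') (y \<Zsemi> Pr2 P Y Y') \<and>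
      forces P V \<chi> g (y \<Zsemi> Pr1 P Y Y') (p \<Zsemi> ?z) \<and> forces P V \<chi> g' (y \<Zsemi> Pr2 P Y Y') (p \<Zsemi> ?z')"
      if "p \<in> hom P V U" "y \<in> hom P V (Y \<times>\<^sub>o Y')" "forces P V \<chi> (f \<otimes>\<^sub>a\<^bsub>L\<^esub> f') (p \<Zsemi> x) y"
        "forces P V \<chi> (g \<otimes>\<^sub>a\<^bsub>L\<^esub> g') y (p \<Zsemi> z)" for V p \<chi> y
      using that step[of "p \<Zsemi> x" V y \<chi>] step'[of y V "p \<Zsemi> z" \<chi>] xz O by (simp add: in_hom_iff)
    have "forces P U \<phi> (f \<Zsemi>\<^bsub>L\<^esub> g) ?x ?z"
    proof (rule forces_seqE[OF _ _ _ 1])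
      fix V p y \<chi> assume "p \<in> hom P V U" "y \<in> hom P V (src (g \<otimes>\<^sub>a\<^bsub>L\<^esub> g'))" "forces P V \<chi> (f \<otimes>\<^sub>a\<^bsub>L\<^esub> f') (p \<Zsemi> x) y"
        "forces P V \<chi> (g \<otimes>\<^sub>a\<^bsub>L\<^esub> g') y (p \<Zsemi> z)"
      from s[OF this(1) _ this(3,4)] this(2) show "forces P V \<chi> (f \<Zsemi>\<^bsub>L\<^esub> g) (p \<Zsemi> ?x) (p \<Zsemi> ?z)"
        using assms by (auto simp: o intro: forces_seqI)
    qed (use ty xz O in \<open>simp_all add: in_hom_iff\<close>)
    moreover have "forces P U \<phi> (f' \<Zsemi>\<^bsub>L\<^esub> g') ?x' ?z'"
    proof (rule forces_seqE[OF _ _ _ 1])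
      fix V p y \<chi> assume "p \<in> hom P V U" "y \<in> hom P V (src (g \<otimes>\<^sub>a\<^bsub>L\<^esub> g'))" "forces P V \<chi> (f \<otimes>\<^sub>a\<^bsub>L\<^esub> f') (p \<Zsemi> x) y"
        "forces P V \<chi> (g \<otimes>\<^sub>a\<^bsub>L\<^esub> g') y (p \<Zsemi> z)"
      from s[OF this(1) _ this(3,4)] this(2) show "forces P V \<chi> (f' \<Zsemi>\<^bsub>L\<^esub> g') (p \<Zsemi> ?x') (p \<Zsemi> ?z')"
        using assms by (auto simp: o intro: forces_seqI)
    qed (use ty xz O in \<open>simp_all add: in_hom_iff\<close>)
    ultimately show "forces P U \<phi> ((f \<Zsemi>\<^bsub>L\<^esub> g) \<otimes>\<^sub>a\<^bsub>L\<^esub> (f' \<Zsemi>\<^bsub>L\<^esub> g')) x z" using lhs by simp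
  qed
qed (use assms in auto)

text \<open>The associators are isomorphisms, so the one-point rules remove them from both
  composites; what remains are the same three relations at the same components. The other naturality
  laws below follow this pattern.\<close>

lemma L_Assoc_natural:
  assumes "f \<in> Arr L" "g \<in> Arr L" "h \<in> Arr L"
  shows "((f \<otimes>\<^sub>a\<^bsub>L\<^esub> g) \<otimes>\<^sub>a\<^bsub>L\<^esub> h) \<Zsemi>\<^bsub>L\<^esub> Assoc L (tgt f) (tgt g) (tgt h) =
         Assoc L (src f) (src g) (src h) \<Zsemi>\<^bsub>L\<^esub> (f \<otimes>\<^sub>a\<^bsub>L\<^esub> (g \<otimes>\<^sub>a\<^bsub>L\<^esub> h))"
proof (rule L_eqI)
  define X Y Z X' Y' Z' where o: "X = src f" "Y = src g" "Z = src h" "X' = tgt f" "Y' = tgt g" "Z' = tgt h"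
  have O: "X \<in> Ob P" "Y \<in> Ob P" "Z \<in> Ob P" "X' \<in> Ob P" "Y' \<in> Ob P" "Z' \<in> Ob P"
    using assms L_Arr_Ob by (auto simp: o)
  note ty = assms o[symmetric]
  fix U \<phi> x z assume "x \<in> hom P U (src (((f \<otimes>\<^sub>a\<^bsub>L\<^esub> g) \<otimes>\<^sub>a\<^bsub>L\<^esub> h) \<Zsemi>\<^bsub>L\<^esub> Assoc L (tgt f) (tgt g) (tgt h)))"
    "z \<in> hom P U (tgt (((f \<otimes>\<^sub>a\<^bsub>L\<^esub> g) \<otimes>\<^sub>a\<^bsub>L\<^esub> h) \<Zsemi>\<^bsub>L\<^esub> Assoc L (tgt f) (tgt g) (tgt h)))"
  then have xz: "x \<in> Arr P" "src x = U" "tgt x = (X \<times>\<^sub>o Y) \<times>\<^sub>o Z" "z \<in> Arr P" "src z = U" "tgt z = X' \<times>\<^sub>o (Y' \<times>\<^sub>o Z')"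
    using O by (auto simp: in_hom_iff ty L_ob_structure)
  let ?\<alpha> = "cart_assoc P X Y Z" and ?\<beta> = "cart_assoc_inv P X' Y' Z'"
  have "forces P U \<phi> (((f \<otimes>\<^sub>a\<^bsub>L\<^esub> g) \<otimes>\<^sub>a\<^bsub>L\<^esub> h) \<Zsemi>\<^bsub>L\<^esub> Assoc L (tgt f) (tgt g) (tgt h)) x z \<longleftrightarrow>
     forces P U \<phi> ((f \<otimes>\<^sub>a\<^bsub>L\<^esub> g) \<otimes>\<^sub>a\<^bsub>L\<^esub> h) x (z \<Zsemi> ?\<beta>)"
    using forces_seq_graph[OF _ inverse_cart_assoc, of "(f \<otimes>\<^sub>a\<^bsub>L\<^esub> g) \<otimes>\<^sub>a\<^bsub>L\<^esub> h" X' Y' Z' x U z \<phi>] ty O xz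
    by (simp add: in_hom_iff L_ob_structure)
  also have "\<dots> \<longleftrightarrow> forces P U \<phi> (f \<otimes>\<^sub>a\<^bsub>L\<^esub> (g \<otimes>\<^sub>a\<^bsub>L\<^esub> h)) (x \<Zsemi> ?\<alpha>) z"
    using forces_tens[of "f \<otimes>\<^sub>a\<^bsub>L\<^esub> g" h "X \<times>\<^sub>o Y" "X' \<times>\<^sub>o Y'" Z Z' x U "z \<Zsemi> ?\<beta>" \<phi>]
      forces_tens[of f g X X' Y Y' "x \<Zsemi> Pr1 P (X \<times>\<^sub>o Y) Z" U "z \<Zsemi> ?\<beta> \<Zsemi> Pr1 P (X' \<times>\<^sub>o Y') Z'" \<phi>]
      forces_tens[of f "g \<otimes>\<^sub>a\<^bsub>L\<^esub> h" X X' "Y \<times>\<^sub>o Z" "Y' \<times>\<^sub>o Z'" "x \<Zsemi> ?\<alpha>" U z \<phi>]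
      forces_tens[of g h Y Y' Z Z' "x \<Zsemi> ?\<alpha> \<Zsemi> Pr2 P X (Y \<times>\<^sub>o Z)" U "z \<Zsemi> Pr2 P X' (Y' \<times>\<^sub>o Z')" \<phi>]
      ty O xz
    by (simp add: in_hom_iff cart_assoc_def cart_assoc_inv_def tri1_def tri2_def tri3_def)
  also have "\<dots> \<longleftrightarrow> forces P U \<phi> (Assoc L (src f) (src g) (src h) \<Zsemi>\<^bsub>L\<^esub> (f \<otimes>\<^sub>a\<^bsub>L\<^esub> (g \<otimes>\<^sub>a\<^bsub>L\<^esub> h))) x z"
    using forces_graph_seq[of "f \<otimes>\<^sub>a\<^bsub>L\<^esub> (g \<otimes>\<^sub>a\<^bsub>L\<^esub> h)" ?\<alpha> "(X \<times>\<^sub>o Y) \<times>\<^sub>o Z" x U z \<phi>] ty O xz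
    by (simp add: in_hom_iff L_ob_structure)
  finally show "forces P U \<phi> (((f \<otimes>\<^sub>a\<^bsub>L\<^esub> g) \<otimes>\<^sub>a\<^bsub>L\<^esub> h) \<Zsemi>\<^bsub>L\<^esub> Assoc L (tgt f) (tgt g) (tgt h)) x z \<longleftrightarrow>
     forces P U \<phi> (Assoc L (src f) (src g) (src h) \<Zsemi>\<^bsub>L\<^esub> (f \<otimes>\<^sub>a\<^bsub>L\<^esub> (g \<otimes>\<^sub>a\<^bsub>L\<^esub> h))) x z" .
qed (use assms L_Arr_Ob in \<open>simp_all add: L_ob_structure\<close>)

lemma L_Lun_natural:
  assumes "f \<in> Arr L"
  shows "(Idn L (One P) \<otimes>\<^sub>a\<^bsub>L\<^esub> f) \<Zsemi>\<^bsub>L\<^esub> Lun L (tgt f) = Lun L (src f) \<Zsemi>\<^bsub>L\<^esub> f"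
proof (rule L_eqI)
  define X Y where o: "X = src f" "Y = tgt f"
  have O: "X \<in> Ob P" "Y \<in> Ob P" using assms L_Arr_Ob by (auto simp: o)
  note ty = assms o[symmetric]
  fix U \<phi> x z assume \<phi>: "\<phi> \<in> Fib P U" and
     "x \<in> hom P U (src ((Idn L (One P) \<otimes>\<^sub>a\<^bsub>L\<^esub> f) \<Zsemi>\<^bsub>L\<^esub> Lun L (tgt f)))"
     "z \<in> hom P U (tgt ((Idn L (One P) \<otimes>\<^sub>a\<^bsub>L\<^esub> f) \<Zsemi>\<^bsub>L\<^esub> Lun L (tgt f)))"
  then have xz: "x \<in> Arr P" "src x = U" "tgt x = One P \<times>\<^sub>o X" "z \<in> Arr P" "src z = U" "tgt z = Y"
    using O by (auto simp: in_hom_iff ty L_ob_structure)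
  show "forces P U \<phi> ((Idn L (One P) \<otimes>\<^sub>a\<^bsub>L\<^esub> f) \<Zsemi>\<^bsub>L\<^esub> Lun L (tgt f)) x z \<longleftrightarrow> forces P U \<phi> (Lun L (src f) \<Zsemi>\<^bsub>L\<^esub> f) x z"
    using forces_seq_graph[OF _ inverse_cart_lun, of "Idn L (One P) \<otimes>\<^sub>a\<^bsub>L\<^esub> f" Y x U z \<phi>]
      forces_graph_seq[of f "cart_lun P X" "One P \<times>\<^sub>o X" x U z \<phi>]
      forces_tens[of "Idn L (One P)" f "One P" "One P" X Y x U "z \<Zsemi> \<langle>bang P Y, Idn P Y\<rangle>" \<phi>]
      forces_Idn_One[of \<phi> U "x \<Zsemi> Pr1 P (One P) X" "z \<Zsemi> bang P Y"] ty O xz \<phi>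
    by (simp add: in_hom_iff L_ob_structure cart_lun_def)
qed (use assms L_Arr_Ob in \<open>simp_all add: L_ob_structure\<close>)

lemma L_Run_natural:
  assumes "f \<in> Arr L"
  shows "(f \<otimes>\<^sub>a\<^bsub>L\<^esub> Idn L (One P)) \<Zsemi>\<^bsub>L\<^esub> Run L (tgt f) = Run L (src f) \<Zsemi>\<^bsub>L\<^esub> f"
proof (rule L_eqI)
  define X Y where o: "X = src f" "Y = tgt f"
  have O: "X \<in> Ob P" "Y \<in> Ob P" using assms L_Arr_Ob by (auto simp: o)
  note ty = assms o[symmetric]
  fix U \<phi> x z assume \<phi>: "\<phi> \<in> Fib P U" and
     "x \<in> hom P U (src ((f \<otimes>\<^sub>a\<^bsub>L\<^esub> Idn L (One P)) \<Zsemi>\<^bsub>L\<^esub> Run L (tgt f)))"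
     "z \<in> hom P U (tgt ((f \<otimes>\<^sub>a\<^bsub>L\<^esub> Idn L (One P)) \<Zsemi>\<^bsub>L\<^esub> Run L (tgt f)))"
  then have xz: "x \<in> Arr P" "src x = U" "tgt x = X \<times>\<^sub>o One P" "z \<in> Arr P" "src z = U" "tgt z = Y"
    using O by (auto simp: in_hom_iff ty L_ob_structure)
  show "forces P U \<phi> ((f \<otimes>\<^sub>a\<^bsub>L\<^esub> Idn L (One P)) \<Zsemi>\<^bsub>L\<^esub> Run L (tgt f)) x z \<longleftrightarrow> forces P U \<phi> (Run L (src f) \<Zsemi>\<^bsub>L\<^esub> f) x z"
    using forces_seq_graph[OF _ inverse_cart_run, of "f \<otimes>\<^sub>a\<^bsub>L\<^esub> Idn L (One P)" Y x U z \<phi>]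
      forces_graph_seq[of f "cart_run P X" "X \<times>\<^sub>o One P" x U z \<phi>]
      forces_tens[of f "Idn L (One P)" X Y "One P" "One P" x U "z \<Zsemi> \<langle>Idn P Y, bang P Y\<rangle>" \<phi>]
      forces_Idn_One[of \<phi> U "x \<Zsemi> Pr2 P X (One P)" "z \<Zsemi> bang P Y"] ty O xz \<phi>
    by (simp add: in_hom_iff L_ob_structure cart_run_def)
qed (use assms L_Arr_Ob in \<open>simp_all add: L_ob_structure\<close>)

lemma L_Sym_natural:
  assumes "f \<in> Arr L" "g \<in> Arr L"
  shows "(f \<otimes>\<^sub>a\<^bsub>L\<^esub> g) \<Zsemi>\<^bsub>L\<^esub> Sym L (tgt f) (tgt g) = Sym L (src f) (src g) \<Zsemi>\<^bsub>L\<^esub> (g \<otimes>\<^sub>a\<^bsub>L\<^esub> f)"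
proof (rule L_eqI)
  define X Y X' Y' where o: "X = src f" "Y = src g" "X' = tgt f" "Y' = tgt g"
  have O: "X \<in> Ob P" "Y \<in> Ob P" "X' \<in> Ob P" "Y' \<in> Ob P" using assms L_Arr_Ob by (auto simp: o)
  note ty = assms o[symmetric]
  fix U \<phi> x z assume "x \<in> hom P U (src ((f \<otimes>\<^sub>a\<^bsub>L\<^esub> g) \<Zsemi>\<^bsub>L\<^esub> Sym L (tgt f) (tgt g)))"
     "z \<in> hom P U (tgt ((f \<otimes>\<^sub>a\<^bsub>L\<^esub> g) \<Zsemi>\<^bsub>L\<^esub> Sym L (tgt f) (tgt g)))"
  then have xz: "x \<in> Arr P" "src x = U" "tgt x = X \<times>\<^sub>o Y" "z \<in> Arr P" "src z = U" "tgt z = Y' \<times>\<^sub>o X'"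
    using O by (auto simp: in_hom_iff ty L_ob_structure)
  show "forces P U \<phi> ((f \<otimes>\<^sub>a\<^bsub>L\<^esub> g) \<Zsemi>\<^bsub>L\<^esub> Sym L (tgt f) (tgt g)) x z \<longleftrightarrow>
     forces P U \<phi> (Sym L (src f) (src g) \<Zsemi>\<^bsub>L\<^esub> (g \<otimes>\<^sub>a\<^bsub>L\<^esub> f)) x z"
    using forces_seq_graph[OF _ inverse_cart_sym, of "f \<otimes>\<^sub>a\<^bsub>L\<^esub> g" X' Y' x U z \<phi>]
      forces_graph_seq[of "g \<otimes>\<^sub>a\<^bsub>L\<^esub> f" "cart_sym P X Y" "X \<times>\<^sub>o Y" x U z \<phi>]
      forces_tens[of f g X X' Y Y' x U "z \<Zsemi> cart_sym P Y' X'" \<phi>]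
      forces_tens[of g f Y Y' X X' "x \<Zsemi> cart_sym P X Y" U z \<phi>] ty O xz
    by (auto simp add: in_hom_iff L_ob_structure cart_sym_def)
qed (use assms L_Arr_Ob in \<open>simp_all add: L_ob_structure\<close>)

lemma L_Leq_mono:
  assumes "f \<in> Arr L" "f' \<in> Arr L" "g \<in> Arr L" "g' \<in> Arr L" "f \<sqsubseteq>\<^bsub>L\<^esub> f'" "g \<sqsubseteq>\<^bsub>L\<^esub> g'"
  shows "tgt f = src g \<Longrightarrow> f \<Zsemi>\<^bsub>L\<^esub> g \<sqsubseteq>\<^bsub>L\<^esub> f' \<Zsemi>\<^bsub>L\<^esub> g'" "f \<otimes>\<^sub>a\<^bsub>L\<^esub> g \<sqsubseteq>\<^bsub>L\<^esub> f' \<otimes>\<^sub>a\<^bsub>L\<^esub> g'"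
proof -
  have s: "src f = src f'" "tgt f = tgt f'" "src g = src g'" "tgt g = tgt g'"
    using assms by (auto simp: L_ob_Leq)
  show "f \<Zsemi>\<^bsub>L\<^esub> g \<sqsubseteq>\<^bsub>L\<^esub> f' \<Zsemi>\<^bsub>L\<^esub> g'" if t: "tgt f = src g"
  proof (rule L_leI)
    fix U \<phi> x z assume *: "forces P U \<phi> (f \<Zsemi>\<^bsub>L\<^esub> g) x z"
    show "forces P U \<phi> (f' \<Zsemi>\<^bsub>L\<^esub> g') x z"
    proof (rule forces_seqE[OF _ _ _ *])
      fix V p y \<chi> assume "forces P V \<chi> f (p \<Zsemi> x) y" "forces P V \<chi> g y (p \<Zsemi> z)"
      then show "forces P V \<chi> (f' \<Zsemi>\<^bsub>L\<^esub> g') (p \<Zsemi> x) (p \<Zsemi> z)"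
        using assms s t forces_le[of f f' V \<chi> "p \<Zsemi> x" y] forces_le[of g g' V \<chi> y "p \<Zsemi> z"]
        by (intro forces_seqI[of f' g' V \<chi> "p \<Zsemi> x" y]) auto
    qed (use assms s t forcesD[OF *] in \<open>auto simp: in_hom_iff\<close>)
  qed (use assms s t in auto)
  show "f \<otimes>\<^sub>a\<^bsub>L\<^esub> g \<sqsubseteq>\<^bsub>L\<^esub> f' \<otimes>\<^sub>a\<^bsub>L\<^esub> g'"
  proof (rule L_leI)
    fix U \<phi> x z assume *: "forces P U \<phi> (f \<otimes>\<^sub>a\<^bsub>L\<^esub> g) x z"
    note t = forcesD[OF *]
    show "forces P U \<phi> (f' \<otimes>\<^sub>a\<^bsub>L\<^esub> g') x z"
      using * assms s t L_Arr_Ob forces_tens[of f g "src f" "tgt f" "src g" "tgt g" x U z \<phi>]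
        forces_tens[of f' g' "src f" "tgt f" "src g" "tgt g" x U z \<phi>]
        forces_le[of f f'] forces_le[of g g'] by (simp add: in_hom_iff)
  qed (use assms s in auto)
qed

text \<open>The pentagon, the triangle and the hexagon lie in the image of \<open>graph\<close>,
  which preserves composites and tensors. By the rules collected in \<open>str\<close> they become
  equations between tuples of projections in the base category.\<close>

lemma poset_enriched_L: "poset_enriched_smc L"
proof
  note str = L_ob_structure graph_Idn[symmetric] graph_tens graph_seq
  show "Unit L \<in> Ob L" by simp
  show "X \<otimes>\<^sub>o\<^bsub>L\<^esub> Y \<in> Ob L" if "X \<in> Ob L" "Y \<in> Ob L" for X Y using that by simp
  show "f \<otimes>\<^sub>a\<^bsub>L\<^esub> g \<in> hom L (X \<otimes>\<^sub>o\<^bsub>L\<^esub> Z) (Y \<otimes>\<^sub>o\<^bsub>L\<^esub> W)" if "f \<in> hom L X Y" "g \<in> hom L Z W" for f g X Y Z W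
    using that by (auto simp: in_hom_iff)
  show "Idn L X \<otimes>\<^sub>a\<^bsub>L\<^esub> Idn L Y = Idn L (X \<otimes>\<^sub>o\<^bsub>L\<^esub> Y)" if "X \<in> Ob L" "Y \<in> Ob L" for X Y
    using that by (simp add: str cart_defs)
  show "(f \<Zsemi>\<^bsub>L\<^esub> g) \<otimes>\<^sub>a\<^bsub>L\<^esub> (f' \<Zsemi>\<^bsub>L\<^esub> g') = (f \<otimes>\<^sub>a\<^bsub>L\<^esub> f') \<Zsemi>\<^bsub>L\<^esub> (g \<otimes>\<^sub>a\<^bsub>L\<^esub> g')"
    if "f \<in> hom L X Y" "g \<in> hom L Y Z" "f' \<in> hom L X' Y'" "g' \<in> hom L Y' Z'" for f g f' g' X Y Z X' Y' Z'
    using that by (intro tens_seq) (auto simp: in_hom_iff)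
  show "Assoc L X Y Z \<in> hom L ((X \<otimes>\<^sub>o\<^bsub>L\<^esub> Y) \<otimes>\<^sub>o\<^bsub>L\<^esub> Z) (X \<otimes>\<^sub>o\<^bsub>L\<^esub> Y \<otimes>\<^sub>o\<^bsub>L\<^esub> Z)"
    "is_iso L (Assoc L X Y Z)"
    if "X \<in> Ob L" "Y \<in> Ob L" "Z \<in> Ob L" for X Y Z
    using that L_structure_inverses(1)[of X Y Z] by (auto simp: is_iso_def in_hom_iff str)
  show "((f \<otimes>\<^sub>a\<^bsub>L\<^esub> g) \<otimes>\<^sub>a\<^bsub>L\<^esub> h) \<Zsemi>\<^bsub>L\<^esub> Assoc L X' Y' Z' = Assoc L X Y Z \<Zsemi>\<^bsub>L\<^esub> (f \<otimes>\<^sub>a\<^bsub>L\<^esub> (g \<otimes>\<^sub>a\<^bsub>L\<^esub> h))"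
    if "f \<in> hom L X X'" "g \<in> hom L Y Y'" "h \<in> hom L Z Z'" for f g h X X' Y Y' Z Z'
    using that L_Assoc_natural[of f g h] by (auto simp: in_hom_iff)
  show "Lun L X \<in> hom L (Unit L \<otimes>\<^sub>o\<^bsub>L\<^esub> X) X" "is_iso L (Lun L X)"
    "Run L X \<in> hom L (X \<otimes>\<^sub>o\<^bsub>L\<^esub> Unit L) X" "is_iso L (Run L X)" if "X \<in> Ob L" for X
    using that L_structure_inverses(2,3)[of X] by (auto simp: is_iso_def in_hom_iff str)
  show "(Idn L (Unit L) \<otimes>\<^sub>a\<^bsub>L\<^esub> f) \<Zsemi>\<^bsub>L\<^esub> Lun L Y = Lun L X \<Zsemi>\<^bsub>L\<^esub> f"
    "(f \<otimes>\<^sub>a\<^bsub>L\<^esub> Idn L (Unit L)) \<Zsemi>\<^bsub>L\<^esub> Run L Y = Run L X \<Zsemi>\<^bsub>L\<^esub> f" if "f \<in> hom L X Y" for f X Y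
    using that L_Lun_natural[of f] L_Run_natural[of f] by (auto simp: in_hom_iff)
  show "Sym L X Y \<in> hom L (X \<otimes>\<^sub>o\<^bsub>L\<^esub> Y) (Y \<otimes>\<^sub>o\<^bsub>L\<^esub> X)" "Sym L X Y \<Zsemi>\<^bsub>L\<^esub> Sym L Y X = Idn L (X \<otimes>\<^sub>o\<^bsub>L\<^esub> Y)"
    if "X \<in> Ob L" "Y \<in> Ob L" for X Y
    using that by (simp_all add: in_hom_iff str cart_defs)
  show "(f \<otimes>\<^sub>a\<^bsub>L\<^esub> g) \<Zsemi>\<^bsub>L\<^esub> Sym L X' Y' = Sym L X Y \<Zsemi>\<^bsub>L\<^esub> (g \<otimes>\<^sub>a\<^bsub>L\<^esub> f)"
    if "f \<in> hom L X X'" "g \<in> hom L Y Y'" for f g X X' Y Y'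
    using that L_Sym_natural[of f g] by (auto simp: in_hom_iff)
  show "(Assoc L W X Y \<otimes>\<^sub>a\<^bsub>L\<^esub> Idn L Z) \<Zsemi>\<^bsub>L\<^esub> Assoc L W (X \<otimes>\<^sub>o\<^bsub>L\<^esub> Y) Z \<Zsemi>\<^bsub>L\<^esub> (Idn L W \<otimes>\<^sub>a\<^bsub>L\<^esub> Assoc L X Y Z)
          = Assoc L (W \<otimes>\<^sub>o\<^bsub>L\<^esub> X) Y Z \<Zsemi>\<^bsub>L\<^esub> Assoc L W X (Y \<otimes>\<^sub>o\<^bsub>L\<^esub> Z)"
    if "W \<in> Ob L" "X \<in> Ob L" "Y \<in> Ob L" "Z \<in> Ob L" for W X Y Z
    using that by (simp add: str cart_defs)
  show "Assoc L X (Unit L) Y \<Zsemi>\<^bsub>L\<^esub> (Idn L X \<otimes>\<^sub>a\<^bsub>L\<^esub> Lun L Y) = Run L X \<otimes>\<^sub>a\<^bsub>L\<^esub> Idn L Y"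
    if "X \<in> Ob L" "Y \<in> Ob L" for X Y
    using that by (simp add: str cart_defs)
  show "Assoc L X Y Z \<Zsemi>\<^bsub>L\<^esub> Sym L X (Y \<otimes>\<^sub>o\<^bsub>L\<^esub> Z) \<Zsemi>\<^bsub>L\<^esub> Assoc L Y Z X
          = (Sym L X Y \<otimes>\<^sub>a\<^bsub>L\<^esub> Idn L Z) \<Zsemi>\<^bsub>L\<^esub> Assoc L Y X Z \<Zsemi>\<^bsub>L\<^esub> (Idn L Y \<otimes>\<^sub>a\<^bsub>L\<^esub> Sym L X Z)"
    if "X \<in> Ob L" "Y \<in> Ob L" "Z \<in> Ob L" for X Y Z
    using that by (simp add: str cart_defs)
  show "f \<sqsubseteq>\<^bsub>L\<^esub> f" if "f \<in> hom L X Y" for f X Y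
    using that by (auto simp: in_hom_iff L_ob_Leq L_ob_Arr)
  show "f \<sqsubseteq>\<^bsub>L\<^esub> h" if "f \<in> hom L X Y" "g \<in> hom L X Y" "h \<in> hom L X Y" "f \<sqsubseteq>\<^bsub>L\<^esub> g" "g \<sqsubseteq>\<^bsub>L\<^esub> h" for f g h X Y
    using that le_trans[of "X \<times>\<^sub>o Y" "lab f" "lab g" "lab h"] by (auto simp: in_hom_iff L_ob_Leq L_ob_Arr)
  show "f = g" if "f \<in> hom L X Y" "g \<in> hom L X Y" "f \<sqsubseteq>\<^bsub>L\<^esub> g" "g \<sqsubseteq>\<^bsub>L\<^esub> f" for f g X Y
    using that L_le_antisym[of f g] by (simp add: in_hom_iff)
  show "f \<Zsemi>\<^bsub>L\<^esub> g \<sqsubseteq>\<^bsub>L\<^esub> f' \<Zsemi>\<^bsub>L\<^esub> g'"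
    if "f \<in> hom L X Y" "f' \<in> hom L X Y" "g \<in> hom L Y Z" "g' \<in> hom L Y Z" "f \<sqsubseteq>\<^bsub>L\<^esub> f'" "g \<sqsubseteq>\<^bsub>L\<^esub> g'"
    for f f' g g' X Y Z
    using that by (intro L_Leq_mono) (auto simp: in_hom_iff)
  show "f \<otimes>\<^sub>a\<^bsub>L\<^esub> g \<sqsubseteq>\<^bsub>L\<^esub> f' \<otimes>\<^sub>a\<^bsub>L\<^esub> g'"
    if "f \<in> hom L X Y" "f' \<in> hom L X Y" "g \<in> hom L Z W" "g' \<in> hom L Z W" "f \<sqsubseteq>\<^bsub>L\<^esub> f'" "g \<sqsubseteq>\<^bsub>L\<^esub> g'"
    for f f' g g' X Y Z W
    using that by (intro L_Leq_mono) (auto simp: in_hom_iff)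
qed

section \<open>Comonoids and the Frobenius law in L(P)\<close>

lemma radj_graph: "f \<in> Arr P \<Longrightarrow> radj L (graph P f) = cograph P f"
  using poset_enriched_smc.radj_eq[OF poset_enriched_L _ right_adjoint_graph] by simp

text \<open>The one witness is equal to both components of \<open>w\<close>, so each of them can be
  substituted for it.\<close>

lemma L_lax_Dup:
  assumes "r \<in> Arr L"
  shows "r \<Zsemi>\<^bsub>L\<^esub> graph P (diag P (tgt r)) \<sqsubseteq>\<^bsub>L\<^esub> graph P (diag P (src r)) \<Zsemi>\<^bsub>L\<^esub> (r \<otimes>\<^sub>a\<^bsub>L\<^esub> r)"
proof (rule L_leI)
  define X Y where o: "X = src r" "Y = tgt r"
  have O: "X \<in> Ob P" "Y \<in> Ob P" using assms L_Arr_Ob by (auto simp: o)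
  note ty = assms o[symmetric]
  fix U \<phi> x w assume *: "forces P U \<phi> (r \<Zsemi>\<^bsub>L\<^esub> graph P (diag P (tgt r))) x w"
  note t = forcesD[OF *]
  have t': "tgt x = X" "tgt w = Y \<times>\<^sub>o Y" using t O by (simp_all add: ty)
  have goal: "forces P U \<phi> (graph P (diag P (src r)) \<Zsemi>\<^bsub>L\<^esub> (r \<otimes>\<^sub>a\<^bsub>L\<^esub> r)) x w \<longleftrightarrow>
    forces P U \<phi> r x (w \<Zsemi> Pr1 P Y Y) \<and> forces P U \<phi> r x (w \<Zsemi> Pr2 P Y Y)"
    using forces_graph_seq[of "r \<otimes>\<^sub>a\<^bsub>L\<^esub> r" "diag P X" X x U w \<phi>]
      forces_tens[of r r X Y X Y "x \<Zsemi> diag P X" U w \<phi>] ty O t t' by (simp add: in_hom_iff diag_def)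
  have step: "forces P V \<chi> r (p \<Zsemi> x) (p \<Zsemi> w \<Zsemi> Pr1 P Y Y) \<and> forces P V \<chi> r (p \<Zsemi> x) (p \<Zsemi> w \<Zsemi> Pr2 P Y Y)"
    if p: "p \<in> hom P V U" and y: "y \<in> hom P V Y" and r: "forces P V \<chi> r (p \<Zsemi> x) y"
      and g: "forces P V \<chi> (graph P (diag P Y)) y (p \<Zsemi> w)" for V p y \<chi>
  proof -
    have "forces P V \<chi> (Idn L (Y \<times>\<^sub>o Y)) (y \<Zsemi> diag P Y) (p \<Zsemi> w)"
      using forces_graph[of "diag P Y" Y "Y \<times>\<^sub>o Y" y V "p \<Zsemi> w" \<chi>] g p y t t' O by (simp add: in_hom_iff)
    then have "forces P V \<chi> (Idn L Y) y (p \<Zsemi> w \<Zsemi> Pr1 P Y Y)" "forces P V \<chi> (Idn L Y) y (p \<Zsemi> w \<Zsemi> Pr2 P Y Y)"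
      using forces_Idn_Prod[of Y Y "y \<Zsemi> diag P Y" V "p \<Zsemi> w" \<chi>] p y t t' O by (auto simp: in_hom_iff diag_def)
    then show ?thesis using forces_subst_right[OF assms _ r] by blast
  qed
  have "forces P U \<phi> r x (w \<Zsemi> Pr1 P Y Y)"
    by (rule forces_seqE[OF _ _ _ *]) (use step t t' ty O in \<open>auto simp: in_hom_iff\<close>)
  moreover have "forces P U \<phi> r x (w \<Zsemi> Pr2 P Y Y)"
    by (rule forces_seqE[OF _ _ _ *]) (use step t t' ty O in \<open>auto simp: in_hom_iff\<close>)
  ultimately show "forces P U \<phi> (graph P (diag P (src r)) \<Zsemi>\<^bsub>L\<^esub> (r \<otimes>\<^sub>a\<^bsub>L\<^esub> r)) x w" using goal by simp
qed (use assms L_Arr_Ob in \<open>simp_all\<close>)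

text \<open>Any two elements of the terminal object are forced to be equal, so this graph imposes no
  condition. It gives lax naturality of \<open>Del\<close>.\<close>

lemma le_graph_bang:
  assumes "s \<in> Arr L" "src s = X" "tgt s = One P"
  shows "s \<sqsubseteq>\<^bsub>L\<^esub> graph P (bang P X)"
proof (rule L_leI)
  have X: "X \<in> Ob P" using assms L_Arr_Ob by auto
  show "graph P (bang P X) \<in> Arr L" "src s = src (graph P (bang P X))" "tgt s = tgt (graph P (bang P X))"
    using assms X by simp_all
  fix U \<phi> x y assume "\<phi> \<in> Fib P U" "x \<in> hom P U (src s)" "y \<in> hom P U (tgt s)"
  then show "forces P U \<phi> (graph P (bang P X)) x y"
    using forces_graph[of "bang P X" X "One P" x U y \<phi>] forces_Idn_One[of \<phi> U "x \<Zsemi> bang P X" y] assms X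
    by (simp add: in_hom_iff)
qed (use assms in simp_all)

text \<open>Puts the last factor on the left of the Frobenius law into the form to which the rule
  for cographs applies.\<close>

lemma tens_cograph:
  assumes "f \<in> Arr P" "X \<in> Ob P"
  shows "Idn L X \<otimes>\<^sub>a\<^bsub>L\<^esub> cograph P f = cograph P (Idn P X \<times>\<^sub>a f)"
proof (rule L_eqI)
  have O: "src f \<in> Ob P" "tgt f \<in> Ob P" using assms by auto
  fix U \<phi> x y assume "x \<in> hom P U (src (Idn L X \<otimes>\<^sub>a\<^bsub>L\<^esub> cograph P f))" "y \<in> hom P U (tgt (Idn L X \<otimes>\<^sub>a\<^bsub>L\<^esub> cograph P f))"
  then have xy: "x \<in> Arr P" "src x = U" "tgt x = X \<times>\<^sub>o tgt f" "y \<in> Arr P" "src y = U" "tgt y = X \<times>\<^sub>o src f"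
    by (auto simp: in_hom_iff)
  show "forces P U \<phi> (Idn L X \<otimes>\<^sub>a\<^bsub>L\<^esub> cograph P f) x y \<longleftrightarrow> forces P U \<phi> (cograph P (Idn P X \<times>\<^sub>a f)) x y"
    using forces_tens[of "Idn L X" "cograph P f" X X "tgt f" "src f" x U y \<phi>]
      forces_cograph[of f "src f" "tgt f" "y \<Zsemi> Pr2 P X (src f)" U "x \<Zsemi> Pr2 P X (tgt f)" \<phi>]
      forces_cograph[of "Idn P X \<times>\<^sub>a f" "X \<times>\<^sub>o src f" "X \<times>\<^sub>o tgt f" y U x \<phi>]
      forces_Idn_Prod[of X "tgt f" x U "y \<Zsemi> (Idn P X \<times>\<^sub>a f)" \<phi>] xy O assms
    by (simp add: in_hom_iff prod_arr_def)
qed (use assms in simp_all)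

text \<open>Both sides say that four elements of \<open>X\<close>, the components of
  \<open>x\<close> and those of \<open>w\<close>, are all equal: the left side by a chain of three
  equations, the right side through a common witness.\<close>

lemma L_Frobenius:
  assumes X: "X \<in> Ob P"
  shows "(graph P (diag P X) \<otimes>\<^sub>a\<^bsub>L\<^esub> Idn L X) \<Zsemi>\<^bsub>L\<^esub> Assoc L X X X \<Zsemi>\<^bsub>L\<^esub> (Idn L X \<otimes>\<^sub>a\<^bsub>L\<^esub> cograph P (diag P X))
         = cograph P (diag P X) \<Zsemi>\<^bsub>L\<^esub> graph P (diag P X)"
proof -
  let ?\<Delta> = "diag P X"
  let ?f = "(?\<Delta> \<times>\<^sub>a Idn P X) \<Zsemi> cart_assoc P X X X" and ?g = "Idn P X \<times>\<^sub>a ?\<Delta>"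
  let ?XX = "X \<times>\<^sub>o X" and ?p = "Pr1 P X X" and ?q = "Pr2 P X X"
  have f: "?f = \<langle>?p, \<langle>?p, ?q\<rangle>\<rangle>" and g: "?g = \<langle>?p, \<langle>?q, ?q\<rangle>\<rangle>"
    using X by (simp_all add: cart_defs)
  have "(graph P ?\<Delta> \<otimes>\<^sub>a\<^bsub>L\<^esub> Idn L X) \<Zsemi>\<^bsub>L\<^esub> Assoc L X X X \<Zsemi>\<^bsub>L\<^esub> (Idn L X \<otimes>\<^sub>a\<^bsub>L\<^esub> cograph P ?\<Delta>)
     = ((graph P ?\<Delta> \<otimes>\<^sub>a\<^bsub>L\<^esub> graph P (Idn P X)) \<Zsemi>\<^bsub>L\<^esub> Assoc L X X X) \<Zsemi>\<^bsub>L\<^esub> (Idn L X \<otimes>\<^sub>a\<^bsub>L\<^esub> cograph P ?\<Delta>)"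
    using X by (simp add: graph_Idn L_ob_structure)
  also have "\<dots> = graph P ?f \<Zsemi>\<^bsub>L\<^esub> cograph P ?g"
    using X by (simp add: L_ob_structure graph_tens graph_seq tens_cograph)
  also have "\<dots> = cograph P ?\<Delta> \<Zsemi>\<^bsub>L\<^esub> graph P ?\<Delta>"
  proof (rule L_eqI)
    fix U \<phi> x w assume \<phi>: "\<phi> \<in> Fib P U" and "x \<in> hom P U (src (graph P ?f \<Zsemi>\<^bsub>L\<^esub> cograph P ?g))" "w \<in> hom P U (tgt (graph P ?f \<Zsemi>\<^bsub>L\<^esub> cograph P ?g))"
    then have xw: "x \<in> Arr P" "src x = U" "tgt x = ?XX" "w \<in> Arr P" "src w = U" "tgt w = ?XX"
      using X by (auto simp: in_hom_iff)
    have "forces P U \<phi> (graph P ?f \<Zsemi>\<^bsub>L\<^esub> cograph P ?g) x w \<longleftrightarrow> forces P U \<phi> (Idn L (X \<times>\<^sub>o ?XX)) (x \<Zsemi> ?f) (w \<Zsemi> ?g)"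
      using forces_graph_seq[of "cograph P ?g" ?f ?XX x U w \<phi>] forces_cograph[of ?g ?XX "X \<times>\<^sub>o ?XX" w U "x \<Zsemi> ?f" \<phi>] X xw
      by (simp add: in_hom_iff)
    also have "\<dots> \<longleftrightarrow> forces P U \<phi> (Idn L X) (x \<Zsemi> ?p) (w \<Zsemi> ?p) \<and> forces P U \<phi> (Idn L X) (x \<Zsemi> ?p) (w \<Zsemi> ?q) \<and>
        forces P U \<phi> (Idn L X) (x \<Zsemi> ?q) (w \<Zsemi> ?q)"
      unfolding f g using X xw
        forces_Idn_Prod[of X ?XX "x \<Zsemi> \<langle>?p, \<langle>?p, ?q\<rangle>\<rangle>" U "w \<Zsemi> \<langle>?p, \<langle>?q, ?q\<rangle>\<rangle>" \<phi>]
        forces_Idn_Prod[of X X x U "w \<Zsemi> \<langle>?q, ?q\<rangle>" \<phi>]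
      by (simp add: in_hom_iff)
    finally have lhs: "forces P U \<phi> (graph P ?f \<Zsemi>\<^bsub>L\<^esub> cograph P ?g) x w \<longleftrightarrow>
       forces P U \<phi> (Idn L X) (x \<Zsemi> ?p) (w \<Zsemi> ?p) \<and> forces P U \<phi> (Idn L X) (x \<Zsemi> ?p) (w \<Zsemi> ?q) \<and>
        forces P U \<phi> (Idn L X) (x \<Zsemi> ?q) (w \<Zsemi> ?q)" .
    have mid: "forces P V \<chi> (cograph P ?\<Delta>) (p \<Zsemi> x) y \<and> forces P V \<chi> (graph P ?\<Delta>) y (p \<Zsemi> w) \<longleftrightarrow>
        (forces P V \<chi> (Idn L X) (p \<Zsemi> x \<Zsemi> ?p) y \<and> forces P V \<chi> (Idn L X) (p \<Zsemi> x \<Zsemi> ?q) y) \<and>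
        forces P V \<chi> (Idn L X) y (p \<Zsemi> w \<Zsemi> ?p) \<and> forces P V \<chi> (Idn L X) y (p \<Zsemi> w \<Zsemi> ?q)"
      if "p \<in> hom P V U" "y \<in> hom P V X" for V \<chi> p y
      using that X xw forces_cograph[of ?\<Delta> X ?XX y V "p \<Zsemi> x" \<chi>] forces_graph[of ?\<Delta> X ?XX y V "p \<Zsemi> w" \<chi>]
        forces_Idn_Prod[of X X "p \<Zsemi> x" V "y \<Zsemi> ?\<Delta>" \<chi>] forces_Idn_Prod[of X X "y \<Zsemi> ?\<Delta>" V "p \<Zsemi> w" \<chi>]
      by (simp add: in_hom_iff diag_def)
    show "forces P U \<phi> (graph P ?f \<Zsemi>\<^bsub>L\<^esub> cograph P ?g) x w \<longleftrightarrow> forces P U \<phi> (cograph P ?\<Delta> \<Zsemi>\<^bsub>L\<^esub> graph P ?\<Delta>) x w"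
    proof
      assume "forces P U \<phi> (graph P ?f \<Zsemi>\<^bsub>L\<^esub> cograph P ?g) x w"
      then have 1: "forces P U \<phi> (Idn L X) (x \<Zsemi> ?p) (w \<Zsemi> ?p)" "forces P U \<phi> (Idn L X) (x \<Zsemi> ?p) (w \<Zsemi> ?q)"
        "forces P U \<phi> (Idn L X) (x \<Zsemi> ?q) (w \<Zsemi> ?q)" using lhs by auto
      have U: "U \<in> Ob P" using xw(1,2) src_Ob by blast
      \<comment> \<open>The common witness is the first component of \<open>x\<close>.\<close>
      have "forces P U \<phi> (Idn L X) (x \<Zsemi> ?p) (x \<Zsemi> ?p)" using forces_refl[of \<phi> U "x \<Zsemi> ?p" X] \<phi> xw X by (simp add: in_hom_iff)
      moreover have "forces P U \<phi> (Idn L X) (x \<Zsemi> ?q) (x \<Zsemi> ?p)" using forces_trans forces_sym 1 by blast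
      ultimately have "forces P U \<phi> (cograph P ?\<Delta>) x (x \<Zsemi> ?p) \<and> forces P U \<phi> (graph P ?\<Delta>) (x \<Zsemi> ?p) w"
        using mid[of "Idn P U" U "x \<Zsemi> ?p" \<phi>] 1 xw X U by (simp add: in_hom_iff)
      then show "forces P U \<phi> (cograph P ?\<Delta> \<Zsemi>\<^bsub>L\<^esub> graph P ?\<Delta>) x w"
        using forces_seqI[of "cograph P ?\<Delta>" "graph P ?\<Delta>"] X by auto
    next
      assume *: "forces P U \<phi> (cograph P ?\<Delta> \<Zsemi>\<^bsub>L\<^esub> graph P ?\<Delta>) x w"
      have st: "forces P V \<chi> (Idn L X) (p \<Zsemi> x \<Zsemi> ?p) (p \<Zsemi> w \<Zsemi> ?p) \<and> forces P V \<chi> (Idn L X) (p \<Zsemi> x \<Zsemi> ?p) (p \<Zsemi> w \<Zsemi> ?q) \<and>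
         forces P V \<chi> (Idn L X) (p \<Zsemi> x \<Zsemi> ?q) (p \<Zsemi> w \<Zsemi> ?q)"
        if "p \<in> hom P V U" "y \<in> hom P V X" "forces P V \<chi> (cograph P ?\<Delta>) (p \<Zsemi> x) y" "forces P V \<chi> (graph P ?\<Delta>) y (p \<Zsemi> w)"
        for V \<chi> p y
        using mid[OF that(1,2)] that(3,4) forces_trans by blast
      have "forces P U \<phi> (Idn L X) (x \<Zsemi> ?p) (w \<Zsemi> ?p)"
        by (rule forces_seqE[OF _ _ _ *]) (use st xw X in \<open>auto simp: in_hom_iff\<close>)
      moreover have "forces P U \<phi> (Idn L X) (x \<Zsemi> ?p) (w \<Zsemi> ?q)"
        by (rule forces_seqE[OF _ _ _ *]) (use st xw X in \<open>auto simp: in_hom_iff\<close>)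
      moreover have "forces P U \<phi> (Idn L X) (x \<Zsemi> ?q) (w \<Zsemi> ?q)"
        by (rule forces_seqE[OF _ _ _ *]) (use st xw X in \<open>auto simp: in_hom_iff\<close>)
      ultimately show "forces P U \<phi> (graph P ?f \<Zsemi>\<^bsub>L\<^esub> cograph P ?g) x w" using lhs by simp
    qed
  qed (use X in simp_all)
  finally show ?thesis .
qed

text \<open>With the inverse associators known explicitly, \<open>mid_swap\<close> is the graph of
  the exchange of the two middle components, and the comonoid and coherence laws are equations of
  tuples. Forcing enters through the adjoints, the Frobenius law and the lax laws.\<close>

theorem cartesian_bicategory_L: "cartesian_bicategory L"
proof -
  interpret L: poset_enriched_smc L by (rule poset_enriched_L)
  note str = L_ob_structure graph_Idn[symmetric] graph_tens graph_seq
  have inv_Assoc: "inv_arrow L (graph P (cart_assoc P X Y Z)) = graph P (cart_assoc_inv P X Y Z)"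
    if "X \<in> Ob P" "Y \<in> Ob P" "Z \<in> Ob P" for X Y Z
    using L.inv_arrow_eq[OF L_structure_inverses(1)] that by (simp add: L_ob_structure)
  have mid: "mid_swap L X Y = graph P \<langle>\<langle>quad1 P X X Y Y, quad3 P X X Y Y\<rangle>, \<langle>quad2 P X X Y Y, quad4 P X X Y Y\<rangle>\<rangle>"
    if "X \<in> Ob P" "Y \<in> Ob P" for X Y
    using that by (simp add: mid_swap_def inv_Assoc str) (simp add: cart_defs cart_assoc_inv_def)
  show ?thesis
  proof
    show "Dup L X \<in> hom L X (X \<otimes>\<^sub>o\<^bsub>L\<^esub> X)" "Del L X \<in> hom L X (Unit L)" if "X \<in> Ob L" for X
      using that by (simp_all add: in_hom_iff str)
    show "Dup L X \<Zsemi>\<^bsub>L\<^esub> (Dup L X \<otimes>\<^sub>a\<^bsub>L\<^esub> Idn L X) \<Zsemi>\<^bsub>L\<^esub> Assoc L X X X = Dup L X \<Zsemi>\<^bsub>L\<^esub> (Idn L X \<otimes>\<^sub>a\<^bsub>L\<^esub> Dup L X)"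
      "Dup L X \<Zsemi>\<^bsub>L\<^esub> (Idn L X \<otimes>\<^sub>a\<^bsub>L\<^esub> Del L X) \<Zsemi>\<^bsub>L\<^esub> Run L X = Idn L X"
      "Dup L X \<Zsemi>\<^bsub>L\<^esub> (Del L X \<otimes>\<^sub>a\<^bsub>L\<^esub> Idn L X) \<Zsemi>\<^bsub>L\<^esub> Lun L X = Idn L X"
      "Dup L X \<Zsemi>\<^bsub>L\<^esub> Sym L X X = Dup L X" if "X \<in> Ob L" for X
      using that by (simp_all add: str cart_defs)
    show "\<exists>g. is_right_adjoint L (Dup L X) g" "\<exists>g. is_right_adjoint L (Del L X) g" if "X \<in> Ob L" for X
      using right_adjoint_graph[of "diag P X"] right_adjoint_graph[of "bang P X"] that
      by (auto simp: L_ob_structure)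
    show "(Dup L X \<otimes>\<^sub>a\<^bsub>L\<^esub> Idn L X) \<Zsemi>\<^bsub>L\<^esub> Assoc L X X X \<Zsemi>\<^bsub>L\<^esub> (Idn L X \<otimes>\<^sub>a\<^bsub>L\<^esub> radj L (Dup L X))
          = radj L (Dup L X) \<Zsemi>\<^bsub>L\<^esub> Dup L X" if "X \<in> Ob L" for X
      using L_Frobenius[of X] that by (simp add: L_ob_structure radj_graph)
    show "r \<Zsemi>\<^bsub>L\<^esub> Dup L Y \<sqsubseteq>\<^bsub>L\<^esub> Dup L X \<Zsemi>\<^bsub>L\<^esub> (r \<otimes>\<^sub>a\<^bsub>L\<^esub> r)" if "r \<in> hom L X Y" for r X Y
      using L_lax_Dup[of r] that by (auto simp: L_ob_structure in_hom_iff)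
    show "r \<Zsemi>\<^bsub>L\<^esub> Del L Y \<sqsubseteq>\<^bsub>L\<^esub> Del L X" if "r \<in> hom L X Y" for r X Y
      using le_graph_bang[of "r \<Zsemi>\<^bsub>L\<^esub> Del L Y" X] L_Arr_Ob[of r] that by (auto simp: L_ob_structure in_hom_iff)
    show "Dup L (X \<otimes>\<^sub>o\<^bsub>L\<^esub> Y) = (Dup L X \<otimes>\<^sub>a\<^bsub>L\<^esub> Dup L Y) \<Zsemi>\<^bsub>L\<^esub> mid_swap L X Y" if "X \<in> Ob L" "Y \<in> Ob L" for X Y
      using that by (simp add: mid str cart_defs)
    show "Del L (X \<otimes>\<^sub>o\<^bsub>L\<^esub> Y) = (Del L X \<otimes>\<^sub>a\<^bsub>L\<^esub> Del L Y) \<Zsemi>\<^bsub>L\<^esub> Lun L (Unit L)" if "X \<in> Ob L" "Y \<in> Ob L" for X Y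
    proof -
      have "bang P (X \<times>\<^sub>o Y) = Pr2 P X Y \<Zsemi> bang P Y" by (rule One_eqI) (use that in auto)
      then show ?thesis using that by (simp add: str cart_defs)
    qed
    show "Del L (Unit L) = Idn L (Unit L)"
      using One_eqI[of "bang P (One P)" "Idn P (One P)"] by (simp add: str)
    have "diag P (One P) = \<langle>bang P (One P), Idn P (One P)\<rangle>"
      using One_eqI[of "bang P (One P)" "Idn P (One P)"] by (simp add: diag_def)
    then show "Dup L (Unit L) = inv_arrow L (Lun L (Unit L))"
      using L.inv_arrow_eq[OF L_structure_inverses(3)[of "One P"]] by (simp add: L_ob_structure)
  qed
qed

end

section \<open>Calculus in a cartesian bicategory\<close>

context symmetric_monoidal_category
begin

lemmas Unit_Ob' [simp] = Unit_Ob and TensOb_Ob' [simp] = TensOb_Ob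

lemma TensArr_simps [simp]:
  assumes "f \<in> Arr B" "g \<in> Arr B"
  shows "f \<otimes>\<^sub>a g \<in> Arr B" "src (f \<otimes>\<^sub>a g) = src f \<otimes>\<^sub>o src g" "tgt (f \<otimes>\<^sub>a g) = tgt f \<otimes>\<^sub>o tgt g"
  using TensArr_hom[of f "src f" "tgt f" g "src g" "tgt g"] assms by (auto simp: in_hom_iff)

lemma TensArr_Idn' [simp]: "X \<in> Ob B \<Longrightarrow> Y \<in> Ob B \<Longrightarrow> Idn B X \<otimes>\<^sub>a Idn B Y = Idn B (X \<otimes>\<^sub>o Y)"
  by (rule TensArr_Idn)

lemma interchange [simp]:
  assumes "f \<in> Arr B" "g \<in> Arr B" "tgt f = src g" "f' \<in> Arr B" "g' \<in> Arr B" "tgt f' = src g'"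
  shows "(f \<otimes>\<^sub>a f') \<Zsemi> (g \<otimes>\<^sub>a g') = (f \<Zsemi> g) \<otimes>\<^sub>a (f' \<Zsemi> g')"
  using TensArr_Seq[of f "src f" "src g" g "tgt g" f' "src f'" "src g'" g' "tgt g'"] assms
  by (simp add: in_hom_iff)

lemma interchange_assoc [simp]:
  assumes "f \<in> Arr B" "g \<in> Arr B" "tgt f = src g" "f' \<in> Arr B" "g' \<in> Arr B" "tgt f' = src g'"
    "h \<in> Arr B" "src h = tgt g \<otimes>\<^sub>o tgt g'"
  shows "(f \<otimes>\<^sub>a f') \<Zsemi> ((g \<otimes>\<^sub>a g') \<Zsemi> h) = ((f \<Zsemi> g) \<otimes>\<^sub>a (f' \<Zsemi> g')) \<Zsemi> h"
  using assms by (simp add: Seq_assoc'[symmetric] del: Seq_assoc')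

lemma Assoc_simps [simp]:
  assumes "X \<in> Ob B" "Y \<in> Ob B" "Z \<in> Ob B"
  shows "Assoc B X Y Z \<in> Arr B" "src (Assoc B X Y Z) = (X \<otimes>\<^sub>o Y) \<otimes>\<^sub>o Z" "tgt (Assoc B X Y Z) = X \<otimes>\<^sub>o (Y \<otimes>\<^sub>o Z)"
    "is_iso B (Assoc B X Y Z)"
  using Assoc_hom[OF assms] Assoc_iso[OF assms] by (auto simp: in_hom_iff)

lemma Lun_simps [simp]:
  assumes "X \<in> Ob B"
  shows "Lun B X \<in> Arr B" "src (Lun B X) = Unit B \<otimes>\<^sub>o X" "tgt (Lun B X) = X" "is_iso B (Lun B X)"
  using Lun_hom[OF assms] Lun_iso[OF assms] by (auto simp: in_hom_iff)

lemma Run_simps [simp]: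
  assumes "X \<in> Ob B"
  shows "Run B X \<in> Arr B" "src (Run B X) = X \<otimes>\<^sub>o Unit B" "tgt (Run B X) = X" "is_iso B (Run B X)"
  using Run_hom[OF assms] Run_iso[OF assms] by (auto simp: in_hom_iff)

lemma Sym_simps [simp]:
  assumes "X \<in> Ob B" "Y \<in> Ob B"
  shows "Sym B X Y \<in> Arr B" "src (Sym B X Y) = X \<otimes>\<^sub>o Y" "tgt (Sym B X Y) = Y \<otimes>\<^sub>o X"
  using Sym_hom[OF assms] by (auto simp: in_hom_iff)

lemma Assoc_nat:
  assumes "f \<in> Arr B" "g \<in> Arr B" "h \<in> Arr B"
  shows "((f \<otimes>\<^sub>a g) \<otimes>\<^sub>a h) \<Zsemi> Assoc B (tgt f) (tgt g) (tgt h) = Assoc B (src f) (src g) (src h) \<Zsemi> (f \<otimes>\<^sub>a (g \<otimes>\<^sub>a h))"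
  by (rule Assoc_natural) (use assms in \<open>auto simp: in_hom_iff\<close>)

lemma inv_Assoc_nat:
  assumes "f \<in> Arr B" "g \<in> Arr B" "h \<in> Arr B"
  shows "(f \<otimes>\<^sub>a (g \<otimes>\<^sub>a h)) \<Zsemi> inv_arrow B (Assoc B (tgt f) (tgt g) (tgt h)) =
         inv_arrow B (Assoc B (src f) (src g) (src h)) \<Zsemi> ((f \<otimes>\<^sub>a g) \<otimes>\<^sub>a h)"
  by (rule iso_cancel_right[of "Assoc B (tgt f) (tgt g) (tgt h)"]) (use assms Assoc_nat[OF assms] in simp_all)

lemma Lun_nat: "f \<in> Arr B \<Longrightarrow> (Idn B (Unit B) \<otimes>\<^sub>a f) \<Zsemi> Lun B (tgt f) = Lun B (src f) \<Zsemi> f"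
  by (rule Lun_natural) (auto simp: in_hom_iff)

lemma Run_nat: "f \<in> Arr B \<Longrightarrow> (f \<otimes>\<^sub>a Idn B (Unit B)) \<Zsemi> Run B (tgt f) = Run B (src f) \<Zsemi> f"
  by (rule Run_natural) (auto simp: in_hom_iff)

lemma Sym_nat: "f \<in> Arr B \<Longrightarrow> g \<in> Arr B \<Longrightarrow>
    (f \<otimes>\<^sub>a g) \<Zsemi> Sym B (tgt f) (tgt g) = Sym B (src f) (src g) \<Zsemi> (g \<otimes>\<^sub>a f)"
  by (rule Sym_natural) (auto simp: in_hom_iff)

text \<open>When \<open>g\<close> ends in the unit object, its tensor partner \<open>f\<close> can
  be postponed until after the unitor. In this way a meet of predicates becomes a restriction
  followed by a predicate.\<close>

lemma Run_slide:
  assumes "f \<in> Arr B" "g \<in> Arr B" "tgt g = Unit B"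
  shows "(f \<otimes>\<^sub>a g) \<Zsemi> Run B (tgt f) = (Idn B (src f) \<otimes>\<^sub>a g) \<Zsemi> (Run B (src f) \<Zsemi> f)"
proof -
  have "(f \<otimes>\<^sub>a g) \<Zsemi> Run B (tgt f) = (Idn B (src f) \<otimes>\<^sub>a g) \<Zsemi> ((f \<otimes>\<^sub>a Idn B (Unit B)) \<Zsemi> Run B (tgt f))"
    using assms by simp
  then show ?thesis using assms by (simp only: Run_nat)
qed

lemma Lun_slide:
  assumes "f \<in> Arr B" "g \<in> Arr B" "tgt g = Unit B"
  shows "(g \<otimes>\<^sub>a f) \<Zsemi> Lun B (tgt f) = (g \<otimes>\<^sub>a Idn B (src f)) \<Zsemi> (Lun B (src f) \<Zsemi> f)"
proof -
  have "(g \<otimes>\<^sub>a f) \<Zsemi> Lun B (tgt f) = (g \<otimes>\<^sub>a Idn B (src f)) \<Zsemi> ((Idn B (Unit B) \<otimes>\<^sub>a f) \<Zsemi> Lun B (tgt f))"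
    using assms by simp
  then show ?thesis using assms by (simp only: Lun_nat)
qed

lemma inv_Run_nat:
  assumes "f \<in> Arr B"
  shows "inv_arrow B (Run B (src f)) \<Zsemi> (f \<otimes>\<^sub>a Idn B (Unit B)) = f \<Zsemi> inv_arrow B (Run B (tgt f))"
  by (rule iso_cancel_right[of "Run B (tgt f)"]) (use assms Run_nat[OF assms] in simp_all)

text \<open>The middle exchange for four possibly different objects; its naturality cannot be stated
  for \<open>mid_swap\<close> alone.\<close>

definition mid4 :: "'o \<Rightarrow> 'o \<Rightarrow> 'o \<Rightarrow> 'o \<Rightarrow> ('o, 'm) arrow" where
  "mid4 X Y Z W =
     Assoc B X Y (Z \<otimes>\<^sub>o W) \<Zsemi>
     (Idn B X \<otimes>\<^sub>a (inv_arrow B (Assoc B Y Z W) \<Zsemi> (Sym B Y Z \<otimes>\<^sub>a Idn B W) \<Zsemi> Assoc B Z Y W)) \<Zsemi>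
     inv_arrow B (Assoc B X Z (Y \<otimes>\<^sub>o W))"

lemma mid_swap_eq: "mid_swap B X Y = mid4 X X Y Y"
  by (simp add: mid_swap_def mid4_def)

lemma mid4_simps [simp]:
  assumes "X \<in> Ob B" "Y \<in> Ob B" "Z \<in> Ob B" "W \<in> Ob B"
  shows "mid4 X Y Z W \<in> Arr B" "src (mid4 X Y Z W) = (X \<otimes>\<^sub>o Y) \<otimes>\<^sub>o (Z \<otimes>\<^sub>o W)"
    "tgt (mid4 X Y Z W) = (X \<otimes>\<^sub>o Z) \<otimes>\<^sub>o (Y \<otimes>\<^sub>o W)"
  using assms by (simp_all add: mid4_def)

lemma mid4_nat:
  assumes "f \<in> Arr B" "g \<in> Arr B" "h \<in> Arr B" "k \<in> Arr B"
  shows "((f \<otimes>\<^sub>a g) \<otimes>\<^sub>a (h \<otimes>\<^sub>a k)) \<Zsemi> mid4 (tgt f) (tgt g) (tgt h) (tgt k) =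
         mid4 (src f) (src g) (src h) (src k) \<Zsemi> ((f \<otimes>\<^sub>a h) \<otimes>\<^sub>a (g \<otimes>\<^sub>a k))"
proof -
  \<comment> \<open>The inner part of \<open>mid4\<close>, which exchanges the first two of three
    factors. Its naturality is proved before the outer associators are crossed.\<close>
  define m where "m Y Z W = inv_arrow B (Assoc B Y Z W) \<Zsemi> ((Sym B Y Z \<otimes>\<^sub>a Idn B W) \<Zsemi> Assoc B Z Y W)" for Y Z W
  have m [simp]: "m Y Z W \<in> Arr B" "src (m Y Z W) = Y \<otimes>\<^sub>o (Z \<otimes>\<^sub>o W)" "tgt (m Y Z W) = Z \<otimes>\<^sub>o (Y \<otimes>\<^sub>o W)"
    if "Y \<in> Ob B" "Z \<in> Ob B" "W \<in> Ob B" for Y Z W using that by (simp_all add: m_def)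
  have "(g \<otimes>\<^sub>a (h \<otimes>\<^sub>a k)) \<Zsemi> m (tgt g) (tgt h) (tgt k)
      = ((g \<otimes>\<^sub>a (h \<otimes>\<^sub>a k)) \<Zsemi> inv_arrow B (Assoc B (tgt g) (tgt h) (tgt k))) \<Zsemi>
          ((Sym B (tgt g) (tgt h) \<otimes>\<^sub>a Idn B (tgt k)) \<Zsemi> Assoc B (tgt h) (tgt g) (tgt k))"
    using assms by (simp add: m_def)
  also have "\<dots> = inv_arrow B (Assoc B (src g) (src h) (src k)) \<Zsemi>
        ((((g \<otimes>\<^sub>a h) \<Zsemi> Sym B (tgt g) (tgt h)) \<otimes>\<^sub>a k) \<Zsemi> Assoc B (tgt h) (tgt g) (tgt k))"
    using assms by (simp add: inv_Assoc_nat)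
  also have "\<dots> = inv_arrow B (Assoc B (src g) (src h) (src k)) \<Zsemi>
        ((Sym B (src g) (src h) \<otimes>\<^sub>a Idn B (src k)) \<Zsemi> (((h \<otimes>\<^sub>a g) \<otimes>\<^sub>a k) \<Zsemi> Assoc B (tgt h) (tgt g) (tgt k)))"
    using assms by (simp add: Sym_nat)
  also have "\<dots> = m (src g) (src h) (src k) \<Zsemi> (h \<otimes>\<^sub>a (g \<otimes>\<^sub>a k))"
    using assms by (simp add: Assoc_nat m_def)
  finally have mn: "(g \<otimes>\<^sub>a (h \<otimes>\<^sub>a k)) \<Zsemi> m (tgt g) (tgt h) (tgt k) = m (src g) (src h) (src k) \<Zsemi> (h \<otimes>\<^sub>a (g \<otimes>\<^sub>a k))" .
  have "((f \<otimes>\<^sub>a g) \<otimes>\<^sub>a (h \<otimes>\<^sub>a k)) \<Zsemi> mid4 (tgt f) (tgt g) (tgt h) (tgt k)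
     = (((f \<otimes>\<^sub>a g) \<otimes>\<^sub>a (h \<otimes>\<^sub>a k)) \<Zsemi> Assoc B (tgt f) (tgt g) (tgt (h \<otimes>\<^sub>a k))) \<Zsemi>
       ((Idn B (tgt f) \<otimes>\<^sub>a m (tgt g) (tgt h) (tgt k)) \<Zsemi> inv_arrow B (Assoc B (tgt f) (tgt h) (tgt g \<otimes>\<^sub>o tgt k)))"
    using assms by (simp add: mid4_def m_def[symmetric])
  also have "\<dots> = Assoc B (src f) (src g) (src h \<otimes>\<^sub>o src k) \<Zsemi> ((f \<otimes>\<^sub>a ((g \<otimes>\<^sub>a (h \<otimes>\<^sub>a k)) \<Zsemi> m (tgt g) (tgt h) (tgt k))) \<Zsemi>
        inv_arrow B (Assoc B (tgt f) (tgt h) (tgt g \<otimes>\<^sub>o tgt k)))"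
    unfolding Assoc_nat[OF assms(1,2) TensArr_simps(1)[OF assms(3,4)]] using assms by simp
  also have "\<dots> = Assoc B (src f) (src g) (src h \<otimes>\<^sub>o src k) \<Zsemi> ((Idn B (src f) \<otimes>\<^sub>a m (src g) (src h) (src k)) \<Zsemi>
        ((f \<otimes>\<^sub>a (h \<otimes>\<^sub>a (g \<otimes>\<^sub>a k))) \<Zsemi> inv_arrow B (Assoc B (tgt f) (tgt h) (tgt (g \<otimes>\<^sub>a k)))))"
    unfolding mn using assms by simp
  also have "\<dots> = mid4 (src f) (src g) (src h) (src k) \<Zsemi> ((f \<otimes>\<^sub>a h) \<otimes>\<^sub>a (g \<otimes>\<^sub>a k))"
    unfolding inv_Assoc_nat[OF assms(1,3) TensArr_simps(1)[OF assms(2,4)]] using assms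
    by (simp add: mid4_def m_def[symmetric])
  finally show ?thesis .
qed

end

section \<open>Left adjoints in a poset-enriched monoidal category\<close>

context poset_enriched_smc
begin

lemma le_refl [simp]: "f \<in> Arr B \<Longrightarrow> f \<sqsubseteq> f"
  by (rule Leq_refl[of f "src f" "tgt f"]) (simp add: in_hom_iff)

lemma le_trans:
  "f \<sqsubseteq> g \<Longrightarrow> g \<sqsubseteq> h \<Longrightarrow> f \<in> Arr B \<Longrightarrow> g \<in> Arr B \<Longrightarrow> h \<in> Arr B \<Longrightarrow>
   src f = src g \<Longrightarrow> tgt f = tgt g \<Longrightarrow> src h = src g \<Longrightarrow> tgt h = tgt g \<Longrightarrow> f \<sqsubseteq> h"
  by (rule Leq_trans[of f "src g" "tgt g" g]) (simp_all add: in_hom_iff)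

lemma le_antisym:
  "f \<sqsubseteq> g \<Longrightarrow> g \<sqsubseteq> f \<Longrightarrow> f \<in> Arr B \<Longrightarrow> g \<in> Arr B \<Longrightarrow> src f = src g \<Longrightarrow> tgt f = tgt g \<Longrightarrow> f = g"
  by (rule Leq_antisym[of f "src g" "tgt g" g]) (simp_all add: in_hom_iff)

lemma Seq_le:
  "f \<sqsubseteq> f' \<Longrightarrow> g \<sqsubseteq> g' \<Longrightarrow> f \<in> Arr B \<Longrightarrow> f' \<in> Arr B \<Longrightarrow> g \<in> Arr B \<Longrightarrow> g' \<in> Arr B \<Longrightarrow>
   src f = src f' \<Longrightarrow> tgt f = tgt f' \<Longrightarrow> src g = tgt f' \<Longrightarrow> src g' = tgt f' \<Longrightarrow> tgt g = tgt g' \<Longrightarrow>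
   f \<Zsemi> g \<sqsubseteq> f' \<Zsemi> g'"
  by (rule Seq_mono[of f "src f'" "tgt f'" f' g "tgt g'"]) (simp_all add: in_hom_iff)

lemma TensArr_le:
  "f \<sqsubseteq> f' \<Longrightarrow> g \<sqsubseteq> g' \<Longrightarrow> f \<in> Arr B \<Longrightarrow> f' \<in> Arr B \<Longrightarrow> g \<in> Arr B \<Longrightarrow> g' \<in> Arr B \<Longrightarrow>
   src f = src f' \<Longrightarrow> tgt f = tgt f' \<Longrightarrow> src g = src g' \<Longrightarrow> tgt g = tgt g' \<Longrightarrow> f \<otimes>\<^sub>a g \<sqsubseteq> f' \<otimes>\<^sub>a g'"
  by (rule TensArr_mono[of f "src f'" "tgt f'" f' g "src g'" "tgt g'"]) (simp_all add: in_hom_iff)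

text \<open>Closure under composition and tensor comes with a formula for \<open>radj\<close>, so
  right adjoints of composite structural arrows can be computed. In a cartesian bicategory
  \<open>ladj_map\<close> turns every such arrow into a map.\<close>

definition ladj :: "('o, 'm) arrow \<Rightarrow> bool" where
  "ladj f \<longleftrightarrow> f \<in> Arr B \<and> (\<exists>g. is_right_adjoint B f g)"

lemma ladjI: "f \<in> Arr B \<Longrightarrow> is_right_adjoint B f g \<Longrightarrow> ladj f"
  by (auto simp: ladj_def)

lemma ladj_radj: "ladj f \<Longrightarrow> is_right_adjoint B f (radj B f)"
  using radj_eq by (auto simp: ladj_def)

lemma radj_simps [simp]:
  assumes "ladj f"
  shows "radj B f \<in> Arr B" "src (radj B f) = tgt f" "tgt (radj B f) = src f"
  using ladj_radj[OF assms] by (auto simp: is_right_adjoint_def in_hom_iff)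

lemma ladj_unit: "ladj f \<Longrightarrow> Idn B (src f) \<sqsubseteq> f \<Zsemi> radj B f"
  and ladj_counit: "ladj f \<Longrightarrow> radj B f \<Zsemi> f \<sqsubseteq> Idn B (tgt f)"
  using ladj_radj by (auto simp: is_right_adjoint_def)

lemma ladj_Arr [simp]: "ladj f \<Longrightarrow> f \<in> Arr B"
  by (simp add: ladj_def)

lemma right_adjoint_Seq:
  assumes "ladj f" "ladj g" "tgt f = src g"
  shows "is_right_adjoint B (f \<Zsemi> g) (radj B g \<Zsemi> radj B f)"
proof -
  have "f \<Zsemi> (Idn B (src g) \<Zsemi> radj B f) \<sqsubseteq> f \<Zsemi> ((g \<Zsemi> radj B g) \<Zsemi> radj B f)"
    by (intro Seq_le ladj_unit le_refl) (use assms in simp_all)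
  then have "Idn B (src f) \<sqsubseteq> f \<Zsemi> (g \<Zsemi> (radj B g \<Zsemi> radj B f))"
    by (intro le_trans[OF ladj_unit[OF assms(1)]]) (use assms in simp_all)
  moreover have "radj B g \<Zsemi> ((radj B f \<Zsemi> f) \<Zsemi> g) \<sqsubseteq> radj B g \<Zsemi> (Idn B (tgt f) \<Zsemi> g)"
    by (intro Seq_le ladj_counit le_refl) (use assms in simp_all)
  then have "radj B g \<Zsemi> (radj B f \<Zsemi> (f \<Zsemi> g)) \<sqsubseteq> Idn B (tgt g)"
    by (intro le_trans[OF _ ladj_counit[OF assms(2)]]) (use assms in simp_all)
  ultimately show ?thesis using assms by (simp add: is_right_adjoint_def in_hom_iff)
qed

lemma ladj_Seq [simp]: "ladj f \<Longrightarrow> ladj g \<Longrightarrow> tgt f = src g \<Longrightarrow> ladj (f \<Zsemi> g)"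
  using ladjI[OF _ right_adjoint_Seq] by simp

lemma radj_Seq: "ladj f \<Longrightarrow> ladj g \<Longrightarrow> tgt f = src g \<Longrightarrow> radj B (f \<Zsemi> g) = radj B g \<Zsemi> radj B f"
  using radj_eq[OF _ right_adjoint_Seq] by simp

lemma right_adjoint_Tens:
  assumes "ladj f" "ladj g"
  shows "is_right_adjoint B (f \<otimes>\<^sub>a g) (radj B f \<otimes>\<^sub>a radj B g)"
proof -
  have "Idn B (src f) \<otimes>\<^sub>a Idn B (src g) \<sqsubseteq> (f \<Zsemi> radj B f) \<otimes>\<^sub>a (g \<Zsemi> radj B g)"
    by (intro TensArr_le ladj_unit) (use assms in simp_all)
  moreover have "(radj B f \<Zsemi> f) \<otimes>\<^sub>a (radj B g \<Zsemi> g) \<sqsubseteq> Idn B (tgt f) \<otimes>\<^sub>a Idn B (tgt g)"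
    by (intro TensArr_le ladj_counit) (use assms in simp_all)
  ultimately show ?thesis using assms by (simp add: is_right_adjoint_def in_hom_iff)
qed

lemma ladj_Tens [simp]: "ladj f \<Longrightarrow> ladj g \<Longrightarrow> ladj (f \<otimes>\<^sub>a g)"
  using ladjI[OF _ right_adjoint_Tens] by simp

lemma radj_Tens: "ladj f \<Longrightarrow> ladj g \<Longrightarrow> radj B (f \<otimes>\<^sub>a g) = radj B f \<otimes>\<^sub>a radj B g"
  using radj_eq[OF _ right_adjoint_Tens] by simp

lemma right_adjoint_inverse: "inverse_arrows B f g \<Longrightarrow> is_right_adjoint B f g"
  by (auto simp: inverse_arrows_def is_right_adjoint_def in_hom_iff)

lemma ladj_iso: "is_iso B f \<Longrightarrow> ladj f"
  using ladjI right_adjoint_inverse[OF inv_arrow_inverse] is_iso_Arr by blast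

lemma radj_iso: "is_iso B f \<Longrightarrow> radj B f = inv_arrow B f"
  using radj_eq right_adjoint_inverse[OF inv_arrow_inverse] is_iso_Arr by blast

lemma radj_inverse: "inverse_arrows B f g \<Longrightarrow> ladj f" "inverse_arrows B f g \<Longrightarrow> radj B f = g"
  using ladj_iso radj_iso inv_arrow_eq by (auto simp: is_iso_def)

lemma ladj_Idn [simp]: "X \<in> Ob B \<Longrightarrow> ladj (Idn B X)"
  using ladj_iso inverse_arrows_Idn by (auto simp: is_iso_def)

lemma radj_Idn [simp]: "X \<in> Ob B \<Longrightarrow> radj B (Idn B X) = Idn B X"
  using radj_eq right_adjoint_inverse[OF inverse_arrows_Idn] by simp

text \<open>Precomposition with \<open>radj B f\<close> is left adjoint to precomposition with
  \<open>f\<close>. On predicates this is the adjunction between quantification and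
  reindexing.\<close>

lemma ladj_transpose:
  assumes "ladj f" "u \<in> Arr B" "src u = src f" "v \<in> Arr B" "src v = tgt f" "tgt u = tgt v"
  shows "radj B f \<Zsemi> u \<sqsubseteq> v \<longleftrightarrow> u \<sqsubseteq> f \<Zsemi> v"
proof
  assume le: "radj B f \<Zsemi> u \<sqsubseteq> v"
  have "Idn B (src f) \<Zsemi> u \<sqsubseteq> (f \<Zsemi> radj B f) \<Zsemi> u"
    by (intro Seq_le ladj_unit le_refl) (use assms in simp_all)
  moreover have "f \<Zsemi> (radj B f \<Zsemi> u) \<sqsubseteq> f \<Zsemi> v" by (intro Seq_le le le_refl) (use assms in simp_all)
  ultimately show "u \<sqsubseteq> f \<Zsemi> v" using assms le_trans[of u "f \<Zsemi> (radj B f \<Zsemi> u)" "f \<Zsemi> v"] by simp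
next
  assume le: "u \<sqsubseteq> f \<Zsemi> v"
  have "radj B f \<Zsemi> u \<sqsubseteq> radj B f \<Zsemi> (f \<Zsemi> v)" by (intro Seq_le le le_refl) (use assms in simp_all)
  moreover have "(radj B f \<Zsemi> f) \<Zsemi> v \<sqsubseteq> Idn B (tgt f) \<Zsemi> v"
    by (intro Seq_le ladj_counit le_refl) (use assms in simp_all)
  then have "radj B f \<Zsemi> (f \<Zsemi> v) \<sqsubseteq> v" using assms by simp
  ultimately show "radj B f \<Zsemi> u \<sqsubseteq> v"
    by (rule le_trans) (use assms in simp_all)
qed

end

section \<open>Comonoids, maps and coherence\<close>

context cartesian_bicategory
begin

lemma Dup_simps [simp]:
  assumes "X \<in> Ob B"
  shows "Dup B X \<in> Arr B" "src (Dup B X) = X" "tgt (Dup B X) = X \<otimes>\<^sub>o X" "ladj (Dup B X)"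
  using Dup_hom[OF assms] Dup_adjoint[OF assms] by (auto simp: in_hom_iff ladj_def)

lemma Del_simps [simp]:
  assumes "X \<in> Ob B"
  shows "Del B X \<in> Arr B" "src (Del B X) = X" "tgt (Del B X) = Unit B" "ladj (Del B X)"
  using Del_hom[OF assms] Del_adjoint[OF assms] by (auto simp: in_hom_iff ladj_def)

text \<open>The missing inequalities are the lax naturality of the right adjoint, transposed.\<close>

lemma ladj_map:
  assumes "ladj f" shows "is_map B f"
proof -
  let ?X = "src f" and ?Y = "tgt f" and ?g = "radj B f"
  have "f \<Zsemi> Dup B ?Y \<sqsubseteq> Dup B ?X \<Zsemi> (f \<otimes>\<^sub>a f)"
    by (rule lax_Dup) (use assms in \<open>simp add: in_hom_iff\<close>)
  moreover have "Dup B ?X \<Zsemi> (f \<otimes>\<^sub>a f) \<sqsubseteq> f \<Zsemi> Dup B ?Y"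
  proof -
    have "?g \<Zsemi> Dup B ?X \<sqsubseteq> Dup B ?Y \<Zsemi> (?g \<otimes>\<^sub>a ?g)"
      by (rule lax_Dup) (use assms in \<open>simp add: in_hom_iff\<close>)
    then have "(?g \<Zsemi> Dup B ?X) \<Zsemi> (f \<otimes>\<^sub>a f) \<sqsubseteq> (Dup B ?Y \<Zsemi> (?g \<otimes>\<^sub>a ?g)) \<Zsemi> (f \<otimes>\<^sub>a f)"
      by (rule Seq_le[OF _ le_refl]) (use assms in simp_all)
    then have 1: "?g \<Zsemi> (Dup B ?X \<Zsemi> (f \<otimes>\<^sub>a f)) \<sqsubseteq> Dup B ?Y \<Zsemi> ((?g \<Zsemi> f) \<otimes>\<^sub>a (?g \<Zsemi> f))"
      using assms by simp
    have "Dup B ?Y \<Zsemi> ((?g \<Zsemi> f) \<otimes>\<^sub>a (?g \<Zsemi> f)) \<sqsubseteq> Dup B ?Y \<Zsemi> (Idn B ?Y \<otimes>\<^sub>a Idn B ?Y)"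
      by (rule Seq_le[OF le_refl TensArr_le[OF ladj_counit ladj_counit]]) (use assms in simp_all)
    then have 2: "Dup B ?Y \<Zsemi> ((?g \<Zsemi> f) \<otimes>\<^sub>a (?g \<Zsemi> f)) \<sqsubseteq> Dup B ?Y" using assms by simp
    have "?g \<Zsemi> (Dup B ?X \<Zsemi> (f \<otimes>\<^sub>a f)) \<sqsubseteq> Dup B ?Y"
      by (rule le_trans[OF 1 2]) (use assms in simp_all)
    then show ?thesis using assms by (subst (asm) ladj_transpose) simp_all
  qed
  ultimately have 1: "f \<Zsemi> Dup B ?Y = Dup B ?X \<Zsemi> (f \<otimes>\<^sub>a f)"
    using assms by (intro le_antisym) simp_all
  have "f \<Zsemi> Del B ?Y \<sqsubseteq> Del B ?X"
    by (rule lax_Del) (use assms in \<open>simp add: in_hom_iff\<close>)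
  moreover have "?g \<Zsemi> Del B ?X \<sqsubseteq> Del B ?Y"
    by (rule lax_Del) (use assms in \<open>simp add: in_hom_iff\<close>)
  then have "Del B ?X \<sqsubseteq> f \<Zsemi> Del B ?Y" using assms by (subst (asm) ladj_transpose) simp_all
  ultimately have "f \<Zsemi> Del B ?Y = Del B ?X" using assms by (intro le_antisym) simp_all
  with 1 show ?thesis by (simp add: is_map_def)
qed

text \<open>The counit laws solved for the unitors. As simplification rules they fire on every copy
  that is half discarded, so they are switched off wherever such a composite has to stay
  visible.\<close>

lemma Dup_Del [simp]:
  assumes "X \<in> Ob B"
  shows "Dup B X \<Zsemi> (Idn B X \<otimes>\<^sub>a Del B X) = inv_arrow B (Run B X)"
    "Dup B X \<Zsemi> (Del B X \<otimes>\<^sub>a Idn B X) = inv_arrow B (Lun B X)"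
proof -
  show "Dup B X \<Zsemi> (Idn B X \<otimes>\<^sub>a Del B X) = inv_arrow B (Run B X)"
    by (rule iso_cancel_right[of "Run B X"]) (use assms Dup_Del_right[of X] in simp_all)
  show "Dup B X \<Zsemi> (Del B X \<otimes>\<^sub>a Idn B X) = inv_arrow B (Lun B X)"
    by (rule iso_cancel_right[of "Lun B X"]) (use assms Dup_Del_left[of X] in simp_all)
qed

text \<open>
  In the presence of the comonoids the coherence laws that are usually derived from the pentagon and
  the hexagon follow from the counit, associativity and commutativity laws of \<open>d\<close>.
\<close>

lemma Run_Unit: "Run B (Unit B) = Lun B (Unit B)"
proof -
  have "inv_arrow B (Lun B (Unit B)) \<Zsemi> Run B (Unit B) = inv_arrow B (Lun B (Unit B)) \<Zsemi> Lun B (Unit B)"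
    using Dup_Del_right[of "Unit B"] by (simp add: Dup_Unit Del_Unit)
  then show ?thesis by (rule iso_cancel_left[rotated -1]) simp_all
qed

lemma Sym_Unit: "Sym B (Unit B) (Unit B) = Idn B (Unit B \<otimes>\<^sub>o Unit B)"
  by (rule iso_cancel_left[of "inv_arrow B (Lun B (Unit B))"]) (use Dup_Sym[of "Unit B"] in \<open>simp_all add: Dup_Unit\<close>)

text \<open>The inverse left unitor copies and discards on the left. Naturality moves the symmetry
  back to the copy, which absorbs it, and then the discarding is on the right.\<close>

lemma Sym_Run:
  assumes "X \<in> Ob B" shows "Sym B (Unit B) X \<Zsemi> Run B X = Lun B X"
proof (rule iso_cancel_left[of "inv_arrow B (Lun B X)"])
  have "inv_arrow B (Lun B X) \<Zsemi> (Sym B (Unit B) X \<Zsemi> Run B X) =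
      Dup B X \<Zsemi> (((Del B X \<otimes>\<^sub>a Idn B X) \<Zsemi> Sym B (Unit B) X) \<Zsemi> Run B X)"
    using assms by (simp add: Dup_Del(2)[symmetric] del: Dup_Del)
  also have "(Del B X \<otimes>\<^sub>a Idn B X) \<Zsemi> Sym B (Unit B) X = Sym B X X \<Zsemi> (Idn B X \<otimes>\<^sub>a Del B X)"
    using Sym_nat[of "Del B X" "Idn B X"] assms by simp
  also have "Dup B X \<Zsemi> ((Sym B X X \<Zsemi> (Idn B X \<otimes>\<^sub>a Del B X)) \<Zsemi> Run B X) =
      ((Dup B X \<Zsemi> Sym B X X) \<Zsemi> (Idn B X \<otimes>\<^sub>a Del B X)) \<Zsemi> Run B X"
    using assms by simp
  also have "\<dots> = inv_arrow B (Lun B X) \<Zsemi> Lun B X"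
    using assms unfolding Dup_Sym[OF assms] by simp
  finally show "inv_arrow B (Lun B X) \<Zsemi> Sym B (Unit B) X \<Zsemi> Run B X = inv_arrow B (Lun B X) \<Zsemi> Lun B X" .
qed (use assms in simp_all)

text \<open>After precomposition with the inverse left unitor both sides make three copies of
  \<open>X\<close> and discard the outer two, with different bracketings. \<open>Dup_assoc\<close>
  and naturality of the associator compare them.\<close>

lemma Assoc_Run_aux:
  assumes X: "X \<in> Ob B"
  shows "Assoc B (Unit B) X (Unit B) \<Zsemi> (Idn B (Unit B) \<otimes>\<^sub>a Run B X) = Run B (Unit B \<otimes>\<^sub>o X)"
proof -
  let ?I = "Unit B" and ?d = "Dup B X" and ?e = "Del B X" and ?i = "Idn B X"
  let ?l = "inv_arrow B (Lun B X)" and ?r = "inv_arrow B (Run B X)"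
  have "?l \<Zsemi> (Idn B ?I \<otimes>\<^sub>a ?r) = (?d \<Zsemi> (?e \<otimes>\<^sub>a ?i)) \<Zsemi> (Idn B ?I \<otimes>\<^sub>a (?d \<Zsemi> (?i \<otimes>\<^sub>a ?e)))"
    using X by simp
  also have "\<dots> = (?d \<Zsemi> (?i \<otimes>\<^sub>a ?d)) \<Zsemi> (?e \<otimes>\<^sub>a (?i \<otimes>\<^sub>a ?e))"
    using X by (simp del: Dup_Del)
  also have "\<dots> = (?d \<Zsemi> (?d \<otimes>\<^sub>a ?i)) \<Zsemi> (Assoc B X X X \<Zsemi> (?e \<otimes>\<^sub>a (?i \<otimes>\<^sub>a ?e)))"
    using X Dup_assoc[OF X, symmetric] by (simp del: Dup_Del)
  also have "Assoc B X X X \<Zsemi> (?e \<otimes>\<^sub>a (?i \<otimes>\<^sub>a ?e)) = ((?e \<otimes>\<^sub>a ?i) \<otimes>\<^sub>a ?e) \<Zsemi> Assoc B ?I X ?I"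
    using Assoc_nat[of ?e ?i ?e] X by simp
  also have "(?d \<Zsemi> (?d \<otimes>\<^sub>a ?i)) \<Zsemi> (((?e \<otimes>\<^sub>a ?i) \<otimes>\<^sub>a ?e) \<Zsemi> Assoc B ?I X ?I) =
     ?d \<Zsemi> (((?d \<Zsemi> (?e \<otimes>\<^sub>a ?i)) \<otimes>\<^sub>a ?e) \<Zsemi> Assoc B ?I X ?I)"
    using X by (simp del: Dup_Del)
  also have "\<dots> = (?d \<Zsemi> (?i \<otimes>\<^sub>a ?e)) \<Zsemi> ((?l \<otimes>\<^sub>a Idn B ?I) \<Zsemi> Assoc B ?I X ?I)"
    unfolding Dup_Del(2)[OF X] using X by (simp del: Dup_Del)
  also have "\<dots> = (?r \<Zsemi> (?l \<otimes>\<^sub>a Idn B ?I)) \<Zsemi> Assoc B ?I X ?I" using X by simp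
  also have "?r \<Zsemi> (?l \<otimes>\<^sub>a Idn B ?I) = ?l \<Zsemi> inv_arrow B (Run B (?I \<otimes>\<^sub>o X))"
    using inv_Run_nat[of ?l] X by simp
  finally have "?l \<Zsemi> (Idn B ?I \<otimes>\<^sub>a ?r) = ?l \<Zsemi> (inv_arrow B (Run B (?I \<otimes>\<^sub>o X)) \<Zsemi> Assoc B ?I X ?I)"
    using X by simp
  then have "Idn B ?I \<otimes>\<^sub>a ?r = inv_arrow B (Run B (?I \<otimes>\<^sub>o X)) \<Zsemi> Assoc B ?I X ?I"
    by (rule iso_cancel_left[rotated -1]) (use X in simp_all)
  then have "Run B (?I \<otimes>\<^sub>o X) \<Zsemi> ((Idn B ?I \<otimes>\<^sub>a ?r) \<Zsemi> (Idn B ?I \<otimes>\<^sub>a Run B X)) =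
      Run B (?I \<otimes>\<^sub>o X) \<Zsemi> ((inv_arrow B (Run B (?I \<otimes>\<^sub>o X)) \<Zsemi> Assoc B ?I X ?I) \<Zsemi> (Idn B ?I \<otimes>\<^sub>a Run B X))"
    by simp
  then show ?thesis using X by simp
qed

lemma is_map_Seq:
  assumes "f \<in> Arr B" "g \<in> Arr B" "tgt f = src g" "is_map B f" "is_map B g"
  shows "is_map B (f \<Zsemi> g)"
proof -
  have f: "f \<Zsemi> Dup B (tgt f) = Dup B (src f) \<Zsemi> (f \<otimes>\<^sub>a f)" "f \<Zsemi> Del B (tgt f) = Del B (src f)"
    and g: "g \<Zsemi> Dup B (tgt g) = Dup B (src g) \<Zsemi> (g \<otimes>\<^sub>a g)" "g \<Zsemi> Del B (tgt g) = Del B (src g)"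
    using assms(4,5) by (auto simp: is_map_def)
  have "(f \<Zsemi> g) \<Zsemi> Dup B (tgt g) = f \<Zsemi> (g \<Zsemi> Dup B (tgt g))" using assms(1-3) by simp
  also have "\<dots> = (f \<Zsemi> Dup B (tgt f)) \<Zsemi> (g \<otimes>\<^sub>a g)" unfolding g using assms(1-3) by simp
  also have "\<dots> = Dup B (src f) \<Zsemi> ((f \<Zsemi> g) \<otimes>\<^sub>a (f \<Zsemi> g))" unfolding f using assms(1-3) by simp
  finally have 1: "(f \<Zsemi> g) \<Zsemi> Dup B (tgt g) = Dup B (src f) \<Zsemi> ((f \<Zsemi> g) \<otimes>\<^sub>a (f \<Zsemi> g))" .
  have "(f \<Zsemi> g) \<Zsemi> Del B (tgt g) = f \<Zsemi> (g \<Zsemi> Del B (tgt g))" using assms(1-3) by simp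
  also have "\<dots> = Del B (src f)" unfolding g using f(2) assms(3) by simp
  finally show ?thesis using 1 assms(1-3) by (simp add: is_map_def)
qed

text \<open>Copying a tensor product is copying its factors followed by the middle exchange, and
  naturality of \<open>mid4\<close> carries \<open>f\<close> and \<open>g\<close> across it.\<close>

lemma is_map_Tens:
  assumes "f \<in> Arr B" "g \<in> Arr B" "is_map B f" "is_map B g"
  shows "is_map B (f \<otimes>\<^sub>a g)"
proof -
  have f: "f \<Zsemi> Dup B (tgt f) = Dup B (src f) \<Zsemi> (f \<otimes>\<^sub>a f)" "f \<Zsemi> Del B (tgt f) = Del B (src f)"
    and g: "g \<Zsemi> Dup B (tgt g) = Dup B (src g) \<Zsemi> (g \<otimes>\<^sub>a g)" "g \<Zsemi> Del B (tgt g) = Del B (src g)"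
    using assms by (auto simp: is_map_def)
  have "(f \<otimes>\<^sub>a g) \<Zsemi> Dup B (tgt f \<otimes>\<^sub>o tgt g) = ((f \<Zsemi> Dup B (tgt f)) \<otimes>\<^sub>a (g \<Zsemi> Dup B (tgt g))) \<Zsemi> mid4 (tgt f) (tgt f) (tgt g) (tgt g)"
    using assms(1,2) by (simp add: Dup_TensOb mid_swap_eq)
  also have "\<dots> = (Dup B (src f) \<otimes>\<^sub>a Dup B (src g)) \<Zsemi> (((f \<otimes>\<^sub>a f) \<otimes>\<^sub>a (g \<otimes>\<^sub>a g)) \<Zsemi> mid4 (tgt f) (tgt f) (tgt g) (tgt g))"
    unfolding f g using assms(1,2) by simp
  also have "\<dots> = Dup B (src f \<otimes>\<^sub>o src g) \<Zsemi> ((f \<otimes>\<^sub>a g) \<otimes>\<^sub>a (f \<otimes>\<^sub>a g))"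
    unfolding mid4_nat[OF assms(1,1,2,2)] using assms(1,2) by (simp add: Dup_TensOb mid_swap_eq)
  finally have 1: "(f \<otimes>\<^sub>a g) \<Zsemi> Dup B (tgt f \<otimes>\<^sub>o tgt g) = Dup B (src f \<otimes>\<^sub>o src g) \<Zsemi> ((f \<otimes>\<^sub>a g) \<otimes>\<^sub>a (f \<otimes>\<^sub>a g))" .
  have "(f \<otimes>\<^sub>a g) \<Zsemi> Del B (tgt f \<otimes>\<^sub>o tgt g) = Del B (src f \<otimes>\<^sub>o src g)"
    using assms(1,2) f(2) g(2) by (simp add: Del_TensOb)
  with 1 show ?thesis using assms(1,2) by (simp add: is_map_def)
qed

text \<open>The symmetry in the middle acts on two unit objects and is trivial by
  \<open>Sym_Unit\<close>.\<close>

lemma mid4_Unit: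
  assumes "X \<in> Ob B" "Y \<in> Ob B"
  shows "mid4 X (Unit B) (Unit B) Y = Idn B ((X \<otimes>\<^sub>o Unit B) \<otimes>\<^sub>o (Unit B \<otimes>\<^sub>o Y))"
  using assms by (simp add: mid4_def Sym_Unit)

end

section \<open>The cartesian category of maps\<close>

lemma R_ob_simps [simp]:
  "Ob (R_ob B) = Ob B" "Idn (R_ob B) = Idn B" "Seq (R_ob B) = Seq B" "Prod (R_ob B) = TensOb B"
  "One (R_ob B) = Unit B"
  by (simp_all add: R_ob_def)

lemma R_ob_Pr:
  "Pr1 (R_ob B) X Y = (Idn B X \<otimes>\<^sub>a\<^bsub>B\<^esub> Del B Y) \<Zsemi>\<^bsub>B\<^esub> Run B X"
  "Pr2 (R_ob B) X Y = (Del B X \<otimes>\<^sub>a\<^bsub>B\<^esub> Idn B Y) \<Zsemi>\<^bsub>B\<^esub> Lun B Y"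
  by (simp_all add: R_ob_def)

lemma R_ob_Arr_iff: "f \<in> Arr (R_ob B) \<longleftrightarrow> f \<in> Arr B \<and> is_map B f"
  by (simp add: R_ob_def)

locale CB = cartesian_bicategory B
  for B :: "('o, 'm) bicat" (structure)
begin

abbreviation "M \<equiv> R_ob B"

lemma map_Arr [simp]: "f \<in> Arr M \<Longrightarrow> f \<in> Arr B"
  by (simp add: R_ob_Arr_iff)

lemma ladj_map' [simp]: "ladj f \<Longrightarrow> f \<in> Arr M"
  by (simp add: R_ob_Arr_iff ladj_map)

lemma map_Dup: "f \<in> Arr M \<Longrightarrow> f \<Zsemi> Dup B (tgt f) = Dup B (src f) \<Zsemi> (f \<otimes>\<^sub>a f)"
  and map_Del: "f \<in> Arr M \<Longrightarrow> f \<Zsemi> Del B (tgt f) = Del B (src f)"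
  by (simp_all add: R_ob_Arr_iff is_map_def)

lemma map_Tens [simp]: "f \<in> Arr M \<Longrightarrow> g \<in> Arr M \<Longrightarrow> f \<otimes>\<^sub>a g \<in> Arr M"
  by (simp add: R_ob_Arr_iff is_map_Tens)

lemma map_Seq [simp]: "f \<in> Arr M \<Longrightarrow> g \<in> Arr M \<Longrightarrow> tgt f = src g \<Longrightarrow> f \<Zsemi> g \<in> Arr M"
  by (simp add: R_ob_Arr_iff is_map_Seq)

lemma ladj_structure [simp]:
  "X \<in> Ob B \<Longrightarrow> Y \<in> Ob B \<Longrightarrow> Z \<in> Ob B \<Longrightarrow> ladj (Assoc B X Y Z)"
  "X \<in> Ob B \<Longrightarrow> ladj (Lun B X)" "X \<in> Ob B \<Longrightarrow> ladj (Run B X)"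
  "X \<in> Ob B \<Longrightarrow> Y \<in> Ob B \<Longrightarrow> ladj (Sym B X Y)"
proof -
  show "ladj (Sym B X Y)" if "X \<in> Ob B" "Y \<in> Ob B"
  proof -
    have "inverse_arrows B (Sym B X Y) (Sym B Y X)"
      using that Sym_Sym by (simp add: inverse_arrows_def in_hom_iff)
    then show ?thesis using ladj_iso by (auto simp: is_iso_def)
  qed
qed (auto intro: ladj_iso)

lemma ladj_Pr [simp]:
  assumes "X \<in> Ob B" "Y \<in> Ob B" shows "ladj (Pr1 M X Y)" "ladj (Pr2 M X Y)"
  using assms by (simp_all add: R_ob_Pr)

lemma category_M: "category M"
  by unfold_locales (auto simp: in_hom_iff)

text \<open>A projection discards the other component, and discarding after a map is discarding
  before it; the counit law of the copy does the rest. This is the existence half of the product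
  property.\<close>

lemma pair_M_Pr:
  assumes "f \<in> Arr M" "g \<in> Arr M" "src g = src f"
  shows "(Dup B (src f) \<Zsemi> (f \<otimes>\<^sub>a g)) \<Zsemi> Pr1 M (tgt f) (tgt g) = f"
    "(Dup B (src f) \<Zsemi> (f \<otimes>\<^sub>a g)) \<Zsemi> Pr2 M (tgt f) (tgt g) = g"
proof -
  have "(Dup B (src f) \<Zsemi> (f \<otimes>\<^sub>a g)) \<Zsemi> Pr1 M (tgt f) (tgt g) =
      Dup B (src f) \<Zsemi> ((f \<otimes>\<^sub>a (g \<Zsemi> Del B (tgt g))) \<Zsemi> Run B (tgt f))"
    using assms by (simp add: R_ob_Pr)
  also have "\<dots> = (Dup B (src f) \<Zsemi> (Idn B (src f) \<otimes>\<^sub>a Del B (src f))) \<Zsemi> (Run B (src f) \<Zsemi> f)"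
    unfolding map_Del[OF assms(2)] using Run_slide[of f "Del B (src g)"] assms by (simp del: Dup_Del)
  also have "\<dots> = f" using assms by simp
  finally show "(Dup B (src f) \<Zsemi> (f \<otimes>\<^sub>a g)) \<Zsemi> Pr1 M (tgt f) (tgt g) = f" .
  have "(Dup B (src f) \<Zsemi> (f \<otimes>\<^sub>a g)) \<Zsemi> Pr2 M (tgt f) (tgt g) =
      Dup B (src f) \<Zsemi> (((f \<Zsemi> Del B (tgt f)) \<otimes>\<^sub>a g) \<Zsemi> Lun B (tgt g))"
    using assms by (simp add: R_ob_Pr)
  also have "\<dots> = (Dup B (src f) \<Zsemi> (Del B (src f) \<otimes>\<^sub>a Idn B (src f))) \<Zsemi> (Lun B (src f) \<Zsemi> g)"
    unfolding map_Del[OF assms(1)] using Lun_slide[of g "Del B (src f)"] assms by (simp del: Dup_Del)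
  also have "\<dots> = g" using assms by simp
  finally show "(Dup B (src f) \<Zsemi> (f \<otimes>\<^sub>a g)) \<Zsemi> Pr2 M (tgt f) (tgt g) = g" .
qed

text \<open>Of the four copies of \<open>X\<close> and \<open>Y\<close> the inner two are discarded,
  which makes the middle exchange trivial and leaves a counit law in each factor. This is the key to
  the uniqueness half of the product property.\<close>

lemma Dup_Pr:
  assumes "X \<in> Ob B" "Y \<in> Ob B"
  shows "Dup B (X \<otimes>\<^sub>o Y) \<Zsemi> (Pr1 M X Y \<otimes>\<^sub>a Pr2 M X Y) = Idn B (X \<otimes>\<^sub>o Y)"
proof -
  let ?I = "Unit B"
  have "Dup B (X \<otimes>\<^sub>o Y) \<Zsemi> (Pr1 M X Y \<otimes>\<^sub>a Pr2 M X Y) =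
      (Dup B X \<otimes>\<^sub>a Dup B Y) \<Zsemi> ((mid4 X X Y Y \<Zsemi> ((Idn B X \<otimes>\<^sub>a Del B Y) \<otimes>\<^sub>a (Del B X \<otimes>\<^sub>a Idn B Y))) \<Zsemi> (Run B X \<otimes>\<^sub>a Lun B Y))"
    using assms by (simp add: Dup_TensOb mid_swap_eq R_ob_Pr)
  also have "mid4 X X Y Y \<Zsemi> ((Idn B X \<otimes>\<^sub>a Del B Y) \<otimes>\<^sub>a (Del B X \<otimes>\<^sub>a Idn B Y)) =
      ((Idn B X \<otimes>\<^sub>a Del B X) \<otimes>\<^sub>a (Del B Y \<otimes>\<^sub>a Idn B Y))"
    using mid4_nat[of "Idn B X" "Del B X" "Del B Y" "Idn B Y"] assms by (simp add: mid4_Unit)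
  also have "(Dup B X \<otimes>\<^sub>a Dup B Y) \<Zsemi> (((Idn B X \<otimes>\<^sub>a Del B X) \<otimes>\<^sub>a (Del B Y \<otimes>\<^sub>a Idn B Y)) \<Zsemi> (Run B X \<otimes>\<^sub>a Lun B Y))
      = ((Dup B X \<Zsemi> (Idn B X \<otimes>\<^sub>a Del B X)) \<Zsemi> Run B X) \<otimes>\<^sub>a ((Dup B Y \<Zsemi> (Del B Y \<otimes>\<^sub>a Idn B Y)) \<Zsemi> Lun B Y)"
    using assms by (simp del: Dup_Del)
  also have "\<dots> = Idn B (X \<otimes>\<^sub>o Y)" using assms by simp
  finally show ?thesis .
qed

lemma cartesian_M: "cartesian_category M"
proof -
  interpret M: category M by (rule category_M)
  show ?thesis
  proof
    fix X Y assume "X \<in> Ob M" "Y \<in> Ob M"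
    then have O: "X \<in> Ob B" "Y \<in> Ob B" by auto
    show "X \<times>\<^sub>o\<^bsub>M\<^esub> Y \<in> Ob M" using O by simp
    show "is_product M X Y (X \<times>\<^sub>o\<^bsub>M\<^esub> Y) (Pr1 M X Y) (Pr2 M X Y)"
      unfolding is_product_def
    proof (intro conjI ballI)
      show "Pr1 M X Y \<in> hom M (X \<times>\<^sub>o\<^bsub>M\<^esub> Y) X" "Pr2 M X Y \<in> hom M (X \<times>\<^sub>o\<^bsub>M\<^esub> Y) Y"
        using O ladj_Pr[OF O] by (auto simp: in_hom_iff) (auto simp: R_ob_Pr)
      fix Z f g assume "f \<in> hom M Z X" "g \<in> hom M Z Y"
      then have fg: "f \<in> Arr M" "src f = Z" "tgt f = X" "g \<in> Arr M" "src g = Z" "tgt g = Y" by (auto simp: in_hom_iff)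
      have Z: "Z \<in> Ob B" using fg src_Ob[of f] by simp
      show "\<exists>!h. h \<in> hom M Z (X \<times>\<^sub>o\<^bsub>M\<^esub> Y) \<and> h \<Zsemi>\<^bsub>M\<^esub> Pr1 M X Y = f \<and> h \<Zsemi>\<^bsub>M\<^esub> Pr2 M X Y = g"
      proof (rule ex1I[of _ "Dup B Z \<Zsemi> (f \<otimes>\<^sub>a g)"])
        show "Dup B Z \<Zsemi> (f \<otimes>\<^sub>a g) \<in> hom M Z (X \<times>\<^sub>o\<^bsub>M\<^esub> Y) \<and> (Dup B Z \<Zsemi> (f \<otimes>\<^sub>a g)) \<Zsemi>\<^bsub>M\<^esub> Pr1 M X Y = f \<and>
            (Dup B Z \<Zsemi> (f \<otimes>\<^sub>a g)) \<Zsemi>\<^bsub>M\<^esub> Pr2 M X Y = g"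
          using pair_M_Pr[of f g] fg Z by (simp add: in_hom_iff del: Seq_assoc')
        fix h assume h: "h \<in> hom M Z (X \<times>\<^sub>o\<^bsub>M\<^esub> Y) \<and> h \<Zsemi>\<^bsub>M\<^esub> Pr1 M X Y = f \<and> h \<Zsemi>\<^bsub>M\<^esub> Pr2 M X Y = g"
        then have hh: "h \<in> Arr M" "src h = Z" "tgt h = X \<otimes>\<^sub>o Y" and f: "f = h \<Zsemi> Pr1 M X Y" and g: "g = h \<Zsemi> Pr2 M X Y"
          by (auto simp: in_hom_iff)
        have p: "src (Pr1 M X Y) = X \<otimes>\<^sub>o Y" "src (Pr2 M X Y) = X \<otimes>\<^sub>o Y" using O by (simp_all add: R_ob_Pr)
        \<comment> \<open>A map commutes with copying, so pairing the components of \<open>h\<close>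
          is \<open>h\<close> followed by the pairing of the projections.\<close>
        have "Dup B Z \<Zsemi> (f \<otimes>\<^sub>a g) = (Dup B Z \<Zsemi> (h \<otimes>\<^sub>a h)) \<Zsemi> (Pr1 M X Y \<otimes>\<^sub>a Pr2 M X Y)"
          unfolding f g using hh O Z p by simp
        also have "\<dots> = h \<Zsemi> (Dup B (X \<otimes>\<^sub>o Y) \<Zsemi> (Pr1 M X Y \<otimes>\<^sub>a Pr2 M X Y))"
          using map_Dup[OF hh(1), symmetric] hh O Z p by simp
        also have "\<dots> = h" using Dup_Pr[OF O] hh O by simp
        finally show "h = Dup B Z \<Zsemi> (f \<otimes>\<^sub>a g)" ..
      qed
    qed
  next
    show "One M \<in> Ob M" by simp
    fix X assume "X \<in> Ob M"
    then have X: "X \<in> Ob B" by simp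
    show "\<exists>!f. f \<in> hom M X (One M)"
    proof (rule ex1I[of _ "Del B X"])
      show "Del B X \<in> hom M X (One M)" using X by (simp add: in_hom_iff)
      fix f assume "f \<in> hom M X (One M)"
      then have f: "f \<in> Arr M" "src f = X" "tgt f = Unit B" by (auto simp: in_hom_iff)
      then show "f = Del B X" using map_Del[of f] by (simp add: Del_Unit)
    qed
  qed
qed

end

text \<open>The rewrites replace the components of \<open>R_ob B\<close> by those of
  \<open>B\<close>, so that the rules about pairs and projections apply to terms written in
  \<open>B\<close>.\<close>

sublocale CB \<subseteq> M: cartesian_category "R_ob B"
  rewrites "Ob (R_ob B) = Ob B" and "Idn (R_ob B) = Idn B" and "Seq (R_ob B) = Seq B"
    and "Prod (R_ob B) = TensOb B" and "One (R_ob B) = Unit B"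
  by (rule cartesian_M) simp_all

section \<open>The doctrine of a cartesian bicategory\<close>

lemma R_ob_fibres:
  "Fib (R_ob B) X = {u. Arrow X (Unit B) u \<in> Arr B}"
  "Meet (R_ob B) X u v = lab (Dup B X \<Zsemi>\<^bsub>B\<^esub> ((Arrow X (Unit B) u \<otimes>\<^sub>a\<^bsub>B\<^esub> Arrow X (Unit B) v) \<Zsemi>\<^bsub>B\<^esub> Lun B (Unit B)))"
  "Top (R_ob B) X = lab (Del B X)"
  "Act (R_ob B) f u = lab (f \<Zsemi>\<^bsub>B\<^esub> Arrow (tgt f) (Unit B) u)"
  "Delta (R_ob B) X = lab (radj B (Dup B X) \<Zsemi>\<^bsub>B\<^esub> Del B X)"
  by (simp_all add: R_ob_def)

section \<open>Structural arrows as tuples of projections\<close>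

context CB
begin

lemma pair_M:
  assumes "f \<in> Arr M" "g \<in> Arr M" "src g = src f"
  shows "\<langle>f, g\<rangle>\<^bsub>M\<^esub> = Dup B (src f) \<Zsemi> (f \<otimes>\<^sub>a g)"
  by (rule M.prod_eqI[of _ _ "tgt f" "tgt g"])
    (use assms pair_M_Pr[OF assms] in \<open>simp_all del: Seq_assoc' M.Seq_assoc'\<close>)

lemma Dup_M: "X \<in> Ob B \<Longrightarrow> Dup B X = \<langle>Idn B X, Idn B X\<rangle>\<^bsub>M\<^esub>"
  by (simp add: pair_M)

lemma bang_M: "X \<in> Ob B \<Longrightarrow> bang M X = Del B X"
  by (rule M.One_eqI) simp_all

lemma Tens_Pr:
  assumes "f \<in> Arr M" "g \<in> Arr M"
  shows "(f \<otimes>\<^sub>a g) \<Zsemi> Pr1 M (tgt f) (tgt g) = Pr1 M (src f) (src g) \<Zsemi> f"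
    "(f \<otimes>\<^sub>a g) \<Zsemi> Pr2 M (tgt f) (tgt g) = Pr2 M (src f) (src g) \<Zsemi> g"
proof -
  have "(f \<otimes>\<^sub>a g) \<Zsemi> Pr1 M (tgt f) (tgt g) = (f \<otimes>\<^sub>a (g \<Zsemi> Del B (tgt g))) \<Zsemi> Run B (tgt f)"
    using assms by (simp add: R_ob_Pr)
  also have "\<dots> = Pr1 M (src f) (src g) \<Zsemi> f"
    unfolding map_Del[OF assms(2)] using assms Run_slide[of f "Del B (src g)"] by (simp add: R_ob_Pr)
  finally show "(f \<otimes>\<^sub>a g) \<Zsemi> Pr1 M (tgt f) (tgt g) = Pr1 M (src f) (src g) \<Zsemi> f" .
  have "(f \<otimes>\<^sub>a g) \<Zsemi> Pr2 M (tgt f) (tgt g) = ((f \<Zsemi> Del B (tgt f)) \<otimes>\<^sub>a g) \<Zsemi> Lun B (tgt g)"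
    using assms by (simp add: R_ob_Pr)
  also have "\<dots> = Pr2 M (src f) (src g) \<Zsemi> g"
    unfolding map_Del[OF assms(1)] using assms Lun_slide[of g "Del B (src f)"] by (simp add: R_ob_Pr)
  finally show "(f \<otimes>\<^sub>a g) \<Zsemi> Pr2 M (tgt f) (tgt g) = Pr2 M (src f) (src g) \<Zsemi> g" .
qed

lemma Tens_M:
  assumes "f \<in> Arr M" "g \<in> Arr M"
  shows "f \<otimes>\<^sub>a g = f \<times>\<^sub>a\<^bsub>M\<^esub> g"
  by (rule M.prod_eqI[of _ _ "tgt f" "tgt g"])
    (use assms Tens_Pr[OF assms] in \<open>simp_all add: prod_arr_def\<close>)

lemma Run_M: "X \<in> Ob B \<Longrightarrow> Run B X = Pr1 M X (Unit B)"
  by (simp add: R_ob_Pr Del_Unit)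

lemma Lun_M: "X \<in> Ob B \<Longrightarrow> Lun B X = Pr2 M (Unit B) X"
  by (simp add: R_ob_Pr Del_Unit)

text \<open>Discarding one factor leaves a symmetry with the unit object, which
  \<open>Sym_Run\<close> evaluates. The second equation is the first one for the exchanged objects,
  cancelled by \<open>Sym_Sym\<close>.\<close>

lemma Sym_Pr:
  assumes "X \<in> Ob B" "Y \<in> Ob B"
  shows "Sym B X Y \<Zsemi> Pr1 M Y X = Pr2 M X Y" "Sym B X Y \<Zsemi> Pr2 M Y X = Pr1 M X Y"
proof -
  have *: "Sym B X Y \<Zsemi> Pr1 M Y X = Pr2 M X Y" if "X \<in> Ob B" "Y \<in> Ob B" for X Y
  proof -
    have "Sym B X Y \<Zsemi> Pr1 M Y X = (Sym B X Y \<Zsemi> (Idn B Y \<otimes>\<^sub>a Del B X)) \<Zsemi> Run B Y"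
      using that by (simp add: R_ob_Pr)
    also have "\<dots> = (Del B X \<otimes>\<^sub>a Idn B Y) \<Zsemi> (Sym B (Unit B) Y \<Zsemi> Run B Y)"
      using that Sym_nat[of "Del B X" "Idn B Y", symmetric] by simp
    finally show ?thesis using that by (simp add: Sym_Run R_ob_Pr)
  qed
  show "Sym B X Y \<Zsemi> Pr1 M Y X = Pr2 M X Y" using * assms by simp
  have "Sym B X Y \<Zsemi> (Sym B Y X \<Zsemi> Pr1 M X Y) = (Sym B X Y \<Zsemi> Sym B Y X) \<Zsemi> Pr1 M X Y"
    using assms by simp
  then show "Sym B X Y \<Zsemi> Pr2 M Y X = Pr1 M X Y" using *[of Y X] assms by (simp add: Sym_Sym)
qed

text \<open>Naturality moves the discarding of two factors in front of the associator. What remains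
  is an associator with two unit objects next to unitors, to be evaluated by the triangle law or,
  when the middle object survives, by \<open>Assoc_Run_aux\<close>.\<close>

lemma Assoc_Pr:
  assumes "X \<in> Ob B" "Y \<in> Ob B" "Z \<in> Ob B"
  shows "Assoc B X Y Z \<Zsemi> Pr1 M X (Y \<otimes>\<^sub>o Z) = Pr1 M (X \<otimes>\<^sub>o Y) Z \<Zsemi> Pr1 M X Y"
    "Assoc B X Y Z \<Zsemi> (Pr2 M X (Y \<otimes>\<^sub>o Z) \<Zsemi> Pr1 M Y Z) = Pr1 M (X \<otimes>\<^sub>o Y) Z \<Zsemi> Pr2 M X Y"
    "Assoc B X Y Z \<Zsemi> (Pr2 M X (Y \<otimes>\<^sub>o Z) \<Zsemi> Pr2 M Y Z) = Pr2 M (X \<otimes>\<^sub>o Y) Z"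
proof -
  let ?I = "Unit B" and ?x = "Idn B X" and ?y = "Idn B Y" and ?z = "Idn B Z" and ?i = "Idn B (Unit B)"
  let ?ex = "Del B X" and ?ey = "Del B Y" and ?ez = "Del B Z" and ?a = "Assoc B X Y Z"
  have "?a \<Zsemi> Pr1 M X (Y \<otimes>\<^sub>o Z) = (?a \<Zsemi> (?x \<otimes>\<^sub>a (?ey \<otimes>\<^sub>a ?ez))) \<Zsemi> ((?x \<otimes>\<^sub>a Lun B ?I) \<Zsemi> Run B X)"
    using assms by (simp add: R_ob_Pr Del_TensOb)
  also have "?a \<Zsemi> (?x \<otimes>\<^sub>a (?ey \<otimes>\<^sub>a ?ez)) = ((?x \<otimes>\<^sub>a ?ey) \<otimes>\<^sub>a ?ez) \<Zsemi> Assoc B X ?I ?I"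
    using Assoc_nat[of ?x ?ey ?ez] assms by simp
  also have "(((?x \<otimes>\<^sub>a ?ey) \<otimes>\<^sub>a ?ez) \<Zsemi> Assoc B X ?I ?I) \<Zsemi> ((?x \<otimes>\<^sub>a Lun B ?I) \<Zsemi> Run B X) =
     ((?x \<otimes>\<^sub>a ?ey) \<otimes>\<^sub>a ?ez) \<Zsemi> ((Assoc B X ?I ?I \<Zsemi> (?x \<otimes>\<^sub>a Lun B ?I)) \<Zsemi> Run B X)"
    using assms by simp
  also have "Assoc B X ?I ?I \<Zsemi> (?x \<otimes>\<^sub>a Lun B ?I) = Run B X \<otimes>\<^sub>a ?i" using triangle[of X ?I] assms by simp
  also have "((?x \<otimes>\<^sub>a ?ey) \<otimes>\<^sub>a ?ez) \<Zsemi> ((Run B X \<otimes>\<^sub>a ?i) \<Zsemi> Run B X) = (Pr1 M X Y \<otimes>\<^sub>a ?ez) \<Zsemi> Run B X"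
    using assms by (simp add: R_ob_Pr)
  also have "\<dots> = Pr1 M (X \<otimes>\<^sub>o Y) Z \<Zsemi> Pr1 M X Y"
    using Run_slide[of "Pr1 M X Y" ?ez] assms by (simp add: R_ob_Pr[of B "X \<otimes>\<^sub>o Y"])
  finally show "Assoc B X Y Z \<Zsemi> Pr1 M X (Y \<otimes>\<^sub>o Z) = Pr1 M (X \<otimes>\<^sub>o Y) Z \<Zsemi> Pr1 M X Y" .
  have "?a \<Zsemi> (Pr2 M X (Y \<otimes>\<^sub>o Z) \<Zsemi> Pr1 M Y Z) =
     ?a \<Zsemi> ((?ex \<otimes>\<^sub>a (?y \<otimes>\<^sub>a ?z)) \<Zsemi> (Lun B (Y \<otimes>\<^sub>o Z) \<Zsemi> Pr1 M Y Z))"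
    using assms by (simp add: R_ob_Pr)
  also have "Lun B (Y \<otimes>\<^sub>o Z) \<Zsemi> Pr1 M Y Z = (?i \<otimes>\<^sub>a Pr1 M Y Z) \<Zsemi> Lun B Y"
    using Lun_nat[of "Pr1 M Y Z"] assms by simp
  also have "?a \<Zsemi> ((?ex \<otimes>\<^sub>a (?y \<otimes>\<^sub>a ?z)) \<Zsemi> ((?i \<otimes>\<^sub>a Pr1 M Y Z) \<Zsemi> Lun B Y)) =
     (?a \<Zsemi> (?ex \<otimes>\<^sub>a (?y \<otimes>\<^sub>a ?ez))) \<Zsemi> ((?i \<otimes>\<^sub>a Run B Y) \<Zsemi> Lun B Y)"
    using assms by (simp add: R_ob_Pr)
  also have "?a \<Zsemi> (?ex \<otimes>\<^sub>a (?y \<otimes>\<^sub>a ?ez)) = ((?ex \<otimes>\<^sub>a ?y) \<otimes>\<^sub>a ?ez) \<Zsemi> Assoc B ?I Y ?I"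
    using Assoc_nat[of ?ex ?y ?ez] assms by simp
  also have "(((?ex \<otimes>\<^sub>a ?y) \<otimes>\<^sub>a ?ez) \<Zsemi> Assoc B ?I Y ?I) \<Zsemi> ((?i \<otimes>\<^sub>a Run B Y) \<Zsemi> Lun B Y) =
     ((?ex \<otimes>\<^sub>a ?y) \<otimes>\<^sub>a ?ez) \<Zsemi> ((Assoc B ?I Y ?I \<Zsemi> (?i \<otimes>\<^sub>a Run B Y)) \<Zsemi> Lun B Y)"
    using assms by simp
  also have "\<dots> = (((?ex \<otimes>\<^sub>a ?y) \<otimes>\<^sub>a ?ez) \<Zsemi> Run B (?I \<otimes>\<^sub>o Y)) \<Zsemi> Lun B Y"
    using assms by (simp add: Assoc_Run_aux)
  also have "\<dots> = Pr1 M (X \<otimes>\<^sub>o Y) Z \<Zsemi> Pr2 M X Y"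
    using Run_slide[of "?ex \<otimes>\<^sub>a ?y" ?ez] assms by (simp add: R_ob_Pr)
  finally show "?a \<Zsemi> (Pr2 M X (Y \<otimes>\<^sub>o Z) \<Zsemi> Pr1 M Y Z) = Pr1 M (X \<otimes>\<^sub>o Y) Z \<Zsemi> Pr2 M X Y" .
  have "?a \<Zsemi> (Pr2 M X (Y \<otimes>\<^sub>o Z) \<Zsemi> Pr2 M Y Z) =
     ?a \<Zsemi> ((?ex \<otimes>\<^sub>a (?y \<otimes>\<^sub>a ?z)) \<Zsemi> (Lun B (Y \<otimes>\<^sub>o Z) \<Zsemi> Pr2 M Y Z))"
    using assms by (simp add: R_ob_Pr)
  also have "Lun B (Y \<otimes>\<^sub>o Z) \<Zsemi> Pr2 M Y Z = (?i \<otimes>\<^sub>a Pr2 M Y Z) \<Zsemi> Lun B Z"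
    using Lun_nat[of "Pr2 M Y Z"] assms by simp
  also have "?a \<Zsemi> ((?ex \<otimes>\<^sub>a (?y \<otimes>\<^sub>a ?z)) \<Zsemi> ((?i \<otimes>\<^sub>a Pr2 M Y Z) \<Zsemi> Lun B Z)) =
     (?a \<Zsemi> (?ex \<otimes>\<^sub>a (?ey \<otimes>\<^sub>a ?z))) \<Zsemi> ((?i \<otimes>\<^sub>a Lun B Z) \<Zsemi> Lun B Z)"
    using assms by (simp add: R_ob_Pr)
  also have "?a \<Zsemi> (?ex \<otimes>\<^sub>a (?ey \<otimes>\<^sub>a ?z)) = ((?ex \<otimes>\<^sub>a ?ey) \<otimes>\<^sub>a ?z) \<Zsemi> Assoc B ?I ?I Z"
    using Assoc_nat[of ?ex ?ey ?z] assms by simp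
  also have "(((?ex \<otimes>\<^sub>a ?ey) \<otimes>\<^sub>a ?z) \<Zsemi> Assoc B ?I ?I Z) \<Zsemi> ((?i \<otimes>\<^sub>a Lun B Z) \<Zsemi> Lun B Z) =
     ((?ex \<otimes>\<^sub>a ?ey) \<otimes>\<^sub>a ?z) \<Zsemi> ((Assoc B ?I ?I Z \<Zsemi> (?i \<otimes>\<^sub>a Lun B Z)) \<Zsemi> Lun B Z)"
    using assms by simp
  also have "Assoc B ?I ?I Z \<Zsemi> (?i \<otimes>\<^sub>a Lun B Z) = Lun B ?I \<otimes>\<^sub>a ?z" using triangle[of ?I Z] assms by (simp add: Run_Unit)
  also have "((?ex \<otimes>\<^sub>a ?ey) \<otimes>\<^sub>a ?z) \<Zsemi> ((Lun B ?I \<otimes>\<^sub>a ?z) \<Zsemi> Lun B Z) = Pr2 M (X \<otimes>\<^sub>o Y) Z"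
    using assms by (simp add: R_ob_Pr Del_TensOb)
  finally show "?a \<Zsemi> (Pr2 M X (Y \<otimes>\<^sub>o Z) \<Zsemi> Pr2 M Y Z) = Pr2 M (X \<otimes>\<^sub>o Y) Z" .
qed

lemma Assoc_M:
  assumes "X \<in> Ob B" "Y \<in> Ob B" "Z \<in> Ob B"
  shows "Assoc B X Y Z = cart_assoc M X Y Z"
proof (rule M.prod_eqI[of _ _ X "Y \<otimes>\<^sub>o Z"])
  show "Assoc B X Y Z \<Zsemi> Pr2 M X (Y \<otimes>\<^sub>o Z) = cart_assoc M X Y Z \<Zsemi> Pr2 M X (Y \<otimes>\<^sub>o Z)"
    by (rule M.prod_eqI[of _ _ Y Z]) (use assms Assoc_Pr[OF assms] in \<open>simp_all add: cart_assoc_def\<close>)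
qed (use assms Assoc_Pr[OF assms] in \<open>simp_all add: cart_assoc_def\<close>)

lemma Sym_M: "X \<in> Ob B \<Longrightarrow> Y \<in> Ob B \<Longrightarrow> Sym B X Y = cart_sym M X Y"
  by (rule M.prod_eqI[of _ _ Y X]) (simp_all add: cart_sym_def Sym_Pr)

lemma inverse_arrows_M: "inverse_arrows M f g \<Longrightarrow> inverse_arrows B f g"
  by (simp add: inverse_arrows_def in_hom_iff)

lemma inv_Assoc_M:
  assumes "X \<in> Ob B" "Y \<in> Ob B" "Z \<in> Ob B"
  shows "inv_arrow B (Assoc B X Y Z) = cart_assoc_inv M X Y Z"
  using inv_arrow_eq[OF inverse_arrows_M[OF M.inverse_cart_assoc[OF assms]]] Assoc_M[OF assms] by simp

lemma inv_cart_assoc: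
  assumes "X \<in> Ob B" "Y \<in> Ob B" "Z \<in> Ob B"
  shows "inv_arrow B (cart_assoc M X Y Z) = cart_assoc_inv M X Y Z"
  using inv_Assoc_M[OF assms] Assoc_M[OF assms] by simp

text \<open>With these rules an equation between structural maps of \<open>B\<close> becomes an
  equation between tuples of projections in \<open>R_ob B\<close>. Coherence questions below are
  settled by this rewriting.\<close>

lemmas map_cart = Dup_M Tens_M Run_M Lun_M Sym_M inv_cart_assoc[unfolded cart_assoc_def R_ob_simps] Assoc_M cart_defs cart_assoc_inv_def

lemma inv_Assoc_Run:
  assumes "X \<in> Ob B" "Y \<in> Ob B"
  shows "inv_arrow B (Assoc B X Y (Unit B)) \<Zsemi> Run B (X \<otimes>\<^sub>o Y) = Idn B X \<otimes>\<^sub>a Run B Y"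
  using assms by (simp add: map_cart)

section \<open>Meets of predicates\<close>

definition meet :: "('o, 'm) arrow \<Rightarrow> ('o, 'm) arrow \<Rightarrow> ('o, 'm) arrow" where
  "meet U V = Dup B (src U) \<Zsemi> ((U \<otimes>\<^sub>a V) \<Zsemi> Lun B (Unit B))"

lemma meet_simps [simp]:
  assumes "U \<in> Arr B" "V \<in> Arr B" "src V = src U" "tgt U = Unit B" "tgt V = Unit B"
  shows "meet U V \<in> Arr B" "src (meet U V) = src U" "tgt (meet U V) = Unit B"
  using assms by (simp_all add: meet_def)

text \<open>\<open>Del\<close> is the identity on the unit object, so lax naturality of
  \<open>Del\<close> makes it the top predicate.\<close>

lemma le_Del:
  assumes "U \<in> Arr B" "tgt U = Unit B" shows "U \<sqsubseteq> Del B (src U)"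
  using lax_Del[of U "src U" "Unit B"] assms by (simp add: in_hom_iff Del_Unit)

text \<open>Reads the meet as the predicate \<open>U\<close> after an endo-arrow that restricts to
  \<open>V\<close>. The restriction can then be simplified on its own.\<close>

lemma meet_Run:
  assumes "U \<in> Arr B" "V \<in> Arr B" "src V = src U" "tgt U = Unit B" "tgt V = Unit B"
  shows "meet U V = Dup B (src U) \<Zsemi> ((Idn B (src U) \<otimes>\<^sub>a V) \<Zsemi> (Run B (src U) \<Zsemi> U))"
  using assms Run_slide[of U V] by (simp add: meet_def Run_Unit)

lemma meet_Lun:
  assumes "U \<in> Arr B" "V \<in> Arr B" "src V = src U" "tgt U = Unit B" "tgt V = Unit B"
  shows "meet U V = Dup B (src U) \<Zsemi> ((U \<otimes>\<^sub>a Idn B (src U)) \<Zsemi> (Lun B (src U) \<Zsemi> V))"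
  using assms Lun_slide[of V U] by (simp add: meet_def)

lemma meet_Del:
  assumes "U \<in> Arr B" "tgt U = Unit B"
  shows "meet U (Del B (src U)) = U" "meet (Del B (src U)) U = U"
proof -
  have "meet U (Del B (src U)) = (Dup B (src U) \<Zsemi> (Idn B (src U) \<otimes>\<^sub>a Del B (src U))) \<Zsemi> (Run B (src U) \<Zsemi> U)"
    using assms by (simp add: meet_Run del: Dup_Del)
  then show "meet U (Del B (src U)) = U" using assms by simp
  have "meet (Del B (src U)) U = (Dup B (src U) \<Zsemi> (Del B (src U) \<otimes>\<^sub>a Idn B (src U))) \<Zsemi> (Lun B (src U) \<Zsemi> U)"
    using assms by (simp add: meet_Lun del: Dup_Del)
  then show "meet (Del B (src U)) U = U" using assms by simp
qed

lemma meet_mono: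
  assumes "U \<sqsubseteq> U'" "V \<sqsubseteq> V'" "U \<in> Arr B" "V \<in> Arr B" "U' \<in> Arr B" "V' \<in> Arr B"
    "src U = X" "src U' = X" "src V = X" "src V' = X"
    "tgt U = Unit B" "tgt V = Unit B" "tgt U' = Unit B" "tgt V' = Unit B"
  shows "meet U V \<sqsubseteq> meet U' V'"
proof -
  have "U \<otimes>\<^sub>a V \<sqsubseteq> U' \<otimes>\<^sub>a V'" by (rule TensArr_le[OF assms(1,2)]) (use assms in simp_all)
  then have "(U \<otimes>\<^sub>a V) \<Zsemi> Lun B (Unit B) \<sqsubseteq> (U' \<otimes>\<^sub>a V') \<Zsemi> Lun B (Unit B)"
    by (rule Seq_le[OF _ le_refl]) (use assms in simp_all)
  moreover have "X \<in> Ob B" using assms src_Ob by blast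
  ultimately show ?thesis
    unfolding meet_def assms by (intro Seq_le[OF le_refl]) (use assms in simp_all)
qed

text \<open>Replacing one of the predicates by top shows that the meet lies below the other.
  Conversely, lax naturality of \<open>Dup\<close> at \<open>W\<close> says that \<open>W\<close>
  lies below its meet with itself, and meets are monotone.\<close>

lemma le_meet_iff:
  assumes "U \<in> Arr B" "V \<in> Arr B" "W \<in> Arr B" "src U = X" "src V = X" "src W = X"
    "tgt U = Unit B" "tgt V = Unit B" "tgt W = Unit B"
  shows "W \<sqsubseteq> meet U V \<longleftrightarrow> W \<sqsubseteq> U \<and> W \<sqsubseteq> V"
proof (intro iffI)
  have X: "X \<in> Ob B" using assms src_Ob by blast
  have "meet U V \<sqsubseteq> meet U (Del B (src U))" "meet U V \<sqsubseteq> meet (Del B (src V)) V"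
    using meet_mono[OF le_refl le_Del, of U V X] meet_mono[OF le_Del le_refl, of U V X] assms X by simp_all
  then have le: "meet U V \<sqsubseteq> U" "meet U V \<sqsubseteq> V"
    using meet_Del(1)[of U] meet_Del(2)[of V] assms by simp_all
  assume W: "W \<sqsubseteq> meet U V"
  have "W \<sqsubseteq> U" by (rule le_trans[OF W le(1)]) (use assms in simp_all)
  moreover have "W \<sqsubseteq> V" by (rule le_trans[OF W le(2)]) (use assms in simp_all)
  ultimately show "W \<sqsubseteq> U \<and> W \<sqsubseteq> V" ..
next
  assume "W \<sqsubseteq> U \<and> W \<sqsubseteq> V"
  then have 1: "meet W W \<sqsubseteq> meet U V" by (intro meet_mono[of _ _ _ _ X]) (use assms in simp_all)
  have "W \<Zsemi> Dup B (Unit B) \<sqsubseteq> Dup B X \<Zsemi> (W \<otimes>\<^sub>a W)"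
    by (rule lax_Dup) (use assms in \<open>simp add: in_hom_iff\<close>)
  then have "(W \<Zsemi> Dup B (Unit B)) \<Zsemi> Lun B (Unit B) \<sqsubseteq> (Dup B X \<Zsemi> (W \<otimes>\<^sub>a W)) \<Zsemi> Lun B (Unit B)"
    by (rule Seq_le[OF _ le_refl]) (use assms in auto)
  moreover have "X \<in> Ob B" using assms src_Ob by blast
  ultimately have 2: "W \<sqsubseteq> meet W W" using assms by (simp add: meet_def Dup_Unit)
  show "W \<sqsubseteq> meet U V" by (rule le_trans[OF 2 1]) (use assms in simp_all)
qed

text \<open>Elements of a partial order are determined by their lower sets; with
  \<open>le_meet_iff\<close> the semilattice laws become propositional tautologies.\<close>

lemma arrow_eqI:
  assumes "f \<in> Arr B" "g \<in> Arr B" "src f = X" "src g = X" "tgt f = Y" "tgt g = Y"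
    and "\<And>h. h \<in> Arr B \<Longrightarrow> src h = X \<Longrightarrow> tgt h = Y \<Longrightarrow> h \<sqsubseteq> f \<longleftrightarrow> h \<sqsubseteq> g"
  shows "f = g"
  using assms(7)[of f] assms(7)[of g] assms(1-6) by (intro le_antisym) simp_all

lemma map_meet:
  assumes "f \<in> Arr M" "U \<in> Arr B" "V \<in> Arr B" "src V = src U" "tgt f = src U" "tgt U = Unit B" "tgt V = Unit B"
  shows "f \<Zsemi> meet U V = meet (f \<Zsemi> U) (f \<Zsemi> V)"
proof -
  have "f \<Zsemi> meet U V = (f \<Zsemi> Dup B (tgt f)) \<Zsemi> ((U \<otimes>\<^sub>a V) \<Zsemi> Lun B (Unit B))"
    using assms by (simp add: meet_def)
  also have "\<dots> = meet (f \<Zsemi> U) (f \<Zsemi> V)"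
    unfolding map_Dup[OF assms(1)] using assms by (simp add: meet_def)
  finally show ?thesis .
qed

lemma R_ob_doctrine [simp]:
  "Fib M X = {u. Arrow X (Unit B) u \<in> Arr B}"
  "Meet M X u v = lab (meet (Arrow X (Unit B) u) (Arrow X (Unit B) v))"
  "Top M X = lab (Del B X)"
  "Act M f u = lab (f \<Zsemi> Arrow (tgt f) (Unit B) u)"
  "Delta M X = lab (radj B (Dup B X) \<Zsemi> Del B X)"
  unfolding meet_def arrow.sel by (fact R_ob_fibres)+

text \<open>The order that a doctrine derives from its meets is the order of the hom-set, so
  adjointness between fibres can be checked in \<open>B\<close>.\<close>

lemma fib_le_M:
  assumes "Arrow X (Unit B) u \<in> Arr B" "Arrow X (Unit B) v \<in> Arr B"
  shows "fib_le M X u v \<longleftrightarrow> Arrow X (Unit B) u \<sqsubseteq> Arrow X (Unit B) v"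
proof -
  let ?U = "Arrow X (Unit B) u" and ?V = "Arrow X (Unit B) v"
  have "fib_le M X u v \<longleftrightarrow> lab (meet ?U ?V) = lab ?U" by (simp add: fib_le_def)
  also have "\<dots> \<longleftrightarrow> meet ?U ?V = ?U" using assms by (auto intro: arrow.expand)
  also have "\<dots> \<longleftrightarrow> ?U \<sqsubseteq> ?V"
  proof
    assume "meet ?U ?V = ?U"
    then show "?U \<sqsubseteq> ?V" using le_meet_iff[of ?U ?V ?U X] assms by simp
  next
    assume "?U \<sqsubseteq> ?V"
    then have "?U \<sqsubseteq> meet ?U ?V" "meet ?U ?V \<sqsubseteq> ?U"
      using le_meet_iff[of ?U ?V ?U X] le_meet_iff[of ?U ?V "meet ?U ?V" X] assms by simp_all
    then show "meet ?U ?V = ?U" using assms by (intro le_antisym) simp_all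
  qed
  finally show ?thesis .
qed

lemma doctrine_M: "doctrine M"
proof -
  interpret M: cartesian_category M by (rule cartesian_M)
  have A: "Arrow X (Unit B) (lab U) = U" if "U \<in> Arr B" "src U = X" "tgt U = Unit B" for U X
    using that by simp
  show ?thesis
  proof (intro doctrine.intro doctrine_axioms.intro cartesian_M)
    fix X assume "X \<in> Ob M"
    then have X: "X \<in> Ob B" by simp
    show "inf_semilattice (Fib M X) (Meet M X) (Top M X)"
    proof
      fix x y assume "x \<in> Fib M X" "y \<in> Fib M X"
      then have xy: "Arrow X (Unit B) x \<in> Arr B" "Arrow X (Unit B) y \<in> Arr B" by simp_all
      show "Meet M X x y \<in> Fib M X" using xy by simp
      have "meet (Arrow X (Unit B) x) (Arrow X (Unit B) y) = meet (Arrow X (Unit B) y) (Arrow X (Unit B) x)"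
        by (rule arrow_eqI[of _ _ X "Unit B"]) (use xy in \<open>auto simp: le_meet_iff[of _ _ _ X]\<close>)
      then show "Meet M X x y = Meet M X y x" by simp
      fix z assume "z \<in> Fib M X"
      then have z: "Arrow X (Unit B) z \<in> Arr B" by simp
      have "meet (meet (Arrow X (Unit B) x) (Arrow X (Unit B) y)) (Arrow X (Unit B) z) =
          meet (Arrow X (Unit B) x) (meet (Arrow X (Unit B) y) (Arrow X (Unit B) z))"
        by (rule arrow_eqI[of _ _ X "Unit B"]) (use xy z in \<open>auto simp: le_meet_iff[of _ _ _ X]\<close>)
      then show "Meet M X (Meet M X x y) z = Meet M X x (Meet M X y z)" using xy z by simp
    next
      fix x assume "x \<in> Fib M X"
      then have x: "Arrow X (Unit B) x \<in> Arr B" by simp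
      have "meet (Arrow X (Unit B) x) (Arrow X (Unit B) x) = Arrow X (Unit B) x"
        by (rule arrow_eqI[of _ _ X "Unit B"]) (use x in \<open>auto simp: le_meet_iff[of _ _ _ X]\<close>)
      then show "Meet M X x x = x" by simp
      show "Meet M X x (Top M X) = x" using meet_Del(1)[of "Arrow X (Unit B) x"] x X by simp
    next
      show "Top M X \<in> Fib M X" using X by simp
    qed
    show "Act M (Idn M X) x = x" if "x \<in> Fib M X" for x using that X by simp
  next
    fix f X Y assume "f \<in> hom M X Y"
    then have f: "f \<in> Arr M" "src f = X" "tgt f = Y" by (auto simp: in_hom_iff)
    then have O: "X \<in> Ob B" "Y \<in> Ob B" using M.src_Ob[of f] M.tgt_Ob[of f] by auto
    show "Act M f (Top M Y) = Top M X" using map_Del[OF f(1)] f O by simp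
    fix x assume "x \<in> Fib M Y"
    then have x: "Arrow Y (Unit B) x \<in> Arr B" by simp
    show "Act M f x \<in> Fib M X" using f x by simp
    show "Act M f (Meet M Y x y) = Meet M X (Act M f x) (Act M f y)" if "y \<in> Fib M Y" for y
      using that f x map_meet[of f "Arrow Y (Unit B) x" "Arrow Y (Unit B) y"] by simp
  next
    fix f g X Y Z x assume "f \<in> hom M X Y" "g \<in> hom M Y Z" "x \<in> Fib M Z"
    then show "Act M (f \<Zsemi>\<^bsub>M\<^esub> g) x = Act M f (Act M g x)" by (auto simp: in_hom_iff)
  qed
qed

end

lemma (in doctrine) Exq_eqI:
  assumes "tgt p \<in> Ob P" "z \<in> Fib P (tgt p)"
    "\<And>y. y \<in> Fib P (tgt p) \<Longrightarrow> fib_le P (tgt p) z y \<longleftrightarrow> fib_le P (src p) x (Act P p y)"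
  shows "Exq P p x = z"
  unfolding Exq_def
proof (rule the_equality)
  fix w assume "w \<in> Fib P (tgt p) \<and> (\<forall>y\<in>Fib P (tgt p). fib_le P (tgt p) w y \<longleftrightarrow> fib_le P (src p) x (Act P p y))"
  then show "w = z" using assms le_antisym[of "tgt p" w z] le_refl[of "tgt p" w] le_refl[of "tgt p" z] by blast
qed (use assms in auto)

section \<open>Quantifiers and equality in R(B)\<close>

context CB
begin

lemma Exq_M:
  assumes "ladj p" "Arrow (src p) (Unit B) u \<in> Arr B"
  shows "Exq M p u = lab (radj B p \<Zsemi> Arrow (src p) (Unit B) u)"
proof (rule doctrine.Exq_eqI[OF doctrine_M])
  fix y assume "y \<in> Fib M (tgt p)"
  then have y: "Arrow (tgt p) (Unit B) y \<in> Arr B" by simp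
  show "fib_le M (tgt p) (lab (radj B p \<Zsemi> Arrow (src p) (Unit B) u)) y \<longleftrightarrow> fib_le M (src p) u (Act M p y)"
    using ladj_transpose[OF assms(1), of "Arrow (src p) (Unit B) u" "Arrow (tgt p) (Unit B) y"] assms y
    by (simp add: fib_le_M)
qed (use assms in simp_all)

definition equ :: "'o \<Rightarrow> ('o, 'm) arrow" where
  "equ X = radj B (Dup B X) \<Zsemi> Del B X"

lemma equ_simps [simp]:
  assumes "X \<in> Ob B" shows "equ X \<in> Arr B" "src (equ X) = X \<otimes>\<^sub>o X" "tgt (equ X) = Unit B"
  using assms by (simp_all add: equ_def)

text \<open>\<open>Dup_Sym\<close> for right adjoints; the symmetry is its own inverse, hence its
  own right adjoint.\<close>

lemma Sym_radj_Dup: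
  assumes "X \<in> Ob B" shows "Sym B X X \<Zsemi> radj B (Dup B X) = radj B (Dup B X)"
proof -
  have "inverse_arrows B (Sym B X X) (Sym B X X)"
    using assms Sym_Sym by (simp add: inverse_arrows_def in_hom_iff)
  then have "radj B (Sym B X X) = Sym B X X" by (rule radj_inverse)
  then show ?thesis using radj_Seq[of "Dup B X" "Sym B X X"] assms by (simp add: Dup_Sym)
qed

text \<open>The first equation is the Frobenius law followed by \<open>id \<otimes> e\<close>, the second its mirror image.\<close>

lemma restrict_equ:
  assumes X: "X \<in> Ob B"
  shows "Dup B (X \<otimes>\<^sub>o X) \<Zsemi> ((Pr1 M X X \<otimes>\<^sub>a equ X) \<Zsemi> Run B X) = radj B (Dup B X)" (is ?A)
    and "Dup B (X \<otimes>\<^sub>o X) \<Zsemi> ((equ X \<otimes>\<^sub>a Pr2 M X X) \<Zsemi> Lun B X) = radj B (Dup B X)" (is ?B)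
proof -
  let ?d = "Dup B X" and ?i = "Idn B X" and ?XX = "X \<otimes>\<^sub>o X"
  let ?dd = "radj B ?d"
  have "Dup B ?XX \<Zsemi> ((Pr1 M X X \<otimes>\<^sub>a equ X) \<Zsemi> Run B X) =
      (Dup B ?XX \<Zsemi> (Pr1 M X X \<otimes>\<^sub>a Idn B ?XX)) \<Zsemi> ((?i \<otimes>\<^sub>a equ X) \<Zsemi> Run B X)"
    using X by simp
  also have "Dup B ?XX \<Zsemi> (Pr1 M X X \<otimes>\<^sub>a Idn B ?XX) = (?d \<otimes>\<^sub>a ?i) \<Zsemi> Assoc B X X X"
    using X by (simp add: map_cart)
  also have "((?d \<otimes>\<^sub>a ?i) \<Zsemi> Assoc B X X X) \<Zsemi> ((?i \<otimes>\<^sub>a equ X) \<Zsemi> Run B X) =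
      ((?d \<otimes>\<^sub>a ?i) \<Zsemi> (Assoc B X X X \<Zsemi> (?i \<otimes>\<^sub>a ?dd))) \<Zsemi> ((?i \<otimes>\<^sub>a Del B X) \<Zsemi> Run B X)"
    using X by (simp add: equ_def)
  also have "\<dots> = ?dd \<Zsemi> ((?d \<Zsemi> (?i \<otimes>\<^sub>a Del B X)) \<Zsemi> Run B X)"
    unfolding Frobenius[OF X] using X by (simp del: Dup_Del)
  also have "\<dots> = ?dd" using X by simp
  finally show A: ?A .
  have "Dup B ?XX \<Zsemi> ((equ X \<otimes>\<^sub>a Pr2 M X X) \<Zsemi> Lun B X) =
     Dup B ?XX \<Zsemi> (((equ X \<otimes>\<^sub>a Pr2 M X X) \<Zsemi> Sym B (Unit B) X) \<Zsemi> Run B X)"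
    using X by (simp add: Sym_Run)
  also have "(equ X \<otimes>\<^sub>a Pr2 M X X) \<Zsemi> Sym B (Unit B) X = Sym B ?XX ?XX \<Zsemi> (Pr2 M X X \<otimes>\<^sub>a equ X)"
    using Sym_nat[of "equ X" "Pr2 M X X"] X by simp
  also have "Dup B ?XX \<Zsemi> ((Sym B ?XX ?XX \<Zsemi> (Pr2 M X X \<otimes>\<^sub>a equ X)) \<Zsemi> Run B X) =
      (Dup B ?XX \<Zsemi> Sym B ?XX ?XX) \<Zsemi> ((Pr2 M X X \<otimes>\<^sub>a equ X) \<Zsemi> Run B X)"
    using X by simp
  also have "\<dots> = Dup B ?XX \<Zsemi> ((Pr2 M X X \<otimes>\<^sub>a equ X) \<Zsemi> Run B X)" using X by (simp add: Dup_Sym)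
  also have "\<dots> = Dup B ?XX \<Zsemi> (((Sym B X X \<Zsemi> Pr1 M X X) \<otimes>\<^sub>a (Sym B X X \<Zsemi> equ X)) \<Zsemi> Run B X)"
    using X Sym_radj_Dup[OF X] by (simp add: Sym_Pr equ_def Seq_assoc'[symmetric] del: Seq_assoc' M.Seq_assoc')
  also have "\<dots> = (Dup B ?XX \<Zsemi> (Sym B X X \<otimes>\<^sub>a Sym B X X)) \<Zsemi> ((Pr1 M X X \<otimes>\<^sub>a equ X) \<Zsemi> Run B X)"
    using X by simp
  also have "Dup B ?XX \<Zsemi> (Sym B X X \<otimes>\<^sub>a Sym B X X) = Sym B X X \<Zsemi> Dup B ?XX"
    using map_Dup[of "Sym B X X"] X by simp
  also have "(Sym B X X \<Zsemi> Dup B ?XX) \<Zsemi> ((Pr1 M X X \<otimes>\<^sub>a equ X) \<Zsemi> Run B X) = ?dd"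
    using X A Sym_radj_Dup[OF X] by simp
  finally show ?B .
qed

text \<open>A predicate on \<open>V\<close> alone consumes only a copy of \<open>V\<close>, so the
  restriction takes place in the second tensor factor.\<close>

lemma restrict_strength:
  assumes O: "X \<in> Ob B" "V \<in> Ob B" and u: "u \<in> Arr B" "src u = V" "tgt u = Unit B"
  shows "Dup B (X \<otimes>\<^sub>o V) \<Zsemi> ((Idn B (X \<otimes>\<^sub>o V) \<otimes>\<^sub>a (Pr2 M X V \<Zsemi> u)) \<Zsemi> Run B (X \<otimes>\<^sub>o V)) =
         Idn B X \<otimes>\<^sub>a (Dup B V \<Zsemi> ((Idn B V \<otimes>\<^sub>a u) \<Zsemi> Run B V))"
proof -
  let ?W = "X \<otimes>\<^sub>o V" and ?q = "Pr2 M X V"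
  let ?K = "Dup B V \<Zsemi> ((Idn B V \<otimes>\<^sub>a u) \<Zsemi> Run B V)"
  have "Dup B ?W \<Zsemi> ((Idn B ?W \<otimes>\<^sub>a (?q \<Zsemi> u)) \<Zsemi> Run B ?W) =
      (Dup B ?W \<Zsemi> (Idn B ?W \<otimes>\<^sub>a ?q)) \<Zsemi> ((Idn B ?W \<otimes>\<^sub>a u) \<Zsemi> Run B ?W)"
    using O u by simp
  also have "Dup B ?W \<Zsemi> (Idn B ?W \<otimes>\<^sub>a ?q) = (Idn B X \<otimes>\<^sub>a Dup B V) \<Zsemi> inv_arrow B (Assoc B X V V)"
    using O u by (simp add: map_cart)
  also have "((Idn B X \<otimes>\<^sub>a Dup B V) \<Zsemi> inv_arrow B (Assoc B X V V)) \<Zsemi> ((Idn B ?W \<otimes>\<^sub>a u) \<Zsemi> Run B ?W) =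
      (Idn B X \<otimes>\<^sub>a Dup B V) \<Zsemi> ((inv_arrow B (Assoc B X V V) \<Zsemi> ((Idn B X \<otimes>\<^sub>a Idn B V) \<otimes>\<^sub>a u)) \<Zsemi> Run B ?W)"
    using O u by simp
  also have "inv_arrow B (Assoc B X V V) \<Zsemi> ((Idn B X \<otimes>\<^sub>a Idn B V) \<otimes>\<^sub>a u) =
      (Idn B X \<otimes>\<^sub>a (Idn B V \<otimes>\<^sub>a u)) \<Zsemi> inv_arrow B (Assoc B X V (Unit B))"
    using inv_Assoc_nat[of "Idn B X" "Idn B V" u] O u by simp
  also have "(Idn B X \<otimes>\<^sub>a Dup B V) \<Zsemi> (((Idn B X \<otimes>\<^sub>a (Idn B V \<otimes>\<^sub>a u)) \<Zsemi> inv_arrow B (Assoc B X V (Unit B))) \<Zsemi> Run B ?W)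
     = Idn B X \<otimes>\<^sub>a ?K"
    using O u by (simp add: inv_Assoc_Run)
  finally show "Dup B ?W \<Zsemi> ((Idn B ?W \<otimes>\<^sub>a (?q \<Zsemi> u)) \<Zsemi> Run B ?W) = Idn B X \<otimes>\<^sub>a ?K" .
qed

text \<open>Leibniz's law: restricting \<open>(x, a, b)\<close> to \<open>a = b\<close> and mapping it to \<open>(x, a, a)\<close> is below the identity.\<close>

lemma Leibniz:
  assumes O: "X \<in> Ob B" "A \<in> Ob B" and y: "y \<in> Arr B" "src y = X \<otimes>\<^sub>o (A \<otimes>\<^sub>o A)" "tgt y = Unit B"
  shows "meet ((Idn B X \<otimes>\<^sub>a (Pr1 M A A \<Zsemi> Dup B A)) \<Zsemi> y) (Pr2 M X (A \<otimes>\<^sub>o A) \<Zsemi> equ A) \<sqsubseteq> y"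
proof -
  let ?AA = "A \<otimes>\<^sub>o A" and ?W = "X \<otimes>\<^sub>o (A \<otimes>\<^sub>o A)" and ?d = "Dup B A"
  let ?q = "Pr2 M X ?AA" and ?g = "Pr1 M A A \<Zsemi> ?d"
  let ?G = "Idn B X \<otimes>\<^sub>a ?g"
  let ?K = "Dup B ?AA \<Zsemi> ((Idn B ?AA \<otimes>\<^sub>a equ A) \<Zsemi> Run B ?AA)"
  have C: "Dup B ?W \<Zsemi> ((Idn B ?W \<otimes>\<^sub>a (?q \<Zsemi> equ A)) \<Zsemi> Run B ?W) = Idn B X \<otimes>\<^sub>a ?K"
    using restrict_strength[of X ?AA "equ A"] O by simp
  have "?K \<Zsemi> ?g = (Dup B ?AA \<Zsemi> (((Idn B ?AA \<otimes>\<^sub>a equ A) \<Zsemi> (Run B ?AA \<Zsemi> Pr1 M A A)))) \<Zsemi> ?d"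
    using O by simp
  also have "(Idn B ?AA \<otimes>\<^sub>a equ A) \<Zsemi> (Run B ?AA \<Zsemi> Pr1 M A A) = (Pr1 M A A \<otimes>\<^sub>a equ A) \<Zsemi> Run B A"
    using Run_slide[of "Pr1 M A A" "equ A"] O by simp
  also have "Dup B ?AA \<Zsemi> ((Pr1 M A A \<otimes>\<^sub>a equ A) \<Zsemi> Run B A) = radj B ?d" using restrict_equ(1) O by simp
  finally have K: "?K \<Zsemi> ?g = radj B ?d \<Zsemi> ?d" .
  have "meet (?G \<Zsemi> y) (?q \<Zsemi> equ A) = (Dup B ?W \<Zsemi> ((Idn B ?W \<otimes>\<^sub>a (?q \<Zsemi> equ A)) \<Zsemi> Run B ?W)) \<Zsemi> (?G \<Zsemi> y)"
    using O y by (simp add: meet_Run)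
  also have "\<dots> = (Idn B X \<otimes>\<^sub>a (?K \<Zsemi> ?g)) \<Zsemi> y" unfolding C using O y by simp
  also have "\<dots> = (Idn B X \<otimes>\<^sub>a (radj B ?d \<Zsemi> ?d)) \<Zsemi> y" unfolding K ..
  also have "\<dots> \<sqsubseteq> (Idn B X \<otimes>\<^sub>a Idn B ?AA) \<Zsemi> y"
    using ladj_counit[of ?d] O y by (intro Seq_le[OF TensArr_le[OF le_refl _] le_refl]) simp_all
  finally show ?thesis using O y by simp
qed

text \<open>Frobenius reciprocity before predicates are attached. The right adjoint of
  \<open>Pr1\<close> creates the component in \<open>Y\<close>, and by naturality this can be done
  before or after \<open>X\<close> is copied.\<close>

lemma Pr1_Frobenius:
  assumes O: "X \<in> Ob B" "Y \<in> Ob B"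
  shows "radj B (Pr1 M X Y) \<Zsemi> (Dup B (X \<otimes>\<^sub>o Y) \<Zsemi> (Pr1 M X Y \<otimes>\<^sub>a Idn B (X \<otimes>\<^sub>o Y))) =
         Dup B X \<Zsemi> (Idn B X \<otimes>\<^sub>a radj B (Pr1 M X Y))"
proof -
  let ?e = "radj B (Del B Y)" and ?d = "Dup B X" and ?I = "Unit B"
  have r: "radj B (Pr1 M X Y) = inv_arrow B (Run B X) \<Zsemi> (Idn B X \<otimes>\<^sub>a ?e)"
    using O by (simp add: R_ob_Pr radj_Seq radj_Tens radj_iso)
  have "Dup B (X \<otimes>\<^sub>o Y) \<Zsemi> (Pr1 M X Y \<otimes>\<^sub>a Idn B (X \<otimes>\<^sub>o Y)) = (?d \<otimes>\<^sub>a Idn B Y) \<Zsemi> Assoc B X X Y"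
    using O by (simp add: map_cart)
  then have "radj B (Pr1 M X Y) \<Zsemi> (Dup B (X \<otimes>\<^sub>o Y) \<Zsemi> (Pr1 M X Y \<otimes>\<^sub>a Idn B (X \<otimes>\<^sub>o Y))) =
     (inv_arrow B (Run B X) \<Zsemi> (?d \<otimes>\<^sub>a Idn B ?I)) \<Zsemi> (((Idn B X \<otimes>\<^sub>a Idn B X) \<otimes>\<^sub>a ?e) \<Zsemi> Assoc B X X Y)"
    unfolding r using O by simp
  also have "inv_arrow B (Run B X) \<Zsemi> (?d \<otimes>\<^sub>a Idn B ?I) = ?d \<Zsemi> inv_arrow B (Run B (X \<otimes>\<^sub>o X))"
    using inv_Run_nat[of ?d] O by simp
  also have "((Idn B X \<otimes>\<^sub>a Idn B X) \<otimes>\<^sub>a ?e) \<Zsemi> Assoc B X X Y = Assoc B X X ?I \<Zsemi> (Idn B X \<otimes>\<^sub>a (Idn B X \<otimes>\<^sub>a ?e))"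
    using Assoc_nat[of "Idn B X" "Idn B X" ?e] O by simp
  also have "(?d \<Zsemi> inv_arrow B (Run B (X \<otimes>\<^sub>o X))) \<Zsemi> (Assoc B X X ?I \<Zsemi> (Idn B X \<otimes>\<^sub>a (Idn B X \<otimes>\<^sub>a ?e)))
     = ?d \<Zsemi> ((inv_arrow B (Run B (X \<otimes>\<^sub>o X)) \<Zsemi> Assoc B X X ?I) \<Zsemi> (Idn B X \<otimes>\<^sub>a (Idn B X \<otimes>\<^sub>a ?e)))"
    using O by simp
  also have "inv_arrow B (Run B (X \<otimes>\<^sub>o X)) \<Zsemi> Assoc B X X ?I = Idn B X \<otimes>\<^sub>a inv_arrow B (Run B X)"
  proof (rule iso_cancel_left[of "inv_arrow B (Assoc B X X ?I) \<Zsemi> Run B (X \<otimes>\<^sub>o X)"])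
    show "(inv_arrow B (Assoc B X X ?I) \<Zsemi> Run B (X \<otimes>\<^sub>o X)) \<Zsemi> (inv_arrow B (Run B (X \<otimes>\<^sub>o X)) \<Zsemi> Assoc B X X ?I) =
        (inv_arrow B (Assoc B X X ?I) \<Zsemi> Run B (X \<otimes>\<^sub>o X)) \<Zsemi> (Idn B X \<otimes>\<^sub>a inv_arrow B (Run B X))"
      using O by (subst (2) inv_Assoc_Run) simp_all
  qed (use O in \<open>simp_all add: is_iso_Seq\<close>)
  finally show ?thesis unfolding r using O by simp
qed

text \<open>Inverses in the category of maps are inverses in \<open>B\<close>, so a projection is an
  isomorphism followed by \<open>Pr1\<close> there too. It is thus a left adjoint, with a right
  adjoint that is known up to this isomorphism.\<close>

lemma M_projection:
  assumes "is_projection M p"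
  obtains Y h where "p \<in> Arr M" "Y \<in> Ob B" "is_iso B h" "h \<in> Arr M" "inv_arrow B h \<in> Arr M" "src h = src p"
    "tgt h = tgt p \<otimes>\<^sub>o Y" "p = h \<Zsemi> Pr1 M (tgt p) Y" "ladj p" "radj B p = radj B (Pr1 M (tgt p) Y) \<Zsemi> inv_arrow B h"
proof -
  obtain Y h where p: "p \<in> Arr M" and Y: "Y \<in> Ob B" and h: "is_iso M h" "src h = src p" "tgt h = tgt p \<otimes>\<^sub>o Y"
    and ph: "p = h \<Zsemi> Pr1 M (tgt p) Y"
    using assms unfolding M.is_projection_iff by blast
  obtain k where k: "inverse_arrows M h k" using h(1) by (auto simp: is_iso_def)
  have hk: "inverse_arrows B h k" by (rule inverse_arrows_M[OF k])
  then have hi: "is_iso B h" "inv_arrow B h = k" by (auto simp: is_iso_def inv_arrow_eq)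
  have hM: "h \<in> Arr M" "k \<in> Arr M" using k by (auto simp: inverse_arrows_def in_hom_iff)
  have o: "tgt p \<in> Ob B" using p by simp
  have "ladj (h \<Zsemi> Pr1 M (tgt p) Y)" "radj B (h \<Zsemi> Pr1 M (tgt p) Y) = radj B (Pr1 M (tgt p) Y) \<Zsemi> inv_arrow B h"
    using hi hM h Y o by (simp_all add: ladj_iso radj_Seq radj_iso)
  then show thesis using that[OF p Y hi(1) hM(1)] hM hi h ph by metis
qed

text \<open>\<open>E\<close> stands for id \<times> \<Delta> and \<open>s\<close> for its retraction
  onto the first two variables, so \<open>s \<Zsemi> E\<close> sends (x, a, b) to (x, a, a). Left to
  right, the meet is reindexed along \<open>E\<close>, where the equality predicate is top. Right to
  left is \<open>Leibniz\<close>.\<close>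

lemma elementary_aux:
  assumes O: "X \<in> Ob B" "A \<in> Ob B"
    and m: "E \<in> Arr M" "src E = X \<otimes>\<^sub>o A" "tgt E = X \<otimes>\<^sub>o (A \<otimes>\<^sub>o A)"
      "s \<in> Arr M" "src s = X \<otimes>\<^sub>o (A \<otimes>\<^sub>o A)" "tgt s = X \<otimes>\<^sub>o A"
    and sE: "s \<Zsemi> E = Idn B X \<otimes>\<^sub>a (Pr1 M A A \<Zsemi> Dup B A)" and Es: "E \<Zsemi> s = Idn B (X \<otimes>\<^sub>o A)"
    and Et: "E \<Zsemi> Pr2 M X (A \<otimes>\<^sub>o A) = Pr2 M X A \<Zsemi> Dup B A"
    and x: "x \<in> Arr B" "src x = X \<otimes>\<^sub>o A" "tgt x = Unit B"
    and y: "y \<in> Arr B" "src y = X \<otimes>\<^sub>o (A \<otimes>\<^sub>o A)" "tgt y = Unit B"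
  shows "meet (s \<Zsemi> x) (Pr2 M X (A \<otimes>\<^sub>o A) \<Zsemi> equ A) \<sqsubseteq> y \<longleftrightarrow> x \<sqsubseteq> E \<Zsemi> y"
proof
    assume le: "meet (s \<Zsemi> x) (Pr2 M X (A \<otimes>\<^sub>o A) \<Zsemi> equ A) \<sqsubseteq> y"
    \<comment> \<open>Reflexivity: by the unit of the adjunction of \<open>Dup\<close>, the
      predicate \<open>equ A\<close> is top on the diagonal.\<close>
    have "Idn B A \<Zsemi> Del B A \<sqsubseteq> (Dup B A \<Zsemi> radj B (Dup B A)) \<Zsemi> Del B A"
      by (rule Seq_le[OF _ le_refl]) (use ladj_unit[of "Dup B A"] O in simp_all)
    then have "Del B A \<sqsubseteq> Dup B A \<Zsemi> equ A" using O by (simp add: equ_def)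
    from Seq_le[OF le_refl this, of "Pr2 M X A"] have "Pr2 M X A \<Zsemi> Del B A \<sqsubseteq> Pr2 M X A \<Zsemi> (Dup B A \<Zsemi> equ A)"
      using O by simp
    then have D: "Del B (X \<otimes>\<^sub>o A) \<sqsubseteq> Pr2 M X A \<Zsemi> (Dup B A \<Zsemi> equ A)"
      using map_Del[of "Pr2 M X A"] O by simp
    have "x \<sqsubseteq> Pr2 M X A \<Zsemi> (Dup B A \<Zsemi> equ A)"
      by (rule le_trans[OF _ D]) (use le_Del[of x] x O in simp_all)
    then have 1: "x \<sqsubseteq> meet x (Pr2 M X A \<Zsemi> (Dup B A \<Zsemi> equ A))"
      using le_meet_iff[of x "Pr2 M X A \<Zsemi> (Dup B A \<Zsemi> equ A)" x "X \<otimes>\<^sub>o A"] x O by simp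
    have "E \<Zsemi> meet (s \<Zsemi> x) (Pr2 M X (A \<otimes>\<^sub>o A) \<Zsemi> equ A) = meet ((E \<Zsemi> s) \<Zsemi> x) ((E \<Zsemi> Pr2 M X (A \<otimes>\<^sub>o A)) \<Zsemi> equ A)"
      using map_meet[of E "s \<Zsemi> x" "Pr2 M X (A \<otimes>\<^sub>o A) \<Zsemi> equ A"] x O m by simp
    also have "\<dots> = meet x (Pr2 M X A \<Zsemi> (Dup B A \<Zsemi> equ A))" unfolding Es Et using x O by simp
    finally have 2: "meet x (Pr2 M X A \<Zsemi> (Dup B A \<Zsemi> equ A)) = E \<Zsemi> meet (s \<Zsemi> x) (Pr2 M X (A \<otimes>\<^sub>o A) \<Zsemi> equ A)" ..
    have 3: "E \<Zsemi> meet (s \<Zsemi> x) (Pr2 M X (A \<otimes>\<^sub>o A) \<Zsemi> equ A) \<sqsubseteq> E \<Zsemi> y"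
      by (rule Seq_le[OF le_refl le]) (use x y O m in simp_all)
    show "x \<sqsubseteq> E \<Zsemi> y" by (rule le_trans[OF 1[unfolded 2] 3]) (use x y O m in simp_all)
next
    assume le: "x \<sqsubseteq> E \<Zsemi> y"
    have "s \<Zsemi> x \<sqsubseteq> s \<Zsemi> (E \<Zsemi> y)" by (rule Seq_le[OF le_refl le]) (use x y O m in simp_all)
    also have "s \<Zsemi> (E \<Zsemi> y) = (s \<Zsemi> E) \<Zsemi> y" by (rule Seq_assoc'[symmetric]) (use y O m in simp_all)
    finally have "s \<Zsemi> x \<sqsubseteq> (Idn B X \<otimes>\<^sub>a (Pr1 M A A \<Zsemi> Dup B A)) \<Zsemi> y" unfolding sE .
    then have 1: "meet (s \<Zsemi> x) (Pr2 M X (A \<otimes>\<^sub>o A) \<Zsemi> equ A) \<sqsubseteq> meet ((Idn B X \<otimes>\<^sub>a (Pr1 M A A \<Zsemi> Dup B A)) \<Zsemi> y) (Pr2 M X (A \<otimes>\<^sub>o A) \<Zsemi> equ A)"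
      by (rule meet_mono[OF _ le_refl]) (use x y O m in simp_all)
    show "meet (s \<Zsemi> x) (Pr2 M X (A \<otimes>\<^sub>o A) \<Zsemi> equ A) \<sqsubseteq> y"
      by (rule le_trans[OF 1 Leibniz]) (use x y O m in simp_all)
qed

theorem EED_M: "elementary_existential_doctrine M"
proof -
  interpret D: doctrine M by (rule doctrine_M)
  let ?I = "Unit B"
  show ?thesis
  proof
    fix A assume "A \<in> Ob M"
    then show "Delta M A \<in> Fib M (A \<times>\<^sub>o\<^bsub>M\<^esub> A)" by simp
  next
    fix X A assume "X \<in> Ob M" "A \<in> Ob M"
    then have O: "X \<in> Ob B" "A \<in> Ob B" by auto
    let ?AA = "A \<otimes>\<^sub>o A" and ?W = "X \<otimes>\<^sub>o (A \<otimes>\<^sub>o A)" and ?XA = "X \<otimes>\<^sub>o A"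
    let ?E = "Idn M X \<times>\<^sub>a\<^bsub>M\<^esub> diag M A"
    let ?s = "\<langle>tri1 M X A A, tri2 M X A A\<rangle>\<^bsub>M\<^esub>" and ?t = "\<langle>tri2 M X A A, tri3 M X A A\<rangle>\<^bsub>M\<^esub>"
    have sE: "?s \<Zsemi> ?E = Idn B X \<otimes>\<^sub>a (Pr1 M A A \<Zsemi> Dup B A)" and t: "?t = Pr2 M X ?AA"
      and Es: "?E \<Zsemi> ?s = Idn B ?XA" and Et: "?E \<Zsemi> Pr2 M X ?AA = Pr2 M X A \<Zsemi> Dup B A"
      using O by (simp_all add: map_cart)
    have m: "?E \<in> Arr M" "src ?E = ?XA" "tgt ?E = ?W" "?s \<in> Arr M" "src ?s = ?W" "tgt ?s = ?XA" using O by simp_all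
    note key = elementary_aux[OF O m sE Es Et]
    show "is_left_adjoint M ?E (\<lambda>x. Meet M (X \<times>\<^sub>o\<^bsub>M\<^esub> (A \<times>\<^sub>o\<^bsub>M\<^esub> A)) (Act M ?s x) (Act M ?t (Delta M A)))"
      unfolding is_left_adjoint_def
    proof (intro ballI conjI)
      fix x assume "x \<in> Fib M (src ?E)"
      then have x: "Arrow ?XA ?I x \<in> Arr B" using m by simp
      have h: "Meet M (X \<times>\<^sub>o\<^bsub>M\<^esub> (A \<times>\<^sub>o\<^bsub>M\<^esub> A)) (Act M ?s x) (Act M ?t (Delta M A)) =
          lab (meet (?s \<Zsemi> Arrow ?XA ?I x) (Pr2 M X ?AA \<Zsemi> equ A))"
        unfolding t using m O x by (simp add: equ_def)
      show "Meet M (X \<times>\<^sub>o\<^bsub>M\<^esub> (A \<times>\<^sub>o\<^bsub>M\<^esub> A)) (Act M ?s x) (Act M ?t (Delta M A)) \<in> Fib M (tgt ?E)"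
        unfolding h using m O x by simp
      fix y assume "y \<in> Fib M (tgt ?E)"
      then have y: "Arrow ?W ?I y \<in> Arr B" using m by simp
      show "fib_le M (tgt ?E) (Meet M (X \<times>\<^sub>o\<^bsub>M\<^esub> (A \<times>\<^sub>o\<^bsub>M\<^esub> A)) (Act M ?s x) (Act M ?t (Delta M A))) y \<longleftrightarrow>
          fib_le M (src ?E) x (Act M ?E y)"
        unfolding h using key[of "Arrow ?XA ?I x" "Arrow ?W ?I y"] m O x y
        by (simp add: fib_le_M)
    qed
  next
    fix p assume "is_projection M p"
    then obtain "ladj p" by (rule M_projection)
    then show "\<exists>h. is_left_adjoint M p h"
      using ladj_transpose[of p]
      by (intro exI[of _ "\<lambda>u. lab (radj B p \<Zsemi> Arrow (src p) ?I u)"]) (simp add: is_left_adjoint_def fib_le_M)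
  next
    fix p f p' f' x assume p: "is_projection M p" and pb: "is_pullback M f p f' p'" and "x \<in> Fib M (src p)"
    then have x: "Arrow (src p) ?I x \<in> Arr B" by simp
    from p obtain Y h where p: "p \<in> Arr M" "Y \<in> Ob B" "is_iso B h" "h \<in> Arr M" "inv_arrow B h \<in> Arr M" "src h = src p"
      "tgt h = tgt p \<otimes>\<^sub>o Y" "p = h \<Zsemi> Pr1 M (tgt p) Y" "ladj p" "radj B p = radj B (Pr1 M (tgt p) Y) \<Zsemi> inv_arrow B h"
      by (rule M_projection)
    note pp = p(1-7,9)
    define X Z where XZ: "X = tgt p" "Z = src f"
    have o: "X \<in> Ob B" "Z \<in> Ob B" using pp pb by (auto simp: XZ is_pullback_def)
    have sq: "f \<in> Arr M" "src f = Z" "tgt f = X" "p' \<in> Arr M" "tgt p' = Z" "f' \<in> Arr M" "src f' = src p'" "tgt f' = src p"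
      "p' \<Zsemi> f = f' \<Zsemi> p"
      using pb by (auto simp: is_pullback_def in_hom_iff XZ)
    note XZ = XZ[symmetric]
    have univ: "\<exists>!k. k \<in> hom M V (src p') \<and> k \<Zsemi> p' = u \<and> k \<Zsemi> f' = v"
      if "u \<in> hom M V Z" "v \<in> hom M V (src p)" "u \<Zsemi> f = v \<Zsemi> p" for V u v
      using pb that M.hom_Ob(1)[OF that(1)] by (simp add: is_pullback_def XZ)
    \<comment> \<open>For the square with sides \<open>?f\<close> and \<open>Pr1 M Z Y\<close> over
      the chosen projection, Beck-Chevalley is naturality of the unitor (\<open>BC\<close>). The
      given pullback is compared with this square by mutually inverse maps \<open>k\<close> and
      \<open>l\<close>, obtained from the two universal properties.\<close>
    let ?ZY = "Z \<otimes>\<^sub>o Y" and ?f = "f \<otimes>\<^sub>a Idn B Y"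
    have ph: "p = h \<Zsemi> Pr1 M X Y" using p(8) by (simp only: XZ)
    have "inv_arrow B h \<Zsemi> p = Pr1 M X Y" by (subst ph) (use pp o XZ in simp)
    then have "Pr1 M Z Y \<Zsemi> f = (?f \<Zsemi> inv_arrow B h) \<Zsemi> p"
      using Tens_Pr(1)[of f "Idn B Y"] sq pp o XZ by simp
    then obtain k where k: "k \<in> hom M ?ZY (src p')" "k \<Zsemi> p' = Pr1 M Z Y" "k \<Zsemi> f' = ?f \<Zsemi> inv_arrow B h"
      using univ[of "Pr1 M Z Y" ?ZY "?f \<Zsemi> inv_arrow B h"] sq pp o XZ by (auto simp: in_hom_iff)
    have f'h: "(f' \<Zsemi> h) \<Zsemi> Pr1 M X Y = p' \<Zsemi> f" using sq pp o XZ by (simp add: ph[symmetric])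
    define l where "l = \<langle>p', (f' \<Zsemi> h) \<Zsemi> Pr2 M X Y\<rangle>\<^bsub>M\<^esub>"
    have l: "l \<in> Arr M" "src l = src p'" "tgt l = ?ZY" "l \<Zsemi> Pr1 M Z Y = p'" "l \<Zsemi> Pr2 M Z Y = (f' \<Zsemi> h) \<Zsemi> Pr2 M X Y"
      using sq pp o XZ by (simp_all add: l_def)
    have k': "k \<in> Arr M" "src k = ?ZY" "tgt k = src p'" using k by (auto simp: in_hom_iff)
    have kfh: "k \<Zsemi> (f' \<Zsemi> h) = ?f"
    proof -
      have "k \<Zsemi> (f' \<Zsemi> h) = (k \<Zsemi> f') \<Zsemi> h" using k' sq pp by simp
      also have "\<dots> = ?f" unfolding k(3) using sq pp o XZ by simp
      finally show ?thesis .
    qed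
    have kl: "k \<Zsemi> l = Idn B ?ZY"
    proof (rule M.prod_eqI[of _ _ Z Y])
      have "(k \<Zsemi> l) \<Zsemi> Pr1 M Z Y = k \<Zsemi> p'" using k' l o pp by simp
      then show "(k \<Zsemi> l) \<Zsemi> Pr1 M Z Y = Idn B ?ZY \<Zsemi> Pr1 M Z Y" using k o pp by simp
      have "(k \<Zsemi> l) \<Zsemi> Pr2 M Z Y = (k \<Zsemi> (f' \<Zsemi> h)) \<Zsemi> Pr2 M X Y" using k' l o pp sq XZ by simp
      also have "\<dots> = Pr2 M Z Y" unfolding kfh using Tens_Pr(2)[of f "Idn B Y"] sq pp o by simp
      finally show "(k \<Zsemi> l) \<Zsemi> Pr2 M Z Y = Idn B ?ZY \<Zsemi> Pr2 M Z Y" using o pp by simp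
    qed (use k' l o pp in simp_all)
    have lf: "l \<Zsemi> ?f = f' \<Zsemi> h"
    proof (rule M.prod_eqI[of _ _ X Y])
      have "(l \<Zsemi> ?f) \<Zsemi> Pr1 M X Y = (l \<Zsemi> Pr1 M Z Y) \<Zsemi> f"
        using Tens_Pr(1)[of f "Idn B Y"] l(1-3) sq(1-8) o pp by simp
      then show "(l \<Zsemi> ?f) \<Zsemi> Pr1 M X Y = (f' \<Zsemi> h) \<Zsemi> Pr1 M X Y" unfolding f'h l(4) .
      have "(l \<Zsemi> ?f) \<Zsemi> Pr2 M X Y = l \<Zsemi> Pr2 M Z Y"
        using Tens_Pr(2)[of f "Idn B Y"] l(1-3) sq(1-8) o pp by simp
      then show "(l \<Zsemi> ?f) \<Zsemi> Pr2 M X Y = (f' \<Zsemi> h) \<Zsemi> Pr2 M X Y" unfolding l(5) .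
    qed (use l sq o pp XZ in simp_all)
    have lk: "l \<Zsemi> k = Idn B (src p')"
    proof -
      have s: "src p' \<in> Ob B" using sq by simp
      have "(l \<Zsemi> k) \<Zsemi> p' = p'" using l k k' sq by simp
      moreover have "(l \<Zsemi> k) \<Zsemi> f' = f'"
      proof -
        have "(l \<Zsemi> k) \<Zsemi> f' = l \<Zsemi> (?f \<Zsemi> inv_arrow B h)" using l k k' sq by simp
        also have "\<dots> = (f' \<Zsemi> h) \<Zsemi> inv_arrow B h" unfolding lf[symmetric] using l sq pp o XZ by simp
        finally show ?thesis using sq pp by simp
      qed
      ultimately have A: "l \<Zsemi> k \<in> hom M (src p') (src p') \<and> (l \<Zsemi> k) \<Zsemi> p' = p' \<and> (l \<Zsemi> k) \<Zsemi> f' = f'"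
        using l(1-3) k' by (simp add: in_hom_iff)
      have "Idn B (src p') \<in> hom M (src p') (src p') \<and> Idn B (src p') \<Zsemi> p' = p' \<and> Idn B (src p') \<Zsemi> f' = f'"
        using sq s by (simp add: in_hom_iff)
      moreover have "\<exists>!m. m \<in> hom M (src p') (src p') \<and> m \<Zsemi> p' = p' \<and> m \<Zsemi> f' = f'"
        using univ[of p' "src p'" f'] sq by (simp add: in_hom_iff)
      ultimately show ?thesis using A by blast
    qed
    have inv: "inverse_arrows B l k" using l k' kl lk sq by (auto simp: inverse_arrows_def in_hom_iff)
    then have li: "ladj l" "radj B l = k" by (rule radj_inverse)+
    have p': "ladj p'" "radj B p' = radj B (Pr1 M Z Y) \<Zsemi> k"
      using radj_Seq[OF li(1), of "Pr1 M Z Y"] ladj_Seq[OF li(1), of "Pr1 M Z Y"] li l o pp by simp_all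
    have rp: "radj B p = radj B (Pr1 M X Y) \<Zsemi> inv_arrow B h" using p(10) by (simp only: XZ)
    have r: "radj B (Pr1 M X Y) = inv_arrow B (Run B X) \<Zsemi> (Idn B X \<otimes>\<^sub>a radj B (Del B Y))" if "X \<in> Ob B" for X
      using that p(2) by (simp add: R_ob_Pr radj_Seq radj_Tens radj_iso)
    have "f \<Zsemi> radj B (Pr1 M X Y) = (f \<Zsemi> inv_arrow B (Run B X)) \<Zsemi> (Idn B X \<otimes>\<^sub>a radj B (Del B Y))"
      unfolding r[OF o(1)] using sq o pp by simp
    also have "f \<Zsemi> inv_arrow B (Run B X) = inv_arrow B (Run B Z) \<Zsemi> (f \<otimes>\<^sub>a Idn B ?I)"
      using inv_Run_nat[of f] sq by simp
    also have "(inv_arrow B (Run B Z) \<Zsemi> (f \<otimes>\<^sub>a Idn B ?I)) \<Zsemi> (Idn B X \<otimes>\<^sub>a radj B (Del B Y)) = radj B (Pr1 M Z Y) \<Zsemi> ?f"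
      unfolding r[OF o(2)] using sq o pp by simp
    finally have BC: "f \<Zsemi> radj B (Pr1 M X Y) = radj B (Pr1 M Z Y) \<Zsemi> ?f" .
    have "f \<Zsemi> radj B p = (f \<Zsemi> radj B (Pr1 M X Y)) \<Zsemi> inv_arrow B h" unfolding rp using sq o pp XZ by simp
    also have "\<dots> = radj B (Pr1 M Z Y) \<Zsemi> (k \<Zsemi> f')" unfolding BC k(3) using sq o pp XZ by simp
    also have "\<dots> = radj B p' \<Zsemi> f'" unfolding p' using k' sq o pp by simp
    finally have "f \<Zsemi> (radj B p \<Zsemi> Arrow (src p) ?I x) = radj B p' \<Zsemi> (f' \<Zsemi> Arrow (src p) ?I x)"
      using Seq_assoc'[of f "radj B p" "Arrow (src p) ?I x"] Seq_assoc'[of "radj B p'" f' "Arrow (src p) ?I x"]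
        sq(1-8) pp p'(1) x XZ by simp
    then show "Act M f (Exq M p x) = Exq M p' (Act M f' x)"
      using sq(1-8) pp p'(1) x XZ by (simp add: Exq_M)
  next
    fix p x y assume p: "is_projection M p" and "x \<in> Fib M (tgt p)" "y \<in> Fib M (src p)"
    then have "Arrow (tgt p) ?I x \<in> Arr B" "Arrow (src p) ?I y \<in> Arr B" by simp_all
    then obtain x' y' where x': "x' = Arrow (tgt p) ?I x" "x' \<in> Arr B" "src x' = tgt p" "tgt x' = ?I" "x = lab x'"
       and y': "y' = Arrow (src p) ?I y" "y' \<in> Arr B" "src y' = src p" "tgt y' = ?I" "y = lab y'" by simp
    from p obtain Y h where p: "p \<in> Arr M" "Y \<in> Ob B" "is_iso B h" "h \<in> Arr M" "inv_arrow B h \<in> Arr M" "src h = src p"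
      "tgt h = tgt p \<otimes>\<^sub>o Y" "p = h \<Zsemi> Pr1 M (tgt p) Y" "ladj p" "radj B p = radj B (Pr1 M (tgt p) Y) \<Zsemi> inv_arrow B h"
      by (rule M_projection)
    note pp = p(1-7,9)
    define X where "X = tgt p"
    have o: "X \<in> Ob B" using pp by (simp add: X_def)
    let ?p = "Pr1 M X Y" and ?h = "inv_arrow B h"
    have ph: "p = h \<Zsemi> ?p" and rp: "radj B p = radj B ?p \<Zsemi> ?h" using p(8,10) by (simp_all only: X_def)
    have hp: "?h \<Zsemi> p = ?p" by (subst ph) (use pp o X_def in simp)
    \<comment> \<open>The isomorphism \<open>h\<close> is pushed into the meet, which leaves the
      chosen projection and \<open>Pr1_Frobenius\<close>.\<close>
    have "radj B p \<Zsemi> meet (p \<Zsemi> x') y' = radj B ?p \<Zsemi> (?h \<Zsemi> meet (p \<Zsemi> x') y')"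
      unfolding rp using x'(2-4) y'(2-4) pp o X_def by simp
    also have "?h \<Zsemi> meet (p \<Zsemi> x') y' = meet ((?h \<Zsemi> p) \<Zsemi> x') (?h \<Zsemi> y')"
      using map_meet[of ?h "p \<Zsemi> x'" y'] x'(2-4) y'(2-4) pp o X_def by simp
    also have "\<dots> = (Dup B (X \<otimes>\<^sub>o Y) \<Zsemi> (?p \<otimes>\<^sub>a Idn B (X \<otimes>\<^sub>o Y))) \<Zsemi> ((x' \<otimes>\<^sub>a (?h \<Zsemi> y')) \<Zsemi> Lun B ?I)"
      unfolding hp meet_def using x'(2-4) y'(2-4) pp o X_def by simp
    also have "radj B ?p \<Zsemi> ((Dup B (X \<otimes>\<^sub>o Y) \<Zsemi> (?p \<otimes>\<^sub>a Idn B (X \<otimes>\<^sub>o Y))) \<Zsemi> ((x' \<otimes>\<^sub>a (?h \<Zsemi> y')) \<Zsemi> Lun B ?I)) =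
       (radj B ?p \<Zsemi> (Dup B (X \<otimes>\<^sub>o Y) \<Zsemi> (?p \<otimes>\<^sub>a Idn B (X \<otimes>\<^sub>o Y)))) \<Zsemi> ((x' \<otimes>\<^sub>a (?h \<Zsemi> y')) \<Zsemi> Lun B ?I)"
      using x'(2-4) y'(2-4) pp o X_def by simp
    also have "\<dots> = meet x' (radj B p \<Zsemi> y')"
      unfolding Pr1_Frobenius[OF o pp(2)] rp meet_def using x'(2-4) y'(2-4) pp o X_def by simp
    finally have "radj B p \<Zsemi> meet (p \<Zsemi> x') y' = meet x' (radj B p \<Zsemi> y')" .
    then show "Exq M p (Meet M (src p) (Act M p x) y) = Meet M (tgt p) x (Exq M p y)"
      using x'(2-4) y'(2-4) p(1,9) by (simp add: Exq_M x'(1)[symmetric] y'(1)[symmetric])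
  qed
qed

end

section \<open>Bending a wire\<close>

context CB
begin

definition bend :: "('o, 'm) arrow \<Rightarrow> ('o, 'm) arrow" where
  "bend S = (S \<otimes>\<^sub>a Idn B (tgt S)) \<Zsemi> equ (tgt S)"

text \<open>The counit formula read as a quantifier: choose an element of \<open>Y\<close>, restrict
  to \<open>r\<close>, and return the chosen element.\<close>

definition unbend :: "'o \<Rightarrow> 'o \<Rightarrow> ('o, 'm) arrow \<Rightarrow> ('o, 'm) arrow" where
  "unbend X Y r = radj B (Pr1 M X Y) \<Zsemi> (Dup B (X \<otimes>\<^sub>o Y) \<Zsemi> ((r \<otimes>\<^sub>a Pr2 M X Y) \<Zsemi> Lun B Y))"

lemma bend_simps [simp]:
  assumes "S \<in> Arr B"
  shows "bend S \<in> Arr B" "src (bend S) = src S \<otimes>\<^sub>o tgt S" "tgt (bend S) = Unit B"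
  using assms by (simp_all add: bend_def)

lemma eps_inv_arr_bend: "eps_inv_arr B S = Arrow (src S) (tgt S) (lab (bend S))"
  by (simp add: eps_inv_arr_def bend_def equ_def Let_def)

lemma radj_Pr1:
  assumes "X \<in> Ob B" "Y \<in> Ob B"
  shows "radj B (Pr1 M X Y) = inv_arrow B (Run B X) \<Zsemi> (Idn B X \<otimes>\<^sub>a radj B (Del B Y))"
  using assms by (simp add: R_ob_Pr radj_Seq radj_Tens radj_iso)

text \<open>Copying \<open>Y\<close> alone, as the counit formula does, is copying the pair and
  keeping one copy of \<open>Y\<close>. The inverse unitor and the right adjoint of
  \<open>Del\<close> together form the right adjoint of \<open>Pr1\<close>.\<close>

lemma eps_arr_unbend:
  assumes r: "r \<in> Arr B" "src r = X \<otimes>\<^sub>o Y" "tgt r = Unit B" and O: "X \<in> Ob B" "Y \<in> Ob B"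
  shows "eps_arr B (Arrow X Y (lab r)) = unbend X Y r"
proof -
  let ?XY = "X \<otimes>\<^sub>o Y"
  have m: "(Idn B X \<otimes>\<^sub>a Dup B Y) \<Zsemi> inv_arrow B (Assoc B X Y Y) = Dup B ?XY \<Zsemi> (Idn B ?XY \<otimes>\<^sub>a Pr2 M X Y)"
    using O by (simp add: map_cart)
  have "eps_arr B (Arrow X Y (lab r)) = radj B (Pr1 M X Y) \<Zsemi>
      (((Idn B X \<otimes>\<^sub>a Dup B Y) \<Zsemi> inv_arrow B (Assoc B X Y Y)) \<Zsemi> ((r \<otimes>\<^sub>a Idn B Y) \<Zsemi> Lun B Y))"
    using r O by (simp add: eps_arr_def radj_Pr1 Let_def)
  also have "\<dots> = unbend X Y r" unfolding m using r O by (simp add: unbend_def)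
  finally show ?thesis .
qed

lemma unbend_simps [simp]:
  assumes "r \<in> Arr B" "src r = X \<otimes>\<^sub>o Y" "tgt r = Unit B" "X \<in> Ob B" "Y \<in> Ob B"
  shows "unbend X Y r \<in> Arr B" "src (unbend X Y r) = X" "tgt (unbend X Y r) = Y"
  using assms by (simp_all add: unbend_def)

text \<open>Naturality brings \<open>S\<close> to the front. What remains on \<open>Y\<close> is the
  right adjoint of \<open>Pr1\<close> followed, by \<open>restrict_equ\<close>, by that of
  \<open>Dup\<close>; together they are the right adjoint of \<open>Dup\<close> followed by
  \<open>Pr1\<close>, which is the identity.\<close>

lemma unbend_bend:
  assumes S: "S \<in> Arr B" shows "unbend (src S) (tgt S) (bend S) = S"
proof -
  let ?X = "src S" and ?Y = "tgt S"
  let ?XY = "?X \<otimes>\<^sub>o ?Y" and ?YY = "?Y \<otimes>\<^sub>o ?Y" and ?y = "Idn B ?Y"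
  have O: "?X \<in> Ob B" "?Y \<in> Ob B" using S by simp_all
  have m: "Dup B (X \<otimes>\<^sub>o ?Y) \<Zsemi> (Idn B (X \<otimes>\<^sub>o ?Y) \<otimes>\<^sub>a Pr2 M X ?Y) = (Idn B X \<otimes>\<^sub>a Dup B ?Y) \<Zsemi> inv_arrow B (Assoc B X ?Y ?Y)"
    if "X \<in> Ob B" for X using that O by (simp add: map_cart)
  have "unbend ?X ?Y (bend S) = radj B (Pr1 M ?X ?Y) \<Zsemi> ((Dup B ?XY \<Zsemi> (Idn B ?XY \<otimes>\<^sub>a Pr2 M ?X ?Y)) \<Zsemi> ((bend S \<otimes>\<^sub>a ?y) \<Zsemi> Lun B ?Y))"
    using S O by (simp add: unbend_def)
  also have "\<dots> = radj B (Pr1 M ?X ?Y) \<Zsemi> ((Idn B ?X \<otimes>\<^sub>a Dup B ?Y) \<Zsemi>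
     ((inv_arrow B (Assoc B ?X ?Y ?Y) \<Zsemi> ((S \<otimes>\<^sub>a ?y) \<otimes>\<^sub>a ?y)) \<Zsemi> ((equ ?Y \<otimes>\<^sub>a ?y) \<Zsemi> Lun B ?Y)))"
    unfolding m[OF O(1)] using S O by (simp add: bend_def)
  also have "inv_arrow B (Assoc B ?X ?Y ?Y) \<Zsemi> ((S \<otimes>\<^sub>a ?y) \<otimes>\<^sub>a ?y) = (S \<otimes>\<^sub>a (?y \<otimes>\<^sub>a ?y)) \<Zsemi> inv_arrow B (Assoc B ?Y ?Y ?Y)"
    using inv_Assoc_nat[of S ?y ?y] S O by simp
  also have "radj B (Pr1 M ?X ?Y) \<Zsemi> ((Idn B ?X \<otimes>\<^sub>a Dup B ?Y) \<Zsemi>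
     (((S \<otimes>\<^sub>a (?y \<otimes>\<^sub>a ?y)) \<Zsemi> inv_arrow B (Assoc B ?Y ?Y ?Y)) \<Zsemi> ((equ ?Y \<otimes>\<^sub>a ?y) \<Zsemi> Lun B ?Y))) =
     (inv_arrow B (Run B ?X) \<Zsemi> (S \<otimes>\<^sub>a Idn B (Unit B))) \<Zsemi> ((?y \<otimes>\<^sub>a radj B (Del B ?Y)) \<Zsemi>
      (((?y \<otimes>\<^sub>a Dup B ?Y) \<Zsemi> inv_arrow B (Assoc B ?Y ?Y ?Y)) \<Zsemi> ((equ ?Y \<otimes>\<^sub>a ?y) \<Zsemi> Lun B ?Y)))"
    using S O by (simp add: radj_Pr1)
  also have "\<dots> = S \<Zsemi> (radj B (Pr1 M ?Y ?Y) \<Zsemi> (Dup B ?YY \<Zsemi> ((equ ?Y \<otimes>\<^sub>a Pr2 M ?Y ?Y) \<Zsemi> Lun B ?Y)))"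
    unfolding inv_Run_nat[OF S] m[OF O(2), symmetric] using S O by (simp add: radj_Pr1)
  also have "\<dots> = S \<Zsemi> radj B (Dup B ?Y \<Zsemi> Pr1 M ?Y ?Y)"
    using restrict_equ(2)[OF O(2)] O by (simp add: radj_Seq)
  also have "Dup B ?Y \<Zsemi> Pr1 M ?Y ?Y = ?y" using O by (simp add: Dup_M)
  finally show ?thesis using S by simp
qed

text \<open>Before quantification the arrow tests r(x, y) and y = y', a meet;
  \<open>restrict_strength\<close> and \<open>restrict_equ\<close> turn the test for equality into
  the right adjoint of \<open>Dup\<close>, acting on \<open>Y\<close> alone. Quantifying y away then
  cancels, because the arrows in question are right adjoints of maps that compose to the
  identity.\<close>

lemma bend_unbend:
  assumes r: "r \<in> Arr B" "src r = X \<otimes>\<^sub>o Y" "tgt r = Unit B" and O: "X \<in> Ob B" "Y \<in> Ob B"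
  shows "bend (unbend X Y r) = r"
proof -
  let ?XY = "X \<otimes>\<^sub>o Y" and ?YY = "Y \<otimes>\<^sub>o Y" and ?y = "Idn B Y" and ?I = "Unit B"
  let ?F = "Dup B ?XY \<Zsemi> ((r \<otimes>\<^sub>a Pr2 M X Y) \<Zsemi> Lun B Y)"
  let ?a = "Assoc B X Y Y"
  have "(?F \<otimes>\<^sub>a ?y) \<Zsemi> equ Y = (Dup B ?XY \<otimes>\<^sub>a ?y) \<Zsemi> (((r \<otimes>\<^sub>a Pr2 M X Y) \<otimes>\<^sub>a ?y) \<Zsemi> ((Lun B Y \<otimes>\<^sub>a ?y) \<Zsemi> equ Y))"
    using r O by simp
  also have "Lun B Y \<otimes>\<^sub>a ?y = Assoc B ?I Y Y \<Zsemi> Lun B ?YY" using O by (simp add: map_cart)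
  also have "((r \<otimes>\<^sub>a Pr2 M X Y) \<otimes>\<^sub>a ?y) \<Zsemi> ((Assoc B ?I Y Y \<Zsemi> Lun B ?YY) \<Zsemi> equ Y) =
      (((r \<otimes>\<^sub>a Pr2 M X Y) \<otimes>\<^sub>a ?y) \<Zsemi> Assoc B ?I Y Y) \<Zsemi> (Lun B ?YY \<Zsemi> equ Y)" using r O by simp
  also have "((r \<otimes>\<^sub>a Pr2 M X Y) \<otimes>\<^sub>a ?y) \<Zsemi> Assoc B ?I Y Y = Assoc B ?XY ?XY Y \<Zsemi> (r \<otimes>\<^sub>a (Pr2 M X Y \<otimes>\<^sub>a ?y))"
    using Assoc_nat[of r "Pr2 M X Y" ?y] r O by simp
  also have "(Dup B ?XY \<otimes>\<^sub>a ?y) \<Zsemi> ((Assoc B ?XY ?XY Y \<Zsemi> (r \<otimes>\<^sub>a (Pr2 M X Y \<otimes>\<^sub>a ?y))) \<Zsemi> (Lun B ?YY \<Zsemi> equ Y)) =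
      ((Dup B ?XY \<otimes>\<^sub>a ?y) \<Zsemi> Assoc B ?XY ?XY Y) \<Zsemi> ((r \<otimes>\<^sub>a (Pr2 M X Y \<otimes>\<^sub>a ?y)) \<Zsemi> ((Idn B ?I \<otimes>\<^sub>a equ Y) \<Zsemi> Lun B ?I))"
    using Lun_nat[of "equ Y"] r O by simp
  also have "(Dup B ?XY \<otimes>\<^sub>a ?y) \<Zsemi> Assoc B ?XY ?XY Y = Dup B (?XY \<otimes>\<^sub>o Y) \<Zsemi> (Pr1 M ?XY Y \<otimes>\<^sub>a Idn B (?XY \<otimes>\<^sub>o Y))"
    using O by (simp add: map_cart)
  also have "(Dup B (?XY \<otimes>\<^sub>o Y) \<Zsemi> (Pr1 M ?XY Y \<otimes>\<^sub>a Idn B (?XY \<otimes>\<^sub>o Y))) \<Zsemi> ((r \<otimes>\<^sub>a (Pr2 M X Y \<otimes>\<^sub>a ?y)) \<Zsemi> ((Idn B ?I \<otimes>\<^sub>a equ Y) \<Zsemi> Lun B ?I)) =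
      meet (Pr1 M ?XY Y \<Zsemi> r) ((Pr2 M X Y \<otimes>\<^sub>a ?y) \<Zsemi> equ Y)"
    using r O by (simp add: meet_def)
  also have "Pr2 M X Y \<otimes>\<^sub>a ?y = ?a \<Zsemi> Pr2 M X ?YY" using O by (simp add: map_cart)
  also have "Pr1 M ?XY Y = ?a \<Zsemi> (Idn B X \<otimes>\<^sub>a Pr1 M Y Y)" using O by (simp add: map_cart)
  also have "meet ((?a \<Zsemi> (Idn B X \<otimes>\<^sub>a Pr1 M Y Y)) \<Zsemi> r) ((?a \<Zsemi> Pr2 M X ?YY) \<Zsemi> equ Y) =
     ?a \<Zsemi> meet ((Idn B X \<otimes>\<^sub>a Pr1 M Y Y) \<Zsemi> r) (Pr2 M X ?YY \<Zsemi> equ Y)"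
    using map_meet[of ?a "(Idn B X \<otimes>\<^sub>a Pr1 M Y Y) \<Zsemi> r" "Pr2 M X ?YY \<Zsemi> equ Y"] r O by simp
  also have "meet ((Idn B X \<otimes>\<^sub>a Pr1 M Y Y) \<Zsemi> r) (Pr2 M X ?YY \<Zsemi> equ Y) =
     (Dup B (X \<otimes>\<^sub>o ?YY) \<Zsemi> ((Idn B (X \<otimes>\<^sub>o ?YY) \<otimes>\<^sub>a (Pr2 M X ?YY \<Zsemi> equ Y)) \<Zsemi> Run B (X \<otimes>\<^sub>o ?YY))) \<Zsemi>
      ((Idn B X \<otimes>\<^sub>a Pr1 M Y Y) \<Zsemi> r)"
    using r O by (simp add: meet_Run)
  also have "\<dots> = (Idn B X \<otimes>\<^sub>a (Dup B ?YY \<Zsemi> ((Idn B ?YY \<otimes>\<^sub>a equ Y) \<Zsemi> (Run B ?YY \<Zsemi> Pr1 M Y Y)))) \<Zsemi> r"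
    using restrict_strength[of X ?YY "equ Y"] r O by simp
  also have "(Idn B ?YY \<otimes>\<^sub>a equ Y) \<Zsemi> (Run B ?YY \<Zsemi> Pr1 M Y Y) = (Pr1 M Y Y \<otimes>\<^sub>a equ Y) \<Zsemi> Run B Y"
    using Run_slide[of "Pr1 M Y Y" "equ Y"] O by simp
  also have "Dup B ?YY \<Zsemi> ((Pr1 M Y Y \<otimes>\<^sub>a equ Y) \<Zsemi> Run B Y) = radj B (Dup B Y)" by (rule restrict_equ(1)[OF O(2)])
  finally have F: "(?F \<otimes>\<^sub>a ?y) \<Zsemi> equ Y = ?a \<Zsemi> ((Idn B X \<otimes>\<^sub>a radj B (Dup B Y)) \<Zsemi> r)" .
  \<comment> \<open>Duplicating the element of \<open>Y\<close> and dropping one copy is the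
    identity; \<open>K\<close> is this equation for right adjoints.\<close>
  have m: "(Idn B X \<otimes>\<^sub>a Dup B Y) \<Zsemi> (inv_arrow B ?a \<Zsemi> (Pr1 M X Y \<otimes>\<^sub>a ?y)) = Idn B ?XY"
    using O by (simp add: map_cart)
  have "radj B ((Idn B X \<otimes>\<^sub>a Dup B Y) \<Zsemi> (inv_arrow B ?a \<Zsemi> (Pr1 M X Y \<otimes>\<^sub>a ?y))) =
     (radj B (Pr1 M X Y) \<otimes>\<^sub>a ?y) \<Zsemi> (?a \<Zsemi> (Idn B X \<otimes>\<^sub>a radj B (Dup B Y)))"
  proof -
    have "inverse_arrows B (inv_arrow B ?a) ?a" using inverse_arrows_sym[OF inv_arrow_inverse] O by simp
    then have "ladj (inv_arrow B ?a)" "radj B (inv_arrow B ?a) = ?a" by (rule radj_inverse)+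
    then show ?thesis using O by (simp add: radj_Seq radj_Tens)
  qed
  then have K: "(radj B (Pr1 M X Y) \<otimes>\<^sub>a ?y) \<Zsemi> (?a \<Zsemi> (Idn B X \<otimes>\<^sub>a radj B (Dup B Y))) = Idn B ?XY"
    unfolding m using O by simp
  have "bend (unbend X Y r) = (radj B (Pr1 M X Y) \<otimes>\<^sub>a ?y) \<Zsemi> ((?F \<otimes>\<^sub>a ?y) \<Zsemi> equ Y)"
    using r O by (simp add: bend_def unbend_def)
  also have "\<dots> = ((radj B (Pr1 M X Y) \<otimes>\<^sub>a ?y) \<Zsemi> (?a \<Zsemi> (Idn B X \<otimes>\<^sub>a radj B (Dup B Y)))) \<Zsemi> r"
    unfolding F using r O by simp
  also have "\<dots> = r" unfolding K using r by simp
  finally show ?thesis .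
qed

text \<open>The left side is composition in L(R(B)): restrict to both bent relations and quantify
  the middle object away. Naturality moves \<open>S\<close> to the front; copying the middle object
  and testing equality is the right adjoint of \<open>Dup\<close> (\<open>D\<close>), and the
  quantifier then cancels against it (\<open>K\<close>).\<close>

lemma bend_Seq:
  assumes ST: "S \<in> Arr B" "T \<in> Arr B" "tgt S = src T"
  shows "radj B (Idn B (src S) \<otimes>\<^sub>a Pr2 M (src T) (tgt T)) \<Zsemi>
     meet (\<langle>tri1 M (src S) (src T) (tgt T), tri2 M (src S) (src T) (tgt T)\<rangle>\<^bsub>M\<^esub> \<Zsemi> bend S)
       (Pr2 M (src S) (src T \<otimes>\<^sub>o tgt T) \<Zsemi> bend T) = bend (S \<Zsemi> T)"
proof -
  define X Y Z where xyz: "X = src S" "Y = src T" "Z = tgt T"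
  have O: "X \<in> Ob B" "Y \<in> Ob B" "Z \<in> Ob B" using ST by (simp_all add: xyz)
  have ty: "S \<in> Arr B" "T \<in> Arr B" "src S = X" "tgt S = Y" "src T = Y" "tgt T = Z" using ST by (simp_all add: xyz)
  let ?x = "Idn B X" and ?y = "Idn B Y" and ?z = "Idn B Z" and ?I = "Unit B"
  let ?YZ = "Y \<otimes>\<^sub>o Z" and ?W = "X \<otimes>\<^sub>o (Y \<otimes>\<^sub>o Z)"
  let ?yz = "Idn B ?YZ"
  let ?s = "\<langle>tri1 M X Y Z, tri2 M X Y Z\<rangle>\<^bsub>M\<^esub>" and ?q = "Pr2 M X ?YZ"
  \<comment> \<open>The map that sends (y, z) to (y, (y, z)).\<close>
  define m where "m = Dup B ?YZ \<Zsemi> (Pr1 M Y Z \<otimes>\<^sub>a ?yz)"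
  have m: "m \<in> Arr M" "src m = ?YZ" "tgt m = Y \<otimes>\<^sub>o ?YZ" using O by (simp_all add: m_def)
  let ?a = "inv_arrow B (Assoc B Y Y Z)" and ?d = "radj B (Dup B Y)"
  \<comment> \<open>Both sides take (y', (y, z)), test y' = y and return (y, z). The right one is
    \<open>restrict_equ\<close> in the first two factors, with \<open>Z\<close> carried
    along.\<close>
  have D: "(?y \<otimes>\<^sub>a m) \<Zsemi> (inv_arrow B (Assoc B Y Y ?YZ) \<Zsemi> ((equ Y \<otimes>\<^sub>a ?yz) \<Zsemi> Lun B ?YZ)) = ?a \<Zsemi> (?d \<otimes>\<^sub>a ?z)"
  proof -
    have 1: "Dup B (Y \<otimes>\<^sub>o Y) \<Zsemi> (Idn B (Y \<otimes>\<^sub>o Y) \<otimes>\<^sub>a Pr2 M Y Y) = (?y \<otimes>\<^sub>a Dup B Y) \<Zsemi> inv_arrow B (Assoc B Y Y Y)"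
      using O by (simp add: map_cart)
    have "?d = (Dup B (Y \<otimes>\<^sub>o Y) \<Zsemi> (Idn B (Y \<otimes>\<^sub>o Y) \<otimes>\<^sub>a Pr2 M Y Y)) \<Zsemi> ((equ Y \<otimes>\<^sub>a ?y) \<Zsemi> Lun B Y)"
      using restrict_equ(2)[OF O(2)] O by simp
    then have "?d \<otimes>\<^sub>a ?z = (((?y \<otimes>\<^sub>a Dup B Y) \<otimes>\<^sub>a ?z) \<Zsemi> (inv_arrow B (Assoc B Y Y Y) \<otimes>\<^sub>a ?z)) \<Zsemi>
        (((equ Y \<otimes>\<^sub>a ?y) \<otimes>\<^sub>a ?z) \<Zsemi> (Lun B Y \<otimes>\<^sub>a ?z))"
      unfolding 1 using O by simp
    also have "Lun B Y \<otimes>\<^sub>a ?z = Assoc B ?I Y Z \<Zsemi> Lun B ?YZ" using O by (simp add: map_cart)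
    also have "((equ Y \<otimes>\<^sub>a ?y) \<otimes>\<^sub>a ?z) \<Zsemi> (Assoc B ?I Y Z \<Zsemi> Lun B ?YZ) = (((equ Y \<otimes>\<^sub>a ?y) \<otimes>\<^sub>a ?z) \<Zsemi> Assoc B ?I Y Z) \<Zsemi> Lun B ?YZ"
      using O by simp
    also have "((equ Y \<otimes>\<^sub>a ?y) \<otimes>\<^sub>a ?z) \<Zsemi> Assoc B ?I Y Z = Assoc B (Y \<otimes>\<^sub>o Y) Y Z \<Zsemi> (equ Y \<otimes>\<^sub>a ?yz)"
      using Assoc_nat[of "equ Y" ?y ?z] O by simp
    finally have "?a \<Zsemi> (?d \<otimes>\<^sub>a ?z) = (?a \<Zsemi> (((?y \<otimes>\<^sub>a Dup B Y) \<otimes>\<^sub>a ?z) \<Zsemi> ((inv_arrow B (Assoc B Y Y Y) \<otimes>\<^sub>a ?z) \<Zsemi> Assoc B (Y \<otimes>\<^sub>o Y) Y Z)))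
       \<Zsemi> ((equ Y \<otimes>\<^sub>a ?yz) \<Zsemi> Lun B ?YZ)"
      using O by simp
    also have "?a \<Zsemi> (((?y \<otimes>\<^sub>a Dup B Y) \<otimes>\<^sub>a ?z) \<Zsemi> ((inv_arrow B (Assoc B Y Y Y) \<otimes>\<^sub>a ?z) \<Zsemi> Assoc B (Y \<otimes>\<^sub>o Y) Y Z)) =
        (?y \<otimes>\<^sub>a m) \<Zsemi> inv_arrow B (Assoc B Y Y ?YZ)"
      using O by (simp add: m_def map_cart)
    finally show ?thesis using O m by simp
  qed
  have st: "Dup B ?W \<Zsemi> (?s \<otimes>\<^sub>a ?q) = (?x \<otimes>\<^sub>a m) \<Zsemi> inv_arrow B (Assoc B X Y ?YZ)"
    using O by (simp add: m_def map_cart)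
  have s: "?s \<in> Arr M" "src ?s = ?W" "tgt ?s = X \<otimes>\<^sub>o Y" using O by simp_all
  have "meet (?s \<Zsemi> bend S) (?q \<Zsemi> bend T) = (Dup B ?W \<Zsemi> (?s \<otimes>\<^sub>a ?q)) \<Zsemi> ((bend S \<otimes>\<^sub>a bend T) \<Zsemi> Lun B ?I)"
    using ty O s by (simp add: meet_def)
  also have "\<dots> = (?x \<otimes>\<^sub>a m) \<Zsemi> ((inv_arrow B (Assoc B X Y ?YZ) \<Zsemi> ((S \<otimes>\<^sub>a ?y) \<otimes>\<^sub>a ?yz)) \<Zsemi> ((equ Y \<otimes>\<^sub>a bend T) \<Zsemi> Lun B ?I))"
    unfolding st using ty O m by (simp add: bend_def[of S])
  also have "inv_arrow B (Assoc B X Y ?YZ) \<Zsemi> ((S \<otimes>\<^sub>a ?y) \<otimes>\<^sub>a ?yz) = (S \<otimes>\<^sub>a (?y \<otimes>\<^sub>a ?yz)) \<Zsemi> inv_arrow B (Assoc B Y Y ?YZ)"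
    using inv_Assoc_nat[of S ?y ?yz] ty O by simp
  also have "(equ Y \<otimes>\<^sub>a bend T) \<Zsemi> Lun B ?I = (equ Y \<otimes>\<^sub>a ?yz) \<Zsemi> (Lun B ?YZ \<Zsemi> bend T)"
    using Lun_slide[of "bend T" "equ Y"] ty O by simp
  also have "(?x \<otimes>\<^sub>a m) \<Zsemi> (((S \<otimes>\<^sub>a (?y \<otimes>\<^sub>a ?yz)) \<Zsemi> inv_arrow B (Assoc B Y Y ?YZ)) \<Zsemi> ((equ Y \<otimes>\<^sub>a ?yz) \<Zsemi> (Lun B ?YZ \<Zsemi> bend T))) =
     (S \<otimes>\<^sub>a ?yz) \<Zsemi> (((?y \<otimes>\<^sub>a m) \<Zsemi> (inv_arrow B (Assoc B Y Y ?YZ) \<Zsemi> ((equ Y \<otimes>\<^sub>a ?yz) \<Zsemi> Lun B ?YZ))) \<Zsemi> bend T)"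
    using ty O m by simp
  also have "\<dots> = (S \<otimes>\<^sub>a ?yz) \<Zsemi> ((?a \<Zsemi> (?d \<otimes>\<^sub>a ?z)) \<Zsemi> bend T)" unfolding D ..
  finally have M: "meet (?s \<Zsemi> bend S) (?q \<Zsemi> bend T) = (S \<otimes>\<^sub>a ?yz) \<Zsemi> ((?a \<Zsemi> (?d \<otimes>\<^sub>a ?z)) \<Zsemi> bend T)" .
  let ?p = "radj B (Pr2 M Y Z)"
  \<comment> \<open>The map sends (y, z) to (y, (y, z)) and drops the second y again;
    \<open>K\<close> is this equation for right adjoints.\<close>
  have e: "(Dup B Y \<otimes>\<^sub>a ?z) \<Zsemi> (Assoc B Y Y Z \<Zsemi> (?y \<otimes>\<^sub>a Pr2 M Y Z)) = Idn B ?YZ" using O by (simp add: map_cart)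
  have "radj B ((Dup B Y \<otimes>\<^sub>a ?z) \<Zsemi> (Assoc B Y Y Z \<Zsemi> (?y \<otimes>\<^sub>a Pr2 M Y Z))) = (?y \<otimes>\<^sub>a ?p) \<Zsemi> (?a \<Zsemi> (?d \<otimes>\<^sub>a ?z))"
    using O by (simp add: radj_Seq radj_Tens radj_iso)
  then have K: "(?y \<otimes>\<^sub>a ?p) \<Zsemi> (?a \<Zsemi> (?d \<otimes>\<^sub>a ?z)) = ?yz" unfolding e using O by simp
  have "radj B (?x \<otimes>\<^sub>a Pr2 M Y Z) \<Zsemi> meet (?s \<Zsemi> bend S) (?q \<Zsemi> bend T) =
      (S \<otimes>\<^sub>a ?z) \<Zsemi> (((?y \<otimes>\<^sub>a ?p) \<Zsemi> (?a \<Zsemi> (?d \<otimes>\<^sub>a ?z))) \<Zsemi> bend T)"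
    unfolding M using ty O by (simp add: radj_Tens)
  also have "\<dots> = bend (S \<Zsemi> T)" unfolding K using ty O by (simp add: bend_def)
  finally show ?thesis unfolding xyz .
qed

lemma mid4_M:
  assumes "X \<in> Ob B" "Y \<in> Ob B" "Z \<in> Ob B" "W \<in> Ob B"
  shows "mid4 X Y Z W = \<langle>\<langle>quad1 M X Y Z W, quad3 M X Y Z W\<rangle>\<^bsub>M\<^esub>, \<langle>quad2 M X Y Z W, quad4 M X Y Z W\<rangle>\<^bsub>M\<^esub>\<rangle>\<^bsub>M\<^esub>"
  using assms by (simp add: mid4_def map_cart)

text \<open>Taking right adjoints in \<open>Dup_TensOb\<close> shows that equality on a tensor
  product is the middle exchange followed by equality in both factors. Naturality moves the exchange
  in front of \<open>S\<close> and \<open>T\<close>, where it is the pairing of the two tuples in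
  the statement.\<close>

lemma bend_Tens:
  assumes ST: "S \<in> Arr B" "T \<in> Arr B"
  shows "bend (S \<otimes>\<^sub>a T) =
    meet (\<langle>quad1 M (src S) (src T) (tgt S) (tgt T), quad3 M (src S) (src T) (tgt S) (tgt T)\<rangle>\<^bsub>M\<^esub> \<Zsemi> bend S)
     (\<langle>quad2 M (src S) (src T) (tgt S) (tgt T), quad4 M (src S) (src T) (tgt S) (tgt T)\<rangle>\<^bsub>M\<^esub> \<Zsemi> bend T)"
proof -
  define X Y Z W where xyz: "X = src S" "Y = tgt S" "Z = src T" "W = tgt T"
  have O: "X \<in> Ob B" "Y \<in> Ob B" "Z \<in> Ob B" "W \<in> Ob B" using ST by (simp_all add: xyz)
  have ty: "S \<in> Arr B" "T \<in> Arr B" "src S = X" "tgt S = Y" "src T = Z" "tgt T = W" using ST by (simp_all add: xyz)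
  let ?y = "Idn B Y" and ?w = "Idn B W" and ?I = "Unit B"
  let ?s = "\<langle>quad1 M X Z Y W, quad3 M X Z Y W\<rangle>\<^bsub>M\<^esub>" and ?t = "\<langle>quad2 M X Z Y W, quad4 M X Z Y W\<rangle>\<^bsub>M\<^esub>"
  have inv: "inverse_arrows B (mid4 Y Y W W) (mid4 Y W Y W)"
    using O by (intro inverse_arrowsI[of _ "(Y \<otimes>\<^sub>o Y) \<otimes>\<^sub>o (W \<otimes>\<^sub>o W)" "(Y \<otimes>\<^sub>o W) \<otimes>\<^sub>o (Y \<otimes>\<^sub>o W)"])
      (simp_all add: in_hom_iff mid4_M cart_defs)
  then have "ladj (mid4 Y Y W W)" "radj B (mid4 Y Y W W) = mid4 Y W Y W" by (rule radj_inverse)+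
  then have "radj B (Dup B (Y \<otimes>\<^sub>o W)) = mid4 Y W Y W \<Zsemi> (radj B (Dup B Y) \<otimes>\<^sub>a radj B (Dup B W))"
    using O by (simp add: Dup_TensOb mid_swap_eq radj_Seq radj_Tens)
  then have u: "equ (Y \<otimes>\<^sub>o W) = mid4 Y W Y W \<Zsemi> ((equ Y \<otimes>\<^sub>a equ W) \<Zsemi> Lun B ?I)"
    using O by (simp add: equ_def Del_TensOb)
  have "bend (S \<otimes>\<^sub>a T) = (((S \<otimes>\<^sub>a T) \<otimes>\<^sub>a (?y \<otimes>\<^sub>a ?w)) \<Zsemi> mid4 Y W Y W) \<Zsemi> ((equ Y \<otimes>\<^sub>a equ W) \<Zsemi> Lun B ?I)"
    using ty O by (simp add: bend_def u)
  also have "((S \<otimes>\<^sub>a T) \<otimes>\<^sub>a (?y \<otimes>\<^sub>a ?w)) \<Zsemi> mid4 Y W Y W = mid4 X Z Y W \<Zsemi> ((S \<otimes>\<^sub>a ?y) \<otimes>\<^sub>a (T \<otimes>\<^sub>a ?w))"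
    using mid4_nat[of S T ?y ?w] ty O by simp
  also have "mid4 X Z Y W = Dup B ((X \<otimes>\<^sub>o Z) \<otimes>\<^sub>o (Y \<otimes>\<^sub>o W)) \<Zsemi> (?s \<otimes>\<^sub>a ?t)"
    using O by (simp add: mid4_M pair_M[of ?s ?t])
  also have "((Dup B ((X \<otimes>\<^sub>o Z) \<otimes>\<^sub>o (Y \<otimes>\<^sub>o W)) \<Zsemi> (?s \<otimes>\<^sub>a ?t)) \<Zsemi> ((S \<otimes>\<^sub>a ?y) \<otimes>\<^sub>a (T \<otimes>\<^sub>a ?w))) \<Zsemi> ((equ Y \<otimes>\<^sub>a equ W) \<Zsemi> Lun B ?I)
      = meet (?s \<Zsemi> bend S) (?t \<Zsemi> bend T)"
    using ty O by (simp add: meet_def bend_def)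
  finally show ?thesis unfolding xyz .
qed

section \<open>Bending as an isomorphism onto L(R(B))\<close>

lemma LM_Arr: "R \<in> Arr (L_ob M) \<longleftrightarrow> src R \<in> Ob B \<and> tgt R \<in> Ob B \<and> Arrow (src R \<otimes>\<^sub>o tgt R) (Unit B) (lab R) \<in> Arr B"
  by (simp add: L_ob_Arr)

lemma eps_inv_Arr: "S \<in> Arr B \<Longrightarrow> eps_inv_arr B S \<in> Arr (L_ob M)"
  by (simp add: LM_Arr eps_inv_arr_bend)

lemma eps_inv_src_tgt [simp]: "src (eps_inv_arr B S) = src S" "tgt (eps_inv_arr B S) = tgt S"
  by (simp_all add: eps_inv_arr_bend)

lemma eps_arr_Arr:
  assumes "R \<in> Arr (L_ob M)"
  shows "eps_arr B R \<in> Arr B" "src (eps_arr B R) = src R" "tgt (eps_arr B R) = tgt R"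
  using eps_arr_unbend[of "Arrow (src R \<otimes>\<^sub>o tgt R) (Unit B) (lab R)" "src R" "tgt R"] assms
  by (simp_all add: LM_Arr)

lemma eps_eps_inv: "S \<in> Arr B \<Longrightarrow> eps_arr B (eps_inv_arr B S) = S"
  by (simp add: eps_inv_arr_bend eps_arr_unbend unbend_bend)

lemma eps_inv_eps:
  assumes "R \<in> Arr (L_ob M)" shows "eps_inv_arr B (eps_arr B R) = R"
  using eps_arr_unbend[of "Arrow (src R \<otimes>\<^sub>o tgt R) (Unit B) (lab R)" "src R" "tgt R"] assms
  by (simp add: LM_Arr eps_inv_arr_bend bend_unbend)

lemma eps_inv_Seq:
  assumes "S \<in> Arr B" "T \<in> Arr B" "tgt S = src T"
  shows "eps_inv_arr B (S \<Zsemi> T) = eps_inv_arr B S \<Zsemi>\<^bsub>L_ob M\<^esub> eps_inv_arr B T"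
proof -
  define X Y Z where xyz: "X = src S" "Y = src T" "Z = tgt T"
  have O: "X \<in> Ob B" "Y \<in> Ob B" "Z \<in> Ob B" using assms by (simp_all add: xyz)
  have ty: "S \<in> Arr B" "T \<in> Arr B" "src S = X" "tgt S = Y" "src T = Y" "tgt T = Z" using assms by (simp_all add: xyz)
  let ?s = "\<langle>tri1 M X Y Z, tri2 M X Y Z\<rangle>\<^bsub>M\<^esub>" and ?q = "Pr2 M X (Y \<otimes>\<^sub>o Z)"
  have t: "\<langle>tri2 M X Y Z, tri3 M X Y Z\<rangle>\<^bsub>M\<^esub> = ?q" and p: "\<langle>tri1 M X Y Z, tri3 M X Y Z\<rangle>\<^bsub>M\<^esub> = Idn B X \<otimes>\<^sub>a Pr2 M Y Z"
    using O by (simp_all add: map_cart)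
  have s: "?s \<in> Arr M" "src ?s = X \<otimes>\<^sub>o (Y \<otimes>\<^sub>o Z)" "tgt ?s = X \<otimes>\<^sub>o Y" using O by simp_all
  have "eps_inv_arr B S \<Zsemi>\<^bsub>L_ob M\<^esub> eps_inv_arr B T =
      Arrow X Z (Exq M (Idn B X \<otimes>\<^sub>a Pr2 M Y Z) (lab (meet (?s \<Zsemi> bend S) (?q \<Zsemi> bend T))))"
    using ty O s by (simp add: L_ob_def L_seq_def eps_inv_arr_bend t p)
  also have "\<dots> = Arrow X Z (lab (radj B (Idn B X \<otimes>\<^sub>a Pr2 M Y Z) \<Zsemi> meet (?s \<Zsemi> bend S) (?q \<Zsemi> bend T)))"
    using ty O s by (simp add: Exq_M)
  also have "\<dots> = eps_inv_arr B (S \<Zsemi> T)"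
    using bend_Seq[OF assms] ty O by (simp add: eps_inv_arr_bend)
  finally show ?thesis ..
qed

lemma eps_inv_Tens:
  assumes "S \<in> Arr B" "T \<in> Arr B"
  shows "eps_inv_arr B (S \<otimes>\<^sub>a T) = eps_inv_arr B S \<otimes>\<^sub>a\<^bsub>L_ob M\<^esub> eps_inv_arr B T"
proof -
  define X Y Z W where xyz: "X = src S" "Y = tgt S" "Z = src T" "W = tgt T"
  have O: "X \<in> Ob B" "Y \<in> Ob B" "Z \<in> Ob B" "W \<in> Ob B" using assms by (simp_all add: xyz)
  have ty: "S \<in> Arr B" "T \<in> Arr B" "src S = X" "tgt S = Y" "src T = Z" "tgt T = W" using assms by (simp_all add: xyz)
  define s t where st: "s = \<langle>quad1 M X Z Y W, quad3 M X Z Y W\<rangle>\<^bsub>M\<^esub>" "t = \<langle>quad2 M X Z Y W, quad4 M X Z Y W\<rangle>\<^bsub>M\<^esub>"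
  have s: "s \<in> Arr M" "src s = (X \<otimes>\<^sub>o Z) \<otimes>\<^sub>o (Y \<otimes>\<^sub>o W)" "tgt s = X \<otimes>\<^sub>o Y"
    "t \<in> Arr M" "src t = (X \<otimes>\<^sub>o Z) \<otimes>\<^sub>o (Y \<otimes>\<^sub>o W)" "tgt t = Z \<otimes>\<^sub>o W" using O by (simp_all add: st)
  have "bend (S \<otimes>\<^sub>a T) = meet (s \<Zsemi> bend S) (t \<Zsemi> bend T)" using bend_Tens[OF assms] by (simp only: ty st)
  then show ?thesis
    using ty O s by (simp add: L_ob_def L_tens_def eps_inv_arr_bend st[symmetric])
qed

text \<open>Bending a map is reindexing the equality predicate along it. So bending carries all
  structural arrows of \<open>B\<close>, which are maps, to those of L(R(B)).\<close>

lemma eps_inv_graph: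
  assumes "f \<in> Arr M" shows "eps_inv_arr B f = graph M f"
proof -
  have "f \<times>\<^sub>a\<^bsub>M\<^esub> Idn M (tgt f) = f \<otimes>\<^sub>a Idn B (tgt f)" using assms by (simp add: Tens_M[symmetric])
  then show ?thesis using assms by (simp add: graph_def eps_inv_arr_bend bend_def equ_def)
qed

text \<open>Bending and unbending are both built from monotone operations, and they are inverse to
  each other.\<close>

lemma eps_inv_Leq:
  assumes "S \<in> Arr B" "T \<in> Arr B" "src S = src T" "tgt S = tgt T"
  shows "eps_inv_arr B S \<sqsubseteq>\<^bsub>L_ob M\<^esub> eps_inv_arr B T \<longleftrightarrow> S \<sqsubseteq> T"
proof -
  define X Y where xy: "X = src T" "Y = tgt T"
  have ty: "S \<in> Arr B" "T \<in> Arr B" "src S = X" "tgt S = Y" "src T = X" "tgt T = Y" and O: "X \<in> Ob B" "Y \<in> Ob B"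
    using assms by (auto simp: xy)
  have "eps_inv_arr B S \<sqsubseteq>\<^bsub>L_ob M\<^esub> eps_inv_arr B T \<longleftrightarrow> bend S \<sqsubseteq> bend T"
    using ty O by (simp add: L_ob_Leq eps_inv_arr_bend fib_le_M)
  also have "\<dots> \<longleftrightarrow> S \<sqsubseteq> T"
  proof
    assume le: "bend S \<sqsubseteq> bend T"
    have "(bend S \<otimes>\<^sub>a Pr2 M X Y) \<Zsemi> Lun B Y \<sqsubseteq> (bend T \<otimes>\<^sub>a Pr2 M X Y) \<Zsemi> Lun B Y"
      by (rule Seq_le[OF TensArr_le[OF le le_refl] le_refl]) (use ty O in simp_all)
    from Seq_le[OF le_refl this, of "Dup B (X \<otimes>\<^sub>o Y)"]
    have "Dup B (X \<otimes>\<^sub>o Y) \<Zsemi> ((bend S \<otimes>\<^sub>a Pr2 M X Y) \<Zsemi> Lun B Y) \<sqsubseteq> Dup B (X \<otimes>\<^sub>o Y) \<Zsemi> ((bend T \<otimes>\<^sub>a Pr2 M X Y) \<Zsemi> Lun B Y)"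
      using ty O by simp
    from Seq_le[OF le_refl this, of "radj B (Pr1 M X Y)"]
    have "unbend X Y (bend S) \<sqsubseteq> unbend X Y (bend T)" unfolding unbend_def using ty O by simp
    then show "S \<sqsubseteq> T" using unbend_bend[of S] unbend_bend[of T] ty by simp
  next
    assume le: "S \<sqsubseteq> T"
    have "(S \<otimes>\<^sub>a Idn B Y) \<Zsemi> equ Y \<sqsubseteq> (T \<otimes>\<^sub>a Idn B Y) \<Zsemi> equ Y"
      by (rule Seq_le[OF TensArr_le[OF le le_refl] le_refl]) (use ty O in simp_all)
    then show "bend S \<sqsubseteq> bend T" using ty by (simp add: bend_def)
  qed
  finally show ?thesis .
qed

end

section \<open>The categories of doctrines and of cartesian bicategories\<close>

text \<open>Extensionality makes the values outside the carriers agree, so morphisms have to be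
  compared on the carriers only.\<close>

lemma ftor_eqI:
  fixes F G :: "('o1, 'm1, 'o2, 'm2) ftor"
  assumes "on_Ob F \<in> extensional A" "on_Ob G \<in> extensional A"
    "on_Arr F \<in> extensional S" "on_Arr G \<in> extensional S"
    "\<And>X. X \<in> A \<Longrightarrow> on_Ob F X = on_Ob G X" "\<And>f. f \<in> S \<Longrightarrow> on_Arr F f = on_Arr G f"
  shows "F = G"
  by (rule ftor.equality) (use assms in \<open>auto intro: extensionalityI\<close>)

lemma doctrine_map_eqI:
  fixes F G :: "('o1, 'm1, 'p1, 'o2, 'm2, 'p2) doctrine_map"
  assumes "on_Ob F \<in> extensional A" "on_Ob G \<in> extensional A"
    "on_Arr F \<in> extensional S" "on_Arr G \<in> extensional S"
    "on_Fib F \<in> extensional A" "on_Fib G \<in> extensional A"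
    "\<And>X. X \<in> A \<Longrightarrow> on_Fib F X \<in> extensional (T X)" "\<And>X. X \<in> A \<Longrightarrow> on_Fib G X \<in> extensional (T X)"
    "\<And>X. X \<in> A \<Longrightarrow> on_Ob F X = on_Ob G X" "\<And>f. f \<in> S \<Longrightarrow> on_Arr F f = on_Arr G f"
    "\<And>X x. X \<in> A \<Longrightarrow> x \<in> T X \<Longrightarrow> on_Fib F X x = on_Fib G X x"
  shows "F = G"
proof (rule doctrine_map.equality)
  show "on_Fib F = on_Fib G"
    by (rule extensionalityI[of _ A]) (use assms in \<open>auto intro!: extensionalityI[of _ "T _"]\<close>)
qed (use assms in \<open>auto intro: extensionalityI\<close>)

section \<open>Monotone functors and right adjoints\<close>

lemma functor_right_adjoint:
  assumes "cartesian_bicategory B" "is_functor B B' F"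
    and mono: "\<And>f g X Y. f \<in> hom B X Y \<Longrightarrow> g \<in> hom B X Y \<Longrightarrow> f \<sqsubseteq>\<^bsub>B\<^esub> g \<Longrightarrow> on_Arr F f \<sqsubseteq>\<^bsub>B'\<^esub> on_Arr F g"
    and f: "f \<in> Arr B" and adj: "is_right_adjoint B f g"
  shows "is_right_adjoint B' (on_Arr F f) (on_Arr F g)"
proof -
  interpret B: cartesian_bicategory B by fact
  interpret F: is_functor B B' F by fact
  have g: "g \<in> Arr B" "src g = tgt f" "tgt g = src f"
    using adj by (auto simp: is_right_adjoint_def in_hom_iff)
  have "on_Arr F (Idn B (src f)) \<sqsubseteq>\<^bsub>B'\<^esub> on_Arr F (f \<Zsemi>\<^bsub>B\<^esub> g)"
    by (rule mono[of _ "src f" "src f"]) (use f g adj in \<open>auto simp: is_right_adjoint_def in_hom_iff\<close>)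
  moreover have "on_Arr F (g \<Zsemi>\<^bsub>B\<^esub> f) \<sqsubseteq>\<^bsub>B'\<^esub> on_Arr F (Idn B (tgt f))"
    by (rule mono[of _ "tgt f" "tgt f"]) (use f g adj in \<open>auto simp: is_right_adjoint_def in_hom_iff\<close>)
  ultimately show ?thesis using f g by (simp add: is_right_adjoint_def in_hom_iff F.on_Idn)
qed

text \<open>A monotone functor preserves the unit and counit inequalities, and right adjoints are
  unique in the target.\<close>

lemma functor_radj:
  assumes "cartesian_bicategory B" "cartesian_bicategory B'" "is_functor B B' F"
    and mono: "\<And>f g X Y. f \<in> hom B X Y \<Longrightarrow> g \<in> hom B X Y \<Longrightarrow> f \<sqsubseteq>\<^bsub>B\<^esub> g \<Longrightarrow> on_Arr F f \<sqsubseteq>\<^bsub>B'\<^esub> on_Arr F g"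
    and adj: "poset_enriched_smc.ladj B f"
  shows "poset_enriched_smc.ladj B' (on_Arr F f)" "on_Arr F (radj B f) = radj B' (on_Arr F f)"
proof -
  interpret B: cartesian_bicategory B by fact
  interpret B': cartesian_bicategory B' by fact
  interpret F: is_functor B B' F by fact
  have *: "is_right_adjoint B' (on_Arr F f) (on_Arr F (radj B f))"
    using functor_right_adjoint[OF assms(1,3) mono _ B.ladj_radj[OF adj]] adj by auto
  then show "B'.ladj (on_Arr F f)" using adj by (auto intro: B'.ladjI)
  show "on_Arr F (radj B f) = radj B' (on_Arr F f)" using B'.radj_eq[OF _ *] adj by simp
qed

text \<open>The clauses on the right adjoints of \<open>Dup\<close> and \<open>Del\<close> come from
  \<open>functor_radj\<close>.\<close>

lemma CBC_morphismI:
  fixes F :: "('o1, 'm1, 'o2, 'm2) ftor"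
  assumes B: "cartesian_bicategory B" and B': "cartesian_bicategory B'" and F: "is_functor B B' F"
    and on_TensOb: "\<And>X Y. X \<in> Ob B \<Longrightarrow> Y \<in> Ob B \<Longrightarrow>
          on_Ob F (X \<otimes>\<^sub>o\<^bsub>B\<^esub> Y) = on_Ob F X \<otimes>\<^sub>o\<^bsub>B'\<^esub> on_Ob F Y"
    and on_TensArr: "\<And>f g. f \<in> Arr B \<Longrightarrow> g \<in> Arr B \<Longrightarrow>
          on_Arr F (f \<otimes>\<^sub>a\<^bsub>B\<^esub> g) = on_Arr F f \<otimes>\<^sub>a\<^bsub>B'\<^esub> on_Arr F g"
    and on_Unit: "on_Ob F (Unit B) = Unit B'"
    and on_Assoc: "\<And>X Y Z. X \<in> Ob B \<Longrightarrow> Y \<in> Ob B \<Longrightarrow> Z \<in> Ob B \<Longrightarrow>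
          on_Arr F (Assoc B X Y Z) = Assoc B' (on_Ob F X) (on_Ob F Y) (on_Ob F Z)"
    and on_Lun: "\<And>X. X \<in> Ob B \<Longrightarrow> on_Arr F (Lun B X) = Lun B' (on_Ob F X)"
    and on_Run: "\<And>X. X \<in> Ob B \<Longrightarrow> on_Arr F (Run B X) = Run B' (on_Ob F X)"
    and on_Leq: "\<And>f g X Y. f \<in> hom B X Y \<Longrightarrow> g \<in> hom B X Y \<Longrightarrow> f \<sqsubseteq>\<^bsub>B\<^esub> g \<Longrightarrow> on_Arr F f \<sqsubseteq>\<^bsub>B'\<^esub> on_Arr F g"
    and on_Dup: "\<And>X. X \<in> Ob B \<Longrightarrow> on_Arr F (Dup B X) = Dup B' (on_Ob F X)"
    and on_Del: "\<And>X. X \<in> Ob B \<Longrightarrow> on_Arr F (Del B X) = Del B' (on_Ob F X)"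
    and ext: "on_Ob F \<in> extensional (Ob B)" "on_Arr F \<in> extensional (Arr B)"
  shows "CBC_morphism B B' F"
proof -
  interpret B: cartesian_bicategory B by fact
  interpret B': cartesian_bicategory B' by fact
  interpret F: is_functor B B' F by fact
  have "on_Arr F (radj B (Dup B X)) = radj B' (Dup B' (on_Ob F X))"
    "on_Arr F (radj B (Del B X)) = radj B' (Del B' (on_Ob F X))" if "X \<in> Ob B" for X
    using functor_radj(2)[OF B B' F on_Leq B.Dup_simps(4)] functor_radj(2)[OF B B' F on_Leq B.Del_simps(4)] that
    by (simp_all add: on_Dup on_Del)
  then show ?thesis
    using assms by (intro CBC_morphism.intro CBC_morphism_axioms.intro) auto
qed

lemma (in CBC_morphism) on_ladj:
  assumes "B.ladj f" shows "B'.ladj (on_Arr F f)" "on_Arr F (radj B f) = radj B' (on_Arr F f)"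
  using functor_radj[OF B.cartesian_bicategory_axioms B'.cartesian_bicategory_axioms is_functor_axioms on_Leq assms]
  by auto

section \<open>The category of cartesian bicategories\<close>

lemma CBC_simps [simp]:
  "Ob CBC = {B. cartesian_bicategory B}"
  "Idn CBC B = Arrow B B \<lparr>on_Ob = \<lambda>X\<in>Ob B. X, on_Arr = \<lambda>f\<in>Arr B. f\<rparr>"
  "F \<Zsemi>\<^bsub>CBC\<^esub> G = Arrow (src F) (tgt G)
     \<lparr>on_Ob = \<lambda>X\<in>Ob (src F). on_Ob (lab G) (on_Ob (lab F) X),
      on_Arr = \<lambda>f\<in>Arr (src F). on_Arr (lab G) (on_Arr (lab F) f)\<rparr>"
  by (simp_all add: CBC_def)

lemma CBC_Arr: "F \<in> Arr CBC \<longleftrightarrow> CBC_morphism (src F) (tgt F) (lab F)"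
  by (cases F) (auto simp: CBC_def)

lemma CBC_Idn:
  assumes "cartesian_bicategory B"
  shows "CBC_morphism B B \<lparr>on_Ob = \<lambda>X\<in>Ob B. X, on_Arr = \<lambda>f\<in>Arr B. f\<rparr>"
proof -
  interpret B: cartesian_bicategory B by fact
  have "is_functor B B \<lparr>on_Ob = \<lambda>X\<in>Ob B. X, on_Arr = \<lambda>f\<in>Arr B. f\<rparr>"
    by unfold_locales (auto simp: in_hom_iff)
  then show ?thesis using assms by (intro CBC_morphismI) (auto simp: in_hom_iff)
qed

lemma CBC_Seq:
  fixes F :: "('o1, 'm1, 'o2, 'm2) ftor" and G :: "('o2, 'm2, 'o3, 'm3) ftor"
  assumes "CBC_morphism B B' F" "CBC_morphism B' B'' G"
  shows "CBC_morphism B B'' \<lparr>on_Ob = \<lambda>X\<in>Ob B. on_Ob G (on_Ob F X),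
      on_Arr = \<lambda>f\<in>Arr B. on_Arr G (on_Arr F f)\<rparr>" (is "CBC_morphism B B'' ?H")
proof -
  interpret F: CBC_morphism B B' F by fact
  interpret G: CBC_morphism B' B'' G by fact
  have "is_functor B B'' ?H"
    by unfold_locales (auto simp: in_hom_iff F.on_Ob G.on_Ob F.on_Idn G.on_Idn)
  moreover have "on_Arr G (on_Arr F f) \<sqsubseteq>\<^bsub>B''\<^esub> on_Arr G (on_Arr F g)"
    if "f \<in> hom B X Y" "g \<in> hom B X Y" "f \<sqsubseteq>\<^bsub>B\<^esub> g" for f g X Y
    using G.on_Leq[OF F.on_Arr F.on_Arr F.on_Leq] that by blast
  ultimately show ?thesis
    by (intro CBC_morphismI F.B.cartesian_bicategory_axioms G.B'.cartesian_bicategory_axioms)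
      (auto simp: F.on_Ob G.on_Ob F.on_TensOb G.on_TensOb F.on_TensArr G.on_TensArr F.on_Unit G.on_Unit
        F.on_Assoc G.on_Assoc F.on_Lun G.on_Lun F.on_Run G.on_Run F.on_Dup G.on_Dup F.on_Del G.on_Del
        in_hom_iff)
qed

lemma category_CBC: "category (CBC :: (('o, 'm) bicat, ('o, 'm, 'o, 'm) ftor) cat)"
proof
  fix f :: "(('o, 'm) bicat, ('o, 'm, 'o, 'm) ftor) arrow"
  assume "f \<in> Arr CBC"
  then interpret CBC_morphism "src f" "tgt f" "lab f" by (simp add: CBC_Arr)
  show "src f \<in> Ob CBC" "tgt f \<in> Ob CBC"
    using B.cartesian_bicategory_axioms B'.cartesian_bicategory_axioms by auto
next
  fix X :: "('o, 'm) bicat" assume "X \<in> Ob CBC"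
  then show "Idn CBC X \<in> hom CBC X X" by (simp add: in_hom_iff CBC_Arr CBC_Idn)
next
  fix f g :: "(('o, 'm) bicat, ('o, 'm, 'o, 'm) ftor) arrow" and X Y Z
  assume "f \<in> hom CBC X Y" "g \<in> hom CBC Y Z"
  then show "f \<Zsemi>\<^bsub>CBC\<^esub> g \<in> hom CBC X Z" by (auto simp: in_hom_iff CBC_Arr CBC_Seq)
next
  fix f :: "(('o, 'm) bicat, ('o, 'm, 'o, 'm) ftor) arrow" and X Y
  assume f: "f \<in> hom CBC X Y"
  then interpret F: CBC_morphism X Y "lab f" by (auto simp: in_hom_iff CBC_Arr)
  have st: "src f = X" "tgt f = Y" using f by (auto simp: in_hom_iff)
  have "\<lparr>on_Ob = \<lambda>A\<in>Ob X. on_Ob (lab f) ((\<lambda>A\<in>Ob X. A) A), on_Arr = \<lambda>r\<in>Arr X. on_Arr (lab f) ((\<lambda>r\<in>Arr X. r) r)\<rparr> = lab f"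
    by (rule ftor_eqI[of _ "Ob X" _ "Arr X"]) (simp_all add: F.on_Ob_extensional F.on_Arr_extensional)
  then show "Idn CBC X \<Zsemi>\<^bsub>CBC\<^esub> f = f" using st by simp
  have "\<lparr>on_Ob = \<lambda>A\<in>Ob X. (\<lambda>A\<in>Ob Y. A) (on_Ob (lab f) A), on_Arr = \<lambda>r\<in>Arr X. (\<lambda>r\<in>Arr Y. r) (on_Arr (lab f) r)\<rparr> = lab f"
    by (rule ftor_eqI[of _ "Ob X" _ "Arr X"]) (simp_all add: F.on_Ob_extensional F.on_Arr_extensional F.on_Ob)
  then show "f \<Zsemi>\<^bsub>CBC\<^esub> Idn CBC Y = f" using st by simp
next
  fix f g h :: "(('o, 'm) bicat, ('o, 'm, 'o, 'm) ftor) arrow" and W X Y Z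
  assume f: "f \<in> hom CBC W X" and g: "g \<in> hom CBC X Y" and "h \<in> hom CBC Y Z"
  interpret F: CBC_morphism W X "lab f" using f by (auto simp: in_hom_iff CBC_Arr)
  have st: "src f = W" "tgt f = X" "src g = X" using f g by (auto simp: in_hom_iff)
  show "(f \<Zsemi>\<^bsub>CBC\<^esub> g) \<Zsemi>\<^bsub>CBC\<^esub> h = f \<Zsemi>\<^bsub>CBC\<^esub> (g \<Zsemi>\<^bsub>CBC\<^esub> h)"
    unfolding CBC_simps arrow.sel st
    by (intro arg_cong[where f = "Arrow W (tgt h)"] ftor_eqI[of _ "Ob W" _ "Arr W"]) (simp_all add: F.on_Ob)
qed

section \<open>The category of doctrines\<close>

lemma EED_simps [simp]:
  "Ob EED = {P. elementary_existential_doctrine P}"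
  "Idn EED P = Arrow P P (id_doctrine_map P)"
  "F \<Zsemi>\<^bsub>EED\<^esub> G = Arrow (src F) (tgt G) (comp_doctrine_map (src F) (lab F) (lab G))"
  by (simp_all add: EED_def)

lemma EED_Arr: "F \<in> Arr EED \<longleftrightarrow> EED_morphism (src F) (tgt F) (lab F)"
  by (cases F) (auto simp: EED_def)

lemma is_projection_src:
  "category C \<Longrightarrow> is_projection C p \<Longrightarrow> p \<in> Arr C \<and> src p \<in> Ob C \<and> tgt p \<in> Ob C"
  using category.src_Ob category.tgt_Ob by (auto simp: is_projection_def)

lemma EED_Idn:
  assumes "elementary_existential_doctrine P" shows "EED_morphism P P (id_doctrine_map P)"
proof -
  interpret P: EED_doctrine P using assms by (rule EED_doctrine.intro)
  have pr: "p \<in> Arr P" "src p \<in> Ob P" "tgt p \<in> Ob P" if "is_projection P p" for p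
    using is_projection_src[OF P.category_axioms that] by auto
  show ?thesis
    by unfold_locales (auto simp: in_hom_iff id_doctrine_map_def pr P.Exq_adjoint)
qed

lemma EED_Seq:
  assumes "EED_morphism P Q F" "EED_morphism Q R G"
  shows "EED_morphism P R (comp_doctrine_map P F G)"
proof -
  interpret F: EED_morphism P Q F by fact
  interpret G: EED_morphism Q R G by fact
  interpret P: EED_doctrine P by (rule EED_doctrine.intro) unfold_locales
  have pr: "p \<in> Arr P" "src p \<in> Ob P" "tgt p \<in> Ob P" if "is_projection P p" for p
    using is_projection_src[OF F.P.category_axioms that] by auto
  \<comment> \<open>\<open>G\<close> preserves the quantifier along the image of \<open>p\<close>
    because a strict cartesian functor sends arbitrary projections to projections.\<close>
  have ex: "on_Fib G (on_Ob F (tgt p)) (on_Fib F (tgt p) (Exq P p x)) =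
      Exq R (on_Arr G (on_Arr F p)) (on_Fib G (on_Ob F (src p)) (on_Fib F (src p) x))"
    if "is_projection P p" "x \<in> Fib P (src p)" for p x
    using that pr[OF that(1)] F.on_Exq[OF that] G.on_Exq[OF F.on_projection[OF that(1)], of "on_Fib F (src p) x"]
    by (simp add: F.on_Fib_closed)
  have act: "on_Fib G (on_Ob F (src f)) (on_Fib F (src f) (Act P f x)) =
      Act R (on_Arr G (on_Arr F f)) (on_Fib G (on_Ob F (tgt f)) (on_Fib F (tgt f) x))"
    if "f \<in> Arr P" "x \<in> Fib P (tgt f)" for f x
    using that F.on_Act[of f "src f" "tgt f" x] G.on_Act[of "on_Arr F f" "on_Ob F (src f)" "on_Ob F (tgt f)" "on_Fib F (tgt f) x"]
    by (simp add: in_hom_iff F.on_Fib_closed)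
  have del: "on_Fib G (on_Ob F A \<times>\<^sub>o\<^bsub>Q\<^esub> on_Ob F A) (on_Fib F (A \<times>\<^sub>o\<^bsub>P\<^esub> A) (Delta P A)) = Delta R (on_Ob G (on_Ob F A))"
    if "A \<in> Ob P" for A
    using that F.on_Delta[of A] G.on_Delta[of "on_Ob F A"] by (simp add: F.on_Ob)
  show ?thesis
  proof
    show "on_Fib (comp_doctrine_map P F G) X (Act P f x) =
        Act R (on_Arr (comp_doctrine_map P F G) f) (on_Fib (comp_doctrine_map P F G) Y x)"
      if "f \<in> hom P X Y" "x \<in> Fib P Y" for f X Y x
      using that act[of f x] F.P.hom_Ob[OF that(1)] by (auto simp: in_hom_iff comp_doctrine_map_def)
    show "on_Fib (comp_doctrine_map P F G) (tgt p) (Exq P p x) =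
         Exq R (on_Arr (comp_doctrine_map P F G) p) (on_Fib (comp_doctrine_map P F G) (src p) x)"
      if "is_projection P p" "x \<in> Fib P (src p)" for p x
      using that ex[OF that] pr[OF that(1)] P.Exq_adjoint(1)[OF that] by (simp add: comp_doctrine_map_def)
    show "on_Fib (comp_doctrine_map P F G) (A \<times>\<^sub>o\<^bsub>P\<^esub> A) (Delta P A) = Delta R (on_Ob (comp_doctrine_map P F G) A)"
      if "A \<in> Ob P" for A
      using that del[OF that] by (simp add: comp_doctrine_map_def F.on_Prod)
  qed (auto simp: in_hom_iff comp_doctrine_map_def F.on_Ob G.on_Ob F.on_Idn G.on_Idn F.on_Prod G.on_Prod
     F.on_Pr1 G.on_Pr1 F.on_Pr2 G.on_Pr2 F.on_One G.on_One F.on_Fib_closed G.on_Fib_closed F.on_Meet G.on_Meet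
     F.on_Top G.on_Top)
qed

lemma comp_doctrine_map_ext:
  "on_Ob (comp_doctrine_map P F G) \<in> extensional (Ob P)"
  "on_Arr (comp_doctrine_map P F G) \<in> extensional (Arr P)"
  "on_Fib (comp_doctrine_map P F G) \<in> extensional (Ob P)"
  "X \<in> Ob P \<Longrightarrow> on_Fib (comp_doctrine_map P F G) X \<in> extensional (Fib P X)"
  by (simp_all add: comp_doctrine_map_def)

lemma category_EED:
  "category (EED :: (('o, 'm, 'p) doctrine, ('o, 'm, 'p, 'o, 'm, 'p) doctrine_map) cat)"
proof
  fix f :: "(('o, 'm, 'p) doctrine, ('o, 'm, 'p, 'o, 'm, 'p) doctrine_map) arrow"
  assume "f \<in> Arr EED"
  then interpret EED_morphism "src f" "tgt f" "lab f" by (simp add: EED_Arr)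
  show "src f \<in> Ob EED" "tgt f \<in> Ob EED"
    using P.elementary_existential_doctrine_axioms Q.elementary_existential_doctrine_axioms by auto
next
  fix X :: "('o, 'm, 'p) doctrine" assume "X \<in> Ob EED"
  then show "Idn EED X \<in> hom EED X X" by (simp add: in_hom_iff EED_Arr EED_Idn)
next
  fix f g :: "(('o, 'm, 'p) doctrine, ('o, 'm, 'p, 'o, 'm, 'p) doctrine_map) arrow" and X Y Z
  assume "f \<in> hom EED X Y" "g \<in> hom EED Y Z"
  then show "f \<Zsemi>\<^bsub>EED\<^esub> g \<in> hom EED X Z" by (auto simp: in_hom_iff EED_Arr EED_Seq)
next
  fix f :: "(('o, 'm, 'p) doctrine, ('o, 'm, 'p, 'o, 'm, 'p) doctrine_map) arrow" and X Y
  assume f: "f \<in> hom EED X Y"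
  then interpret F: EED_morphism X Y "lab f" by (auto simp: in_hom_iff EED_Arr)
  note ext = F.on_Ob_extensional F.on_Arr_extensional F.on_Fib_extensional comp_doctrine_map_ext
  have st: "src f = X" "tgt f = Y" using f by (auto simp: in_hom_iff)
  have "comp_doctrine_map X (id_doctrine_map X) (lab f) = lab f"
    by (rule doctrine_map_eqI[of _ "Ob X" _ "Arr X" "Fib X"]) (simp_all add: ext, simp_all add: comp_doctrine_map_def id_doctrine_map_def)
  then show "Idn EED X \<Zsemi>\<^bsub>EED\<^esub> f = f" using st by simp
  have "comp_doctrine_map X (lab f) (id_doctrine_map Y) = lab f"
    by (rule doctrine_map_eqI[of _ "Ob X" _ "Arr X" "Fib X"])
      (simp_all add: ext, simp_all add: comp_doctrine_map_def id_doctrine_map_def F.on_Ob F.on_Fib_closed)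
  then show "f \<Zsemi>\<^bsub>EED\<^esub> Idn EED Y = f" using st by simp
next
  fix f g h :: "(('o, 'm, 'p) doctrine, ('o, 'm, 'p, 'o, 'm, 'p) doctrine_map) arrow" and W X Y Z
  assume f: "f \<in> hom EED W X" and g: "g \<in> hom EED X Y" and "h \<in> hom EED Y Z"
  interpret F: EED_morphism W X "lab f" using f by (auto simp: in_hom_iff EED_Arr)
  have "comp_doctrine_map W (comp_doctrine_map W (lab f) (lab g)) (lab h) =
      comp_doctrine_map W (lab f) (comp_doctrine_map X (lab g) (lab h))"
    by (rule doctrine_map_eqI[of _ "Ob W" _ "Arr W" "Fib W"])
      (simp_all add: comp_doctrine_map_ext, simp_all add: comp_doctrine_map_def F.on_Ob F.on_Fib_closed)
  then show "(f \<Zsemi>\<^bsub>EED\<^esub> g) \<Zsemi>\<^bsub>EED\<^esub> h = f \<Zsemi>\<^bsub>EED\<^esub> (g \<Zsemi>\<^bsub>EED\<^esub> h)"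
    using f g by (auto simp: in_hom_iff)
qed

section \<open>The functors and the adjunction\<close>

context EED_morphism
begin

lemma L_mor_src_tgt [simp]:
  assumes "r \<in> Arr (L_ob P)"
  shows "src (on_Arr (L_mor P F) r) = on_Ob F (src r)" "tgt (on_Arr (L_mor P F) r) = on_Ob F (tgt r)"
    "lab (on_Arr (L_mor P F) r) = on_Fib F (src r \<times>\<^sub>o\<^bsub>P\<^esub> tgt r) (lab r)"
  using assms by (simp_all add: L_mor_def)

lemma L_mor_Arr:
  assumes "r \<in> Arr (L_ob P)" shows "on_Arr (L_mor P F) r \<in> Arr (L_ob Q)"
proof -
  have "lab r \<in> Fib P (src r \<times>\<^sub>o\<^bsub>P\<^esub> tgt r)" "src r \<in> Ob P" "tgt r \<in> Ob P" using assms by (simp_all add: L_ob_Arr)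
  then show ?thesis
    using on_Fib_closed[of "src r \<times>\<^sub>o\<^bsub>P\<^esub> tgt r" "lab r"] assms by (simp add: L_ob_Arr on_Ob on_Prod)
qed

text \<open>Reindexing and \<open>Delta\<close> are preserved, hence graphs are. As the identities
  and all structural arrows of L(P) are graphs, this settles their preservation.\<close>

lemma L_mor_graph:
  assumes "f \<in> Arr P" shows "on_Arr (L_mor P F) (graph P f) = graph Q (on_Arr F f)"
proof -
  interpret PD: EED_doctrine P by (rule EED_doctrine.intro) unfold_locales
  let ?Y = "tgt f"
  have "on_Fib F (src f \<times>\<^sub>o\<^bsub>P\<^esub> ?Y) (Act P (f \<times>\<^sub>a\<^bsub>P\<^esub> Idn P ?Y) (Delta P ?Y)) =
      Act Q (on_Arr F (f \<times>\<^sub>a\<^bsub>P\<^esub> Idn P ?Y)) (on_Fib F (?Y \<times>\<^sub>o\<^bsub>P\<^esub> ?Y) (Delta P ?Y))"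
    using assms by (intro on_Act) (simp_all add: in_hom_iff)
  then show ?thesis
    using assms PD.graph_Arr[OF assms]
    by (simp add: L_mor_def graph_def on_Delta on_prod_arr on_Idn)
qed

text \<open>By \<open>projection_13\<close> the quantifier of a composite runs along a projection,
  so \<open>on_Exq\<close> applies to it; strictness identifies its image with the corresponding
  projection of \<open>Q\<close>.\<close>

lemma L_mor_Seq:
  assumes "r \<in> Arr (L_ob P)" "s \<in> Arr (L_ob P)" "tgt r = src s"
  shows "on_Arr (L_mor P F) (r \<Zsemi>\<^bsub>L_ob P\<^esub> s) = on_Arr (L_mor P F) r \<Zsemi>\<^bsub>L_ob Q\<^esub> on_Arr (L_mor P F) s"
proof -
  interpret PD: EED_doctrine P by (rule EED_doctrine.intro) unfold_locales
  interpret QD: EED_doctrine Q by (rule EED_doctrine.intro) unfold_locales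
  define X Y Z where o: "X = src r" "Y = src s" "Z = tgt s"
  have O: "X \<in> Ob P" "Y \<in> Ob P" "Z \<in> Ob P" and l: "lab r \<in> Fib P (X \<times>\<^sub>o\<^bsub>P\<^esub> Y)" "lab s \<in> Fib P (Y \<times>\<^sub>o\<^bsub>P\<^esub> Z)"
    and st: "src r = X" "tgt r = Y" "src s = Y" "tgt s = Z"
    using assms by (auto simp: o L_ob_Arr)
  let ?w = "Meet P (X \<times>\<^sub>o\<^bsub>P\<^esub> (Y \<times>\<^sub>o\<^bsub>P\<^esub> Z)) (Act P \<langle>tri1 P X Y Z, tri2 P X Y Z\<rangle>\<^bsub>P\<^esub> (lab r))
     (Act P \<langle>tri2 P X Y Z, tri3 P X Y Z\<rangle>\<^bsub>P\<^esub> (lab s))"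
  have w: "?w \<in> Fib P (X \<times>\<^sub>o\<^bsub>P\<^esub> (Y \<times>\<^sub>o\<^bsub>P\<^esub> Z))" using O l by simp
  have A: "on_Fib F (X \<times>\<^sub>o\<^bsub>P\<^esub> (Y \<times>\<^sub>o\<^bsub>P\<^esub> Z)) (Act P \<langle>tri1 P X Y Z, tri2 P X Y Z\<rangle>\<^bsub>P\<^esub> (lab r)) =
      Act Q (on_Arr F \<langle>tri1 P X Y Z, tri2 P X Y Z\<rangle>\<^bsub>P\<^esub>) (on_Fib F (X \<times>\<^sub>o\<^bsub>P\<^esub> Y) (lab r))"
    "on_Fib F (X \<times>\<^sub>o\<^bsub>P\<^esub> (Y \<times>\<^sub>o\<^bsub>P\<^esub> Z)) (Act P \<langle>tri2 P X Y Z, tri3 P X Y Z\<rangle>\<^bsub>P\<^esub> (lab s)) =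
      Act Q (on_Arr F \<langle>tri2 P X Y Z, tri3 P X Y Z\<rangle>\<^bsub>P\<^esub>) (on_Fib F (Y \<times>\<^sub>o\<^bsub>P\<^esub> Z) (lab s))"
    using O l by (auto intro!: on_Act simp: in_hom_iff)
  have "on_Fib F (X \<times>\<^sub>o\<^bsub>P\<^esub> Z) (Exq P \<langle>tri1 P X Y Z, tri3 P X Y Z\<rangle>\<^bsub>P\<^esub> ?w) =
     Exq Q (on_Arr F \<langle>tri1 P X Y Z, tri3 P X Y Z\<rangle>\<^bsub>P\<^esub>) (on_Fib F (X \<times>\<^sub>o\<^bsub>P\<^esub> (Y \<times>\<^sub>o\<^bsub>P\<^esub> Z)) ?w)"
    using on_Exq[OF PD.projection_13[OF O], of ?w] w O by simp
  then have "on_Fib F (X \<times>\<^sub>o\<^bsub>P\<^esub> Z) (Exq P \<langle>tri1 P X Y Z, tri3 P X Y Z\<rangle>\<^bsub>P\<^esub> ?w) = lab (on_Arr (L_mor P F) r \<Zsemi>\<^bsub>L_ob Q\<^esub> on_Arr (L_mor P F) s)"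
    using O l assms(1,2) st A
    by (simp add: QD.L_seq_eq L_seq_def Let_def on_Meet on_pair on_tri on_Prod)
  then show ?thesis
    using PD.seq_Arr[OF assms] assms st
    by (intro arrow.expand) (auto simp: PD.L_seq_eq L_seq_def Let_def)
qed

lemma L_mor_Tens:
  assumes "r \<in> Arr (L_ob P)" "s \<in> Arr (L_ob P)"
  shows "on_Arr (L_mor P F) (r \<otimes>\<^sub>a\<^bsub>L_ob P\<^esub> s) = on_Arr (L_mor P F) r \<otimes>\<^sub>a\<^bsub>L_ob Q\<^esub> on_Arr (L_mor P F) s"
proof -
  interpret PD: EED_doctrine P by (rule EED_doctrine.intro) unfold_locales
  interpret QD: EED_doctrine Q by (rule EED_doctrine.intro) unfold_locales
  define X Y Z W where o: "X = src r" "Y = tgt r" "Z = src s" "W = tgt s"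
  have O: "X \<in> Ob P" "Y \<in> Ob P" "Z \<in> Ob P" "W \<in> Ob P" and l: "lab r \<in> Fib P (X \<times>\<^sub>o\<^bsub>P\<^esub> Y)" "lab s \<in> Fib P (Z \<times>\<^sub>o\<^bsub>P\<^esub> W)"
    and st: "src r = X" "tgt r = Y" "src s = Z" "tgt s = W"
    using assms by (auto simp: o L_ob_Arr)
  let ?U = "(X \<times>\<^sub>o\<^bsub>P\<^esub> Z) \<times>\<^sub>o\<^bsub>P\<^esub> (Y \<times>\<^sub>o\<^bsub>P\<^esub> W)"
  have A: "on_Fib F ?U (Act P \<langle>quad1 P X Z Y W, quad3 P X Z Y W\<rangle>\<^bsub>P\<^esub> (lab r)) =
      Act Q (on_Arr F \<langle>quad1 P X Z Y W, quad3 P X Z Y W\<rangle>\<^bsub>P\<^esub>) (on_Fib F (X \<times>\<^sub>o\<^bsub>P\<^esub> Y) (lab r))"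
    "on_Fib F ?U (Act P \<langle>quad2 P X Z Y W, quad4 P X Z Y W\<rangle>\<^bsub>P\<^esub> (lab s)) =
      Act Q (on_Arr F \<langle>quad2 P X Z Y W, quad4 P X Z Y W\<rangle>\<^bsub>P\<^esub>) (on_Fib F (Z \<times>\<^sub>o\<^bsub>P\<^esub> W) (lab s))"
    using O l by (auto intro!: on_Act simp: in_hom_iff)
  have "on_Fib F ?U (Meet P ?U (Act P \<langle>quad1 P X Z Y W, quad3 P X Z Y W\<rangle>\<^bsub>P\<^esub> (lab r))
     (Act P \<langle>quad2 P X Z Y W, quad4 P X Z Y W\<rangle>\<^bsub>P\<^esub> (lab s))) = lab (on_Arr (L_mor P F) r \<otimes>\<^sub>a\<^bsub>L_ob Q\<^esub> on_Arr (L_mor P F) s)"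
    using O l assms(1,2) st A
    by (simp add: QD.L_tens_eq L_tens_def Let_def on_Meet on_pair on_quad on_Prod)
  then show ?thesis
    using PD.tens_Arr[OF assms] assms st O
    by (intro arrow.expand) (auto simp: PD.L_tens_eq L_tens_def Let_def on_Prod)
qed

lemma CBC_L_mor: "CBC_morphism (L_ob P) (L_ob Q) (L_mor P F)"
proof -
  interpret PD: EED_doctrine P by (rule EED_doctrine.intro) unfold_locales
  interpret QD: EED_doctrine Q by (rule EED_doctrine.intro) unfold_locales
  have ob: "on_Ob (L_mor P F) X = on_Ob F X" if "X \<in> Ob P" for X using that by (simp add: L_mor_def)
  have "is_functor (L_ob P) (L_ob Q) (L_mor P F)"
  proof
    show "on_Ob (L_mor P F) X \<in> Ob (L_ob Q)" if "X \<in> Ob (L_ob P)" for X using that by (simp add: ob on_Ob)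
    show "on_Arr (L_mor P F) (Idn (L_ob P) X) = Idn (L_ob Q) (on_Ob (L_mor P F) X)" if "X \<in> Ob (L_ob P)" for X
      using that L_mor_graph[of "Idn P X"] by (simp add: ob PD.graph_Idn QD.graph_Idn on_Idn on_Ob)
    show "on_Arr (L_mor P F) f \<in> hom (L_ob Q) (on_Ob (L_mor P F) X) (on_Ob (L_mor P F) Y)"
      if "f \<in> hom (L_ob P) X Y" for f X Y
      using that L_mor_Arr[of f] PD.L_Arr_Ob[of f] by (auto simp: in_hom_iff ob)
    show "on_Arr (L_mor P F) (f \<Zsemi>\<^bsub>L_ob P\<^esub> g) = on_Arr (L_mor P F) f \<Zsemi>\<^bsub>L_ob Q\<^esub> on_Arr (L_mor P F) g"
      if "f \<in> hom (L_ob P) X Y" "g \<in> hom (L_ob P) Y Z" for f g X Y Z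
      using that by (intro L_mor_Seq) (auto simp: in_hom_iff)
  qed
  then show ?thesis
  proof (rule CBC_morphismI[OF PD.cartesian_bicategory_L QD.cartesian_bicategory_L])
    show "on_Arr (L_mor P F) f \<sqsubseteq>\<^bsub>L_ob Q\<^esub> on_Arr (L_mor P F) g"
      if "f \<in> hom (L_ob P) X Y" "g \<in> hom (L_ob P) X Y" "f \<sqsubseteq>\<^bsub>L_ob P\<^esub> g" for f g X Y
    proof -
      have fg: "f \<in> Arr (L_ob P)" "g \<in> Arr (L_ob P)" "src f = X" "src g = X" "tgt f = Y" "tgt g = Y"
        "X \<in> Ob P" "Y \<in> Ob P" "lab f \<in> Fib P (X \<times>\<^sub>o\<^bsub>P\<^esub> Y)" "lab g \<in> Fib P (X \<times>\<^sub>o\<^bsub>P\<^esub> Y)"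
        "Meet P (X \<times>\<^sub>o\<^bsub>P\<^esub> Y) (lab f) (lab g) = lab f"
        using that by (auto simp: in_hom_iff L_ob_Arr L_ob_Leq fib_le_def)
      then show ?thesis
        using on_Meet[of "X \<times>\<^sub>o\<^bsub>P\<^esub> Y" "lab f" "lab g"] by (simp add: L_ob_Leq fib_le_def on_Prod)
    qed
  qed (auto simp: ob on_Prod on_One L_mor_Tens L_ob_structure L_mor_graph on_cart on_diag on_bang,
      simp_all add: L_mor_def)
qed

end

lemma is_functor_L:
  "is_functor (EED :: (('o, 'm, 'm) doctrine, ('o, 'm, 'm, 'o, 'm, 'm) doctrine_map) cat)
     (CBC :: (('o, 'm) bicat, ('o, 'm, 'o, 'm) ftor) cat) L_functor"
proof (intro is_functor.intro is_functor_axioms.intro category_EED category_CBC)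
  fix P :: "('o, 'm, 'm) doctrine" assume "P \<in> Ob EED"
  then interpret EED_doctrine P by (intro EED_doctrine.intro) simp
  show "on_Ob L_functor P \<in> Ob CBC" by (simp add: L_functor_def cartesian_bicategory_L)
  have "L_mor P (id_doctrine_map P) = \<lparr>on_Ob = \<lambda>X\<in>Ob (L_ob P). X, on_Arr = \<lambda>f\<in>Arr (L_ob P). f\<rparr>"
    by (rule ftor_eqI[of _ "Ob P" _ "Arr (L_ob P)"])
      (simp_all add: L_mor_def id_doctrine_map_def L_ob_Arr)
  then show "on_Arr L_functor (Idn EED P) = Idn CBC (on_Ob L_functor P)" by (simp add: L_functor_def)
next
  fix f :: "(('o, 'm, 'm) doctrine, ('o, 'm, 'm, 'o, 'm, 'm) doctrine_map) arrow" and P Q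
  assume f: "f \<in> hom EED P Q"
  then interpret F: EED_morphism P Q "lab f" by (auto simp: in_hom_iff EED_Arr)
  show "on_Arr L_functor f \<in> hom CBC (on_Ob L_functor P) (on_Ob L_functor Q)"
    using f F.CBC_L_mor by (auto simp: in_hom_iff CBC_Arr L_functor_def)
  fix g :: "(('o, 'm, 'm) doctrine, ('o, 'm, 'm, 'o, 'm, 'm) doctrine_map) arrow" and R
  assume g: "g \<in> hom EED Q R"
  have st: "src f = P" "tgt f = Q" "src g = Q" "tgt g = R" using f g by (auto simp: in_hom_iff)
  have "L_mor P (comp_doctrine_map P (lab f) (lab g)) = \<lparr>on_Ob = \<lambda>X\<in>Ob (L_ob P). on_Ob (L_mor Q (lab g)) (on_Ob (L_mor P (lab f)) X),
      on_Arr = \<lambda>r\<in>Arr (L_ob P). on_Arr (L_mor Q (lab g)) (on_Arr (L_mor P (lab f)) r)\<rparr>"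
  proof (rule ftor_eqI[of _ "Ob P" _ "Arr (L_ob P)"])
    fix r assume r: "r \<in> Arr (L_ob P)"
    then show "on_Arr (L_mor P (comp_doctrine_map P (lab f) (lab g))) r =
      on_Arr \<lparr>on_Ob = \<lambda>X\<in>Ob (L_ob P). on_Ob (L_mor Q (lab g)) (on_Ob (L_mor P (lab f)) X),
      on_Arr = \<lambda>r\<in>Arr (L_ob P). on_Arr (L_mor Q (lab g)) (on_Arr (L_mor P (lab f)) r)\<rparr> r"
      using F.L_mor_Arr[OF r] by (simp add: L_mor_def comp_doctrine_map_def L_ob_Arr F.on_Prod)
  qed (simp_all add: L_mor_def comp_doctrine_map_def F.on_Ob)
  then show "on_Arr L_functor (f \<Zsemi>\<^bsub>EED\<^esub> g) = on_Arr L_functor f \<Zsemi>\<^bsub>CBC\<^esub> on_Arr L_functor g"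
    using st by (simp add: L_functor_def)
qed

section \<open>The functor R on morphisms\<close>

context CBC_morphism
begin

lemma on_is_map:
  assumes "f \<in> Arr B" "is_map B f" shows "is_map B' (on_Arr F f)"
proof -
  have "on_Arr F (f \<Zsemi>\<^bsub>B\<^esub> Dup B (tgt f)) = on_Arr F (Dup B (src f) \<Zsemi>\<^bsub>B\<^esub> (f \<otimes>\<^sub>a\<^bsub>B\<^esub> f))"
    "on_Arr F (f \<Zsemi>\<^bsub>B\<^esub> Del B (tgt f)) = on_Arr F (Del B (src f))"
    using assms by (simp_all add: is_map_def)
  then show ?thesis using assms(1) by (simp add: is_map_def on_Dup on_Del on_TensArr)
qed

text \<open>A fibre element is a bare label, and its arrow is recovered from the source and target
  that the fibre prescribes. The prescribed target is the right one because \<open>F\<close>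
  preserves the unit object.\<close>

lemma on_pred:
  assumes "Arrow X (Unit B) u \<in> Arr B"
  shows "Arrow (on_Ob F X) (Unit B') (lab (on_Arr F (Arrow X (Unit B) u))) = on_Arr F (Arrow X (Unit B) u)"
  using assms by (simp add: on_Unit)

text \<open>The clauses on fibres are equations between arrows into the unit object, with labels
  wrapped and unwrapped by \<open>fib\<close> and \<open>fib'\<close>. For the quantifiers, a
  projection is a left adjoint and \<open>Exq\<close> composes with its right adjoint, which
  \<open>on_ladj\<close> preserves.\<close>

lemma EED_R_mor: "EED_morphism (R_ob B) (R_ob B') (R_mor B F)"
proof -
  interpret CB: CB B by (rule CB.intro) unfold_locales
  interpret CB': CB B' by (rule CB.intro) unfold_locales
  let ?G = "R_mor B F"
  have ob: "on_Ob ?G X = on_Ob F X" if "X \<in> Ob B" for X using that by (simp add: R_mor_def)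
  have ar: "on_Arr ?G f = on_Arr F f" if "f \<in> Arr (R_ob B)" for f using that by (simp add: R_mor_def)
  have fib: "on_Fib ?G X u = lab (on_Arr F (Arrow X (Unit B) u))" if "Arrow X (Unit B) u \<in> Arr B" for X u
    using that B.src_Ob[OF that] by (simp add: R_mor_def)
  have fib': "on_Fib ?G X (lab U) = lab (on_Arr F U)" if "U \<in> Arr B" "src U = X" "tgt U = Unit B" for X U
    using that fib[of X "lab U"] by simp
  have map: "on_Arr F f \<in> Arr (R_ob B')" if "f \<in> Arr (R_ob B)" for f
    using that on_is_map by (simp add: R_ob_Arr_iff)
  have meet: "on_Arr F (CB.meet U V) = CB'.meet (on_Arr F U) (on_Arr F V)"
    if "U \<in> Arr B" "V \<in> Arr B" "src V = src U" "tgt U = Unit B" "tgt V = Unit B" for U V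
    using that by (simp add: CB.meet_def CB'.meet_def on_Dup on_TensArr on_Lun on_Unit)
  show ?thesis
  proof (intro EED_morphism.intro strict_cartesian_functor.intro is_functor.intro is_functor_axioms.intro
      strict_cartesian_functor_axioms.intro EED_morphism_axioms.intro CB.EED_M CB'.EED_M CB.cartesian_M CB'.cartesian_M
      CB.category_M CB'.category_M)
    show "on_Ob ?G X \<in> Ob (R_ob B')" if "X \<in> Ob (R_ob B)" for X using that by (simp add: ob on_Ob)
    show "on_Arr ?G f \<in> hom (R_ob B') (on_Ob ?G X) (on_Ob ?G Y)" if "f \<in> hom (R_ob B) X Y" for f X Y
      using that map[of f] CB.M.src_Ob[of f] CB.M.tgt_Ob[of f] by (auto simp: in_hom_iff ar ob)
    show "on_Arr ?G (Idn (R_ob B) X) = Idn (R_ob B') (on_Ob ?G X)" if "X \<in> Ob (R_ob B)" for X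
      using that by (simp add: ob ar on_Idn)
    show "on_Arr ?G (f \<Zsemi>\<^bsub>R_ob B\<^esub> g) = on_Arr ?G f \<Zsemi>\<^bsub>R_ob B'\<^esub> on_Arr ?G g"
      if "f \<in> hom (R_ob B) X Y" "g \<in> hom (R_ob B) Y Z" for f g X Y Z
      using that by (auto simp: in_hom_iff ar)
    show "on_Ob ?G (X \<times>\<^sub>o\<^bsub>R_ob B\<^esub> Y) = on_Ob ?G X \<times>\<^sub>o\<^bsub>R_ob B'\<^esub> on_Ob ?G Y"
      "on_Arr ?G (Pr1 (R_ob B) X Y) = Pr1 (R_ob B') (on_Ob ?G X) (on_Ob ?G Y)"
      "on_Arr ?G (Pr2 (R_ob B) X Y) = Pr2 (R_ob B') (on_Ob ?G X) (on_Ob ?G Y)"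
      if "X \<in> Ob (R_ob B)" "Y \<in> Ob (R_ob B)" for X Y
      using that by (simp_all add: ob ar on_TensOb)
        (simp_all add: R_ob_Pr on_TensArr on_Idn on_Del on_Run on_Lun)
    show "on_Ob ?G (One (R_ob B)) = One (R_ob B')" by (simp add: ob on_Unit)
  next
    fix X x y assume X: "X \<in> Ob (R_ob B)" and "x \<in> Fib (R_ob B) X"
    then have x: "Arrow X (Unit B) x \<in> Arr B" by simp
    show "on_Fib ?G X x \<in> Fib (R_ob B') (on_Ob ?G X)"
      using x X on_pred[OF x] by (simp add: fib ob)
    assume "y \<in> Fib (R_ob B) X"
    then have y: "Arrow X (Unit B) y \<in> Arr B" by simp
    show "on_Fib ?G X (Meet (R_ob B) X x y) = Meet (R_ob B') (on_Ob ?G X) (on_Fib ?G X x) (on_Fib ?G X y)"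
      using x y X on_pred[OF x] on_pred[OF y] by (simp add: fib fib' ob meet)
  next
    show "on_Fib ?G X (Top (R_ob B) X) = Top (R_ob B') (on_Ob ?G X)" if "X \<in> Ob (R_ob B)" for X
      using that by (simp add: fib' ob on_Del)
    show "on_Fib ?G (A \<times>\<^sub>o\<^bsub>R_ob B\<^esub> A) (Delta (R_ob B) A) = Delta (R_ob B') (on_Ob ?G A)" if "A \<in> Ob (R_ob B)" for A
      using that by (simp add: fib' ob on_radj_Dup on_Dup on_Del)
  next
    fix f X Y x assume "f \<in> hom (R_ob B) X Y" "x \<in> Fib (R_ob B) Y"
    then have f: "f \<in> Arr (R_ob B)" "src f = X" "tgt f = Y" and x: "Arrow Y (Unit B) x \<in> Arr B" by (auto simp: in_hom_iff)
    then show "on_Fib ?G X (Act (R_ob B) f x) = Act (R_ob B') (on_Arr ?G f) (on_Fib ?G Y x)"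
      using on_pred[OF x] by (simp add: fib fib' ar)
  next
    fix p x assume p: "is_projection (R_ob B) p" and "x \<in> Fib (R_ob B) (src p)"
    then have x: "Arrow (src p) (Unit B) x \<in> Arr B" by simp
    from p obtain pm: "p \<in> Arr (R_ob B)" and pl: "B.ladj p" by (rule CB.M_projection)
    show "on_Fib ?G (tgt p) (Exq (R_ob B) p x) = Exq (R_ob B') (on_Arr ?G p) (on_Fib ?G (src p) x)"
      using on_pred[OF x] pm pl x on_ladj[OF pl]
      by (simp add: fib fib' ar CB.Exq_M CB'.Exq_M)
  next
    show "on_Ob ?G \<in> extensional (Ob (R_ob B))" "on_Arr ?G \<in> extensional (Arr (R_ob B))"
      "on_Fib ?G \<in> extensional (Ob (R_ob B))" by (simp_all add: R_mor_def)
    show "on_Fib ?G X \<in> extensional (Fib (R_ob B) X)" if "X \<in> Ob (R_ob B)" for X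
      using that by (simp add: R_mor_def)
  qed
qed

end

lemma is_functor_R:
  "is_functor (CBC :: (('o, 'm) bicat, ('o, 'm, 'o, 'm) ftor) cat)
     (EED :: (('o, 'm, 'm) doctrine, ('o, 'm, 'm, 'o, 'm, 'm) doctrine_map) cat) R_functor"
proof (intro is_functor.intro is_functor_axioms.intro category_EED category_CBC)
  fix B :: "('o, 'm) bicat" assume "B \<in> Ob CBC"
  then interpret CB B by (intro CB.intro) simp
  show "on_Ob R_functor B \<in> Ob EED" by (simp add: R_functor_def EED_M)
  have "R_mor B \<lparr>on_Ob = \<lambda>X\<in>Ob B. X, on_Arr = \<lambda>f\<in>Arr B. f\<rparr> = id_doctrine_map (R_ob B)"
    by (rule doctrine_map_eqI[of _ "Ob B" _ "Arr (R_ob B)" "Fib (R_ob B)"])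
      (simp_all add: R_mor_def id_doctrine_map_def)
  then show "on_Arr R_functor (Idn CBC B) = Idn EED (on_Ob R_functor B)" by (simp add: R_functor_def)
next
  fix f :: "(('o, 'm) bicat, ('o, 'm, 'o, 'm) ftor) arrow" and B B'
  assume f: "f \<in> hom CBC B B'"
  then interpret F: CBC_morphism B B' "lab f" by (auto simp: in_hom_iff CBC_Arr)
  interpret CB: CB B by (rule CB.intro) unfold_locales
  interpret CB': CB B' by (rule CB.intro) unfold_locales
  show "on_Arr R_functor f \<in> hom EED (on_Ob R_functor B) (on_Ob R_functor B')"
    using f F.EED_R_mor by (auto simp: in_hom_iff EED_Arr R_functor_def)
  fix g :: "(('o, 'm) bicat, ('o, 'm, 'o, 'm) ftor) arrow" and B''
  assume g: "g \<in> hom CBC B' B''"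
  have st: "src f = B" "tgt f = B'" "src g = B'" "tgt g = B''" using f g by (auto simp: in_hom_iff)
  have "R_mor B \<lparr>on_Ob = \<lambda>X\<in>Ob B. on_Ob (lab g) (on_Ob (lab f) X), on_Arr = \<lambda>r\<in>Arr B. on_Arr (lab g) (on_Arr (lab f) r)\<rparr> =
      comp_doctrine_map (R_ob B) (R_mor B (lab f)) (R_mor B' (lab g))"
  proof (rule doctrine_map_eqI[of _ "Ob B" _ "Arr (R_ob B)" "Fib (R_ob B)"])
    fix r assume r: "r \<in> Arr (R_ob B)"
    then have "on_Arr (lab f) r \<in> Arr (R_ob B')" using F.on_is_map by (simp add: R_ob_Arr_iff)
    then show "on_Arr (R_mor B \<lparr>on_Ob = \<lambda>X\<in>Ob B. on_Ob (lab g) (on_Ob (lab f) X), on_Arr = \<lambda>r\<in>Arr B. on_Arr (lab g) (on_Arr (lab f) r)\<rparr>) r =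
      on_Arr (comp_doctrine_map (R_ob B) (R_mor B (lab f)) (R_mor B' (lab g))) r"
      using r by (simp add: R_mor_def comp_doctrine_map_def)
  next
    fix X x assume "X \<in> Ob B" "x \<in> Fib (R_ob B) X"
    then show "on_Fib (R_mor B \<lparr>on_Ob = \<lambda>X\<in>Ob B. on_Ob (lab g) (on_Ob (lab f) X), on_Arr = \<lambda>r\<in>Arr B. on_Arr (lab g) (on_Arr (lab f) r)\<rparr>) X x =
      on_Fib (comp_doctrine_map (R_ob B) (R_mor B (lab f)) (R_mor B' (lab g))) X x"
      using F.on_pred[of X x] by (simp add: R_mor_def comp_doctrine_map_def F.on_Ob)
  qed (simp_all add: R_mor_def comp_doctrine_map_def F.on_Ob)
  then show "on_Arr R_functor (f \<Zsemi>\<^bsub>CBC\<^esub> g) = on_Arr R_functor f \<Zsemi>\<^bsub>EED\<^esub> on_Arr R_functor g"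
    using st by (simp add: R_functor_def)
qed

section \<open>The unit\<close>

context EED_doctrine
begin

lemma CB_L: "CB L"
  by (rule CB.intro) (rule cartesian_bicategory_L)

text \<open>Reindexing in R(L(P)) is composition with a graph; by the one-point rule this is
  reindexing in P with the target carried along.\<close>

lemma graph_seq_lab:
  assumes "f \<in> Arr P" "s \<in> Arr L" "tgt f = src s"
  shows "graph P f \<Zsemi>\<^bsub>L\<^esub> s = Arrow (src f) (tgt s) (Act P (f \<times>\<^sub>a Idn P (tgt s)) (lab s))"
proof (rule L_eqI)
  define X Y Z where o: "X = src f" "Y = src s" "Z = tgt s"
  have O: "X \<in> Ob P" "Y \<in> Ob P" "Z \<in> Ob P" "lab s \<in> Fib P (Y \<times>\<^sub>o Z)" using assms by (auto simp: o L_ob_Arr)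
  have ty: "f \<in> Arr P" "s \<in> Arr L" "src f = X" "tgt f = Y" "src s = Y" "tgt s = Z" using assms by (simp_all add: o)
  show "graph P f \<Zsemi>\<^bsub>L\<^esub> s \<in> Arr L" "Arrow (src f) (tgt s) (Act P (f \<times>\<^sub>a Idn P (tgt s)) (lab s)) \<in> Arr L"
    using ty O by simp_all (simp add: L_ob_Arr)
  fix U \<phi> x z assume "x \<in> hom P U (src (graph P f \<Zsemi>\<^bsub>L\<^esub> s))" "z \<in> hom P U (tgt (graph P f \<Zsemi>\<^bsub>L\<^esub> s))"
  then have xz: "x \<in> Arr P" "src x = U" "tgt x = X" "z \<in> Arr P" "src z = U" "tgt z = Z" using ty by (auto simp: in_hom_iff)
  show "forces P U \<phi> (graph P f \<Zsemi>\<^bsub>L\<^esub> s) x z \<longleftrightarrow>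
      forces P U \<phi> (Arrow (src f) (tgt s) (Act P (f \<times>\<^sub>a Idn P (tgt s)) (lab s))) x z"
    using forces_graph_seq[of s f X x U z \<phi>] forces_Act[of "f \<times>\<^sub>a Idn P Z" X Z Y Z "lab s" x U z \<phi>] ty O xz
    by (simp add: in_hom_iff prod_arr_def)
qed simp_all

text \<open>A relation from \<open>A\<close> to \<open>B\<close> and its predicate on the product
  hold of the same elements; the argument \<open>z\<close> in the terminal object carries no
  information.\<close>

lemma forces_pred:
  assumes "A \<in> Ob P" "B \<in> Ob P" "d \<in> Fib P (A \<times>\<^sub>o B)" "x \<in> hom P U (A \<times>\<^sub>o B)" "z \<in> hom P U (One P)"
  shows "forces P U \<phi> (Arrow (A \<times>\<^sub>o B) (One P) (Act P (cart_run P (A \<times>\<^sub>o B)) d)) x z \<longleftrightarrow>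
         forces P U \<phi> (Arrow A B d) (x \<Zsemi> Pr1 P A B) (x \<Zsemi> Pr2 P A B)"
  using forces_Act[of "cart_run P (A \<times>\<^sub>o B)" "A \<times>\<^sub>o B" "One P" A B d x U z \<phi>] assms
  by (simp add: in_hom_iff cart_run_def)

text \<open>The two components of \<open>x\<close> have a common witness exactly when they are
  equal. The component in \<open>One P\<close> accounts for the unitor.\<close>

lemma equ_L:
  assumes A: "A \<in> Ob P"
  shows "cograph P (diag P A) \<Zsemi>\<^bsub>L\<^esub> graph P (bang P A) =
         Arrow (A \<times>\<^sub>o A) (One P) (Act P (cart_run P (A \<times>\<^sub>o A)) (Delta P A))"
proof (rule L_eqI)
  let ?r = "cograph P (diag P A) \<Zsemi>\<^bsub>L\<^esub> graph P (bang P A)"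
  show "Arrow (A \<times>\<^sub>o A) (One P) (Act P (cart_run P (A \<times>\<^sub>o A)) (Delta P A)) \<in> Arr L" using A by (simp add: L_ob_Arr)
  fix U \<phi> x z assume \<phi>: "\<phi> \<in> Fib P U" and "x \<in> hom P U (src ?r)" "z \<in> hom P U (tgt ?r)"
  then have xz: "x \<in> Arr P" "src x = U" "tgt x = A \<times>\<^sub>o A" "z \<in> Arr P" "src z = U" "tgt z = One P" using A by (auto simp: in_hom_iff)
  let ?x = "x \<Zsemi> Pr1 P A A" and ?y = "x \<Zsemi> Pr2 P A A"
  have rhs: "forces P U \<phi> (Arrow (A \<times>\<^sub>o A) (One P) (Act P (cart_run P (A \<times>\<^sub>o A)) (Delta P A))) x z \<longleftrightarrow>
      forces P U \<phi> (Idn L A) ?x ?y"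
    using forces_pred[of A A "Delta P A" x U z \<phi>] A xz by (simp add: in_hom_iff L_ob_Idn)
  have cog: "forces P V \<chi> (cograph P (diag P A)) w v \<longleftrightarrow> forces P V \<chi> (Idn L A) (w \<Zsemi> Pr1 P A A) v \<and> forces P V \<chi> (Idn L A) (w \<Zsemi> Pr2 P A A) v"
    if "w \<in> hom P V (A \<times>\<^sub>o A)" "v \<in> hom P V A" for V \<chi> w v
    using forces_cograph[of "diag P A" A "A \<times>\<^sub>o A" v V w \<chi>] forces_Idn_Prod[of A A w V "v \<Zsemi> diag P A" \<chi>] that A
    by (simp add: in_hom_iff diag_def)
  show "forces P U \<phi> ?r x z \<longleftrightarrow>
      forces P U \<phi> (Arrow (A \<times>\<^sub>o A) (One P) (Act P (cart_run P (A \<times>\<^sub>o A)) (Delta P A))) x z"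
    unfolding rhs
  proof
    assume *: "forces P U \<phi> ?r x z"
    show "forces P U \<phi> (Idn L A) ?x ?y"
    proof (rule forces_seqE[OF _ _ _ *])
      fix V p v \<chi> assume p: "p \<in> hom P V U" and v: "v \<in> hom P V (src (graph P (bang P A)))"
        and "forces P V \<chi> (cograph P (diag P A)) (p \<Zsemi> x) v"
      then have "forces P V \<chi> (Idn L A) (p \<Zsemi> ?x) v" "forces P V \<chi> (Idn L A) (p \<Zsemi> ?y) v"
        using cog[of "p \<Zsemi> x" V v \<chi>] xz A by (auto simp: in_hom_iff)
      then show "forces P V \<chi> (Idn L A) (p \<Zsemi> ?x) (p \<Zsemi> ?y)" using forces_trans forces_sym by blast
    qed (use xz A in \<open>auto simp: in_hom_iff\<close>)
  next
    assume *: "forces P U \<phi> (Idn L A) ?x ?y"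
    have "forces P U \<phi> (cograph P (diag P A)) x ?x"
      using cog[of x U ?x \<phi>] forces_sym[OF *] forces_refl[of \<phi> U ?x A] \<phi> xz A by (simp add: in_hom_iff)
    moreover have "forces P U \<phi> (graph P (bang P A)) ?x z"
      using forces_graph[of "bang P A" A "One P" ?x U z \<phi>] forces_Idn_One[of \<phi> U "?x \<Zsemi> bang P A" z] \<phi> xz A
      by (simp add: in_hom_iff)
    ultimately show "forces P U \<phi> ?r x z" using A by (intro forces_seqI) simp_all
  qed
qed (use A in simp_all)

lemma cart_run_le_iff:
  assumes X: "X \<in> Ob P" and x: "x \<in> Fib P X" "y \<in> Fib P X"
  shows "fib_le P (X \<times>\<^sub>o One P) (Act P (cart_run P X) x) (Act P (cart_run P X) y) \<longleftrightarrow> fib_le P X x y"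
proof -
  have i: "inverse_arrows P (cart_run P X) \<langle>Idn P X, bang P X\<rangle>" by (rule inverse_cart_run[OF X])
  show ?thesis
    using Act_mono[of "cart_run P X" x y] X x i
      Act_mono[of "\<langle>Idn P X, bang P X\<rangle>" "Act P (cart_run P X) x" "Act P (cart_run P X) y"]
    by (auto simp: inverse_arrows_def)
qed

lemma cart_run_surj:
  assumes X: "X \<in> Ob P" and v: "v \<in> Fib P (X \<times>\<^sub>o One P)"
  obtains x where "x \<in> Fib P X" "v = Act P (cart_run P X) x"
proof
  have i: "inverse_arrows P (cart_run P X) \<langle>Idn P X, bang P X\<rangle>" by (rule inverse_cart_run[OF X])
  show "Act P \<langle>Idn P X, bang P X\<rangle> v \<in> Fib P X" using X v by simp
  show "v = Act P (cart_run P X) (Act P \<langle>Idn P X, bang P X\<rangle> v)"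
    using X v i by (subst Act_Act) (simp_all add: inverse_arrows_def)
qed

text \<open>The bent relation asks for two equal elements of the target of \<open>r\<close>, the
  first related by \<open>r\<close> to the first component of the argument, the second equal to its
  second component. Substitution collapses this to \<open>r\<close> itself. It is the computation
  behind the first triangle identity.\<close>

lemma eps_inv_L:
  assumes r: "r \<in> Arr L"
  shows "eps_inv_arr L r = Arrow (src r) (tgt r) (Act P (cart_run P (src r \<times>\<^sub>o tgt r)) (lab r))"
proof -
  define X Y where o: "X = src r" "Y = tgt r"
  have O: "X \<in> Ob P" "Y \<in> Ob P" "lab r \<in> Fib P (X \<times>\<^sub>o Y)" using r by (auto simp: o L_ob_Arr)
  have ty: "r \<in> Arr L" "src r = X" "tgt r = Y" using r by (simp_all add: o)
  let ?e = "cograph P (diag P Y) \<Zsemi>\<^bsub>L\<^esub> graph P (bang P Y)"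
  let ?l = "(r \<otimes>\<^sub>a\<^bsub>L\<^esub> Idn L Y) \<Zsemi>\<^bsub>L\<^esub> ?e"
  have "?l = Arrow (X \<times>\<^sub>o Y) (One P) (Act P (cart_run P (X \<times>\<^sub>o Y)) (lab r))" (is "_ = ?r")
  proof (rule L_eqI)
    show "?l \<in> Arr L" "?r \<in> Arr L" "src ?l = src ?r" "tgt ?l = tgt ?r" using ty O by simp_all (simp add: L_ob_Arr)
    fix U \<phi> w z assume \<phi>: "\<phi> \<in> Fib P U" and "w \<in> hom P U (src ?l)" "z \<in> hom P U (tgt ?l)"
    then have wz: "w \<in> Arr P" "src w = U" "tgt w = X \<times>\<^sub>o Y" "z \<in> Arr P" "src z = U" "tgt z = One P"
      using ty O by (auto simp: in_hom_iff)
    let ?x = "w \<Zsemi> Pr1 P X Y" and ?y = "w \<Zsemi> Pr2 P X Y"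
    have rhs: "forces P U \<phi> ?r w z \<longleftrightarrow> forces P U \<phi> r ?x ?y"
      using forces_pred[of X Y "lab r" w U z \<phi>] ty O wz by (simp add: in_hom_iff)
    have t: "forces P V \<chi> (r \<otimes>\<^sub>a\<^bsub>L\<^esub> Idn L Y) a v \<longleftrightarrow>
        forces P V \<chi> r (a \<Zsemi> Pr1 P X Y) (v \<Zsemi> Pr1 P Y Y) \<and> forces P V \<chi> (Idn L Y) (a \<Zsemi> Pr2 P X Y) (v \<Zsemi> Pr2 P Y Y)"
      if "a \<in> hom P V (X \<times>\<^sub>o Y)" "v \<in> hom P V (Y \<times>\<^sub>o Y)" for V \<chi> a v
      using forces_tens[of r "Idn L Y" X Y Y Y a V v \<chi>] that ty O by simp
    have e: "forces P V \<chi> ?e v c \<longleftrightarrow> forces P V \<chi> (Idn L Y) (v \<Zsemi> Pr1 P Y Y) (v \<Zsemi> Pr2 P Y Y)"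
      if "v \<in> hom P V (Y \<times>\<^sub>o Y)" "c \<in> hom P V (One P)" for V \<chi> v c
      unfolding equ_L[OF O(2)] using forces_pred[of Y Y "Delta P Y" v V c \<chi>] that O by (simp add: L_ob_Idn)
    show "forces P U \<phi> ?l w z \<longleftrightarrow> forces P U \<phi> ?r w z"
      unfolding rhs
    proof
      assume *: "forces P U \<phi> ?l w z"
      show "forces P U \<phi> r ?x ?y"
      proof (rule forces_seqE[OF _ _ _ *])
        fix V p v \<chi> assume p: "p \<in> hom P V U" and "v \<in> hom P V (src ?e)"
          and 1: "forces P V \<chi> (r \<otimes>\<^sub>a\<^bsub>L\<^esub> Idn L Y) (p \<Zsemi> w) v" and 2: "forces P V \<chi> ?e v (p \<Zsemi> z)"
        then have v: "v \<in> hom P V (Y \<times>\<^sub>o Y)" using O by simp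
        have 3: "forces P V \<chi> r (p \<Zsemi> ?x) (v \<Zsemi> Pr1 P Y Y)" "forces P V \<chi> (Idn L Y) (p \<Zsemi> ?y) (v \<Zsemi> Pr2 P Y Y)"
          using t[of "p \<Zsemi> w" V v \<chi>] 1 p v wz O by (auto simp: in_hom_iff)
        have 4: "forces P V \<chi> (Idn L Y) (v \<Zsemi> Pr1 P Y Y) (v \<Zsemi> Pr2 P Y Y)"
          using e[of v V "p \<Zsemi> z" \<chi>] 2 p v wz by (auto simp: in_hom_iff)
        show "forces P V \<chi> r (p \<Zsemi> ?x) (p \<Zsemi> ?y)"
          by (rule forces_subst_right[OF r forces_trans[OF 4 forces_sym[OF 3(2)]] 3(1)])
      qed (use ty O wz in \<open>auto simp: in_hom_iff\<close>)
    next
      assume *: "forces P U \<phi> r ?x ?y"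
      have y: "forces P U \<phi> (Idn L Y) ?y ?y" using forces_refl[of \<phi> U ?y Y] \<phi> wz O by (simp add: in_hom_iff)
      \<comment> \<open>The witness for the bent wire is the second component taken twice.\<close>
      have "forces P U \<phi> (r \<otimes>\<^sub>a\<^bsub>L\<^esub> Idn L Y) w \<langle>?y, ?y\<rangle>"
        using t[of w U "\<langle>?y, ?y\<rangle>" \<phi>] * y wz O by (simp add: in_hom_iff)
      moreover have "forces P U \<phi> ?e \<langle>?y, ?y\<rangle> z" using e[of "\<langle>?y, ?y\<rangle>" U z \<phi>] y wz O by (simp add: in_hom_iff)
      ultimately show "forces P U \<phi> ?l w z" by (rule forces_seqI[rotated 3]) (use ty O in simp_all)
    qed
  qed
  then show ?thesis using ty O by (simp add: eps_inv_arr_def Let_def L_ob_structure radj_graph)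
qed

end

text \<open>The unit is only defined when arrows and fibre elements have the same type of labels.\<close>

locale homogeneous_doctrine = EED_doctrine P
  for P :: "('o, 'm, 'm) doctrine" (structure)
begin

lemma EED_eta: "EED_morphism P (R_ob L) (lab (eta P))"
proof -
  let ?e = "lab (eta P)"
  interpret CB: CB L by (rule CB_L)
  interpret R: elementary_existential_doctrine "R_ob L" by (rule CB.EED_M)
  interpret R: EED_doctrine "R_ob L" by (rule EED_doctrine.intro) unfold_locales
  define b where "b X x = Act P (cart_run P X) x" for X x
  have ob: "on_Ob ?e X = X" if "X \<in> Ob P" for X using that by (simp add: eta_def)
  have ar: "on_Arr ?e f = graph P f" if "f \<in> Arr P" for f using that by (simp add: eta_def)
  have fib: "on_Fib ?e X x = b X x" if "X \<in> Ob P" "x \<in> Fib P X" for X x using that by (simp add: eta_def b_def)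
  have Fib: "v \<in> Fib (R_ob L) X \<longleftrightarrow> X \<in> Ob P \<and> v \<in> Fib P (X \<times>\<^sub>o One P)" for X v
    by (simp add: L_ob_Arr)
  have b: "b X x \<in> Fib (R_ob L) X" if "X \<in> Ob P" "x \<in> Fib P X" for X x using that unfolding Fib by (simp add: b_def)
  have b_surj: "\<exists>x\<in>Fib P X. v = b X x" if "v \<in> Fib (R_ob L) X" for X v
    using that cart_run_surj[of X v] unfolding Fib b_def by metis
  have le: "fib_le (R_ob L) X (b X x) (b X y) \<longleftrightarrow> fib_le P X x y" if "X \<in> Ob P" "x \<in> Fib P X" "y \<in> Fib P X" for X x y
    using CB.fib_le_M[of X "b X x" "b X y"] b[OF that(1,2)] b[OF that(1,3)] cart_run_le_iff[OF that]
    by (simp add: L_ob_Leq b_def)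
  have act: "b (src f) (Act P f x) = Act (R_ob L) (graph P f) (b (tgt f) x)" if f: "f \<in> Arr P" and x: "x \<in> Fib P (tgt f)" for f x
  proof -
    have "Arrow (tgt f) (One P) (b (tgt f) x) \<in> Arr L" using b[of "tgt f" x] f x by simp
    then have "Act (R_ob L) (graph P f) (b (tgt f) x) = Act P (f \<times>\<^sub>a Idn P (One P)) (b (tgt f) x)"
      using graph_seq_lab[OF f, of "Arrow (tgt f) (One P) (b (tgt f) x)"] by simp
    also have "\<dots> = Act P ((f \<times>\<^sub>a Idn P (One P)) \<Zsemi> cart_run P (tgt f)) x" using f x by (simp add: b_def)
    also have "(f \<times>\<^sub>a Idn P (One P)) \<Zsemi> cart_run P (tgt f) = cart_run P (src f) \<Zsemi> f"
      using f by (simp add: prod_arr_def cart_run_def)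
    finally show ?thesis using f x by (simp add: b_def)
  qed
  \<comment> \<open>Graphs are maps because they have cographs as right adjoints.\<close>
  have G: "graph P f \<in> Arr (R_ob L)" if "f \<in> Arr P" for f
    using CB.ladj_map'[OF CB.ladjI[OF graph_Arr[OF that] right_adjoint_graph[OF that]]] .
  note str = L_ob_structure graph_Idn[symmetric] graph_tens graph_seq
  show ?thesis
  proof (intro EED_morphism.intro strict_cartesian_functor.intro is_functor.intro is_functor_axioms.intro
      strict_cartesian_functor_axioms.intro EED_morphism_axioms.intro elementary_existential_doctrine_axioms CB.EED_M
      cartesian_category_axioms CB.cartesian_M category_axioms CB.category_M)
    show "on_Ob ?e X \<in> Ob (R_ob L)" if "X \<in> Ob P" for X using that by (simp add: ob)
    show "on_Arr ?e f \<in> hom (R_ob L) (on_Ob ?e X) (on_Ob ?e Y)" if "f \<in> hom P X Y" for f X Y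
      using that G[of f] hom_Ob[OF that] by (auto simp: in_hom_iff ar ob)
    show "on_Arr ?e (Idn P X) = Idn (R_ob L) (on_Ob ?e X)" if "X \<in> Ob P" for X
      using that by (simp add: ob ar graph_Idn)
    show "on_Arr ?e (f \<Zsemi> g) = on_Arr ?e f \<Zsemi>\<^bsub>R_ob L\<^esub> on_Arr ?e g"
      if "f \<in> hom P X Y" "g \<in> hom P Y Z" for f g X Y Z
      using that by (auto simp: in_hom_iff ar graph_seq)
    show "on_Ob ?e (X \<times>\<^sub>o Y) = on_Ob ?e X \<times>\<^sub>o\<^bsub>R_ob L\<^esub> on_Ob ?e Y"
      if "X \<in> Ob P" "Y \<in> Ob P" for X Y using that by (simp add: ob)
    show "on_Arr ?e (Pr1 P X Y) = Pr1 (R_ob L) (on_Ob ?e X) (on_Ob ?e Y)"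
      "on_Arr ?e (Pr2 P X Y) = Pr2 (R_ob L) (on_Ob ?e X) (on_Ob ?e Y)"
      if "X \<in> Ob P" "Y \<in> Ob P" for X Y
      unfolding R_ob_Pr using that by (simp_all add: ob ar str) (simp_all add: cart_defs)
    show "on_Ob ?e (One P) = One (R_ob L)" by (simp add: ob)
  next
    fix X x assume X: "X \<in> Ob P" and x: "x \<in> Fib P X"
    show "on_Fib ?e X x \<in> Fib (R_ob L) (on_Ob ?e X)"
      using b[OF X x] X x by (simp add: fib ob)
    fix y assume y: "y \<in> Fib P X"
    have X': "X \<in> Ob (R_ob L)" using X by simp
    have m: "Meet P X x y \<in> Fib P X" using X x y by simp
    have m': "Meet (R_ob L) X (b X x) (b X y) \<in> Fib (R_ob L) X" using R.Meet_Fib[OF X' b[OF X x] b[OF X y]] .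
    \<comment> \<open>Surjectivity of \<open>b\<close> names the meet of R(L(P)) as the image of
      some \<open>z\<close>, so the two meets can be compared through the order in
      \<open>P\<close>.\<close>
    obtain z where z: "z \<in> Fib P X" "Meet (R_ob L) X (b X x) (b X y) = b X z" using b_surj[OF m'] by blast
    have zl: "fib_le P X z x" "fib_le P X z y"
      using R.Meet_le1[OF X' b[OF X x] b[OF X y]] R.Meet_le2[OF X' b[OF X x] b[OF X y]] z le X x y by auto
    have "b X (Meet P X x y) = b X z"
    proof (rule R.le_antisym[OF X' b[OF X m] b[OF X z(1)]])
      show "fib_le (R_ob L) X (b X (Meet P X x y)) (b X z)"
        unfolding z(2)[symmetric] R.le_Meet_iff[OF X' b[OF X x] b[OF X y] b[OF X m]]
        using le[OF X m x] le[OF X m y] Meet_le1[OF X x y] Meet_le2[OF X x y] by simp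
      show "fib_le (R_ob L) X (b X z) (b X (Meet P X x y))"
        using le[OF X z(1) m] le_Meet_iff[OF X x y z(1)] zl by simp
    qed
    then show "on_Fib ?e X (Meet P X x y) =
        Meet (R_ob L) (on_Ob ?e X) (on_Fib ?e X x) (on_Fib ?e X y)"
      unfolding fib[OF X x] fib[OF X y] fib[OF X m] ob[OF X] z(2) .
  next
    fix X assume X: "X \<in> Ob P"
    then have X': "X \<in> Ob (R_ob L)" by simp
    obtain z where z: "z \<in> Fib P X" "Top (R_ob L) X = b X z" using b_surj[OF R.Top_Fib[OF X']] by blast
    have t: "Top P X \<in> Fib P X" using X by simp
    have "b X (Top P X) = b X z"
    proof (rule R.le_antisym[OF X' b[OF X t] b[OF X z(1)]])
      show "fib_le (R_ob L) X (b X (Top P X)) (b X z)" unfolding z(2)[symmetric] by (rule R.le_Top[OF X' b[OF X t]])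
      show "fib_le (R_ob L) X (b X z) (b X (Top P X))" using le[OF X z(1) t] X z by simp
    qed
    then show "on_Fib ?e X (Top P X) = Top (R_ob L) (on_Ob ?e X)"
      unfolding fib[OF X t] ob[OF X] z(2) .
    have "radj L (Dup L X) \<Zsemi>\<^bsub>L\<^esub> Del L X = Arrow (X \<times>\<^sub>o X) (One P) (b (X \<times>\<^sub>o X) (Delta P X))"
      using equ_L[OF X] X by (simp add: L_ob_structure radj_graph b_def)
    then show "on_Fib ?e (X \<times>\<^sub>o X) (Delta P X) = Delta (R_ob L) (on_Ob ?e X)"
      using X by (simp add: fib ob)
  next
    fix f X Y x assume "f \<in> hom P X Y" "x \<in> Fib P Y"
    then show "on_Fib ?e X (Act P f x) = Act (R_ob L) (on_Arr ?e f) (on_Fib ?e Y x)"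
      using act[of f x] hom_Ob[of f X Y] by (auto simp: in_hom_iff fib ar simp del: CB.R_ob_doctrine)
  next
    fix p x assume p: "is_projection P p" and x: "x \<in> Fib P (src p)"
    have pA: "p \<in> Arr P" "src p \<in> Ob P" "tgt p \<in> Ob P" using is_projection_src[OF category_axioms p] by auto
    note ex = Exq_adjoint[OF p x]
    \<comment> \<open>Both sides are left adjoint values for the same reindexing, since
      \<open>b\<close> is an order isomorphism that commutes with it.\<close>
    have "Exq (R_ob L) (graph P p) (b (src p) x) = b (tgt p) (Exq P p x)"
    proof (rule R.Exq_eqI)
      show "tgt (graph P p) \<in> Ob (R_ob L)" using pA by simp
      show "b (tgt p) (Exq P p x) \<in> Fib (R_ob L) (tgt (graph P p))" using b[OF pA(3) ex(1)] by simp
      fix v assume "v \<in> Fib (R_ob L) (tgt (graph P p))"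
      then obtain y where y: "y \<in> Fib P (tgt p)" "v = b (tgt p) y" using b_surj[of v "tgt p"] by auto
      have a: "Act P p y \<in> Fib P (src p)" using y pA by simp
      show "fib_le (R_ob L) (tgt (graph P p)) (b (tgt p) (Exq P p x)) v \<longleftrightarrow>
          fib_le (R_ob L) (src (graph P p)) (b (src p) x) (Act (R_ob L) (graph P p) v)"
        unfolding y(2) act[OF pA(1) y(1), symmetric] graph_src_tgt le[OF pA(3) ex(1) y(1)] le[OF pA(2) x a]
        by (rule ex(2)[OF y(1)])
    qed
    then show "on_Fib ?e (tgt p) (Exq P p x) = Exq (R_ob L) (on_Arr ?e p) (on_Fib ?e (src p) x)"
      using pA x ex(1) by (simp add: fib ar)
  next
    show "on_Ob ?e \<in> extensional (Ob P)" "on_Arr ?e \<in> extensional (Arr P)"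
      "on_Fib ?e \<in> extensional (Ob P)" by (simp_all add: eta_def)
    show "on_Fib ?e X \<in> extensional (Fib P X)" if "X \<in> Ob P" for X
      using that by (simp add: eta_def)
  qed
qed

end

text \<open>On arrows this is preservation of graphs. On fibres \<open>F\<close> commutes with
  reindexing, and it sends the unitor of \<open>P\<close> to that of \<open>Q\<close>.\<close>

lemma eta_natural:
  fixes P Q :: "('o, 'm, 'm) doctrine"
  assumes F: "EED_morphism P Q F"
  shows "comp_doctrine_map P F (lab (eta Q)) =
         comp_doctrine_map P (lab (eta P)) (R_mor (L_ob P) (L_mor P F))"
proof -
  interpret F: EED_morphism P Q F by fact
  interpret PD: homogeneous_doctrine P
    by (intro homogeneous_doctrine.intro EED_doctrine.intro F.P.elementary_existential_doctrine_axioms)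
  interpret CB: CB "L_ob P" by (rule PD.CB_L)
  interpret E: EED_morphism P "R_ob (L_ob P)" "lab (eta P)" by (rule PD.EED_eta)
  show ?thesis
  proof (rule doctrine_map_eqI[of _ "Ob P" _ "Arr P" "Fib P"])
    fix f assume f: "f \<in> Arr P"
    have "graph P f \<in> Arr (R_ob (L_ob P))" using E.on_Arr_simps(1)[OF f] f by (simp add: eta_def)
    then show "on_Arr (comp_doctrine_map P F (lab (eta Q))) f =
       on_Arr (comp_doctrine_map P (lab (eta P)) (R_mor (L_ob P) (L_mor P F))) f"
      using f by (simp add: comp_doctrine_map_def eta_def R_mor_def F.L_mor_graph)
  next
    fix X x assume X: "X \<in> Ob P" and x: "x \<in> Fib P X"
    let ?b = "Act P (cart_run P X) x"
    have b: "Arrow X (One P) ?b \<in> Arr (L_ob P)" using X x by (simp add: L_ob_Arr)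
    have "on_Fib F (X \<times>\<^sub>o\<^bsub>P\<^esub> One P) ?b = Act Q (on_Arr F (cart_run P X)) (on_Fib F X x)"
      using X x by (intro F.on_Act) (simp_all add: in_hom_iff)
    then show "on_Fib (comp_doctrine_map P F (lab (eta Q))) X x =
       on_Fib (comp_doctrine_map P (lab (eta P)) (R_mor (L_ob P) (L_mor P F))) X x"
      using X x b by (simp add: comp_doctrine_map_def eta_def R_mor_def F.on_Ob F.on_Fib_closed F.on_cart F.L_mor_src_tgt)
  qed (simp_all add: comp_doctrine_map_def eta_def R_mor_def F.on_Ob L_mor_def)
qed

section \<open>The counit\<close>

context CB
begin

lemma CBC_eps_inv: "CBC_morphism B (L_ob M) (lab (eps_inv B))"
proof -
  let ?F = "lab (eps_inv B)"
  interpret D: EED_doctrine M by (rule EED_doctrine.intro) (rule EED_M)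
  have ob: "on_Ob ?F X = X" if "X \<in> Ob B" for X using that by (simp add: eps_inv_def)
  have ar: "on_Arr ?F f = eps_inv_arr B f" if "f \<in> Arr B" for f using that by (simp add: eps_inv_def)
  have "is_functor B (L_ob M) ?F"
  proof (intro is_functor.intro is_functor_axioms.intro category_axioms D.category_L)
    show "on_Arr ?F (Idn B X) = Idn (L_ob M) (on_Ob ?F X)" if "X \<in> Ob B" for X
      using that D.graph_Idn[of X] by (simp add: ob ar eps_inv_graph)
    show "on_Arr ?F f \<in> hom (L_ob M) (on_Ob ?F X) (on_Ob ?F Y)"
      if "f \<in> hom B X Y" for f X Y
      using that hom_Ob[OF that] eps_inv_Arr[of f] by (auto simp: in_hom_iff ob ar)
    show "on_Arr ?F (f \<Zsemi> g) = on_Arr ?F f \<Zsemi>\<^bsub>L_ob M\<^esub> on_Arr ?F g"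
      if "f \<in> hom B X Y" "g \<in> hom B Y Z" for f g X Y Z
      using that by (auto simp: in_hom_iff ar eps_inv_Seq)
  qed (simp_all add: ob)
  then show ?thesis
  proof (rule CBC_morphismI[OF cartesian_bicategory_axioms D.cartesian_bicategory_L])
    show "on_Arr ?F f \<sqsubseteq>\<^bsub>L_ob M\<^esub> on_Arr ?F g"
      if "f \<in> hom B X Y" "g \<in> hom B X Y" "f \<sqsubseteq> g" for f g X Y
      using that by (auto simp: in_hom_iff ar eps_inv_Leq)
  qed (simp_all add: ob ar eps_inv_Tens eps_inv_graph L_ob_structure Assoc_M bang_M,
      simp_all add: Lun_M Run_M Dup_M cart_lun_def cart_run_def diag_def eps_inv_def)
qed

text \<open>Every arrow of L(R(B)) is a bent arrow of \<open>B\<close>, so each preservation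
  property of bending, read backwards, is one of unbending. For the order this uses that bending
  also reflects it.\<close>

lemma CBC_eps: "CBC_morphism (L_ob M) B (lab (eps B))"
proof -
  let ?F = "lab (eps B)" and ?G = "lab (eps_inv B)"
  interpret D: EED_doctrine M by (rule EED_doctrine.intro) (rule EED_M)
  interpret I: CBC_morphism B "L_ob M" "lab (eps_inv B)" by (rule CBC_eps_inv)
  have ob: "on_Ob ?F X = X" if "X \<in> Ob B" for X using that by (simp add: eps_def)
  have ar: "on_Arr ?F R = eps_arr B R" if "R \<in> Arr (L_ob M)" for R using that by (simp add: eps_def)
  have Iob: "on_Ob ?G X = X" if "X \<in> Ob B" for X using that by (simp add: eps_inv_def)
  have Iar: "on_Arr ?G f = eps_inv_arr B f" if "f \<in> Arr B" for f using that by (simp add: eps_inv_def)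
  have inv: "on_Arr ?F (eps_inv_arr B f) = f" if "f \<in> Arr B" for f
    using that by (simp add: ar eps_inv_Arr eps_eps_inv)
  have Fob: "src R \<in> Ob B" "tgt R \<in> Ob B" if "R \<in> Arr (L_ob M)" for R using that by (simp_all add: LM_Arr)
  have ex: "\<exists>f\<in>Arr B. src f = src R \<and> tgt f = tgt R \<and> R = eps_inv_arr B f" if "R \<in> Arr (L_ob M)" for R
    using that eps_arr_Arr[OF that] eps_inv_eps[OF that] by (intro bexI[of _ "eps_arr B R"]) auto
  have "is_functor (L_ob M) B ?F"
  proof (intro is_functor.intro is_functor_axioms.intro category_axioms D.category_L)
    show "on_Arr ?F (Idn (L_ob M) X) = Idn B (on_Ob ?F X)" if "X \<in> Ob (L_ob M)" for X
      using that I.on_Idn[of X] inv[of "Idn B X"] by (simp add: ob Iob Iar)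
    show "on_Arr ?F f \<in> hom B (on_Ob ?F X) (on_Ob ?F Y)"
      if "f \<in> hom (L_ob M) X Y" for f X Y
      using that eps_arr_Arr[of f] Fob[of f] by (auto simp: in_hom_iff ob ar)
    show "on_Arr ?F (f \<Zsemi>\<^bsub>L_ob M\<^esub> g) = on_Arr ?F f \<Zsemi> on_Arr ?F g"
      if fg: "f \<in> hom (L_ob M) X Y" "g \<in> hom (L_ob M) Y Z" for f g X Y Z
    proof -
      obtain f' g' where w: "f' \<in> Arr B" "tgt f' = Y" "g' \<in> Arr B" "src g' = Y"
        and e: "f = eps_inv_arr B f'" "g = eps_inv_arr B g'"
        using ex[of f] ex[of g] fg unfolding in_hom_iff by metis
      show ?thesis unfolding e using w inv[of "f' \<Zsemi> g'"] eps_inv_Seq[of f' g'] by (simp add: inv)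
    qed
  qed (simp_all add: ob)
  then show ?thesis
  proof (rule CBC_morphismI[OF D.cartesian_bicategory_L cartesian_bicategory_axioms])
    show "on_Arr ?F f \<sqsubseteq> on_Arr ?F g"
      if fg: "f \<in> hom (L_ob M) X Y" "g \<in> hom (L_ob M) X Y" "f \<sqsubseteq>\<^bsub>L_ob M\<^esub> g" for f g X Y
    proof -
      obtain f' g' where w: "f' \<in> Arr B" "g' \<in> Arr B" "src f' = src g'" "tgt f' = tgt g'"
        and e: "f = eps_inv_arr B f'" "g = eps_inv_arr B g'"
        using ex[of f] ex[of g] fg unfolding in_hom_iff by metis
      show ?thesis using fg(3) unfolding e using w by (simp add: eps_inv_Leq inv)
    qed
    show "on_Arr ?F (f \<otimes>\<^sub>a\<^bsub>L_ob M\<^esub> g) = on_Arr ?F f \<otimes>\<^sub>a on_Arr ?F g"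
      if fg: "f \<in> Arr (L_ob M)" "g \<in> Arr (L_ob M)" for f g
    proof -
      obtain f' g' where w: "f' \<in> Arr B" "g' \<in> Arr B" and e: "f = eps_inv_arr B f'" "g = eps_inv_arr B g'"
        using ex[of f] ex[of g] fg by metis
      show ?thesis unfolding e using w inv[of "f' \<otimes>\<^sub>a g'"] eps_inv_Tens[of f' g'] by (simp add: inv)
    qed
    show "on_Arr ?F (Assoc (L_ob M) X Y Z) = Assoc B (on_Ob ?F X) (on_Ob ?F Y) (on_Ob ?F Z)"
      if "X \<in> Ob (L_ob M)" "Y \<in> Ob (L_ob M)" "Z \<in> Ob (L_ob M)" for X Y Z
      using that I.on_Assoc[of X Y Z] inv[of "Assoc B X Y Z"] by (simp add: ob Iob Iar)
    show "on_Arr ?F (Lun (L_ob M) X) = Lun B (on_Ob ?F X)"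
      "on_Arr ?F (Run (L_ob M) X) = Run B (on_Ob ?F X)"
      "on_Arr ?F (Dup (L_ob M) X) = Dup B (on_Ob ?F X)"
      "on_Arr ?F (Del (L_ob M) X) = Del B (on_Ob ?F X)"
      if "X \<in> Ob (L_ob M)" for X
      using that I.on_Lun[of X] I.on_Run[of X] I.on_Dup[of X] I.on_Del[of X]
        inv[of "Lun B X"] inv[of "Run B X"] inv[of "Dup B X"] inv[of "Del B X"] by (simp_all add: ob Iob Iar)
  qed (simp_all add: ob, simp_all add: eps_def)
qed

lemma inverse_eps: "inverse_arrows CBC (eps B) (eps_inv B)"
proof -
  have st: "src (eps B) = L_ob M" "tgt (eps B) = B" "src (eps_inv B) = B" "tgt (eps_inv B) = L_ob M"
    by (simp_all add: eps_def eps_inv_def)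
  have 1: "\<lparr>on_Ob = \<lambda>X\<in>Ob (L_ob M). on_Ob (lab (eps_inv B)) (on_Ob (lab (eps B)) X),
      on_Arr = \<lambda>R\<in>Arr (L_ob M). on_Arr (lab (eps_inv B)) (on_Arr (lab (eps B)) R)\<rparr> =
      \<lparr>on_Ob = \<lambda>X\<in>Ob (L_ob M). X, on_Arr = \<lambda>R\<in>Arr (L_ob M). R\<rparr>"
    by (rule ftor_eqI[of _ "Ob B" _ "Arr (L_ob M)"])
      (simp_all add: eps_def eps_inv_def eps_arr_Arr eps_inv_eps)
  have 2: "\<lparr>on_Ob = \<lambda>X\<in>Ob B. on_Ob (lab (eps B)) (on_Ob (lab (eps_inv B)) X),
      on_Arr = \<lambda>R\<in>Arr B. on_Arr (lab (eps B)) (on_Arr (lab (eps_inv B)) R)\<rparr> =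
      \<lparr>on_Ob = \<lambda>X\<in>Ob B. X, on_Arr = \<lambda>R\<in>Arr B. R\<rparr>"
    by (rule ftor_eqI[of _ "Ob B" _ "Arr B"])
      (simp_all add: eps_def eps_inv_def eps_inv_Arr eps_eps_inv)
  show ?thesis
    unfolding inverse_arrows_def in_hom_iff CBC_Arr CBC_simps st 1 2 using CBC_eps CBC_eps_inv by simp
qed

end

text \<open>Naturality is checked on the inverse: \<open>R\<close> is a bent arrow, and
  \<open>F\<close> preserves tensors, \<open>Del\<close> and the right adjoint of
  \<open>Dup\<close>, hence bending.\<close>

lemma (in CBC_morphism) eps_natural:
  assumes R: "R \<in> Arr (L_ob (R_ob B))"
  shows "eps_arr B' (on_Arr (L_mor (R_ob B) (R_mor B F)) R) = on_Arr F (eps_arr B R)"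
proof -
  interpret CB: CB B by (rule CB.intro) unfold_locales
  interpret CB': CB B' by (rule CB.intro) unfold_locales
  interpret G: EED_morphism "R_ob B" "R_ob B'" "R_mor B F" by (rule EED_R_mor)
  define S where "S = eps_arr B R"
  have S: "S \<in> Arr B" and RS: "R = eps_inv_arr B S"
    using CB.eps_arr_Arr[OF R] CB.eps_inv_eps[OF R] by (simp_all add: S_def)
  have N: "on_Arr F (CB.bend S) = CB'.bend (on_Arr F S)"
    using S by (simp add: CB.bend_def CB'.bend_def CB.equ_def CB'.equ_def on_TensArr on_Idn on_radj_Dup on_Dup on_Del)
  have "on_Arr (L_mor (R_ob B) (R_mor B F)) R = eps_inv_arr B' (on_Arr F S)"
  proof (rule arrow.expand)
    have "lab (on_Arr (L_mor (R_ob B) (R_mor B F)) R) = on_Fib (R_mor B F) (src S \<otimes>\<^sub>o\<^bsub>B\<^esub> tgt S) (lab (CB.bend S))"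
      using G.L_mor_src_tgt(3)[OF R] by (simp add: RS CB.eps_inv_arr_bend)
    also have "\<dots> = lab (CB'.bend (on_Arr F S))" using S N by (simp add: R_mor_def)
    finally show "src (on_Arr (L_mor (R_ob B) (R_mor B F)) R) = src (eps_inv_arr B' (on_Arr F S)) \<and>
       tgt (on_Arr (L_mor (R_ob B) (R_mor B F)) R) = tgt (eps_inv_arr B' (on_Arr F S)) \<and>
       lab (on_Arr (L_mor (R_ob B) (R_mor B F)) R) = lab (eps_inv_arr B' (on_Arr F S))"
      using G.L_mor_src_tgt(1,2)[OF R] S by (simp add: RS CB'.eps_inv_arr_bend CB.eps_inv_arr_bend R_mor_def)
  qed
  then show ?thesis using S CB'.eps_eps_inv[of "on_Arr F S"] by (simp add: S_def)
qed

text \<open>On the unit object \<open>Del\<close> is the identity and \<open>Dup\<close> is an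
  inverse unitor, so bending an arrow into the unit object only adds a unitor. This is the second
  triangle identity on predicates.\<close>

lemma (in CB) eps_arr_pred:
  assumes u: "Arrow X (Unit B) u \<in> Arr B"
  shows "eps_arr B (Arrow X (Unit B) (lab (Run B X \<Zsemi> Arrow X (Unit B) u))) = Arrow X (Unit B) u"
proof -
  let ?U = "Arrow X (Unit B) u" and ?I = "Unit B"
  have X: "X \<in> Ob B" using src_Ob[OF u] by simp
  have "radj B (Dup B ?I) = Lun B ?I"
    unfolding Dup_Unit by (rule radj_inverse) (simp add: inverse_arrows_sym[OF inv_arrow_inverse])
  then have "bend ?U = (?U \<otimes>\<^sub>a Idn B ?I) \<Zsemi> Run B ?I" using u by (simp add: bend_def equ_def Del_Unit Run_Unit)
  also have "\<dots> = Run B X \<Zsemi> ?U" using Run_nat[OF u] by simp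
  finally have "Arrow X ?I (lab (Run B X \<Zsemi> ?U)) = eps_inv_arr B ?U" by (simp add: eps_inv_arr_bend)
  then show ?thesis using eps_eps_inv[OF u] by simp
qed

theorem theorem7p3:
  shows "adjunction
           (EED :: (('o, 'm, 'm) doctrine, ('o, 'm, 'm, 'o, 'm, 'm) doctrine_map) cat)
           (CBC :: (('o, 'm) bicat, ('o, 'm, 'o, 'm) ftor) cat)
           L_functor R_functor eta eps
       \<and> nat_iso
           (CBC :: (('o, 'm) bicat, ('o, 'm, 'o, 'm) ftor) cat) CBC
           (comp_ftor R_functor L_functor) id_ftor eps
       \<and> (\<forall>B \<in> Ob (CBC :: (('o, 'm) bicat, ('o, 'm, 'o, 'm) ftor) cat).
            inverse_arrows CBC (eps B) (eps_inv B))"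
proof -
  let ?EED = "EED :: (('o, 'm, 'm) doctrine, ('o, 'm, 'm, 'o, 'm, 'm) doctrine_map) cat"
  let ?CBC = "CBC :: (('o, 'm) bicat, ('o, 'm, 'o, 'm) ftor) cat"
  interpret E: category ?EED by (rule category_EED)
  interpret C: category ?CBC by (rule category_CBC)
  interpret L: is_functor ?EED ?CBC L_functor by (rule is_functor_L)
  interpret R: is_functor ?CBC ?EED R_functor by (rule is_functor_R)
  note fsimps = L_functor_def R_functor_def comp_ftor_def id_ftor_def
  have idE: "is_functor ?EED ?EED id_ftor" and idC: "is_functor ?CBC ?CBC id_ftor"
    by unfold_locales (simp_all add: id_ftor_def)
  note LR = is_functor_comp[OF is_functor_L is_functor_R] and RL = is_functor_comp[OF is_functor_R is_functor_L]
  have unit: "nat_trans ?EED ?EED id_ftor (comp_ftor L_functor R_functor) eta"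
  proof (intro nat_trans.intro nat_trans_axioms.intro idE LR)
    show "eta P \<in> hom ?EED (on_Ob id_ftor P) (on_Ob (comp_ftor L_functor R_functor) P)" if "P \<in> Ob ?EED" for P
      using homogeneous_doctrine.EED_eta[OF homogeneous_doctrine.intro[OF EED_doctrine.intro], of P] that
      by (simp add: in_hom_iff EED_Arr fsimps) (simp add: eta_def)
    fix f P Q assume f: "f \<in> hom ?EED P Q"
    then have st: "src f = P" "tgt f = Q" "EED_morphism P Q (lab f)" by (auto simp: in_hom_iff EED_Arr)
    have "src (eta P) = P" "tgt (eta Q) = R_ob (L_ob Q)" by (simp_all add: eta_def)
    then show "on_Arr id_ftor f \<Zsemi>\<^bsub>?EED\<^esub> eta Q = eta P \<Zsemi>\<^bsub>?EED\<^esub> on_Arr (comp_ftor L_functor R_functor) f"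
      using eta_natural[OF st(3)] st by (simp add: fsimps)
  qed
  have counit: "nat_trans ?CBC ?CBC (comp_ftor R_functor L_functor) id_ftor eps"
  proof (intro nat_trans.intro nat_trans_axioms.intro idC RL)
    show "eps B \<in> hom ?CBC (on_Ob (comp_ftor R_functor L_functor) B) (on_Ob id_ftor B)" if "B \<in> Ob ?CBC" for B
      using CB.CBC_eps[OF CB.intro, of B] that
      by (simp add: in_hom_iff CBC_Arr fsimps) (simp add: eps_def)
    fix f B B' assume f: "f \<in> hom ?CBC B B'"
    then have st: "src f = B" "tgt f = B'" "CBC_morphism B B' (lab f)" by (auto simp: in_hom_iff CBC_Arr)
    interpret F: CBC_morphism B B' "lab f" by (rule st(3))
    interpret CB: CB B by (rule CB.intro) unfold_locales
    interpret G: EED_morphism "R_ob B" "R_ob B'" "R_mor B (lab f)" by (rule F.EED_R_mor)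
    let ?F = "L_mor (R_ob B) (R_mor B (lab f))"
    have e: "src (eps B) = L_ob (R_ob B)" "tgt (eps B) = B" "src (eps B') = L_ob (R_ob B')" "tgt (eps B') = B'"
      by (simp_all add: eps_def)
    have "\<lparr>on_Ob = \<lambda>X\<in>Ob (L_ob (R_ob B)). on_Ob (lab (eps B')) (on_Ob ?F X),
         on_Arr = \<lambda>r\<in>Arr (L_ob (R_ob B)). on_Arr (lab (eps B')) (on_Arr ?F r)\<rparr> =
       \<lparr>on_Ob = \<lambda>X\<in>Ob (L_ob (R_ob B)). on_Ob (lab f) (on_Ob (lab (eps B)) X),
         on_Arr = \<lambda>r\<in>Arr (L_ob (R_ob B)). on_Arr (lab f) (on_Arr (lab (eps B)) r)\<rparr>"
    proof (rule ftor_eqI[of _ "Ob B" _ "Arr (L_ob (R_ob B))"])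
      fix r assume r: "r \<in> Arr (L_ob (R_ob B))"
      show "on_Arr \<lparr>on_Ob = \<lambda>X\<in>Ob (L_ob (R_ob B)). on_Ob (lab (eps B')) (on_Ob ?F X),
         on_Arr = \<lambda>r\<in>Arr (L_ob (R_ob B)). on_Arr (lab (eps B')) (on_Arr ?F r)\<rparr> r =
       on_Arr \<lparr>on_Ob = \<lambda>X\<in>Ob (L_ob (R_ob B)). on_Ob (lab f) (on_Ob (lab (eps B)) X),
         on_Arr = \<lambda>r\<in>Arr (L_ob (R_ob B)). on_Arr (lab f) (on_Arr (lab (eps B)) r)\<rparr> r"
        using r F.eps_natural[OF r] G.L_mor_Arr[OF r] by (simp add: eps_def)
    qed (simp_all add: eps_def L_mor_def R_mor_def F.on_Ob)
    then show "on_Arr (comp_ftor R_functor L_functor) f \<Zsemi>\<^bsub>?CBC\<^esub> eps B' = eps B \<Zsemi>\<^bsub>?CBC\<^esub> on_Arr id_ftor f"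
      using st e by (simp add: fsimps)
  qed
  have inv: "inverse_arrows ?CBC (eps B) (eps_inv B)" if "B \<in> Ob ?CBC" for B
    using CB.inverse_eps[OF CB.intro, of B] that by simp
  have "adjunction ?EED ?CBC L_functor R_functor eta eps"
  proof (intro adjunction.intro adjunction_axioms.intro unit counit is_functor_L is_functor_R)
    fix P assume "P \<in> Ob ?EED"
    then interpret P: homogeneous_doctrine P by (intro homogeneous_doctrine.intro EED_doctrine.intro) simp
    interpret CB: CB "L_ob P" by (rule P.CB_L)
    interpret eta: EED_morphism P "R_ob (L_ob P)" "lab (eta P)" by (rule P.EED_eta)
    have e: "src (eta P) = P" "tgt (eps (L_ob P)) = L_ob P" by (simp_all add: eta_def eps_def)
    have "\<lparr>on_Ob = \<lambda>X\<in>Ob (L_ob P). on_Ob (lab (eps (L_ob P))) (on_Ob (L_mor P (lab (eta P))) X),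
        on_Arr = \<lambda>r\<in>Arr (L_ob P). on_Arr (lab (eps (L_ob P))) (on_Arr (L_mor P (lab (eta P))) r)\<rparr> =
        \<lparr>on_Ob = \<lambda>X\<in>Ob (L_ob P). X, on_Arr = \<lambda>r\<in>Arr (L_ob P). r\<rparr>"
    proof (rule ftor_eqI[of _ "Ob P" _ "Arr (L_ob P)"])
      fix r assume r: "r \<in> Arr (L_ob P)"
      then have "src r \<in> Ob P" "tgt r \<in> Ob P" "lab r \<in> Fib P (src r \<times>\<^sub>o\<^bsub>P\<^esub> tgt r)" by (simp_all add: L_ob_Arr)
      \<comment> \<open>The fibre part of the unit reindexes along the unitor, and by
        \<open>eps_inv_L\<close> this is bending in L(P), which the counit undoes.\<close>
      then have "on_Arr (L_mor P (lab (eta P))) r = eps_inv_arr (L_ob P) r"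
        using r by (simp add: P.eps_inv_L L_mor_def eta_def)
      then show "on_Arr \<lparr>on_Ob = \<lambda>X\<in>Ob (L_ob P). on_Ob (lab (eps (L_ob P))) (on_Ob (L_mor P (lab (eta P))) X),
        on_Arr = \<lambda>r\<in>Arr (L_ob P). on_Arr (lab (eps (L_ob P))) (on_Arr (L_mor P (lab (eta P))) r)\<rparr> r =
        on_Arr \<lparr>on_Ob = \<lambda>X\<in>Ob (L_ob P). X, on_Arr = \<lambda>r\<in>Arr (L_ob P). r\<rparr> r"
        using r CB.eps_eps_inv[OF r] CB.eps_inv_Arr[OF r] by (simp add: eps_def)
    qed (simp_all add: eps_def L_mor_def eta_def)
    then show "on_Arr L_functor (eta P) \<Zsemi>\<^bsub>?CBC\<^esub> eps (on_Ob L_functor P) = Idn ?CBC (on_Ob L_functor P)"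
      using e by (simp add: fsimps)
  next
    fix B assume "B \<in> Ob ?CBC"
    then interpret B: CB B by (intro CB.intro) simp
    have e: "src (eta (R_ob B)) = R_ob B" "src (eps B) = L_ob (R_ob B)" "tgt (eps B) = B" by (simp_all add: eta_def eps_def)
    interpret D: homogeneous_doctrine "R_ob B" by (intro homogeneous_doctrine.intro EED_doctrine.intro B.EED_M)
    interpret eta: EED_morphism "R_ob B" "R_ob (L_ob (R_ob B))" "lab (eta (R_ob B))" by (rule D.EED_eta)
    have "comp_doctrine_map (R_ob B) (lab (eta (R_ob B))) (R_mor (L_ob (R_ob B)) (lab (eps B))) = id_doctrine_map (R_ob B)"
    proof (rule doctrine_map_eqI[of _ "Ob B" _ "Arr (R_ob B)" "Fib (R_ob B)"])
      fix f assume f: "f \<in> Arr (R_ob B)"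
      then have "graph (R_ob B) f \<in> Arr (R_ob (L_ob (R_ob B)))" using eta.on_Arr_simps(1)[OF f] by (simp add: eta_def)
      \<comment> \<open>On maps the unit is \<open>graph\<close>, and by
        \<open>eps_inv_graph\<close> the graph of a map of \<open>B\<close> is the bent map.\<close>
      moreover have "eps_arr B (graph (R_ob B) f) = f"
        using B.eps_inv_graph[OF f] B.eps_eps_inv[of f] f by simp
      ultimately show "on_Arr (comp_doctrine_map (R_ob B) (lab (eta (R_ob B))) (R_mor (L_ob (R_ob B)) (lab (eps B)))) f =
          on_Arr (id_doctrine_map (R_ob B)) f"
        using f D.graph_Arr[OF f] by (simp add: comp_doctrine_map_def id_doctrine_map_def eta_def R_mor_def eps_def)
    next
      fix X u assume X: "X \<in> Ob B" and "u \<in> Fib (R_ob B) X"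
      then have u: "Arrow X (Unit B) u \<in> Arr B" by simp
      let ?b = "lab (Run B X \<Zsemi>\<^bsub>B\<^esub> Arrow X (Unit B) u)"
      \<comment> \<open>On predicates the unit precomposes with the unitor of \<open>B\<close>,
        which unbending removes by \<open>eps_arr_pred\<close>.\<close>
      have run: "cart_run (R_ob B) X = Run B X" using X by (simp add: cart_run_def B.Run_M)
      have "Arrow X (Unit B) ?b \<in> Arr (L_ob (R_ob B))" using X u by (simp add: B.LM_Arr)
      then show "on_Fib (comp_doctrine_map (R_ob B) (lab (eta (R_ob B))) (R_mor (L_ob (R_ob B)) (lab (eps B)))) X u =
          on_Fib (id_doctrine_map (R_ob B)) X u"
        using X u B.eps_arr_pred[OF u] by (simp add: comp_doctrine_map_def id_doctrine_map_def eta_def R_mor_def eps_def run R_ob_fibres)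
    qed (simp_all add: comp_doctrine_map_def id_doctrine_map_def eta_def R_mor_def eps_def)
    then show "eta (on_Ob R_functor B) \<Zsemi>\<^bsub>?EED\<^esub> on_Arr R_functor (eps B) = Idn ?EED (on_Ob R_functor B)"
      using e by (simp add: fsimps)
  qed
  moreover have "nat_iso ?CBC ?CBC (comp_ftor R_functor L_functor) id_ftor eps"
    by (intro nat_iso.intro nat_iso_axioms.intro counit) (use inv in \<open>auto simp: is_iso_def\<close>)
  ultimately show ?thesis using inv by blast
qed

end
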